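(* Let $W=G_{30}$ (the Coxeter group of type $H_4$, acting on $\mathbb C^4$). Up to type equivalence there are exactly three nice $4$-tuples in $W$. Each of the three types produces, after middle convolution, exactly one MCG-finite rank $2$ $5$-tuple up to equivalence, and the three resulting equivalence classes are distinct. Each of these three $5$-tuples comes from a $4$-tuple by inserting the identity: for suitable choice of the normalizing scalars, the fifth matrix is the identity, so that the first four matrices form an MCG-finite $4$-tuple in $\mathrm{SL}_2(\mathbb C)^4$ with product $I$. Thus the nice $4$-tuples in $W$ produce MCG-finite $4$-tuples and no MCG-finite $5$-tuples free of identity matrices. There are no nice $5$-tuples in $W$.
   Context: A reflection is an invertible matrix of finite order having exactly one eigenvalue different from $1$, of multiplicity $1$. A $T$-tuple $[A_1,\dots,A_T]$ in a finite complex reflection group $W$ is nice if all $A_i$ are reflections in $W$, $W=\langle A_1,\dots,A_T\rangle$, and the inverse product $(A_1\cdots A_T)^{-1}$ has an eigenvalue $\lambda\ne 1$ of multiplicity $T-2$ (exactly). The type of a tuple is the multiset of eigenvalues of its inverse product; the inverse tuple of $[A_1,\dots,A_T]$ is $[A_T^{-1},\dots,A_1^{-1}]$. Two nice tuples are type equivalent if they have the same type or the type of one is the type of the inverse tuple of the other. Middle convolution: for $\mathbf A=[A_1,\dots,A_T]\in\mathrm{GL}(V)^T$ and $\lambda\in\mathbb C^\times$, $\lambda\ne1$, let $B_k\in \mathrm{GL}(V^T)$ be the block matrix equal to the identity outside its $k$-th block row, which is $(\lambda(A_1-1),\dots,\lambda(A_{k-1}-1),\lambda A_k,A_{k+1}-1,\dots,A_T-1)$.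 Let $\mathcal K=\bigoplus_k\ker(A_k-1)$ (the $k$-th summand in the $k$-th copy of $V$) and $\mathcal L=\bigcap_k\ker(B_k-1)$. Then $MC_\lambda(\mathbf A)=[\tilde A_1,\dots,\tilde A_T]$ is the tuple induced by $(B_1,\dots,B_T)$ on $V^T/(\mathcal K+\mathcal L)$, defined up to simultaneous conjugation. For a nice $T$-tuple and $\lambda\neq 1$ an eigenvalue of multiplicity $T-2$ of its inverse product, it consists of $2\times2$ matrices. The rank $2$ tuples "produced" by a nice tuple $\mathbf A$ are the induced tuples below, for all such $\lambda$. A tuple induced by $MC_\lambda(\mathbf A)$ is a tuple $[c_1\tilde A_1,\dots,c_T\tilde A_T,c_{T+1}(\tilde A_1\cdots\tilde A_T)^{-1}]\in\mathrm{SL}_2(\mathbb C)^{T+1}$ with $c_i\in\mathbb C^\times$ and $\prod_{i=1}^{T+1}c_i=1$. The braid group on $T+1$ strands acts on $(T+1)$-tuples up to simultaneous conjugation by $\sigma_i[M_1,\dots,M_{T+1}]=[M_1,\dots,M_{i-1},M_iM_{i+1}M_i^{-1},M_i,M_{i+2},\dots,M_{T+1}]$, $1\le i\le T$; a tuple with product $I$ is MCG-finite if its orbit (on simultaneous conjugacy classes) is finite. Two induced tuples are equivalent if they are related by simultaneous conjugation, the braid group action, and changing the choice of the scalars $(c_i)$ (i.e. replacing $M_i$ by $\pm M_i$ with an even number of minus signs). By convention, a tuple that contains (for some choice of scalars) an identity matrix is regarded as a shorter tuple with the identity inserted. *)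

theory Defs
  imports
    "Jordan_Normal_Form.Char_Poly"
    "Jordan_Normal_Form.Matrix_Kernel"
    "HOL-Algebra.Generated_Groups"
begin

section \<open>Complex matrices and reflections\<close>

definition GL :: "nat \<Rightarrow> complex mat monoid" where
  "GL n = units_of (ring_mat TYPE(complex) n ())"

definition mat_prod :: "nat \<Rightarrow> complex mat list \<Rightarrow> complex mat" where
  "mat_prod n As = foldr (*) As (1\<^sub>m n)"

text \<open>The multiset of eigenvalues, counted with algebraic multiplicity.\<close>

definition eigs :: "complex mat \<Rightarrow> complex multiset" where
  "eigs A = proots (char_poly A)"

definition reflection :: "nat \<Rightarrow> complex mat \<Rightarrow> bool" where
  "reflection n A \<longleftrightarrow>
     A \<in> carrier (GL n) \<and> (\<exists>k>0. A ^\<^sub>m k = 1\<^sub>m n) \<and> size {#\<mu> \<in># eigs A. \<mu> \<noteq> 1#} = 1"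

section \<open>The group of type $H_4$\<close>

text \<open>
  The geometric representation of the Coxeter group with diagram
  \<open>0 --5-- 1 --3-- 2 --3-- 3\<close>, complexified: in the basis of simple roots, the \<open>i\<close>-th simple
  reflection maps \<open>e\<^sub>j\<close> to \<open>e\<^sub>j - 2 B(i,j) e\<^sub>i\<close>, where \<open>B(i,j) = - cos (pi / m(i,j))\<close>.
\<close>

definition H4_coxeter :: "nat \<Rightarrow> nat \<Rightarrow> nat" where
  "H4_coxeter i j =
     (if i = j then 1
      else if {i, j} = {0, 1} then 5
      else if {i, j} = {1, 2} \<or> {i, j} = {2, 3} then 3
      else 2)"

definition H4_form :: "nat \<Rightarrow> nat \<Rightarrow> real" where
  "H4_form i j = - cos (pi / real (H4_coxeter i j))"

definition H4_simple :: "nat \<Rightarrow> complex mat" where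
  "H4_simple i = mat 4 4 (\<lambda>(a, j).
     (if a = j then 1 else 0) - (if a = i then 2 * complex_of_real (H4_form i j) else 0))"

definition G30 :: "complex mat set" where
  "G30 = generate (GL 4) (H4_simple ` {0..<4})"

section \<open>Nice tuples\<close>

definition inverse_product :: "nat \<Rightarrow> complex mat list \<Rightarrow> complex mat" where
  "inverse_product n As = inv\<^bsub>GL n\<^esub> (mat_prod n As)"

definition inverse_tuple :: "nat \<Rightarrow> complex mat list \<Rightarrow> complex mat list" where
  "inverse_tuple n As = rev (map (\<lambda>A. inv\<^bsub>GL n\<^esub> A) As)"

definition tuple_type :: "nat \<Rightarrow> complex mat list \<Rightarrow> complex multiset" where
  "tuple_type n As = eigs (inverse_product n As)"

definition type_equiv :: "nat \<Rightarrow> complex mat list \<Rightarrow> complex mat list \<Rightarrow> bool" where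
  "type_equiv n As Bs \<longleftrightarrow>
     tuple_type n As = tuple_type n Bs \<or>
     tuple_type n As = tuple_type n (inverse_tuple n Bs) \<or>
     tuple_type n Bs = tuple_type n (inverse_tuple n As)"

text \<open>
  The membership condition matters only for \<open>length As \<le> 2\<close>, where the multiplicity
  \<open>length As - 2\<close> would be \<open>0\<close>.
\<close>

definition nice_eigenvalue :: "nat \<Rightarrow> complex mat list \<Rightarrow> complex \<Rightarrow> bool" where
  "nice_eigenvalue n As lam \<longleftrightarrow>
     lam \<noteq> 1 \<and> lam \<in># tuple_type n As \<and> count (tuple_type n As) lam = length As - 2"

definition nice_tuples :: "nat \<Rightarrow> complex mat set \<Rightarrow> nat \<Rightarrow> complex mat list set" where
  "nice_tuples n W T =
     {As. length As = T \<and> (\<forall>A\<in>set As. reflection n A \<and> A \<in> W) \<and>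
          generate (GL n) (set As) = W \<and> (\<exists>lam. nice_eigenvalue n As lam)}"

definition nice_classes :: "nat \<Rightarrow> complex mat set \<Rightarrow> nat \<Rightarrow> complex mat list set set" where
  "nice_classes n W T =
     nice_tuples n W T //
       {(As, Bs). As \<in> nice_tuples n W T \<and> Bs \<in> nice_tuples n W T \<and> type_equiv n As Bs}"

section \<open>Middle convolution\<close>

text \<open>
  For \<open>As\<close> a list of \<open>T\<close> matrices of size \<open>n\<close>, the space $V^T$ is \<open>carrier_vec (T * n)\<close>, the
  coordinate \<open>k * n + a\<close> being the \<open>a\<close>-th coordinate in the \<open>k\<close>-th copy of $V$.
\<close>

definition MC_block :: "nat \<Rightarrow> complex \<Rightarrow> complex mat list \<Rightarrow> nat \<Rightarrow> complex mat" where
  "MC_block n lam As k = mat (length As * n) (length As * n) (\<lambda>(r, c).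
     let i = r div n; j = c div n in
     (if i \<noteq> k then (if i = j then 1\<^sub>m n else 0\<^sub>m n n)
      else if j < k then lam \<cdot>\<^sub>m (As ! j - 1\<^sub>m n)
      else if j = k then lam \<cdot>\<^sub>m (As ! k)
      else As ! j - 1\<^sub>m n) $$ (r mod n, c mod n))"

definition MC_K :: "nat \<Rightarrow> complex mat list \<Rightarrow> complex vec set" where
  "MC_K n As = {v \<in> carrier_vec (length As * n).
     \<forall>k<length As. vec n (\<lambda>a. v $ (k * n + a)) \<in> mat_kernel (As ! k - 1\<^sub>m n)}"

definition MC_L :: "nat \<Rightarrow> complex \<Rightarrow> complex mat list \<Rightarrow> complex vec set" where
  "MC_L n lam As = {v \<in> carrier_vec (length As * n).
     \<forall>k<length As. v \<in> mat_kernel (MC_block n lam As k - 1\<^sub>m (length As * n))}"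

text \<open>
  \<open>middle_convolution n lam As m Ms\<close> says that \<open>Ms\<close> is the tuple of \<open>m \<times> m\<close> matrices, in some basis
  of the quotient $V^T/(\mathcal K + \mathcal L)$, of the maps induced by the block matrices. A basis
  of the quotient is given by the matrix \<open>P\<close> of the resulting surjection from $V^T$ onto
  $\mathbb C^m$ with kernel $\mathcal K + \mathcal L$. This leaves \<open>Ms\<close> determined up to
  simultaneous conjugation, and it can hold only if \<open>m\<close> is the dimension of the quotient.
\<close>

definition middle_convolution ::
  "nat \<Rightarrow> complex \<Rightarrow> complex mat list \<Rightarrow> nat \<Rightarrow> complex mat list \<Rightarrow> bool" where
  "middle_convolution n lam As m Ms \<longleftrightarrow>
     length Ms = length As \<and> set Ms \<subseteq> carrier_mat m m \<and>
     (\<exists>P \<in> carrier_mat m (length As * n).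
        mat_kernel P = {u + v | u v. u \<in> MC_K n As \<and> v \<in> MC_L n lam As} \<and>
        (\<lambda>v. P *\<^sub>v v) ` carrier_vec (length As * n) = carrier_vec m \<and>
        (\<forall>k<length As. P * MC_block n lam As k = Ms ! k * P))"

section \<open>Rank 2 tuples\<close>

definition SL2_tuple :: "complex mat list \<Rightarrow> bool" where
  "SL2_tuple M \<longleftrightarrow> (\<forall>A\<in>set M. A \<in> carrier_mat 2 2 \<and> det A = 1) \<and> mat_prod 2 M = 1\<^sub>m 2"

definition sim_conj :: "complex mat list \<Rightarrow> complex mat list \<Rightarrow> bool" where
  "sim_conj M N \<longleftrightarrow> (\<exists>g \<in> carrier (GL 2). N = map (\<lambda>A. g * A * inv\<^bsub>GL 2\<^esub> g) M)"

text \<open>The \<open>0\<close>-based generator: \<open>braid i\<close> is $\sigma_{i+1}$.\<close>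

definition braid :: "nat \<Rightarrow> complex mat list \<Rightarrow> complex mat list" where
  "braid i M = take i M @ [M ! i * M ! Suc i * inv\<^bsub>GL 2\<^esub> (M ! i), M ! i] @ drop (i + 2) M"

definition braid_step :: "complex mat list \<Rightarrow> complex mat list \<Rightarrow> bool" where
  "braid_step M N \<longleftrightarrow> SL2_tuple M \<and> (\<exists>i. Suc i < length M \<and> N = braid i M)"

text \<open>
  The orbit of a tuple under the braid group is its class under the equivalence relation generated
  by the action of the generators.
\<close>

definition mcg_finite :: "complex mat list \<Rightarrow> bool" where
  "mcg_finite M \<longleftrightarrow> SL2_tuple M \<and> finite ((\<lambda>N. {N'. sim_conj N N'}) ` {N. equivclp braid_step M N})"

text \<open>Changing the scalars: multiplication by signs, an even number of which are \<open>-1\<close>.\<close>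

definition sign_change :: "complex mat list \<Rightarrow> complex mat list \<Rightarrow> bool" where
  "sign_change M N \<longleftrightarrow>
     (\<exists>es. length es = length M \<and> set es \<subseteq> {1, -1} \<and> prod_list es = 1 \<and> N = map2 (\<cdot>\<^sub>m) es M)"

definition tuple_equiv :: "complex mat list \<Rightarrow> complex mat list \<Rightarrow> bool" where
  "tuple_equiv = equivclp (\<lambda>M N. SL2_tuple M \<and> (sim_conj M N \<or> braid_step M N \<or> sign_change M N))"

definition identity_free :: "complex mat list \<Rightarrow> bool" where
  "identity_free M \<longleftrightarrow> (\<forall>N. sign_change M N \<longrightarrow> 1\<^sub>m 2 \<notin> set N)"

definition induced_tuple :: "nat \<Rightarrow> complex \<Rightarrow> complex mat list \<Rightarrow> complex mat list \<Rightarrow> bool" where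
  "induced_tuple n lam As M \<longleftrightarrow>
     (\<exists>Ms cs. middle_convolution n lam As 2 Ms \<and>
        length cs = length As + 1 \<and> 0 \<notin> set cs \<and> prod_list cs = 1 \<and>
        M = map2 (\<cdot>\<^sub>m) cs (Ms @ [inv\<^bsub>GL 2\<^esub> (mat_prod 2 Ms)]) \<and>
        (\<forall>A\<in>set M. det A = 1))"

definition produced :: "nat \<Rightarrow> complex mat list set \<Rightarrow> complex mat list set" where
  "produced n C = {M. \<exists>As\<in>C. \<exists>lam. nice_eigenvalue n As lam \<and> induced_tuple n lam As M}"

definition produced_mcg_classes :: "nat \<Rightarrow> complex mat list set \<Rightarrow> complex mat list set set" where
  "produced_mcg_classes n C = {M \<in> produced n C. mcg_finite M} // {(M, N). tuple_equiv M N}"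

end

theory Submission
  imports Defs "Jordan_Normal_Form.Schur_Decomposition"
begin

text \<open>
  The reflections in \<open>G30\<close> are the reflections in roots, the vectors of norm 2 over the golden integers:
  the defect of a reflection has rank one, and as the form of type $H_4$ is unimodular over the golden
  integers, a root can be extracted from it. For a tuple of such reflections with Gram matrix \<open>G = L + U\<close>,
  the eigenvectors of the inverse product for \<open>\<lambda>\<close> correspond to the kernel of \<open>\<lambda> L + U\<close>. If \<open>\<lambda> = -1\<close>, a
  multiple eigenvalue makes Pfaffians of \<open>G\<close> vanish, which is impossible for generating tuples because
  the form modulo 2 is symplectic and unimodular; this excludes all 5-tuples, whose eigenvalue is real.
  If \<open>\<lambda>\<close> is not real, \<open>G\<close> is determined by three entries \<open>p, q, r\<close>, with
  \<open>t = \<lambda> + 1/\<lambda> = p\<^sup>2 + q\<^sup>2 + r\<^sup>2 - p q r - 2\<close>, and the Gram determinant \<open>(2 - t)\<^sup>2\<close> is a unit. This leaves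
  three values of \<open>t\<close>, which are the three types.

  The middle convolution is read off from a factorization \<open>x\<^sub>j \<bullet> y\<^sub>k\<close> of rank 2 of the matrix \<open>\<lambda> L + U\<close>: it
  consists of the maps \<open>1 - y\<^sub>k x\<^sub>k\<close>, whose product is \<open>\<lambda>\<^sup>2\<close>, so that the fifth matrix becomes the identity.
  The braid group acts on the finitely many triples \<open>(p, q, r)\<close> with given \<open>t\<close> by \<open>(p, p q - r, q)\<close> and
  \<open>(p r - q, p, r)\<close>, and together with sign changes of the roots it acts transitively. Replacing \<open>\<lambda>\<close> by
  \<open>1/\<lambda>\<close> amounts to the inverse transpose. The squares \<open>2 - t\<close> and \<open>4\<close> of the traces separate the types.
\<close>

section \<open>The golden integers\<close>

text \<open>Golden integers are pairs of integers, so that the finite questions (values of Gram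
  entries, closure and transitivity of the braid moves, generation by explicit roots) are settled by
  evaluation. Finiteness comes from the Galois conjugate: the form is positive definite in both real
  embeddings, so inner products of roots are bounded in both, which leaves nine values. Extracting a
  root from a reflection comes down to showing that a certain diagonal entry is a square; for this
  the primes 2, 3 and the one over 5 have to be excluded. Generation of the whole group enters
  twice, through the unit Gram determinant and through an odd Pfaffian. The three values of
  \<open>t\<close> are 2 cos of pi/3, pi/5 and 3 pi/5. Two features of the definitions shape the
  second half. The convolution is a relation determined up to conjugation, so a model of the
  quotient must be shown to satisfy it and to be unique. An orbit is an equivalence class, so the
  finite families must be closed under braid moves in both directions, and in a 5-tuple the identity
  matrix wanders through all places.\<close>

datatype gint = Gint (grat: int) (gphi: int)

instantiation gint :: comm_ring_1
begin
definition zero_gint :: gint where "0 = Gint 0 0"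
definition one_gint :: gint where "1 = Gint 1 0"
definition plus_gint :: "gint \<Rightarrow> gint \<Rightarrow> gint" where
  "x + y = Gint (grat x + grat y) (gphi x + gphi y)"
definition minus_gint :: "gint \<Rightarrow> gint \<Rightarrow> gint" where
  "x - y = Gint (grat x - grat y) (gphi x - gphi y)"
definition uminus_gint :: "gint \<Rightarrow> gint" where
  "- x = Gint (- grat x) (- gphi x)"
definition times_gint :: "gint \<Rightarrow> gint \<Rightarrow> gint" where
  "x * y = Gint (grat x * grat y + gphi x * gphi y)
     (grat x * gphi y + gphi x * grat y + gphi x * gphi y)"
instance
  by standard
    (simp_all add: zero_gint_def one_gint_def plus_gint_def minus_gint_def uminus_gint_def
      times_gint_def algebra_simps gint.expand)
end

lemmas gint_ring_defs = zero_gint_def one_gint_def plus_gint_def minus_gint_def uminus_gint_def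
  times_gint_def

lemma gint_numeral: "numeral n = Gint (numeral n) 0"
proof -
  have "of_nat m = Gint (int m) 0" for m
    by (induction m) (simp_all add: gint_ring_defs)
  from this[of "numeral n"] show ?thesis by simp
qed

lemmas gint_simps = gint_ring_defs gint_numeral

definition golden_int :: gint where "golden_int = Gint 0 1"

definition golden :: real where "golden = (1 + sqrt 5) / 2"

text \<open>The second root \<open>1 - golden\<close> gives the Galois conjugate embedding.\<close>

definition embed :: "'a::comm_ring_1 \<Rightarrow> gint \<Rightarrow> 'a" where
  "embed r x = of_int (grat x) + of_int (gphi x) * r"

lemma golden_sq: "golden * golden = golden + 1"
  by (simp add: golden_def field_simps)

lemma golden_conj_sq: "(1 - golden) * (1 - golden) = (1 - golden) + 1"
  using golden_sq by (simp add: algebra_simps)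

lemma golden_bounds: "1.618 < golden" "golden < 1.6181"
proof -
  have "2.236 < sqrt 5" by (rule real_less_rsqrt) (simp add: power2_eq_square)
  moreover have "sqrt 5 < 2.2362" by (rule real_less_lsqrt) (simp_all add: power2_eq_square)
  ultimately show "1.618 < golden" "golden < 1.6181" by (simp_all add: golden_def)
qed

text \<open>A ring homomorphism out of the golden integers is the choice of a root of x^2 = x + 1;
  the two real embeddings and the complex one are treated at once.\<close>

locale golden_root =
  fixes r :: "'a::comm_ring_1"
  assumes root: "r * r = r + 1"
begin

sublocale emb: comm_ring_hom "embed r"
proof
  show "embed r (x * y) = embed r x * embed r y" for x y
  proof -
    have "embed r (x * y) = of_int (grat x) * of_int (grat y)
       + (of_int (grat x) * of_int (gphi y) + of_int (gphi x) * of_int (grat y)) * r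
       + of_int (gphi x) * of_int (gphi y) * (r + 1)"
      by (simp add: embed_def gint_simps algebra_simps)
    also have "\<dots> = embed r x * embed r y"
      unfolding root[symmetric] by (simp add: embed_def algebra_simps)
    finally show ?thesis .
  qed
qed (simp_all add: embed_def gint_ring_defs algebra_simps)

end

lemma embed_numeral [simp]: "embed r (numeral n) = numeral n"
  by (simp add: embed_def gint_numeral)

lemma embed_Gint: "embed r (Gint a b) = of_int a + of_int b * r"
  by (simp add: embed_def)

lemma embed_golden_int [simp]: "embed r golden_int = r"
  by (simp add: embed_def golden_int_def)

interpretation ev1: golden_root golden
  by standard (rule golden_sq)

interpretation ev2: golden_root "1 - golden"
  by standard (rule golden_conj_sq)

abbreviation cgolden :: complex where "cgolden \<equiv> complex_of_real golden"

lemma cgolden_sq: "cgolden * cgolden = cgolden + 1"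
  by (metis golden_sq of_real_1 of_real_add of_real_mult)

interpretation evc: golden_root cgolden
  by standard (rule cgolden_sq)

abbreviation "ev1 \<equiv> embed golden"
abbreviation "ev2 \<equiv> embed (1 - golden)"
abbreviation "evc \<equiv> embed cgolden"

lemma evc_of_real: "evc x = complex_of_real (ev1 x)"
  by (simp add: embed_def)

text \<open>The norm form has no nontrivial zero: multiplying \<open>a = - b golden\<close> and
  \<open>a + b = - b (golden - 1)\<close> gives \<open>a^2 + a b = b^2\<close>, which modulo 2 makes
  both numbers even, so descent applies.\<close>

lemma golden_irrational:
  assumes "of_int a + of_int b * golden = (0::real)"
  shows "a = 0 \<and> b = 0"
proof -
  have descent: "b = 0" if "a^2 + a * b = b^2" for a b :: int
    using that
  proof (induction "nat \<bar>b\<bar>" arbitrary: a b rule: less_induct)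
    case less
    have "even b \<and> even a" using less.prems
      by (metis even_add even_mult_iff even_power zero_less_numeral)
    then obtain c d where cd: "a = 2 * c" "b = 2 * d" by (auto elim!: evenE)
    hence "c^2 + c * d = d^2" using less.prems by (simp add: power2_eq_square)
    thus ?case using less.hyps[of d c] cd by (cases "d = 0") (auto simp: abs_mult nat_less_eq_zless)
  qed
  have "real_of_int a * (of_int a + of_int b) = (of_int b * golden) * (of_int b * (golden - 1))"
    using assms by (simp add: eq_neg_iff_add_eq_0[symmetric] algebra_simps)
  also have "\<dots> = of_int b * of_int b"
  proof -
    have "\<dots> = of_int b * of_int b * (golden * golden - golden)"
      by (simp only: algebra_simps)
    thus ?thesis unfolding golden_sq by simp
  qed
  finally have "real_of_int (a^2 + a * b) = real_of_int (b^2)"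
    by (simp add: power2_eq_square algebra_simps)
  hence "a^2 + a * b = b^2" by (simp only: of_int_eq_iff)
  with descent have "b = 0" .
  with assms show ?thesis by simp
qed

lemma ev1_eq_0: "ev1 x = 0 \<longleftrightarrow> x = 0"
  using golden_irrational[of "grat x" "gphi x"]
  by (cases x) (auto simp: embed_def gint_simps)

lemma ev1_inj: "ev1 x = ev1 y \<longleftrightarrow> x = y"
  using ev1_eq_0[of "x - y"] by (simp add: ev1.emb.hom_minus)

lemma evc_inj: "evc x = evc y \<longleftrightarrow> x = y"
  by (simp add: evc_of_real ev1_inj)

lemma gint_no_zero_divisors: "x * y = 0 \<Longrightarrow> x = 0 \<or> y = (0::gint)"
  using ev1_eq_0 ev1.emb.hom_mult mult_eq_0_iff by metis

instance gint :: idom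
  by standard (use gint_no_zero_divisors in blast)

text \<open>Under its two real embeddings the ring is a lattice in the plane, so a square contains
  finitely many elements. The conjugates differ by \<open>b\<close> times sqrt 5, which leaves -1, 0
  and 1 for \<open>b\<close>.\<close>

lemma gint_bounded:
  assumes "\<bar>ev1 x\<bar> \<le> 2" "\<bar>ev2 x\<bar> \<le> 2"
  shows "x \<in> {0, 1, -1, 2, -2, Gint 0 1, Gint 0 (-1), Gint (-1) 1, Gint 1 (-1)}"
proof -
  obtain a b where x: "x = Gint a b" by (cases x)
  have h: "\<bar>real_of_int a + of_int b * golden\<bar> \<le> 2"
    "\<bar>real_of_int a + of_int b * (1 - golden)\<bar> \<le> 2"
    using assms by (simp_all add: x embed_def)
  have "\<bar>of_int b * (2 * golden - 1)\<bar> \<le> 4"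
    using h by (simp add: algebra_simps)
  hence b4: "\<bar>real_of_int b\<bar> * (2 * golden - 1) \<le> 4"
    using golden_bounds by (simp add: abs_mult)
  have "\<bar>b\<bar> < 2"
  proof (rule ccontr)
    assume "\<not> \<bar>b\<bar> < 2"
    hence "2 \<le> \<bar>real_of_int b\<bar>" by linarith
    hence "2 * (2 * golden - 1) \<le> \<bar>real_of_int b\<bar> * (2 * golden - 1)"
      using golden_bounds by (intro mult_right_mono) auto
    thus False using b4 golden_bounds by simp
  qed
  hence "b = -1 \<or> b = 0 \<or> b = 1" by linarith
  thus ?thesis
  proof (elim disjE)
    assume b: "b = -1"
    hence "a < 2" "-1 < a" using h golden_bounds by (simp_all add: abs_le_iff)
    hence "a = 0 \<or> a = 1" by linarith
    thus ?thesis by (auto simp: x b gint_simps)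
  next
    assume b: "b = 0"
    hence "a \<le> 2" "-2 \<le> a" using h by simp_all
    hence "a = 0 \<or> a = 1 \<or> a = 2 \<or> a = -1 \<or> a = -2" by linarith
    thus ?thesis by (auto simp: x b gint_simps)
  next
    assume b: "b = 1"
    hence "a < 1" "-2 < a" using h golden_bounds by (simp_all add: abs_le_iff)
    hence "a = 0 \<or> a = -1" by linarith
    thus ?thesis by (auto simp: x b gint_simps)
  qed
qed

text \<open>\<open>gint_bounded\<close> shifted by 2; these will be the values of 2 minus an inner
  product of two roots.\<close>

lemma gint_bounded_nonneg:
  assumes "0 \<le> ev1 x" "ev1 x \<le> 4" "0 \<le> ev2 x" "ev2 x \<le> 4"
  shows "x \<in> {0, 1, 2, 3, 4, Gint 1 1, Gint 2 (-1), Gint 2 1, Gint 3 (-1)}"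
proof -
  have "\<bar>ev1 (x - 2)\<bar> \<le> 2" "\<bar>ev2 (x - 2)\<bar> \<le> 2"
    using assms by (simp_all add: embed_def gint_simps)
  from gint_bounded[OF this] show ?thesis
    by (cases x) (auto simp: gint_simps)
qed

section \<open>The form of type $H_4$\<close>

text \<open>The symmetric bilinear form \<open>2 B\<close> in the basis of simple roots, the parameter \<open>g\<close> being the
  golden ratio, its Galois conjugate, or the corresponding element of \<open>gint\<close>.\<close>

definition form :: "'a::comm_ring_1 \<Rightarrow> 'a vec \<Rightarrow> 'a vec \<Rightarrow> 'a" where
  "form g x y = 2 * (x$0 * y$0 + x$1 * y$1 + x$2 * y$2 + x$3 * y$3) - g * (x$0 * y$1 + x$1 * y$0)
     - (x$1 * y$2 + x$2 * y$1) - (x$2 * y$3 + x$3 * y$2)"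

text \<open>The linear functional \<open>form g x\<close> in coordinates, that is, the Gram matrix
  of the simple roots applied to \<open>x\<close>.\<close>

definition coroot :: "'a::comm_ring_1 \<Rightarrow> 'a vec \<Rightarrow> 'a vec" where
  "coroot g x = vec_of_list [2 * x$0 - g * x$1, 2 * x$1 - g * x$0 - x$2, 2 * x$2 - x$1 - x$3,
     2 * x$3 - x$2]"

definition refl :: "'a::comm_ring_1 \<Rightarrow> 'a vec \<Rightarrow> 'a mat" where
  "refl g a = mat 4 4 (\<lambda>(i, j). (if i = j then 1 else 0) - a $ i * coroot g a $ j)"

lemma less_4_cases: "i < 4 \<longleftrightarrow> i = 0 \<or> i = 1 \<or> i = 2 \<or> i = (3::nat)"
  by auto

lemma sum_4: "(\<Sum>i = 0..<4::nat. f i) = f 0 + f 1 + f 2 + (f 3 :: 'a::comm_monoid_add)"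
  by (simp add: numeral_eq_Suc)

lemma all_less_4: "(\<forall>i<4. P i) \<longleftrightarrow> P 0 \<and> P 1 \<and> P 2 \<and> P (3::nat)"
  by (auto simp: less_4_cases)

lemma vec4_eqI:
  assumes "v \<in> carrier_vec 4" "w \<in> carrier_vec 4" "v$0 = w$0" "v$1 = w$1" "v$2 = w$2" "v$3 = w$3"
  shows "v = w"
  using assms by (intro eq_vecI) (auto simp: less_4_cases)

lemma coroot_index [simp]:
  "coroot g x $ 0 = 2 * x$0 - g * x$1" "coroot g x $ Suc 0 = 2 * x$1 - g * x$0 - x$2"
  "coroot g x $ 2 = 2 * x$2 - x$1 - x$3" "coroot g x $ 3 = 2 * x$3 - x$2"
  "coroot g x \<in> carrier_vec 4" "dim_vec (coroot g x) = 4"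
  by (simp_all add: coroot_def numeral_eq_Suc carrier_vecI)

lemma form_coroot: "v \<in> carrier_vec 4 \<Longrightarrow> form g x v = coroot g x \<bullet> v"
  by (simp add: form_def scalar_prod_def sum_4 algebra_simps)

lemma form_sym: "form g x y = form g y x"
  by (simp add: form_def algebra_simps)

lemma form_add_left: "x \<in> carrier_vec 4 \<Longrightarrow> y \<in> carrier_vec 4 \<Longrightarrow> form g (x + y) z = form g x z + form g y z"
  by (simp add: form_def algebra_simps)

lemma form_diff_left: "x \<in> carrier_vec 4 \<Longrightarrow> y \<in> carrier_vec 4 \<Longrightarrow> form g (x - y) z = form g x z - form g y z"
  by (simp add: form_def algebra_simps)

lemma form_smult_left: "x \<in> carrier_vec 4 \<Longrightarrow> form g (c \<cdot>\<^sub>v x) z = c * form g x z"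
  by (simp add: form_def algebra_simps)

lemma form_add_right: "x \<in> carrier_vec 4 \<Longrightarrow> y \<in> carrier_vec 4 \<Longrightarrow> form g z (x + y) = form g z x + form g z y"
  by (simp add: form_def algebra_simps)

lemma form_diff_right: "x \<in> carrier_vec 4 \<Longrightarrow> y \<in> carrier_vec 4 \<Longrightarrow> form g z (x - y) = form g z x - form g z y"
  by (simp add: form_def algebra_simps)

lemma form_smult_right: "x \<in> carrier_vec 4 \<Longrightarrow> form g z (c \<cdot>\<^sub>v x) = c * form g z x"
  by (simp add: form_def algebra_simps)

lemmas form_linear = form_add_left form_diff_left form_smult_left form_add_right form_diff_right
  form_smult_right

lemma refl_carrier [simp]: "refl g a \<in> carrier_mat 4 4"
  by (simp add: refl_def)

lemma refl_apply:
  assumes "v \<in> carrier_vec 4" "a \<in> carrier_vec 4"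
  shows "refl g a *\<^sub>v v = v - form g a v \<cdot>\<^sub>v a"
proof (rule eq_vecI)
  fix i assume "i < dim_vec (v - form g a v \<cdot>\<^sub>v a)"
  hence i: "i < 4" using assms by simp
  have "(refl g a *\<^sub>v v) $ i = (\<Sum>j = 0..<4. (if i = j then v $ j else 0) - a $ i * (coroot g a $ j * v $ j))"
    using i assms by (auto simp: refl_def scalar_prod_def algebra_simps intro!: sum.cong)
  also have "\<dots> = v $ i - a $ i * (coroot g a \<bullet> v)"
    using i assms by (simp add: sum_subtractf sum_distrib_left[symmetric] scalar_prod_def)
  finally show "(refl g a *\<^sub>v v) $ i = (v - form g a v \<cdot>\<^sub>v a) $ i"
    using i assms by (simp add: form_coroot mult.commute)
qed (use assms in \<open>simp add: refl_def\<close>)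

lemma (in golden_root) form_hom:
  "x \<in> carrier_vec 4 \<Longrightarrow> y \<in> carrier_vec 4 \<Longrightarrow>
    form r (map_vec (embed r) x) (map_vec (embed r) y) = embed r (form golden_int x y)"
  by (simp add: form_def emb.hom_minus emb.hom_mult emb.hom_add)

lemma (in golden_root) coroot_hom:
  "x \<in> carrier_vec 4 \<Longrightarrow> coroot r (map_vec (embed r) x) = map_vec (embed r) (coroot golden_int x)"
  by (intro vec4_eqI; simp add: emb.hom_minus emb.hom_mult)

lemma (in golden_root) refl_hom:
  "x \<in> carrier_vec 4 \<Longrightarrow> refl r (map_vec (embed r) x) = map_mat (embed r) (refl golden_int x)"
  by (intro eq_matI; simp add: refl_def coroot_hom emb.hom_minus emb.hom_mult carrier_vecD)

text \<open>Successive completion of squares, starting at the end of the diagram away from the label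
  5. Definiteness hangs on the last coefficient alone, which is positive for both roots of x^2 = x +
  1.\<close>

lemma form_sum_of_squares:
  fixes g :: real
  shows "form g x x = 2 * (x$3 - x$2 / 2)^2 + 3/2 * (x$2 - 2/3 * x$1)^2
    + 4/3 * (x$1 - 3/4 * g * x$0)^2 + (2 - 3/4 * g^2) * (x$0)^2"
  by (simp add: form_def power2_eq_square field_simps)

lemma golden_discriminant: "0 < 2 - 3/4 * golden^2" "0 < 2 - 3/4 * (1 - golden)^2"
  using golden_sq golden_conj_sq golden_bounds by (simp_all add: power2_eq_square)

lemma form_nonneg:
  fixes g :: real
  assumes "0 < 2 - 3/4 * g^2"
  shows "0 \<le> form g x x"
  unfolding form_sum_of_squares using assms
  by (intro add_nonneg_nonneg mult_nonneg_nonneg) auto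

lemma form_eq_0:
  fixes g :: real
  assumes "0 < 2 - 3/4 * g^2" "x \<in> carrier_vec 4" "form g x x = 0"
  shows "x = 0\<^sub>v 4"
proof -
  have "0 \<le> 2 * (x$3 - x$2 / 2)^2" "0 \<le> 3/2 * (x$2 - 2/3 * x$1)^2"
    "0 \<le> 4/3 * (x$1 - 3/4 * g * x$0)^2" "0 \<le> (2 - 3/4 * g^2) * (x$0)^2"
    using assms by auto
  with assms(3) have "2 * (x$3 - x$2 / 2)^2 = 0" "3/2 * (x$2 - 2/3 * x$1)^2 = 0"
    "4/3 * (x$1 - 3/4 * g * x$0)^2 = 0" "(2 - 3/4 * g^2) * (x$0)^2 = 0"
    unfolding form_sum_of_squares by linarith+
  hence "x$0 = 0" "x$1 = 3/4 * g * x$0" "x$2 = 2/3 * x$1" "x$3 = x$2 / 2"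
    using assms(1) by auto
  thus ?thesis using assms(2) by (intro vec4_eqI) auto
qed

text \<open>Cauchy-Schwarz for vectors of norm 2, read off from the norms of the sum and the
  difference.\<close>

lemma form_abs_le:
  fixes g :: real
  assumes g: "0 < 2 - 3/4 * g^2" and v: "x \<in> carrier_vec 4" "y \<in> carrier_vec 4"
    and n: "form g x x = 2" "form g y y = 2"
  shows "\<bar>form g x y\<bar> \<le> 2"
proof -
  have "0 \<le> form g (x + y) (x + y)" "0 \<le> form g (x - y) (x - y)"
    using form_nonneg[OF g] by auto
  thus ?thesis using v n form_sym[of g y x] by (simp add: form_linear)
qed

lemma root_form_values:
  assumes v: "x \<in> carrier_vec 4" "y \<in> carrier_vec 4"
    and n: "form golden_int x x = 2" "form golden_int y y = 2"
  shows "form golden_int x y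
    \<in> {0, 1, -1, 2, -2, Gint 0 1, Gint 0 (-1), Gint (-1) 1, Gint 1 (-1)}"
proof (rule gint_bounded)
  have 1: "form golden (map_vec ev1 x) (map_vec ev1 x) = 2" "form golden (map_vec ev1 y) (map_vec ev1 y) = 2"
    and 2: "form (1 - golden) (map_vec ev2 x) (map_vec ev2 x) = 2"
     "form (1 - golden) (map_vec ev2 y) (map_vec ev2 y) = 2"
    using n v by (simp_all add: ev1.form_hom ev2.form_hom)
  show "\<bar>ev1 (form golden_int x y)\<bar> \<le> 2"
    using form_abs_le[OF golden_discriminant(1) _ _ 1] v by (simp add: ev1.form_hom)
  show "\<bar>ev2 (form golden_int x y)\<bar> \<le> 2"
    using form_abs_le[OF golden_discriminant(2) _ _ 2] v by (simp add: ev2.form_hom)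
qed

section \<open>The matrix group and its isometries\<close>

lemma GL_carrier: "A \<in> carrier (GL n) \<longleftrightarrow>
    A \<in> carrier_mat n n \<and> (\<exists>B\<in>carrier_mat n n. A * B = 1\<^sub>m n \<and> B * A = 1\<^sub>m n)"
  by (auto simp: GL_def units_of_def Units_def ring_mat_def)

lemma GL_simps [simp]: "\<one>\<^bsub>GL n\<^esub> = 1\<^sub>m n" "A \<otimes>\<^bsub>GL n\<^esub> B = A * B"
  by (simp_all add: GL_def units_of_def ring_mat_def)

lemma GL_group: "group (GL n)"
proof -
  interpret ring "ring_mat TYPE(complex) n ()" by (rule ring_mat)
  show ?thesis unfolding GL_def by (rule units_group)
qed

lemma GL_inv:
  assumes "A \<in> carrier_mat n n" "B \<in> carrier_mat n n" "A * B = 1\<^sub>m n" "B * A = 1\<^sub>m n"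
  shows "inv\<^bsub>GL n\<^esub> A = B"
proof -
  interpret group "GL n" by (rule GL_group)
  have "A \<in> carrier (GL n)" "B \<in> carrier (GL n)" using assms by (auto simp: GL_carrier)
  with assms show ?thesis by (intro inv_equality) auto
qed

lemma GL_inv_props:
  assumes "A \<in> carrier (GL n)"
  shows "inv\<^bsub>GL n\<^esub> A \<in> carrier_mat n n" "A * inv\<^bsub>GL n\<^esub> A = 1\<^sub>m n" "inv\<^bsub>GL n\<^esub> A * A = 1\<^sub>m n"
proof -
  obtain B where "B \<in> carrier_mat n n" "A * B = 1\<^sub>m n" "B * A = 1\<^sub>m n"
    using assms by (auto simp: GL_carrier)
  with GL_inv[of A n B] assms
  show "inv\<^bsub>GL n\<^esub> A \<in> carrier_mat n n" "A * inv\<^bsub>GL n\<^esub> A = 1\<^sub>m n" "inv\<^bsub>GL n\<^esub> A * A = 1\<^sub>m n"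
    by (auto simp: GL_carrier)
qed

section \<open>Isometries and reflections\<close>

definition isometry :: "'a::comm_ring_1 \<Rightarrow> 'a mat \<Rightarrow> bool" where
  "isometry g A \<longleftrightarrow> A \<in> carrier_mat 4 4 \<and>
    (\<forall>x\<in>carrier_vec 4. \<forall>y\<in>carrier_vec 4. form g (A *\<^sub>v x) (A *\<^sub>v y) = form g x y)"

lemma isometry_one: "isometry g (1\<^sub>m 4)"
  by (simp add: isometry_def)

lemma isometry_mult: "isometry g A \<Longrightarrow> isometry g B \<Longrightarrow> isometry g (A * B)"
  by (auto simp: isometry_def)

lemma isometry_refl:
  assumes "a \<in> carrier_vec 4" "form g a a = 2"
  shows "isometry g (refl g a)"
  unfolding isometry_def
proof (intro conjI ballI)
  fix x y :: "'a vec" assume v: "x \<in> carrier_vec 4" "y \<in> carrier_vec 4"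
  have "form g x a = form g a x" by (rule form_sym)
  thus "form g (refl g a *\<^sub>v x) (refl g a *\<^sub>v y) = form g x y"
    using assms v by (simp add: refl_apply form_linear)
qed simp

lemma mat_mult_unit_vec:
  fixes A :: "'a::comm_ring_1 mat"
  assumes "A \<in> carrier_mat m n" "j < n"
  shows "A *\<^sub>v unit_vec n j = col A j"
  using assms by (intro eq_vecI) (auto simp: scalar_prod_right_unit)

lemma mat_eq_by_vec:
  fixes A B :: "'a::comm_ring_1 mat"
  assumes "A \<in> carrier_mat m n" "B \<in> carrier_mat m n"
    "\<And>v. v \<in> carrier_vec n \<Longrightarrow> A *\<^sub>v v = B *\<^sub>v v"
  shows "A = B"
proof (rule eq_matI)
  fix i j assume ij: "i < dim_row B" "j < dim_col B"
  hence "col A j = col B j"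
    using assms mat_mult_unit_vec[of A m n j] mat_mult_unit_vec[of B m n j] by simp
  hence "col A j $ i = col B j $ i" by simp
  thus "A $$ (i, j) = B $$ (i, j)" using assms(1,2) ij by simp
qed (use assms in auto)

lemma refl_involution:
  assumes "a \<in> carrier_vec 4" "form g a a = 2"
  shows "refl g a * refl g a = 1\<^sub>m 4"
proof (rule mat_eq_by_vec[of _ 4 4])
  fix v :: "'a vec" assume v: "v \<in> carrier_vec 4"
  have "(refl g a * refl g a) *\<^sub>v v = refl g a *\<^sub>v (refl g a *\<^sub>v v)" 
    using v by (simp add: assoc_mult_mat_vec[of _ 4 4 _ 4])
  also have "\<dots> = v"
    using v assms by (intro eq_vecI) (auto simp: refl_apply form_linear)
  finally show "(refl g a * refl g a) *\<^sub>v v = 1\<^sub>m 4 *\<^sub>v v" using v by simp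
qed (auto intro: mult_carrier_mat[of _ 4 4])

text \<open>For c = cos (pi/5) the identity cos (3 pi/5) = - cos (2 pi/5) is a cubic equation with
  the root -1; the remaining quadratic has \<open>golden / 2\<close> as its only positive
  root.\<close>

lemma cos_pi_5: "cos (pi / 5) = golden / 2"
proof -
  define c where "c = cos (pi / 5)"
  have c0: "0 < c" unfolding c_def by (rule cos_gt_zero) auto
  have "cos (3 * (pi / 5)) = - cos (2 * (pi / 5))"
  proof -
    have "3 * (pi / 5) = pi - 2 * (pi / 5)" by simp
    thus ?thesis by (metis cos_pi_minus)
  qed
  hence "4 * c^3 - 3 * c = - (2 * c^2 - 1)"
    unfolding c_def cos_treble_cos cos_double_cos .
  hence "(c + 1) * (4 * c^2 - 2 * c - 1) = 0"
    by (simp add: algebra_simps power2_eq_square power3_eq_cube)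
  hence "4 * c^2 - 2 * c - 1 = 0" using c0 by simp
  hence "(2 * c - golden) * (2 * c + golden - 1) = 0"
    using golden_sq by (simp add: algebra_simps power2_eq_square)
  moreover have "2 * c + golden - 1 > 0" using c0 golden_bounds by simp
  ultimately show ?thesis unfolding c_def by simp
qed

section \<open>Simple reflections and integrality of the group\<close>

definition simple_root :: "nat \<Rightarrow> gint vec" where "simple_root i = unit_vec 4 i"

lemma simple_root_carrier [simp]: "simple_root i \<in> carrier_vec 4"
  by (simp add: simple_root_def)

lemma simple_root_index [simp]: "j < 4 \<Longrightarrow> simple_root i $ j = (if j = i then 1 else 0)"
  by (simp add: simple_root_def unit_vec_def)

lemma H4_form_coroot:
  assumes "i < 4" "j < 4"
  shows "2 * complex_of_real (H4_form i j) = evc (coroot golden_int (simple_root i) $ j)"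
proof -
  have "i \<in> {0, 1, 2, 3}" "j \<in> {0, 1, 2, 3}" using assms by auto
  thus ?thesis
    by (elim insertE emptyE)
      (simp_all add: H4_form_def H4_coxeter_def cos_pi_5 cos_60 doubleton_eq_iff evc.emb.hom_uminus)
qed

lemma H4_simple_refl:
  assumes "i < 4"
  shows "H4_simple i = map_mat evc (refl golden_int (simple_root i))"
proof (rule eq_matI)
  fix a j assume "a < dim_row (map_mat evc (refl golden_int (simple_root i)))"
    "j < dim_col (map_mat evc (refl golden_int (simple_root i)))"
  hence "a < 4" "j < 4" by (auto simp: refl_def)
  thus "H4_simple i $$ (a, j) = map_mat evc (refl golden_int (simple_root i)) $$ (a, j)"
    using assms H4_form_coroot[of i j]
    by (simp add: H4_simple_def refl_def evc.emb.hom_minus evc.emb.hom_mult)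
qed (auto simp: H4_simple_def refl_def)

lemma simple_root_norm: "i < 4 \<Longrightarrow> form golden_int (simple_root i) (simple_root i) = 2"
  by (auto simp: less_4_cases form_def)

lemma map_mat_evc_mult:
  "A \<in> carrier_mat 4 4 \<Longrightarrow> B \<in> carrier_mat 4 4 \<Longrightarrow>
   map_mat evc (A * B) = map_mat evc A * map_mat evc B"
  by (rule evc.emb.mat_hom_mult)

lemma map_mat_evc_one: "map_mat evc (1\<^sub>m 4) = 1\<^sub>m 4"
  by (rule evc.emb.mat_hom_one)

lemma H4_simple_involution:
  assumes "i < 4" shows "H4_simple i * H4_simple i = 1\<^sub>m 4" "H4_simple i \<in> carrier_mat 4 4"
  using assms refl_involution[OF _ simple_root_norm[OF assms]]
  by (simp_all add: H4_simple_refl map_mat_evc_mult[symmetric] map_mat_evc_one)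

lemma H4_simple_GL: "i < 4 \<Longrightarrow> H4_simple i \<in> carrier (GL 4)"
  using H4_simple_involution by (auto simp: GL_carrier)

lemma G30_subset: "G30 \<subseteq> carrier (GL 4)"
  unfolding G30_def by (rule group.generate_incl[OF GL_group]) (auto intro: H4_simple_GL)

text \<open>One integral matrix serves all embeddings. Preservation of the form is carried through
  the induction in each of them, since over the golden integers it speaks about integral vectors
  only.\<close>

lemma G30_integral:
  assumes "A \<in> G30"
  obtains A0 where "A = map_mat evc A0" "isometry golden_int A0" "isometry golden (map_mat ev1 A0)"
    "isometry (1 - golden) (map_mat ev2 A0)" "isometry cgolden (map_mat evc A0)"
proof -
  define good where "good A0 \<longleftrightarrow> isometry golden_int A0 \<and> isometry golden (map_mat ev1 A0)
      \<and> isometry (1 - golden) (map_mat ev2 A0) \<and> isometry cgolden (map_mat evc A0)" for A0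
  have refl: "good (refl golden_int (simple_root i))" if "i < 4" for i
    unfolding good_def ev1.refl_hom[OF simple_root_carrier, symmetric]
      ev2.refl_hom[OF simple_root_carrier, symmetric] evc.refl_hom[OF simple_root_carrier, symmetric]
    by (intro conjI isometry_refl)
      (simp_all add: ev1.form_hom ev2.form_hom evc.form_hom simple_root_norm[OF that])
  have "\<exists>A0. A = map_mat evc A0 \<and> good A0"
    using assms unfolding G30_def
  proof (induction rule: generate.induct)
    case one
    show ?case
      by (rule exI[of _ "1\<^sub>m 4"])
        (simp add: good_def isometry_one map_mat_evc_one ev1.emb.mat_hom_one ev2.emb.mat_hom_one)
  next
    case (incl h)
    then obtain i where "i < 4" "h = H4_simple i" by auto
    thus ?case using refl[of i] H4_simple_refl by blast
  next
    case (inv h)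
    then obtain i where i: "i < 4" "h = H4_simple i" by auto
    hence "inv\<^bsub>GL 4\<^esub> h = H4_simple i" using H4_simple_involution by (simp add: GL_inv)
    thus ?case using i refl[of i] H4_simple_refl by metis
  next
    case (eng h1 h2)
    then obtain A B where "h1 = map_mat evc A" "good A" "h2 = map_mat evc B" "good B"
      by blast
    thus ?case
      by (intro exI[of _ "A * B"])
        (auto simp: good_def isometry_mult map_mat_evc_mult ev1.emb.mat_hom_mult[of _ 4 4 _ 4]
          ev2.emb.mat_hom_mult[of _ 4 4 _ 4] isometry_def[of golden_int])
  qed
  thus thesis using that unfolding good_def by blast
qed

section \<open>Unitarity\<close>

interpretation cnj: comm_ring_hom cnj
  by standard simp_all

text \<open>A real matrix preserving the complexified form also preserves the Hermitian form
  \<open>form cgolden (map_vec cnj v) w\<close>, so it is unitary.\<close>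

definition real_isometry :: "complex mat \<Rightarrow> bool" where
  "real_isometry Q \<longleftrightarrow> isometry cgolden Q \<and> map_mat cnj Q = Q"

lemma map_mat_cnj_evc: "map_mat cnj (map_mat evc A) = map_mat evc A"
  by (intro eq_matI) (simp_all add: evc_of_real)

lemma G30_real_isometry: "A \<in> G30 \<Longrightarrow> real_isometry A"
  by (metis G30_integral map_mat_cnj_evc real_isometry_def)

text \<open>The Hermitian square of \<open>v\<close> is the sum of the norms of its real and
  imaginary parts, and the real form is definite.\<close>

lemma form_cnj_eq_0:
  assumes v: "v \<in> carrier_vec 4" and 0: "form cgolden (map_vec cnj v) v = 0"
  shows "v = 0\<^sub>v 4"
proof -
  have "form golden (map_vec Re v) (map_vec Re v) + form golden (map_vec Im v) (map_vec Im v)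
     = Re (form cgolden (map_vec cnj v) v)"
    using v by (simp add: form_def algebra_simps)
  hence "form golden (map_vec Re v) (map_vec Re v) + form golden (map_vec Im v) (map_vec Im v) = 0"
    using 0 by simp
  hence "form golden (map_vec Re v) (map_vec Re v) = 0" "form golden (map_vec Im v) (map_vec Im v) = 0"
    using form_nonneg[OF golden_discriminant(1)] by (smt (verit))+
  hence "map_vec Re v = 0\<^sub>v 4" "map_vec Im v = 0\<^sub>v 4"
    using form_eq_0[OF golden_discriminant(1)] v by simp_all
  hence "Re (v $ i) = 0 \<and> Im (v $ i) = 0" if "i < 4" for i
    using that v by (metis carrier_vecD index_map_vec(1) index_zero_vec(1))
  thus ?thesis using v by (intro eq_vecI) (auto simp: complex_eq_iff)
qed

lemma real_isometryD:
  assumes "real_isometry Q"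
  shows "Q \<in> carrier_mat 4 4"
    and "x \<in> carrier_vec 4 \<Longrightarrow> y \<in> carrier_vec 4 \<Longrightarrow> form cgolden (Q *\<^sub>v x) (Q *\<^sub>v y) = form cgolden x y"
    and "x \<in> carrier_vec 4 \<Longrightarrow> map_vec cnj (Q *\<^sub>v x) = Q *\<^sub>v map_vec cnj x"
proof -
  show Q: "Q \<in> carrier_mat 4 4" using assms by (simp add: real_isometry_def isometry_def)
  show "x \<in> carrier_vec 4 \<Longrightarrow> y \<in> carrier_vec 4 \<Longrightarrow> form cgolden (Q *\<^sub>v x) (Q *\<^sub>v y) = form cgolden x y"
    using assms by (simp add: real_isometry_def isometry_def)
  show "x \<in> carrier_vec 4 \<Longrightarrow> map_vec cnj (Q *\<^sub>v x) = Q *\<^sub>v map_vec cnj x"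
    using cnj.mult_mat_vec_hom[OF Q] assms by (simp add: real_isometry_def)
qed

lemma map_vec_cnj_smult: "map_vec cnj (a \<cdot>\<^sub>v v) = cnj a \<cdot>\<^sub>v map_vec cnj v"
  by (intro eq_vecI) auto

lemma eigenvalue_norm:
  assumes Q: "real_isometry Q" and v: "v \<in> carrier_vec 4" "v \<noteq> 0\<^sub>v 4" and e: "Q *\<^sub>v v = a \<cdot>\<^sub>v v"
  shows "cnj a * a = 1"
proof -
  note D = real_isometryD[OF Q]
  have "form cgolden (map_vec cnj v) v = form cgolden (Q *\<^sub>v map_vec cnj v) (Q *\<^sub>v v)"
    using D(2) v by simp
  also have "\<dots> = form cgolden (cnj a \<cdot>\<^sub>v map_vec cnj v) (a \<cdot>\<^sub>v v)"
    using D(3)[OF v(1)] by (simp add: e map_vec_cnj_smult)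
  also have "\<dots> = cnj a * a * form cgolden (map_vec cnj v) v"
    using v by (simp add: form_linear)
  finally show ?thesis using form_cnj_eq_0[OF v(1)] v(2) by (metis mult_cancel_right1)
qed

text \<open>Unitary maps have no Jordan blocks: the pairing of \<open>w\<close> with
  \<open>v\<close> is invariant, and comparing both sides isolates \<open>b\<close> times the
  Hermitian square of \<open>w\<close>.\<close>

lemma eigenvalue_semisimple:
  assumes Q: "real_isometry Q" and v: "v \<in> carrier_vec 4" and w: "w \<in> carrier_vec 4" "w \<noteq> 0\<^sub>v 4"
    and ew: "Q *\<^sub>v w = a \<cdot>\<^sub>v w" and ev: "Q *\<^sub>v v = a \<cdot>\<^sub>v v + b \<cdot>\<^sub>v w"
  shows "b = 0"
proof -
  note D = real_isometryD[OF Q]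
  note a = eigenvalue_norm[OF Q w ew]
  have "form cgolden (map_vec cnj w) v = form cgolden (Q *\<^sub>v map_vec cnj w) (Q *\<^sub>v v)"
    using D(2) v w by simp
  also have "\<dots> = form cgolden (cnj a \<cdot>\<^sub>v map_vec cnj w) (a \<cdot>\<^sub>v v + b \<cdot>\<^sub>v w)"
    using D(3)[OF w(1)] by (simp add: ew ev map_vec_cnj_smult)
  also have "\<dots> = cnj a * a * form cgolden (map_vec cnj w) v + cnj a * b * form cgolden (map_vec cnj w) w"
    using v w by (simp add: form_linear algebra_simps)
  finally have "cnj a * b * form cgolden (map_vec cnj w) w = 0" using a by simp
  thus ?thesis using form_cnj_eq_0[OF w(1)] w(2) a by auto
qed

text \<open>A Schur form with the eigenvalues on the diagonal in a prescribed order, so that a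
  multiple eigenvalue can be put first.\<close>

lemma eigs_decomposition:
  assumes A: "A \<in> carrier_mat n n" and e: "eigs A = mset es"
  obtains T P P' where "similar_mat_wit A T P P'" "upper_triangular T" "diag_mat T = es"
proof -
  obtain as where as: "char_poly A = (\<Prod>a\<leftarrow>as. [:- a, 1:])" using char_poly_factorized[OF A] by blast
  have "eigs A = mset as" 
  proof -
    have "(\<Prod>a\<leftarrow>bs. [:- a, 1:]) \<noteq> 0" for bs :: "complex list"
      by (auto simp: prod_list_zero_iff)
    thus ?thesis unfolding eigs_def as
      by (induction as) (simp_all add: proots_mult del: mult_pCons_left)
  qed
  hence "mset as = mset es" using e by simp
  hence "(\<Prod>a\<leftarrow>as. [:- a, 1:]) = (\<Prod>a\<leftarrow>es. [:- a, 1:])"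
    by (simp only: prod_mset_prod_list[symmetric] mset_map)
  with as have cp: "char_poly A = (\<Prod>a\<leftarrow>es. [:- a, 1:])" by (simp only:)
  obtain T P P' where "schur_decomposition A es = (T, P, P')"
    by (cases "schur_decomposition A es")
  from schur_decomposition[OF A cp this] that show thesis by blast
qed

lemma mult_mat_vec_cols:
  fixes A :: "'a::comm_ring_1 mat"
  assumes "A \<in> carrier_mat n 4" "x \<in> carrier_vec 4"
  shows "A *\<^sub>v x = x$0 \<cdot>\<^sub>v col A 0 + x$1 \<cdot>\<^sub>v col A 1 + x$2 \<cdot>\<^sub>v col A 2 + x$3 \<cdot>\<^sub>v col A 3"
  using assms by (intro eq_vecI) (auto simp: scalar_prod_def sum_4 ac_simps)

lemma size_eigs: "A \<in> carrier_mat n n \<Longrightarrow> size (eigs A) = n"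
  by (simp add: eigs_def size_proots_complex degree_monic_char_poly)

lemma upper_triangular_cols:
  fixes Q :: "complex mat"
  assumes wit: "similar_mat_wit Q T P P'" "upper_triangular T" "Q \<in> carrier_mat 4 4"
  shows "j < 4 \<Longrightarrow> col P j \<in> carrier_vec 4"
    and "Q *\<^sub>v col P 0 = T $$ (0,0) \<cdot>\<^sub>v col P 0"
    and "Q *\<^sub>v col P 1 = T $$ (1,1) \<cdot>\<^sub>v col P 1 + T $$ (0,1) \<cdot>\<^sub>v col P 0"
    and "Q *\<^sub>v col P 2 = T $$ (2,2) \<cdot>\<^sub>v col P 2 + (T $$ (0,2) \<cdot>\<^sub>v col P 0 + T $$ (1,2) \<cdot>\<^sub>v col P 1)"
    and "a \<cdot>\<^sub>v col P 0 + b \<cdot>\<^sub>v col P 1 = 0\<^sub>v 4 \<Longrightarrow> a = 0 \<and> b = 0"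
    and "col P 0 \<noteq> 0\<^sub>v 4"
    and "x \<in> carrier_vec 4 \<Longrightarrow> Q *\<^sub>v x = P *\<^sub>v (T *\<^sub>v (P' *\<^sub>v x))"
proof -
  note w = similar_mat_witD2[OF assms(3) wit(1)]
  have C: "T \<in> carrier_mat 4 4" "P \<in> carrier_mat 4 4" "P' \<in> carrier_mat 4 4" using w by auto
  show cP: "col P j \<in> carrier_vec 4" if "j < 4" for j using C by (auto intro: carrier_vecI)
  have QP: "Q * P = P * T"
  proof -
    have "Q * P = P * T * (P' * P)" using w by (simp add: assoc_mult_mat[of _ 4 4 _ 4 _ 4])
    thus ?thesis using w C by simp
  qed
  have step: "Q *\<^sub>v col P j = P *\<^sub>v col T j" if "j < 4" for j
  proof -
    have "Q *\<^sub>v col P j = col (Q * P) j" using that w by (intro eq_vecI) auto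
    also have "\<dots> = P *\<^sub>v col T j" unfolding QP using that w by (intro eq_vecI) auto
    finally show ?thesis .
  qed
  have lt: "0 < (4::nat)" "1 < (4::nat)" "2 < (4::nat)" by simp_all
  have ut: "T $$ (i, j) = 0" if "j < i" "i < 4" for i j
    using wit(2) that C by (auto simp: upper_triangular_def)
  have cT: "col T j \<in> carrier_vec 4" for j using C by (auto intro: carrier_vecI)
  have ct: "col T j $ i = T $$ (i, j)" if "i < 4" "j < 4" for i j using C that by simp
  show "Q *\<^sub>v col P 0 = T $$ (0,0) \<cdot>\<^sub>v col P 0"
    unfolding step[OF lt(1)] mult_mat_vec_cols[OF C(2) cT]
    using C by (intro eq_vecI) (auto simp: ct ut)
  show "Q *\<^sub>v col P 1 = T $$ (1,1) \<cdot>\<^sub>v col P 1 + T $$ (0,1) \<cdot>\<^sub>v col P 0"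
    unfolding step[OF lt(2)] mult_mat_vec_cols[OF C(2) cT]
    using C by (intro eq_vecI) (auto simp: ct ut)
  show "Q *\<^sub>v col P 2 = T $$ (2,2) \<cdot>\<^sub>v col P 2 + (T $$ (0,2) \<cdot>\<^sub>v col P 0 + T $$ (1,2) \<cdot>\<^sub>v col P 1)"
    unfolding step[OF lt(3)] mult_mat_vec_cols[OF C(2) cT]
    using C by (intro eq_vecI) (auto simp: ct ut)
  have inj: "x = 0\<^sub>v 4" if x: "x \<in> carrier_vec 4" "P *\<^sub>v x = 0\<^sub>v 4" for x
  proof -
    have "x = P' * P *\<^sub>v x" using w x by simp
    also have "\<dots> = P' *\<^sub>v (P *\<^sub>v x)" by (rule assoc_mult_mat_vec[of _ 4 4 _ 4]) (use C x in auto)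
    also have "\<dots> = 0\<^sub>v 4" unfolding x(2) using C by (intro eq_vecI) auto
    finally show ?thesis .
  qed
  have ind: "a = 0 \<and> b = 0" if "a \<cdot>\<^sub>v col P 0 + b \<cdot>\<^sub>v col P 1 = 0\<^sub>v 4" for a b
  proof -
    define z where "z = vec 4 (\<lambda>i. if i = 0 then a else if i = 1 then b else 0)"
    have z: "z \<in> carrier_vec 4" "z $ 0 = a" "z $ 1 = b" "z $ 2 = 0" "z $ 3 = 0"
      by (simp_all add: z_def)
    have "P *\<^sub>v z = a \<cdot>\<^sub>v col P 0 + b \<cdot>\<^sub>v col P 1"
      unfolding mult_mat_vec_cols[OF C(2) z(1)] z(2-) using C by (intro eq_vecI) auto
    hence "z = 0\<^sub>v 4" using inj[OF z(1)] that by simp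
    hence "z $ 0 = 0" "z $ 1 = 0" by simp_all
    thus ?thesis using z by simp
  qed
  show "a \<cdot>\<^sub>v col P 0 + b \<cdot>\<^sub>v col P 1 = 0\<^sub>v 4 \<Longrightarrow> a = 0 \<and> b = 0" by (rule ind)
  show "col P 0 \<noteq> 0\<^sub>v 4"
  proof
    assume "col P 0 = 0\<^sub>v 4"
    hence "1 \<cdot>\<^sub>v col P 0 + 0 \<cdot>\<^sub>v col P 1 = 0\<^sub>v 4" using cP[of 1] C by (intro eq_vecI) auto
    from ind[OF this] show False by simp
  qed
  show "Q *\<^sub>v x = P *\<^sub>v (T *\<^sub>v (P' *\<^sub>v x))" if x: "x \<in> carrier_vec 4"
  proof -
    have "Q *\<^sub>v x = P * T * P' *\<^sub>v x" using w by simp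
    also have "\<dots> = P * T *\<^sub>v (P' *\<^sub>v x)"
      by (rule assoc_mult_mat_vec[of _ 4 4 _ 4]) (use C x in auto)
    also have "\<dots> = P *\<^sub>v (T *\<^sub>v (P' *\<^sub>v x))"
      by (rule assoc_mult_mat_vec[of _ 4 4 _ 4]) (use C x in auto)
    finally show ?thesis .
  qed
qed

text \<open>Algebraic and geometric multiplicity agree: with \<open>a\<close> in the first two
  diagonal places, semisimplicity removes the entry above the diagonal.\<close>

lemma two_eigenvectors:
  assumes Q: "real_isometry Q" and c: "2 \<le> count (eigs Q) a"
  obtains v w where "v \<in> carrier_vec 4" "w \<in> carrier_vec 4" "Q *\<^sub>v v = a \<cdot>\<^sub>v v" "Q *\<^sub>v w = a \<cdot>\<^sub>v w"
    "\<And>x y. x \<cdot>\<^sub>v v + y \<cdot>\<^sub>v w = 0\<^sub>v 4 \<Longrightarrow> x = 0 \<and> y = 0"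
proof -
  note D = real_isometryD[OF Q]
  have "{#a, a#} \<subseteq># eigs Q" using c by (auto simp: subseteq_mset_def)
  then obtain R where R: "eigs Q = {#a, a#} + R" by (metis subset_mset.add_diff_inverse)
  obtain rs where "R = mset rs" by (metis ex_mset)
  hence "eigs Q = mset (a # a # rs)" using R by simp
  from eigs_decomposition[OF D(1) this]
  obtain T P P' where wit: "similar_mat_wit Q T P P'" "upper_triangular T" "diag_mat T = a # a # rs" .
  note w = similar_mat_witD2[OF D(1) wit(1)]
  have "T $$ (0,0) = diag_mat T ! 0" "T $$ (1,1) = diag_mat T ! 1"
    using w by (auto simp: diag_mat_def nth_map)
  hence T: "T $$ (0,0) = a" "T $$ (1,1) = a" using wit(3) by simp_all
  note U = upper_triangular_cols[OF wit(1,2) D(1), unfolded T]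
  have "T $$ (0,1) = 0"
    using eigenvalue_semisimple[OF Q U(1)[of 1] U(1)[of 0] U(6) U(2,3)] by simp
  hence "Q *\<^sub>v col P 1 = a \<cdot>\<^sub>v col P 1" using U(3) U(1)[of 0] U(1)[of 1] by (auto intro!: eq_vecI)
  thus thesis using that[OF U(1)[of 0] U(1)[of 1] U(2) _ U(5)] by simp
qed

text \<open>With the eigenvalue 1 in the first three diagonal places, the triangular form differs
  from the identity only in its last column, so \<open>Q - 1\<close> has rank one. The remaining
  eigenvalue \<open>a\<close> is real, because the trace is, and of modulus 1, hence it is -1, and
  the normalization 2 is \<open>1 - a\<close>.\<close>

lemma one_dimensional_defect:
  assumes Q: "real_isometry Q" and s: "size {#\<mu> \<in># eigs Q. \<mu> \<noteq> 1#} = 1"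
  obtains u w where "u \<in> carrier_vec 4" "w \<in> carrier_vec 4" "w \<bullet> u = 2"
    "\<And>x. x \<in> carrier_vec 4 \<Longrightarrow> Q *\<^sub>v x = x - (w \<bullet> x) \<cdot>\<^sub>v u"
proof -
  note D = real_isometryD[OF Q]
  obtain a where a: "{#\<mu> \<in># eigs Q. \<mu> \<noteq> 1#} = {#a#}" using s size_1_singleton_mset by blast
  have "a \<in># {#\<mu> \<in># eigs Q. \<mu> \<noteq> 1#}" unfolding a by simp
  hence a1: "a \<noteq> 1" by simp
  have split: "eigs Q = {#\<mu> \<in># eigs Q. \<mu> = 1#} + {#a#}"
    using multiset_partition[of "eigs Q" "\<lambda>\<mu>. \<mu> = 1"] a by simp
  have "{#\<mu> \<in># eigs Q. \<mu> = 1#} = replicate_mset 3 1"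
  proof -
    have "size {#\<mu> \<in># eigs Q. \<mu> = 1#} = 3"
      using arg_cong[OF split, of size] size_eigs[OF D(1)] by simp
    thus ?thesis by (simp add: filter_eq_replicate_mset)
  qed
  hence "eigs Q = mset [1, 1, 1, a]" using split by (simp add: numeral_eq_Suc)
  from eigs_decomposition[OF D(1) this]
  obtain T P P' where wit: "similar_mat_wit Q T P P'" "upper_triangular T" "diag_mat T = [1, 1, 1, a]" .
  note w = similar_mat_witD2[OF D(1) wit(1)]
  have C: "T \<in> carrier_mat 4 4" "P \<in> carrier_mat 4 4" "P' \<in> carrier_mat 4 4" using w by auto
  have "T $$ (i,i) = diag_mat T ! i" if "i < 4" for i
    using w that by (auto simp: diag_mat_def nth_map)
  from this[of 0] this[of 1] this[of 2] this[of 3]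
  have T: "T $$ (0,0) = 1" "T $$ (1,1) = 1" "T $$ (2,2) = 1" "T $$ (3,3) = a"
    unfolding wit(3) by simp_all
  note U = upper_triangular_cols[OF wit(1,2) D(1), unfolded T]
  have T01: "T $$ (0,1) = 0"
    using eigenvalue_semisimple[OF Q U(1)[of 1] U(1)[of 0] U(6) U(2,3)] by simp
  \<comment> \<open>The part of the third column above the diagonal is fixed by \<open>Q\<close>, so
    it would produce a Jordan block if it were nonzero.\<close>
  define z where "z = T $$ (0,2) \<cdot>\<^sub>v col P 0 + T $$ (1,2) \<cdot>\<^sub>v col P 1"
  have z: "z \<in> carrier_vec 4" unfolding z_def using U(1)[of 0] U(1)[of 1] by simp
  have Qz: "Q *\<^sub>v z = 1 \<cdot>\<^sub>v z"
    unfolding z_def using U(1)[of 0] U(1)[of 1] U(2,3) D(1) T01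
    by (simp add: mult_add_distrib_mat_vec[of _ 4 4] mult_mat_vec[of _ 4 4]) (auto intro!: eq_vecI)
  have z0: "z = 0\<^sub>v 4"
  proof (rule ccontr)
    assume z0: "z \<noteq> 0\<^sub>v 4"
    have "Q *\<^sub>v col P 2 = 1 \<cdot>\<^sub>v col P 2 + 1 \<cdot>\<^sub>v z" using U(4) z by (simp add: z_def)
    from eigenvalue_semisimple[OF Q _ z z0 Qz this] U(1)[of 2] show False by simp
  qed
  hence T2: "T $$ (0,2) = 0" "T $$ (1,2) = 0" using U(5) unfolding z_def by blast+
  have ut: "T $$ (i, j) = 0" if "j < i" "i < 4" for i j
    using wit(2) that C by (auto simp: upper_triangular_def)
  \<comment> \<open>\<open>T\<close> is the identity plus the column \<open>c\<close> times the last
    coordinate, so \<open>Q\<close> is the identity minus the column \<open>u\<close> times the row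
    \<open>r\<close>.\<close>
  define c where "c = col T 3 - unit_vec 4 3"
  define u where "u = - (P *\<^sub>v c)"
  define r where "r = row P' 3"
  have c: "c \<in> carrier_vec 4" using C by (auto simp: c_def intro: carrier_vecI)
  have u: "u \<in> carrier_vec 4" using C c by (auto simp: u_def intro: carrier_vecI)
  have r: "r \<in> carrier_vec 4" using C by (auto simp: r_def intro: carrier_vecI)
  have Ty: "T *\<^sub>v y = y + y $ 3 \<cdot>\<^sub>v c" if "y \<in> carrier_vec 4" for y
  proof -
    have low: "T $$ (Suc 0, 0) = 0" "T $$ (2, 0) = 0" "T $$ (3, 0) = 0" "T $$ (2, Suc 0) = 0"
      "T $$ (3, Suc 0) = 0" "T $$ (3, 2) = 0" by (simp_all add: ut)
    have cy: "dim_vec y = 4" "dim_row T = 4" "dim_col T = 4" using that C by auto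
    have "(T *\<^sub>v y) $ i = (y + y $ 3 \<cdot>\<^sub>v c) $ i" if i: "i < 4" for i
    proof -
      have e: "(T *\<^sub>v y) $ i = T $$ (i, 0) * y $ 0 + T $$ (i, 1) * y $ 1 + T $$ (i, 2) * y $ 2 + T $$ (i, 3) * y $ 3"
        using i cy by (simp add: scalar_prod_def sum_4)
      have "(y + y $ 3 \<cdot>\<^sub>v c) $ i = y $ i + y $ 3 * (T $$ (i, 3) - (if i = 3 then 1 else 0))"
        using i cy by (simp add: c_def)
      with e show ?thesis using i T(1-3) T01 T2 low
        by (elim less_4_cases[THEN iffD1, elim_format] disjE) (simp_all add: algebra_simps)
    qed
    thus ?thesis using c cy by (intro eq_vecI) auto
  qed
  have form: "Q *\<^sub>v x = x - (r \<bullet> x) \<cdot>\<^sub>v u" if x: "x \<in> carrier_vec 4" for x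
  proof -
    have y: "P' *\<^sub>v x \<in> carrier_vec 4" using C x by (auto intro: carrier_vecI)
    have "P *\<^sub>v (P' *\<^sub>v x) = x"
      using w x by (simp add: assoc_mult_mat_vec[of _ 4 4 _ 4, symmetric])
    moreover have "(P' *\<^sub>v x) $ 3 = r \<bullet> x" using C by (simp add: r_def)
    ultimately have "Q *\<^sub>v x = x + (r \<bullet> x) \<cdot>\<^sub>v (P *\<^sub>v c)"
      unfolding U(7)[OF x] Ty[OF y] using C y c
      by (simp add: mult_add_distrib_mat_vec[of _ 4 4] mult_mat_vec[of _ 4 4])
    thus ?thesis unfolding u_def using x C by (auto intro!: eq_vecI)
  qed
  have "P' *\<^sub>v (P *\<^sub>v c) = c"
    using w c by (simp add: assoc_mult_mat_vec[of _ 4 4 _ 4, symmetric])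
  moreover have "(P' *\<^sub>v (P *\<^sub>v c)) $ 3 = r \<bullet> (P *\<^sub>v c)" using C by (simp add: r_def)
  ultimately have "r \<bullet> (P *\<^sub>v c) = c $ 3" by simp
  hence ru: "r \<bullet> u = 1 - a"
    using r C c T(4) unfolding u_def by (simp add: c_def scalar_prod_uminus_right)
  have Qu: "Q *\<^sub>v u = a \<cdot>\<^sub>v u"
    unfolding form[OF u] ru using u by (auto intro!: eq_vecI simp: algebra_simps)
  have "u \<noteq> 0\<^sub>v 4" using ru a1 r by auto
  from eigenvalue_norm[OF Q u this Qu] have n: "cnj a * a = 1" .
  have real: "cnj (Q $$ (i, i)) = Q $$ (i, i)" if "i < 4" for i
    using Q that D(1) unfolding real_isometry_def by (metis carrier_matD index_map_mat(1))
  \<comment> \<open>\<open>r \<bullet> u = 1 - a\<close> is also the trace of \<open>1 - Q\<close>,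
    which is a real number.\<close>
  have diag: "r $ i * u $ i = 1 - Q $$ (i, i)" if i: "i < 4" for i
  proof -
    have "Q $$ (i, i) = (Q *\<^sub>v unit_vec 4 i) $ i"
      using D(1) i by (simp add: mat_mult_unit_vec[of _ 4 4])
    also have "\<dots> = 1 - r $ i * u $ i"
      using form[of "unit_vec 4 i"] i u r by simp
    finally show ?thesis by simp
  qed
  have "r \<bullet> u = (\<Sum>i = 0..<4. 1 - Q $$ (i, i))"
    using u by (auto simp: scalar_prod_def diag intro!: sum.cong)
  hence "cnj (r \<bullet> u) = r \<bullet> u" by (simp add: real)
  hence "cnj a = a" by (simp add: ru)
  with n have "(a - 1) * (a + 1) = 0" by (simp add: algebra_simps)
  with a1 have "a = -1" by (simp add: eq_neg_iff_add_eq_0)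
  with ru form u r that show thesis by simp
qed

section \<open>Reflections and roots\<close>

text \<open>The half quadratic form and the duality map attached to the inverse Gram matrix of the simple
  roots; this inverse is again an even integral matrix, because the form is unimodular.\<close>

definition half_dual_form :: "(nat \<Rightarrow> nat \<Rightarrow> gint) \<Rightarrow> gint" where
  "half_dual_form N = Gint 4 6 * N 0 0 + Gint 6 9 * N 1 1 + Gint 3 4 * N 2 2 + Gint 1 1 * N 3 3
     + Gint 9 15 * N 0 1 + Gint 6 10 * N 0 2 + Gint 3 5 * N 0 3 + Gint 8 12 * N 1 2
     + Gint 4 6 * N 1 3 + Gint 3 4 * N 2 3"

lemma half_dual_form_cong:
  "(\<And>i j. i < 4 \<Longrightarrow> j < 4 \<Longrightarrow> N i j = M i j) \<Longrightarrow> half_dual_form N = half_dual_form M"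
  unfolding half_dual_form_def by simp

lemma half_dual_form_scale: "half_dual_form (\<lambda>i j. c * N i j) = c * half_dual_form N"
  unfolding half_dual_form_def by (simp only: algebra_simps)

definition weight :: "(nat \<Rightarrow> gint) \<Rightarrow> gint vec" where
  "weight n = vec_of_list [
     Gint 8 12 * n 0 + Gint 9 15 * n 1 + Gint 6 10 * n 2 + Gint 3 5 * n 3,
     Gint 9 15 * n 0 + Gint 12 18 * n 1 + Gint 8 12 * n 2 + Gint 4 6 * n 3,
     Gint 6 10 * n 0 + Gint 8 12 * n 1 + Gint 6 8 * n 2 + Gint 3 4 * n 3,
     Gint 3 5 * n 0 + Gint 4 6 * n 1 + Gint 3 4 * n 2 + Gint 2 2 * n 3]"

lemma weight_index [simp]:
  "weight n $ 0 = Gint 8 12 * n 0 + Gint 9 15 * n 1 + Gint 6 10 * n 2 + Gint 3 5 * n 3"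
  "weight n $ Suc 0 = Gint 9 15 * n 0 + Gint 12 18 * n 1 + Gint 8 12 * n 2 + Gint 4 6 * n 3"
  "weight n $ 2 = Gint 6 10 * n 0 + Gint 8 12 * n 1 + Gint 6 8 * n 2 + Gint 3 4 * n 3"
  "weight n $ 3 = Gint 3 5 * n 0 + Gint 4 6 * n 1 + Gint 3 4 * n 2 + Gint 2 2 * n 3"
  "weight n \<in> carrier_vec 4" "dim_vec (weight n) = 4"
  by (simp_all add: weight_def numeral_eq_Suc carrier_vecI)

lemma weight_coroot:
  assumes "x \<in> carrier_vec 4"
  shows "weight (\<lambda>i. coroot golden_int x $ i) = x"
proof -
  obtain a b c d e f g h where "x $ 0 = Gint a b" "x $ Suc 0 = Gint c d" "x $ 2 = Gint e f" "x $ 3 = Gint g h"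
    by (metis gint.exhaust)
  thus ?thesis using assms
    by (intro vec4_eqI) (simp_all add: golden_int_def gint_simps)
qed

lemma coroot_weight:
  assumes "i < 4"
  shows "coroot golden_int (weight n) $ i = n i"
proof -
  obtain a b c d e f g h where "n 0 = Gint a b" "n 1 = Gint c d" "n 2 = Gint e f" "n 3 = Gint g h"
    by (metis gint.exhaust)
  thus ?thesis using assms
    by (auto simp: less_4_cases golden_int_def gint_simps)
qed

lemma form_weight: "form golden_int (weight n) (weight n) = 2 * half_dual_form (\<lambda>i j. n i * n j)"
proof -
  have "form golden_int (weight n) (weight n) = coroot golden_int (weight n) \<bullet> weight n"
    by (rule form_coroot) simp
  also have "\<dots> = n 0 * weight n $ 0 + n 1 * weight n $ 1 + n 2 * weight n $ 2 + n 3 * weight n $ 3"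
    using coroot_weight[of 0 n] coroot_weight[of 1 n] coroot_weight[of 2 n] coroot_weight[of 3 n]
    by (simp add: scalar_prod_def sum_4 del: coroot_index)
  also have "\<dots> = 2 * half_dual_form (\<lambda>i j. n i * n j)"
  proof -
    have d: "Gint 8 12 = 2 * Gint 4 6" "Gint 12 18 = 2 * Gint 6 9" "Gint 6 8 = 2 * Gint 3 4"
      "Gint 2 2 = 2 * Gint 1 1" by (simp_all add: gint_simps)
    show ?thesis unfolding half_dual_form_def
      by (simp only: weight_index d One_nat_def mult_2 algebra_simps)
  qed
  finally show ?thesis .
qed

section \<open>The field norm and divisibility by small primes\<close>

definition gnorm :: "gint \<Rightarrow> int" where
  "gnorm x = (grat x)^2 + grat x * gphi x - (gphi x)^2"

lemma gnorm_mult: "gnorm (x * y) = gnorm x * gnorm y"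
  by (simp add: gnorm_def gint_ring_defs power2_eq_square algebra_simps)

lemma gnorm_unit: "x dvd 1 \<Longrightarrow> \<bar>gnorm x\<bar> = 1"
proof -
  assume "x dvd 1"
  then obtain y where "x * y = 1" by (auto elim: dvdE)
  hence "gnorm x * gnorm y = 1" by (metis gnorm_mult gnorm_def one_gint_def gint.sel mult_zero_right
    power_one power_zero_numeral add_0_right diff_0_right)
  thus ?thesis by (metis abs_mult abs_zmult_eq_1 abs_1)
qed

text \<open>2 stays prime in the golden integers: in a square the coefficient of the golden ratio is
  \<open>b^2\<close> modulo 2, which makes \<open>b\<close> and then \<open>a\<close> even.\<close>

lemma dvd_square_2:
  assumes "2 dvd x * (x::gint)" shows "2 dvd x"
proof -
  obtain a b where x: "x = Gint a b" by (cases x)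
  obtain y where "x * x = 2 * y" using assms by (auto elim: dvdE)
  hence "a * a + b * b = 2 * grat y" "b * b = 2 * (gphi y - a * b)"
    by (simp_all add: x gint_simps algebra_simps)
  hence "even (a * a + b * b)" "even (b * b)" by (simp_all only: dvd_triv_left)
  hence "even a" "even b" by auto
  then obtain c d where "a = 2 * c" "b = 2 * d" by (auto elim!: evenE)
  hence "x = 2 * Gint c d" by (simp add: x gint_simps)
  thus ?thesis by simp
qed

text \<open>3 stays prime as well: the rational part \<open>a^2 + b^2\<close> of a square vanishes
  modulo 3 only if both coordinates do.\<close>

lemma dvd_square_3:
  assumes "3 dvd x * (x::gint)" shows "3 dvd x"
proof -
  obtain a b where x: "x = Gint a b" by (cases x)
  obtain y where y: "x * x = 3 * y" using assms by (auto elim: dvdE)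
  hence h: "a * a + b * b = 3 * grat y"
    by (simp add: x gint_simps)
  have m: "z * z mod 3 = 0 \<and> z mod 3 = 0 \<or> z * z mod 3 = 1" for z :: int
  proof -
    have "z * z mod 3 = (z mod 3) * (z mod 3) mod 3" by (simp add: mod_mult_eq)
    moreover have "z mod 3 = 0 \<or> z mod 3 = 1 \<or> z mod 3 = 2" by presburger
    ultimately show ?thesis by auto
  qed
  have "(a * a + b * b) mod 3 = 0" unfolding h by simp
  hence "a mod 3 = 0" "b mod 3 = 0" using m[of a] m[of b] by presburger+
  then obtain c d where "a = 3 * c" "b = 3 * d" by (metis mod_0_imp_dvd dvdE)
  hence "x = 3 * Gint c d" by (simp add: x gint_simps)
  thus ?thesis by simp
qed

text \<open>The two generators of the prime over 5 have residue field of five elements, the golden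
  ratio going to 3.\<close>

lemma dvd_square_ramified:
  assumes p: "p = Gint 2 1 \<or> p = Gint 3 (-1)" and "p dvd x * x" shows "p dvd x"
proof -
  obtain a b where x: "x = Gint a b" by (cases x)
  obtain y where y: "x * x = p * y" using assms by (auto elim: dvdE)
  have "5 dvd (a + 3 * b)^2"
  proof -
    have h: "a * a + b * b = grat (p * y)" "2 * (a * b) + b * b = gphi (p * y)"
      using y by (auto simp: x gint_simps)
    have "(a + 3 * b)^2 = grat (p * y) + 3 * gphi (p * y) + 5 * (b * b)"
      unfolding h[symmetric] by (simp add: power2_eq_square algebra_simps)
    moreover have "5 dvd grat (p * y) + 3 * gphi (p * y)"
    proof -
      have "grat (p * y) + 3 * gphi (p * y) = 5 * (if p = Gint 2 1 then grat y + 2 * gphi y else gphi y)"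
        using p by (auto simp: gint_simps)
      thus ?thesis by simp
    qed
    ultimately show ?thesis by simp
  qed
  hence "5 dvd a + 3 * b" by (simp add: prime_dvd_power_iff)
  then obtain k where k: "a = 5 * k - 3 * b" by (auto elim!: dvdE simp: algebra_simps)
  have "x = Gint 2 1 * Gint (3 * k - 2 * b) (b - k)" "x = Gint 3 (-1) * Gint (2 * k - b) k"
    by (simp_all add: x k gint_simps)
  thus ?thesis using p by (metis dvdI)
qed

text \<open>\<open>N\<close> is a symmetric matrix of rank one that has to be factored as
  \<open>c c^T\<close> over the golden integers. For a nonzero diagonal entry \<open>d\<close> with
  column \<open>n\<close>, \<open>d N = n n^T\<close>, and the dual form takes the value
  \<open>d\<close> on \<open>n\<close>. If \<open>d\<close> were prime, it would divide
  \<open>n\<close>, and that value would be divisible by \<open>d^2\<close>. The other candidates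
  are squares: 1, 4, and \<open>Gint 1 1\<close> and \<open>Gint 2 (-1)\<close>, the squares of the
  golden ratio and of its inverse.\<close>

lemma root_of_dual_form:
  fixes N :: "nat \<Rightarrow> nat \<Rightarrow> gint"
  assumes sym: "\<And>i j. i < 4 \<Longrightarrow> j < 4 \<Longrightarrow> N i j = N j i"
    and rank: "\<And>i j k. i < 4 \<Longrightarrow> j < 4 \<Longrightarrow> k < 4 \<Longrightarrow> N i j * N k k = N i k * N j k"
    and one: "half_dual_form N = 1"
    and bounds: "\<And>i. i < 4 \<Longrightarrow> N i i \<in> {0, 1, 2, 3, 4, Gint 1 1, Gint 2 (-1), Gint 2 1, Gint 3 (-1)}"
  shows "\<exists>c. (\<forall>i<4. \<forall>j<4. N i j = c i * c j) \<and> half_dual_form (\<lambda>i j. c i * c j) = 1"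
proof -
  have "\<exists>k<4. N k k \<noteq> 0"
  proof (rule ccontr)
    assume "\<not> (\<exists>k<4. N k k \<noteq> 0)"
    hence z: "N k k = 0" if "k < 4" for k using that by auto
    have "N i j = 0" if "i < 4" "j < 4" for i j
      using rank[of i i j] that z[of i] z[of j] by simp
    thus False using one by (simp add: half_dual_form_def)
  qed
  then obtain k where k: "k < 4" "N k k \<noteq> 0" by blast
  define d where "d = N k k"
  define n where "n i = N i k" for i
  have Nd: "N i j * d = n i * n j" if "i < 4" "j < 4" for i j
    using rank[of i j k] that k by (simp add: d_def n_def)
  have q: "half_dual_form (\<lambda>i j. n i * n j) = d"
  proof -
    have "half_dual_form (\<lambda>i j. n i * n j) = half_dual_form (\<lambda>i j. d * N i j)"
      using Nd by (intro half_dual_form_cong) (simp add: mult.commute)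
    thus ?thesis using one by (simp add: half_dual_form_scale)
  qed
  have factor: "half_dual_form (\<lambda>i j. n i * n j) = p * p * half_dual_form (\<lambda>i j. m i * m j)"
    if "\<And>i. i < 4 \<Longrightarrow> n i = p * m i" for p m
    unfolding half_dual_form_scale[symmetric]
    using that by (intro half_dual_form_cong) (simp add: ac_simps)
  have not_prime: False
    if "\<And>x. p dvd x * x \<Longrightarrow> p dvd x" "d = p" "\<bar>gnorm p\<bar> \<noteq> 1" for p
  proof -
    have "p dvd n i" if "i < 4" for i
    proof -
      have "p dvd n i * n i" using Nd[of i i] that \<open>d = p\<close> by (metis dvd_triv_right)
      thus ?thesis by (rule \<open>\<And>x. p dvd x * x \<Longrightarrow> p dvd x\<close>)
    qed
    hence "\<forall>i. \<exists>m. i < 4 \<longrightarrow> n i = p * m" unfolding dvd_def by blast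
    then obtain m where "\<And>i. i < 4 \<Longrightarrow> n i = p * m i" by metis
    from factor[OF this] have "p = p * (p * half_dual_form (\<lambda>i j. m i * m j))"
      using q \<open>d = p\<close> by (simp add: mult.assoc)
    hence "p * 1 = p * (p * half_dual_form (\<lambda>i j. m i * m j))" by simp
    hence "p * half_dual_form (\<lambda>i j. m i * m j) = 1"
      using k \<open>d = p\<close> unfolding mult_cancel_left by (auto simp: d_def)
    hence "p dvd 1" by (metis dvd_triv_left)
    thus False using gnorm_unit that(3) by blast
  qed
  have "\<exists>s. d = s * s \<and> (\<forall>i<4. s dvd n i)"
  proof -
    have "d \<in> {0, 1, 2, 3, 4, Gint 1 1, Gint 2 (-1), Gint 2 1, Gint 3 (-1)}"
      using bounds k unfolding d_def by blast
    moreover have "d \<noteq> 0" using k by (simp add: d_def)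
    moreover have "d \<noteq> 2" using not_prime[OF dvd_square_2] by (auto simp: gnorm_def gint_simps)
    moreover have "d \<noteq> 3" using not_prime[OF dvd_square_3] by (auto simp: gnorm_def gint_simps)
    moreover have "d \<noteq> Gint 2 1" "d \<noteq> Gint 3 (-1)"
      using not_prime[OF dvd_square_ramified] by (auto simp: gnorm_def)
    moreover have ?thesis if "d = 1" using that by (intro exI[of _ 1]) simp
    moreover have ?thesis if "d = 4"
    proof (intro exI[of _ 2] conjI allI impI)
      fix i :: nat assume "i < 4"
      hence "n i * n i = 2 * (2 * N i i)" using Nd[of i i] that by (simp add: gint_simps)
      hence "2 dvd n i * n i" by (metis dvd_triv_left)
      thus "2 dvd n i" by (rule dvd_square_2)
    qed (simp add: that)
    moreover have ?thesis if "d = Gint 1 1"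
    proof (intro exI[of _ "Gint 0 1"] conjI allI impI)
      have "Gint 0 1 * Gint (-1) 1 = 1" by (simp add: gint_simps)
      thus "Gint 0 1 dvd n i" for i by (metis dvd_triv_left dvd_trans one_dvd)
    qed (simp add: that gint_simps)
    moreover have ?thesis if "d = Gint 2 (-1)"
    proof (intro exI[of _ "Gint (-1) 1"] conjI allI impI)
      have "Gint (-1) 1 * Gint 0 1 = 1" by (simp add: gint_simps)
      thus "Gint (-1) 1 dvd n i" for i by (metis dvd_triv_left dvd_trans one_dvd)
    qed (simp add: that gint_simps)
    ultimately show ?thesis by blast
  qed
  then obtain s where s: "d = s * s" "\<And>i. i < 4 \<Longrightarrow> s dvd n i" by blast
  hence "\<forall>i. \<exists>c. i < 4 \<longrightarrow> n i = s * c" unfolding dvd_def by blast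
  then obtain c where c: "\<And>i. i < 4 \<Longrightarrow> n i = s * c i" by metis
  have s0: "s \<noteq> 0" using k s by (auto simp: d_def)
  have 1: "N i j = c i * c j" if "i < 4" "j < 4" for i j
  proof -
    have "(s * s) * N i j = (s * s) * (c i * c j)"
      using Nd[OF that] c[OF that(1)] c[OF that(2)] s(1) by (simp add: ac_simps)
    thus ?thesis using s0 by simp
  qed
  have "(s * s) * half_dual_form (\<lambda>i j. c i * c j) = (s * s) * 1"
    using factor[OF c] q s(1) by simp
  hence "half_dual_form (\<lambda>i j. c i * c j) = 1" using s0 by (simp only: mult_cancel_left) simp
  with 1 show ?thesis by blast
qed

definition is_root :: "gint vec \<Rightarrow> bool" where
  "is_root a \<longleftrightarrow> a \<in> carrier_vec 4 \<and> form golden_int a a = 2"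

definition crefl :: "gint vec \<Rightarrow> complex mat" where
  "crefl a = map_mat evc (refl golden_int a)"

text \<open>The vectors \<open>w\<close> and \<open>u\<close> of the defect are only complex, but
  the Gram matrix times \<open>1 - A\<close> is a symmetric matrix of rank one over the golden
  integers. Its factorization \<open>c c^T\<close> yields the root as the vector dual to
  \<open>c\<close>.\<close>

lemma reflection_root:
  assumes A: "A \<in> G30" and refl: "reflection 4 A"
  obtains a where "is_root a" "A = crefl a"
proof -
  obtain A0 where A0: "A = map_mat evc A0" "isometry golden_int A0" "isometry golden (map_mat ev1 A0)"
    "isometry (1 - golden) (map_mat ev2 A0)" "isometry cgolden (map_mat evc A0)"
    using G30_integral[OF A] .
  have C0: "A0 \<in> carrier_mat 4 4" using A0(2) by (simp add: isometry_def)
  note Q = G30_real_isometry[OF A]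
  obtain u w where u: "u \<in> carrier_vec 4" and w: "w \<in> carrier_vec 4" and wu: "w \<bullet> u = 2"
    and act: "\<And>x. x \<in> carrier_vec 4 \<Longrightarrow> A *\<^sub>v x = x - (w \<bullet> x) \<cdot>\<^sub>v u"
    using one_dimensional_defect[OF Q] refl by (auto simp: reflection_def)
  \<comment> \<open>An isometry that is an involution is self-adjoint.\<close>
  have symm: "(w \<bullet> y) * form cgolden x u = (w \<bullet> x) * form cgolden u y"
    if v: "x \<in> carrier_vec 4" "y \<in> carrier_vec 4" for x y
  proof -
    have Ay: "A *\<^sub>v y \<in> carrier_vec 4" using v u by (simp add: act)
    have "A *\<^sub>v (A *\<^sub>v y) = y"
      unfolding act[OF Ay] unfolding act[OF v(2)] using v u w wu
      by (intro eq_vecI) (auto simp: scalar_prod_minus_distrib[of _ 4] algebra_simps)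
    hence "form cgolden x (A *\<^sub>v y) = form cgolden (A *\<^sub>v x) y"
      using real_isometryD(2)[OF Q v(1) Ay] by simp
    thus ?thesis using v u by (simp add: act form_linear)
  qed
  \<comment> \<open>\<open>m j\<close> is column \<open>j\<close> of \<open>1 - A0\<close>, so that
    \<open>N\<close> is the Gram matrix of the simple roots times \<open>1 - A0\<close>.\<close>
  define m where "m j = unit_vec 4 j - col A0 j" for j
  define N where "N i j = coroot golden_int (m j) $ i" for i j
  have m: "m j \<in> carrier_vec 4" for j using C0 by (auto simp: m_def intro: carrier_vecI)
  have em: "map_vec evc (m j) = w $ j \<cdot>\<^sub>v u" if j: "j < 4" for j
  proof -
    have "map_vec evc (col A0 j) = A *\<^sub>v unit_vec 4 j"
      using C0 j A0(1) by (simp add: mat_mult_unit_vec[of _ 4 4] col_def) (auto intro!: eq_vecI)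
    also have "\<dots> = unit_vec 4 j - w $ j \<cdot>\<^sub>v u" using act[of "unit_vec 4 j"] w j by simp
    finally have e: "map_vec evc (col A0 j) = unit_vec 4 j - w $ j \<cdot>\<^sub>v u" .
    show ?thesis
    proof (rule eq_vecI)
      fix i assume "i < dim_vec (w $ j \<cdot>\<^sub>v u)"
      hence i: "i < 4" using u by simp
      have "map_vec evc (col A0 j) $ i = (unit_vec 4 j - w $ j \<cdot>\<^sub>v u) $ i" using e by simp
      thus "map_vec evc (m j) $ i = (w $ j \<cdot>\<^sub>v u) $ i"
        using i j u C0 by (auto simp: m_def evc.emb.hom_minus)
    qed (use u C0 in \<open>simp add: m_def\<close>)
  qed
  have evN: "evc (N i j) = w $ j * coroot cgolden u $ i" if "i < 4" "j < 4" for i j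
  proof -
    have "evc (N i j) = coroot cgolden (map_vec evc (m j)) $ i"
      using that m by (simp add: N_def evc.coroot_hom)
    also have "\<dots> = w $ j * coroot cgolden u $ i"
      unfolding em[OF that(2)] using that u by (auto simp: less_4_cases algebra_simps)
    finally show ?thesis .
  qed
  have cu: "coroot cgolden u $ i = form cgolden (unit_vec 4 i) u" if "i < 4" for i
  proof -
    have "form cgolden (unit_vec 4 i) u = form cgolden u (unit_vec 4 i)" by (rule form_sym)
    thus ?thesis using that u by (simp add: form_coroot)
  qed
  have sym: "N i j = N j i" if "i < 4" "j < 4" for i j
  proof -
    have "form cgolden u (unit_vec 4 j) = form cgolden (unit_vec 4 j) u" by (rule form_sym)
    hence "w $ j * coroot cgolden u $ i = w $ i * coroot cgolden u $ j"
      using symm[of "unit_vec 4 i" "unit_vec 4 j"] that w by (simp add: cu)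
    hence "evc (N i j) = evc (N j i)" by (simp add: evN that)
    thus ?thesis by (simp add: evc_inj)
  qed
  have rank: "N i j * N k k = N i k * N j k" if "i < 4" "j < 4" "k < 4" for i j k
  proof -
    have "evc (N i j * N k k) = evc (N i k * N j k)"
      unfolding sym[OF that(2,3)] by (simp add: evc.emb.hom_mult evN that)
    thus ?thesis by (simp add: evc_inj)
  qed
  have mw: "m j = weight (\<lambda>i. N i j)" for j
    unfolding N_def by (rule weight_coroot[OF m, symmetric])
  \<comment> \<open>Contracting \<open>N\<close> with the inverse Gram matrix gives back the trace
    of \<open>1 - A0\<close>, which is 2; the dual form is half of it.\<close>
  have one: "half_dual_form N = 1"
  proof -
    have "evc (\<Sum>i = 0..<4. m i $ i) = (\<Sum>i = 0..<4. w $ i * u $ i)"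
    proof -
      have "evc (m i $ i) = w $ i * u $ i" if "i < 4" for i
        using arg_cong[OF em[OF that], of "\<lambda>v. v $ i"] that u m[of i] by simp
      thus ?thesis by (auto simp: evc.emb.hom_sum intro!: sum.cong)
    qed
    also have "\<dots> = evc 2" using wu u by (simp add: scalar_prod_def)
    finally have "(\<Sum>i = 0..<4. m i $ i) = 2" by (simp only: evc_inj)
    hence tr: "m 0 $ 0 + m 1 $ Suc 0 + m 2 $ 2 + m 3 $ 3 = 2" by (simp add: sum_4)
    have "2 * half_dual_form N = 2 * 1"
    proof -
      have d: "Gint 8 12 = 2 * Gint 4 6" "Gint 12 18 = 2 * Gint 6 9" "Gint 6 8 = 2 * Gint 3 4"
        "Gint 2 2 = 2 * Gint 1 1" by (simp_all add: gint_simps)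
      have s: "N 1 0 = N 0 1" "N 2 0 = N 0 2" "N 3 0 = N 0 3" "N 2 1 = N 1 2" "N 3 1 = N 1 3" "N 3 2 = N 2 3"
        using sym by simp_all
      have e: "m 0 $ 0 = weight (\<lambda>i. N i 0) $ 0" "m 1 $ Suc 0 = weight (\<lambda>i. N i 1) $ Suc 0"
        "m 2 $ 2 = weight (\<lambda>i. N i 2) $ 2" "m 3 $ 3 = weight (\<lambda>i. N i 3) $ 3"
        using mw by simp_all
      have "2 * half_dual_form N = m 0 $ 0 + m 1 $ Suc 0 + m 2 $ 2 + m 3 $ 3"
        unfolding e weight_index half_dual_form_def s d
        by (simp only: mult_2 algebra_simps)
      thus ?thesis using tr by simp
    qed
    thus ?thesis by (simp only: mult_cancel_left) (simp add: gint_simps)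
  qed
  \<comment> \<open>A diagonal entry is 2 minus the inner product of a simple root with its image,
    so both conjugates lie between 0 and 4.\<close>
  have bounds: "N i i \<in> {0, 1, 2, 3, 4, Gint 1 1, Gint 2 (-1), Gint 2 1, Gint 3 (-1)}" if i: "i < 4" for i
  proof -
    define e where "e = (unit_vec 4 i :: gint vec)"
    have e: "e \<in> carrier_vec 4" "form golden_int e e = 2"
      using i by (auto simp: e_def form_def less_4_cases)
    have Ae: "A0 *\<^sub>v e \<in> carrier_vec 4" using C0 e by (auto intro: carrier_vecI)
    have n: "form golden_int (A0 *\<^sub>v e) (A0 *\<^sub>v e) = 2" using A0(2) e by (simp add: isometry_def)
    have "N i i = form golden_int e (m i)"
    proof -
      have "form golden_int e (m i) = form golden_int (m i) e" by (rule form_sym)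
      thus ?thesis using i m by (simp add: N_def e_def form_coroot)
    qed
    also have "\<dots> = 2 - form golden_int e (A0 *\<^sub>v e)"
      using e Ae C0 i unfolding m_def by (simp add: e_def form_linear mat_mult_unit_vec[of _ 4 4])
    finally have N: "N i i = 2 - form golden_int e (A0 *\<^sub>v e)" .
    have "\<bar>ev1 (form golden_int e (A0 *\<^sub>v e))\<bar> \<le> 2" "\<bar>ev2 (form golden_int e (A0 *\<^sub>v e))\<bar> \<le> 2"
      unfolding ev1.form_hom[OF e(1) Ae, symmetric] ev2.form_hom[OF e(1) Ae, symmetric]
      by (rule form_abs_le[OF golden_discriminant(1)] form_abs_le[OF golden_discriminant(2)];
          use e Ae n in \<open>simp add: ev1.form_hom ev2.form_hom\<close>)+
    thus ?thesis by (intro gint_bounded_nonneg) (simp_all add: N ev1.emb.hom_minus ev2.emb.hom_minus)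
  qed
  from root_of_dual_form[OF sym rank one bounds]
  obtain c where c: "\<And>i j. i < 4 \<Longrightarrow> j < 4 \<Longrightarrow> N i j = c i * c j"
    "half_dual_form (\<lambda>i j. c i * c j) = 1" by blast
  define a where "a = weight c"
  have a: "a \<in> carrier_vec 4" by (simp add: a_def)
  have "is_root a" by (simp add: is_root_def a_def form_weight c(2))
  moreover have "A0 = refl golden_int a"
  proof (rule eq_matI)
    fix i j assume "i < dim_row (refl golden_int a)" "j < dim_col (refl golden_int a)"
    hence ij: "i < 4" "j < 4" by (auto simp: refl_def)
    have "m j $ i = a $ i * c j"
      using ij unfolding mw a_def
      by (auto simp: less_4_cases c algebra_simps)
    hence "(if i = j then 1 else 0) - A0 $$ (i, j) = a $ i * c j"
      using ij C0 by (auto simp: m_def)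
    thus "A0 $$ (i, j) = refl golden_int a $$ (i, j)"
      using ij coroot_weight[of j c] by (simp add: refl_def a_def algebra_simps)
  qed (use C0 in \<open>auto simp: refl_def\<close>)
  ultimately show thesis using that A0(1) by (auto simp: crefl_def)
qed

section \<open>Generating tuples of reflections\<close>

lemma crefl_carrier [simp]: "crefl a \<in> carrier_mat 4 4"
  by (simp add: crefl_def)

lemma is_rootD: "is_root a \<Longrightarrow> a \<in> carrier_vec 4" "is_root a \<Longrightarrow> form golden_int a a = 2"
  by (simp_all add: is_root_def)

lemma crefl_involution: "is_root a \<Longrightarrow> crefl a * crefl a = 1\<^sub>m 4"
  unfolding crefl_def
  by (simp add: map_mat_evc_mult[symmetric] refl_involution is_root_def map_mat_evc_one)

lemma crefl_GL: "is_root a \<Longrightarrow> crefl a \<in> carrier (GL 4)"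
  using crefl_involution[of a] crefl_carrier[of a] unfolding GL_carrier by blast

lemma crefl_inv: "is_root a \<Longrightarrow> inv\<^bsub>GL 4\<^esub> (crefl a) = crefl a"
  using crefl_involution by (simp add: GL_inv)

lemma simple_is_root: "i < 4 \<Longrightarrow> is_root (simple_root i)"
  by (simp add: is_root_def simple_root_norm)

lemma map_mat_evc_inj: "map_mat evc A = map_mat evc B \<Longrightarrow> A = B"
proof (rule eq_matI)
  fix i j assume h: "map_mat evc A = map_mat evc B" and ij: "i < dim_row B" "j < dim_col B"
  have d: "dim_row A = dim_row B" "dim_col A = dim_col B"
    using arg_cong[OF h, of dim_row] arg_cong[OF h, of dim_col] by simp_all
  have "map_mat evc A $$ (i, j) = map_mat evc B $$ (i, j)" using h by simp
  thus "A $$ (i, j) = B $$ (i, j)" using ij d by (simp add: evc_inj)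
qed (metis index_map_mat(2), metis index_map_mat(3))

text \<open>Of the nine possible inner products all nonzero ones are units, except for 2 and -2,
  where equality holds in Cauchy-Schwarz.\<close>

lemma root_form_unit:
  assumes "is_root x" "is_root y" "form golden_int x y \<noteq> 0"
  shows "form golden_int x y dvd 1 \<or> x = y \<or> x = - y"
proof -
  let ?f = "form golden_int x y"
  have x: "x \<in> carrier_vec 4" "form golden_int x x = 2" and y: "y \<in> carrier_vec 4" "form golden_int y y = 2"
    using assms by (simp_all add: is_root_def)
  have zero: "z = 0\<^sub>v 4" if z: "z \<in> carrier_vec 4" "form golden_int z z = 0" for z
  proof -
    have "map_vec ev1 z = 0\<^sub>v 4"
      using form_eq_0[OF golden_discriminant(1), of "map_vec ev1 z"] z by (simp add: ev1.form_hom)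
    hence "ev1 (z $ i) = 0" if "i < 4" for i
      using that z by (metis carrier_vecD index_map_vec(1) index_zero_vec(1))
    thus ?thesis using z by (intro eq_vecI) (auto simp: ev1_eq_0)
  qed
  have "Gint 0 1 * Gint (-1) 1 = 1" "Gint 0 (-1) * Gint 1 (-1) = 1" "1 * 1 = (1::gint)" "(-1) * (-1) = (1::gint)"
    by (simp_all add: gint_simps)
  hence units: "Gint 0 1 dvd 1" "Gint (-1) 1 dvd 1" "Gint 0 (-1) dvd 1" "Gint 1 (-1) dvd 1" "(1::gint) dvd 1" "(-1::gint) dvd 1"
    by (metis dvdI mult.commute)+
  have yx: "form golden_int y x = ?f" by (rule form_sym)
  have "x = y" if "?f = 2"
  proof -
    have "x - y = 0\<^sub>v 4" by (rule zero) (use x y that yx in \<open>simp_all add: form_linear\<close>)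
    hence "(x - y) $ i = 0" if "i < 4" for i using that by simp
    thus ?thesis using x y by (intro eq_vecI) auto
  qed
  moreover have "x = - y" if "?f = -2"
  proof -
    have "x + y = 0\<^sub>v 4" by (rule zero) (use x y that yx in \<open>simp_all add: form_linear\<close>)
    hence "(x + y) $ i = 0" if "i < 4" for i using that by simp
    thus ?thesis using x y by (intro eq_vecI) (auto simp: eq_neg_iff_add_eq_0)
  qed
  ultimately show ?thesis
    using root_form_values[OF x(1) y(1) x(2) y(2)] assms(3) units by (elim insertE emptyE) simp_all
qed

text \<open>If the reflections in some roots generate the group, those roots span the whole root lattice
  over the golden integers.\<close>

lemma simple_root_in_span:
  assumes gen: "generate (GL 4) (crefl ` S) = G30" and S: "\<And>a. a \<in> S \<Longrightarrow> is_root a"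
    and sub: "S \<subseteq> L" "L \<subseteq> carrier_vec 4" "\<And>x y. x \<in> L \<Longrightarrow> y \<in> L \<Longrightarrow> x + y \<in> L"
      "\<And>c x. x \<in> L \<Longrightarrow> c \<cdot>\<^sub>v x \<in> L"
    and i: "i < 4"
  shows "simple_root i \<in> L"
proof -
  have diff: "x - y \<in> L" if "x \<in> L" "y \<in> L" for x y
  proof -
    have "x - y = x + (-1) \<cdot>\<^sub>v y" using that sub(2) by (intro eq_vecI) auto
    thus ?thesis using that sub(3,4) by simp
  qed
  \<comment> \<open>The set \<open>M\<close> is arbitrary here, because the argument is applied both
    to \<open>L\<close> and to a single vector.\<close>
  have induct: "\<exists>A0\<in>carrier_mat 4 4. A = map_mat evc A0 \<and> (\<forall>x\<in>M. A0 *\<^sub>v x \<in> M)"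
    if A: "A \<in> G30" and M: "M \<subseteq> carrier_vec 4" "\<And>a x. a \<in> S \<Longrightarrow> x \<in> M \<Longrightarrow> x - form golden_int a x \<cdot>\<^sub>v a \<in> M" for A M
    using A unfolding gen[symmetric]
  proof (induction rule: generate.induct)
    case one
    show ?case by (rule bexI[of _ "1\<^sub>m 4"]) (use M in \<open>auto simp: map_mat_evc_one\<close>)
  next
    case (incl h)
    then obtain a where "a \<in> S" "h = crefl a" by auto
    thus ?case using M is_rootD(1)[OF S] unfolding crefl_def
      by (intro bexI[of _ "refl golden_int a"]) (auto simp: refl_apply subset_iff)
  next
    case (inv h)
    then obtain a where "a \<in> S" "h = crefl a" by auto
    thus ?case using M is_rootD(1)[OF S] unfolding crefl_inv[OF S[OF \<open>a \<in> S\<close>]] \<open>h = crefl a\<close>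
      by (intro bexI[of _ "refl golden_int a"]) (auto simp: refl_apply subset_iff crefl_def)
  next
    case (eng h1 h2)
    then obtain A B where "A \<in> carrier_mat 4 4" "h1 = map_mat evc A" "\<forall>x\<in>M. A *\<^sub>v x \<in> M"
      "B \<in> carrier_mat 4 4" "h2 = map_mat evc B" "\<forall>x\<in>M. B *\<^sub>v x \<in> M" by blast
    thus ?case using M(1)
      by (intro bexI[of _ "A * B"])
        (auto simp: map_mat_evc_mult subset_iff assoc_mult_mat_vec[of _ 4 4 _ 4])
  qed
  have stable: "x - form golden_int (simple_root i) x \<cdot>\<^sub>v simple_root i \<in> M"
    if M: "M \<subseteq> carrier_vec 4" "\<And>a x. a \<in> S \<Longrightarrow> x \<in> M \<Longrightarrow> x - form golden_int a x \<cdot>\<^sub>v a \<in> M" and x: "x \<in> M" for x M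
  proof -
    have "H4_simple i \<in> G30" unfolding G30_def using i by (intro generate.incl) auto
    from induct[OF this M(1)] M(2) obtain A0 where "H4_simple i = map_mat evc A0" "\<forall>x\<in>M. A0 *\<^sub>v x \<in> M"
      by blast
    hence "\<forall>x\<in>M. refl golden_int (simple_root i) *\<^sub>v x \<in> M"
      using H4_simple_refl[OF i] map_mat_evc_inj by metis
    thus ?thesis using x M(1) by (auto simp: refl_apply subset_iff)
  qed
  \<comment> \<open>This multiple of the simple root is \<open>a\<close> minus its reflection in the
    simple root.\<close>
  have L: "form golden_int (simple_root i) a \<cdot>\<^sub>v simple_root i \<in> L" if a: "a \<in> S" for a
  proof -
    have "a - form golden_int (simple_root i) a \<cdot>\<^sub>v simple_root i \<in> L"
      by (rule stable) (use sub a diff in auto)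
    from diff[OF _ this, of a] have "a - (a - form golden_int (simple_root i) a \<cdot>\<^sub>v simple_root i) \<in> L"
      using a sub(1) by auto
    moreover have "a - (a - form golden_int (simple_root i) a \<cdot>\<^sub>v simple_root i)
        = form golden_int (simple_root i) a \<cdot>\<^sub>v simple_root i"
      using is_rootD(1)[OF S[OF a]] by (intro eq_vecI) auto
    ultimately show ?thesis by simp
  qed
  obtain a where a: "a \<in> S" "form golden_int (simple_root i) a \<noteq> 0"
  proof (rule ccontr)
    note R = that
    assume no: "\<not> thesis"
    have z: "form golden_int (simple_root i) a = 0" if "a \<in> S" for a using that no R by blast
    let ?e = "simple_root i"
    \<comment> \<open>If all roots in \<open>S\<close> were orthogonal to the simple root, every
      generator would fix it, yet its own reflection negates it.\<close>
    have "?e - form golden_int ?e ?e \<cdot>\<^sub>v ?e \<in> {?e}"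
    proof (rule stable)
      fix a x assume "a \<in> S" "x \<in> {?e}"
      moreover have "form golden_int a ?e = form golden_int ?e a" by (rule form_sym)
      moreover have "?e - 0 \<cdot>\<^sub>v a = ?e"
        using is_rootD(1)[OF S[OF \<open>a \<in> S\<close>]] by (intro vec4_eqI) auto
      ultimately show "x - form golden_int a x \<cdot>\<^sub>v a \<in> {?e}" using z by simp
    qed auto
    hence "(?e - form golden_int ?e ?e \<cdot>\<^sub>v ?e) $ i = ?e $ i" by simp
    thus False using i simple_root_norm[OF i]
      by (simp add: simple_root_def gint_simps)
  qed
  from root_form_unit[OF simple_is_root[OF i] S[OF a(1)] a(2)] show ?thesis
  proof (elim disjE)
    assume "form golden_int (simple_root i) a dvd 1"
    then obtain c where "form golden_int (simple_root i) a * c = 1" by (auto elim: dvdE)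
    hence "simple_root i = c \<cdot>\<^sub>v (form golden_int (simple_root i) a \<cdot>\<^sub>v simple_root i)"
      by (simp add: smult_smult_assoc mult.commute)
    thus ?thesis using sub(4)[OF L[OF a(1)], of c] by simp
  next
    assume "simple_root i = a" thus ?thesis using a sub(1) by auto
  next
    assume "simple_root i = - a"
    hence "simple_root i = (-1) \<cdot>\<^sub>v a" by (intro eq_vecI) auto
    thus ?thesis using a sub(1,4) by auto
  qed
qed

text \<open>The Pfaffian of the alternating matrix with the inner products above the diagonal.
  Modulo 2 the Gram matrix of roots is itself alternating, the norms being 2.\<close>

definition pf :: "gint vec \<Rightarrow> gint vec \<Rightarrow> gint vec \<Rightarrow> gint vec \<Rightarrow> gint" where
  "pf a b c d = form golden_int a b * form golden_int c d - form golden_int a c * form golden_int b d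
     + form golden_int a d * form golden_int b c"

text \<open>Modulo 2 the form is symplectic and unimodular, so not all Pfaffians of a spanning set vanish.\<close>

lemma some_pf_odd:
  assumes gen: "generate (GL 4) (crefl ` S) = G30" and S: "\<And>a. a \<in> S \<Longrightarrow> is_root a"
  obtains a b c d where "a \<in> S" "b \<in> S" "c \<in> S" "d \<in> S" "\<not> 2 dvd pf a b c d"
proof (rule ccontr)
  note R = that
  assume no: "\<not> thesis"
  have 0: "2 dvd pf a b c d" if "a \<in> S" "b \<in> S" "c \<in> S" "d \<in> S" for a b c d using that no R by blast
  let ?e = simple_root
  have span: "?e i \<in> {x \<in> carrier_vec 4. P x}"
    if "\<And>a. a \<in> S \<Longrightarrow> P a" "\<And>x y. x \<in> carrier_vec 4 \<Longrightarrow> y \<in> carrier_vec 4 \<Longrightarrow> P x \<Longrightarrow> P y \<Longrightarrow> P (x + y)"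
      "\<And>c x. x \<in> carrier_vec 4 \<Longrightarrow> P x \<Longrightarrow> P (c \<cdot>\<^sub>v x)" "i < 4" for P i
    by (rule simple_root_in_span[OF gen S _ _ _ _ \<open>i < 4\<close>]) (use that is_rootD(1)[OF S] in auto)
  have add: "pf (x + y) b c d = pf x b c d + pf y b c d" "pf b (x + y) c d = pf b x c d + pf b y c d"
    "pf b c (x + y) d = pf b c x d + pf b c y d" "pf b c d (x + y) = pf b c d x + pf b c d y"
    if "x \<in> carrier_vec 4" "y \<in> carrier_vec 4" for x y b c d
    using that by (simp_all add: pf_def form_linear algebra_simps)
  have smult: "pf (k \<cdot>\<^sub>v x) b c d = k * pf x b c d" "pf b (k \<cdot>\<^sub>v x) c d = k * pf b x c d"
    "pf b c (k \<cdot>\<^sub>v x) d = k * pf b c x d" "pf b c d (k \<cdot>\<^sub>v x) = k * pf b c d x"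
    if "x \<in> carrier_vec 4" for x b c d k
    using that by (simp_all add: pf_def form_linear algebra_simps)
  \<comment> \<open>The Pfaffian is linear in each argument, so simple roots can be substituted one
    at a time.\<close>
  have 1: "2 dvd pf (?e 0) b c d" if "b \<in> S" "c \<in> S" "d \<in> S" for b c d
    using span[of "\<lambda>x. 2 dvd pf x b c d" 0] 0 that by (simp add: add smult)
  have 2: "2 dvd pf (?e 0) (?e 1) c d" if "c \<in> S" "d \<in> S" for c d
    using span[of "\<lambda>x. 2 dvd pf (?e 0) x c d" 1] 1 that by (simp add: add smult)
  have 3: "2 dvd pf (?e 0) (?e 1) (?e 2) d" if "d \<in> S" for d
    using span[of "\<lambda>x. 2 dvd pf (?e 0) (?e 1) x d" 2] 2 that by (simp add: add smult)
  have "2 dvd pf (?e 0) (?e 1) (?e 2) (?e 3)"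
    using span[of "\<lambda>x. 2 dvd pf (?e 0) (?e 1) (?e 2) x" 3] 3 by (simp add: add smult)
  \<comment> \<open>Only the matching 01, 23 of the diagram contributes, and its value is a
    unit.\<close>
  moreover have "pf (?e 0) (?e 1) (?e 2) (?e 3) = golden_int" by (simp add: pf_def form_def)
  ultimately obtain y where "golden_int = 2 * y" by (auto elim: dvdE)
  hence "2 * gphi y = 1" by (cases y) (simp add: golden_int_def gint_simps)
  thus False by presburger
qed

text \<open>Adjacent transpositions sort the indices, which leaves the strictly increasing case and
  repetitions.\<close>

lemma symmetric_four_args:
  fixes P :: "nat \<Rightarrow> nat \<Rightarrow> nat \<Rightarrow> nat \<Rightarrow> bool"
  assumes s12: "\<And>a b c d. P a b c d \<Longrightarrow> P b a c d" and s23: "\<And>a b c d. P a b c d \<Longrightarrow> P a c b d"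
    and s34: "\<And>a b c d. P a b c d \<Longrightarrow> P a b d c"
    and dup: "\<And>a c d. P a a c d"
    and strict: "\<And>a b c d. a < b \<Longrightarrow> b < c \<Longrightarrow> c < d \<Longrightarrow> d < n \<Longrightarrow> P a b c d"
    and n: "a < n" "b < n" "c < n" "d < n"
  shows "P a b c d"
proof -
  have 0: "P a b c d" if "a \<le> b" "b \<le> c" "c \<le> d" "d < n" for a b c d
    using that strict[of a b c d] dup s12 s23 s34 by (metis le_neq_implies_less)
  have 1: "P a b c d" if "a \<le> b" "b \<le> c" "c < n" "d < n" for a b c d
    using that 0 s12 s23 s34 by (metis nat_le_linear)
  have 2: "P a b c d" if "a \<le> b" "b < n" "c < n" "d < n" for a b c d
    using that 1 s12 s23 by (metis nat_le_linear)
  show ?thesis using n 2 s12 by (metis nat_le_linear)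
qed

text \<open>Permuting the arguments changes the Pfaffian by a sign and an even amount, and a
  repeated root makes it even. So if it vanished for all increasing indices, it would be even for
  all indices.\<close>

lemma generating_pf_nonzero:
  assumes gen: "generate (GL 4) (crefl ` set rs) = G30" and S: "\<And>a. a \<in> set rs \<Longrightarrow> is_root a"
  obtains a b c d where "a < b" "b < c" "c < d" "d < length rs" "pf (rs!a) (rs!b) (rs!c) (rs!d) \<noteq> 0"
proof (rule ccontr)
  note R = that
  assume no: "\<not> thesis"
  have 0: "pf (rs!a) (rs!b) (rs!c) (rs!d) = 0" if "a < b" "b < c" "c < d" "d < length rs" for a b c d
    using that no R by blast
  let ?f = "form golden_int"
  obtain x y z w where "x \<in> set rs" "y \<in> set rs" "z \<in> set rs" "w \<in> set rs" "\<not> 2 dvd pf x y z w"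
    using some_pf_odd[OF gen S] .
  then obtain a b c d where abcd: "a < length rs" "b < length rs" "c < length rs" "d < length rs"
    and odd: "\<not> 2 dvd pf (rs!a) (rs!b) (rs!c) (rs!d)" by (metis in_set_conv_nth)
  have sym: "?f x y = ?f y x" for x y by (rule form_sym)
  define P where "P a b c d \<longleftrightarrow> a < length rs \<longrightarrow> b < length rs \<longrightarrow> c < length rs \<longrightarrow> d < length rs
      \<longrightarrow> 2 dvd pf (rs!a) (rs!b) (rs!c) (rs!d)" for a b c d
  have e12: "pf y x z w = pf x y z w + 2 * (?f x z * ?f y w - ?f x w * ?f y z)" for x y z w
    using sym[of x y] by (simp add: pf_def algebra_simps)
  have e23: "pf x z y w = 2 * (?f x w * ?f y z) - pf x y z w" for x y z w
    using sym[of y z] by (simp add: pf_def algebra_simps)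
  have e34: "pf x y w z = pf x y z w + 2 * (?f x z * ?f y w - ?f x w * ?f y z)" for x y z w
    using sym[of w z] by (simp add: pf_def algebra_simps)
  have "P a b c d"
  proof (rule symmetric_four_args[where P = P and n = "length rs"])
    show "P b a c d" if "P a b c d" for a b c d using that unfolding P_def e12[of "rs!b" "rs!a"] by simp
    show "P a c b d" if "P a b c d" for a b c d using that unfolding P_def e23[of "rs!a" "rs!c"] by simp
    show "P a b d c" if "P a b c d" for a b c d using that unfolding P_def e34[of "rs!a" "rs!b" "rs!d"] by simp
    show "P a a c d" for a c d
    proof -
      have "pf x x z w = 2 * ?f z w" if "?f x x = 2" for x z w
        using that by (simp add: pf_def algebra_simps)
      thus ?thesis using S unfolding P_def is_root_def by (metis dvd_triv_left nth_mem)
    qed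
    show "P a b c d" if "a < b" "b < c" "c < d" "d < length rs" for a b c d
      using 0[OF that] by (simp add: P_def)
  qed (use abcd in auto)
  thus False using abcd odd by (simp add: P_def)
qed

section \<open>The kernel of the Seifert matrix\<close>

text \<open>For reflections \<open>A\<^sub>k = 1 - a\<^sub>k f\<^sub>k\<close> with Gram matrix \<open>G = L + U\<close>, \<open>L\<close> and \<open>U\<close> unitriangular, the
  product \<open>c\<close> satisfies \<open>v - c v = \<Sum> z\<^sub>k a\<^sub>k\<close> with \<open>U z = (f\<^sub>k v)\<^sub>k\<close>. Eigenvectors of the inverse of \<open>c\<close>
  for an eigenvalue \<open>\<lambda> \<noteq> 1\<close> thus give solutions of \<open>(\<lambda> L + U) z = 0\<close>.\<close>

definition defect :: "complex vec list \<Rightarrow> complex mat \<Rightarrow> complex vec \<Rightarrow> (nat \<Rightarrow> complex) \<Rightarrow> bool" where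
  "defect as C v z \<longleftrightarrow>
     (\<forall>i<4. v $ i - (C *\<^sub>v v) $ i = (\<Sum>k<length as. z k * (as ! k) $ i)) \<and>
     (\<forall>k<length as. z k + (\<Sum>j<length as. if k < j then form cgolden (as ! k) (as ! j) * z j else 0)
        = form cgolden (as ! k) v)"

lemma form_sum:
  assumes "\<And>i. i < 4 \<Longrightarrow> x $ i = (\<Sum>k<n. z k * (as ! k) $ i)"
  shows "form cgolden a x = (\<Sum>k<n. form cgolden a (as ! k) * z k)"
proof -
  have "form cgolden a x = (\<Sum>k<n. 2 * (a$0 * (z k * (as!k)$0) + a$1 * (z k * (as!k)$1) + a$2 * (z k * (as!k)$2)
      + a$3 * (z k * (as!k)$3)) - cgolden * (a$0 * (z k * (as!k)$1) + a$1 * (z k * (as!k)$0))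
      - (a$1 * (z k * (as!k)$2) + a$2 * (z k * (as!k)$1)) - (a$2 * (z k * (as!k)$3) + a$3 * (z k * (as!k)$2)))"
    unfolding form_def using assms[of 0] assms[of 1] assms[of 2] assms[of 3]
    by (simp add: sum.distrib sum_subtractf sum_distrib_left distrib_left)
  also have "\<dots> = (\<Sum>k<n. form cgolden a (as ! k) * z k)"
    by (rule sum.cong) (simp_all add: form_def algebra_simps)
  finally show ?thesis .
qed

text \<open>Prepending a reflection subtracts a further multiple of its root \<open>a\<close> from
  the image of \<open>v\<close>, and the coefficient becomes the new \<open>z 0\<close>.\<close>

lemma defect_exists:
  assumes "set as \<subseteq> carrier_vec 4" "v \<in> carrier_vec 4"
  shows "\<exists>z. defect as (mat_prod 4 (map (refl cgolden) as)) v z"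
  using assms
proof (induction as)
  case Nil
  thus ?case by (simp add: defect_def mat_prod_def)
next
  case (Cons a as)
  let ?C = "mat_prod 4 (map (refl cgolden) as)"
  have C: "?C \<in> carrier_mat 4 4"
    unfolding mat_prod_def by (induction as) (auto intro: mult_carrier_mat[of _ 4 4])
  have a: "a \<in> carrier_vec 4" using Cons by simp
  obtain z where z: "defect as ?C v z" using Cons by auto
  define w where "w = ?C *\<^sub>v v"
  have w: "w \<in> carrier_vec 4" using C Cons(3) by (auto simp: w_def intro: carrier_vecI)
  define z' where "z' k = (case k of 0 \<Rightarrow> form cgolden a w | Suc k \<Rightarrow> z k)" for k
  have cv: "mat_prod 4 (map (refl cgolden) (a # as)) *\<^sub>v v = w - form cgolden a w \<cdot>\<^sub>v a"
    using C a w Cons(3) by (simp add: mat_prod_def w_def assoc_mult_mat_vec[of _ 4 4 _ 4] refl_apply)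
  have d: "(v - w) $ i = (\<Sum>k<length as. z k * (as ! k) $ i)" if "i < 4" for i
    using z that w unfolding defect_def w_def[symmetric] by simp
  have fa: "form cgolden a v - form cgolden a w = (\<Sum>k<length as. form cgolden a (as ! k) * z k)"
    using form_sum[OF d, of a] w Cons(3) by (simp add: form_linear)
  have "defect (a # as) (mat_prod 4 (map (refl cgolden) (a # as))) v z'"
    unfolding defect_def cv
  proof (intro conjI allI impI)
    fix i :: nat assume "i < 4"
    thus "v $ i - (w - form cgolden a w \<cdot>\<^sub>v a) $ i = (\<Sum>k<length (a # as). z' k * ((a # as) ! k) $ i)"
      using d[of i] w a by (simp add: z'_def sum.lessThan_Suc_shift del: sum.lessThan_Suc)
  next
    fix k assume k: "k < length (a # as)"
    show "z' k + (\<Sum>j<length (a # as). if k < j then form cgolden ((a # as) ! k) ((a # as) ! j) * z' j else 0)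
      = form cgolden ((a # as) ! k) v"
    proof (cases k)
      case 0
      thus ?thesis using fa unfolding diff_eq_eq
        by (simp add: z'_def add.commute sum.lessThan_Suc_shift del: sum.lessThan_Suc)
    next
      case (Suc l)
      hence "z l + (\<Sum>j<length as. if l < j then form cgolden (as ! l) (as ! j) * z j else 0)
          = form cgolden (as ! l) v" using z k unfolding defect_def by auto
      thus ?thesis using Suc
        by (simp add: z'_def sum.lessThan_Suc_shift del: sum.lessThan_Suc cong: if_cong)
    qed
  qed
  thus ?case by blast
qed

lemma defect_linear:
  assumes "defect as C v z" "defect as C v' z'" "v \<in> carrier_vec 4" "v' \<in> carrier_vec 4" "C \<in> carrier_mat 4 4"
  shows "defect as C (x \<cdot>\<^sub>v v + y \<cdot>\<^sub>v v') (\<lambda>k. x * z k + y * z' k)"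
  unfolding defect_def
proof (intro conjI allI impI)
  fix i :: nat assume i: "i < 4"
  have "(C *\<^sub>v (x \<cdot>\<^sub>v v + y \<cdot>\<^sub>v v')) $ i = x * (C *\<^sub>v v) $ i + y * (C *\<^sub>v v') $ i"
    using assms i by (simp add: mult_add_distrib_mat_vec[of _ 4 4] mult_mat_vec[of _ 4 4] del: index_mult_mat_vec)
  moreover have "(\<Sum>k<length as. (x * z k + y * z' k) * (as ! k) $ i)
    = x * (\<Sum>k<length as. z k * (as ! k) $ i) + y * (\<Sum>k<length as. z' k * (as ! k) $ i)"
    by (simp add: sum_distrib_left sum.distrib algebra_simps)
  moreover have "v $ i - (C *\<^sub>v v) $ i = (\<Sum>k<length as. z k * (as ! k) $ i)"
     "v' $ i - (C *\<^sub>v v') $ i = (\<Sum>k<length as. z' k * (as ! k) $ i)"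
    using assms i unfolding defect_def by blast+
  ultimately show "(x \<cdot>\<^sub>v v + y \<cdot>\<^sub>v v') $ i - (C *\<^sub>v (x \<cdot>\<^sub>v v + y \<cdot>\<^sub>v v')) $ i
      = (\<Sum>k<length as. (x * z k + y * z' k) * (as ! k) $ i)"
    using assms i by (simp add: algebra_simps del: index_mult_mat_vec)
next
  fix k assume k: "k < length as"
  let ?S = "\<lambda>z. \<Sum>j<length as. if k < j then form cgolden (as ! k) (as ! j) * z j else 0"
  have lin: "?S (\<lambda>k. x * z k + y * z' k) = x * ?S z + y * ?S z'"
    unfolding sum_distrib_left sum.distrib[symmetric] by (rule sum.cong) (auto simp: algebra_simps)
  have "form cgolden (as ! k) (x \<cdot>\<^sub>v v + y \<cdot>\<^sub>v v')
    = x * form cgolden (as ! k) v + y * form cgolden (as ! k) v'"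
    using assms by (simp add: form_linear)
  also have "\<dots> = x * (z k + ?S z) + y * (z' k + ?S z')"
    using assms k unfolding defect_def by simp
  finally show "x * z k + y * z' k + ?S (\<lambda>k. x * z k + y * z' k) = form cgolden (as ! k) (x \<cdot>\<^sub>v v + y \<cdot>\<^sub>v v')"
    unfolding lin by (simp only: distrib_left add_ac)
qed

text \<open>Here \<open>(1 - 1/l) v\<close> is the sum of the \<open>z k a k\<close>. Pairing it
  with the roots gives \<open>(l - 1) U z = l (L + U) z\<close>, which is
  \<open>(l L + U) z = 0\<close>.\<close>

lemma defect_eigenvector:
  assumes d: "defect as C v z" and v: "v \<in> carrier_vec 4" and e: "C *\<^sub>v v = inverse l \<cdot>\<^sub>v v" and l: "l \<noteq> 0" "l \<noteq> 1"
    and n: "\<And>a. a \<in> set as \<Longrightarrow> form cgolden a a = 2"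
  shows "k < length as \<Longrightarrow> (\<Sum>j<length as. (if j < k then l * form cgolden (as ! k) (as ! j)
      else if j = k then 1 + l else form cgolden (as ! k) (as ! j)) * z j) = 0"
    and "(\<forall>k<length as. z k = 0) \<Longrightarrow> v = 0\<^sub>v 4"
proof -
  have 1: "(1 - inverse l) * v $ i = (\<Sum>k<length as. z k * (as ! k) $ i)" if "i < 4" for i
    using d that v unfolding defect_def e by (simp add: algebra_simps)
  have 0: "1 - inverse l \<noteq> 0" using l by auto
  show "v = 0\<^sub>v 4" if "\<forall>k<length as. z k = 0"
  proof -
    have "(1 - inverse l) * v $ i = 0" if "i < 4" for i using 1[OF that] \<open>\<forall>k<length as. z k = 0\<close> by simp
    thus ?thesis using 0 v by (intro eq_vecI) auto
  qed
  assume k: "k < length as"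
  let ?g = "\<lambda>j. form cgolden (as ! k) (as ! j)"
  have "form cgolden (as ! k) ((1 - inverse l) \<cdot>\<^sub>v v) = (\<Sum>j<length as. ?g j * z j)"
    by (rule form_sum) (use 1 v in auto)
  hence "(1 - inverse l) * (z k + (\<Sum>j<length as. if k < j then ?g j * z j else 0)) = (\<Sum>j<length as. ?g j * z j)"
    using d k v unfolding defect_def by (simp add: form_linear)
  hence "(l - 1) * (z k + (\<Sum>j<length as. if k < j then ?g j * z j else 0)) = l * (\<Sum>j<length as. ?g j * z j)"
    using l by (simp add: field_simps)
  moreover have "z k = (\<Sum>j<length as. if j = k then z j else 0)" using k by simp
  ultimately have "l * (\<Sum>j<length as. ?g j * z j)
      - (l - 1) * ((\<Sum>j<length as. if j = k then z j else 0) + (\<Sum>j<length as. if k < j then ?g j * z j else 0)) = 0"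
    by simp
  also have "l * (\<Sum>j<length as. ?g j * z j)
      - (l - 1) * ((\<Sum>j<length as. if j = k then z j else 0) + (\<Sum>j<length as. if k < j then ?g j * z j else 0))
     = (\<Sum>j<length as. l * (?g j * z j) - (l - 1) * ((if j = k then z j else 0) + (if k < j then ?g j * z j else 0)))"
    by (simp only: sum_distrib_left[symmetric] sum.distrib sum_subtractf)
  also have "\<dots> = (\<Sum>j<length as. (if j < k then l * ?g j else if j = k then 1 + l else ?g j) * z j)"
    using n k by (intro sum.cong) (auto simp: algebra_simps)
  finally show "(\<Sum>j<length as. (if j < k then l * ?g j else if j = k then 1 + l else ?g j) * z j) = 0" .
qed

section \<open>Determinants of Gram matrices\<close>

lemma mat_delete_first: "mat_delete (mat (Suc n) (Suc n) f) 0 j = mat n n (\<lambda>(i, k). f (Suc i, if k < j then k else Suc k))"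
  by (intro eq_matI) (auto simp: mat_delete_def)

text \<open>Laplace expansion in a form that can be iterated by rewriting down to size 0.\<close>

lemma det_mat_Suc: "det (mat (Suc n) (Suc n) f) =
    (\<Sum>j<Suc n. f (0, j) * ((-1) ^ j * det (mat n n (\<lambda>(i, k). f (Suc i, if k < j then k else Suc k)))))"
  by (subst laplace_expansion_row[of _ "Suc n" 0]) (auto simp: cofactor_def mat_delete_first intro!: sum.cong)

lemma det_gram_4:
  fixes p q r u v w :: "'a::comm_ring_1"
  assumes "\<And>i. i < 4 \<Longrightarrow> f (i, i) = 2" "\<And>i j. i < 4 \<Longrightarrow> j < 4 \<Longrightarrow> f (i, j) = f (j, i)"
    "f (0, 1) = p" "f (0, 2) = q" "f (1, 2) = r" "f (0, 3) = u" "f (1, 3) = v" "f (2, 3) = w"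
  shows "det (mat 4 4 f) = 16 - 4 * (p*p + q*q + r*r + u*u + v*v + w*w)
     + 4 * (p*q*r + p*u*v + q*u*w + r*v*w) + p*p*w*w + q*q*v*v + r*r*u*u
     - 2 * (p*w*q*v + p*w*r*u + q*v*r*u)"
proof -
  have "f (1, 0) = p" "f (2, 0) = q" "f (2, 1) = r" "f (3, 0) = u" "f (3, 1) = v" "f (3, 2) = w"
    "f (0, 0) = 2" "f (1, 1) = 2" "f (2, 2) = 2" "f (3, 3) = 2"
    using assms by (simp_all)
  note e = this assms(3-)
  show ?thesis
    using e unfolding numeral_eq_Suc pred_numeral_simps BitM.simps One_nat_def numeral_One det_mat_Suc
    by (simp add: numeral_eq_Suc) (simp add: algebra_simps)
qed

text \<open>The Gram matrix is \<open>R^T K R\<close> with \<open>K\<close> that of the simple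
  roots. \<open>K\<close> is invertible because the form is unimodular, and \<open>R\<close> has a
  right inverse because the roots span the lattice.\<close>

lemma gram_det_unit:
  assumes gen: "generate (GL 4) (crefl ` set rs) = G30" and S: "\<And>a. a \<in> set rs \<Longrightarrow> is_root a"
    and len: "length rs = 4"
  shows "det (mat 4 4 (\<lambda>(i, j). form golden_int (rs ! i) (rs ! j))) dvd 1"
proof -
  have rs: "rs ! j \<in> carrier_vec 4" if "j < 4" for j using S that len by (auto simp: is_root_def)
  define R where "R = mat 4 4 (\<lambda>(i, j). (rs ! j) $ i)"
  define K where "K = mat 4 4 (\<lambda>(k, l). coroot golden_int (simple_root l) $ k)"
  define KI where "KI = mat 4 4 (\<lambda>(l, m). weight (\<lambda>i. if i = m then 1 else 0) $ l)"
  have C: "R \<in> carrier_mat 4 4" "K \<in> carrier_mat 4 4" "KI \<in> carrier_mat 4 4" by (simp_all add: R_def K_def KI_def)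
  have Kx: "(\<Sum>l = 0..<4. coroot golden_int (simple_root l) $ k * x $ l) = coroot golden_int x $ k"
    if "k < 4" for x :: "gint vec" and k
    using that by (auto simp: less_4_cases sum_4 algebra_simps)
  have "K * KI = 1\<^sub>m 4"
  proof (rule eq_matI)
    fix k m assume "k < dim_row (1\<^sub>m 4 :: gint mat)" "m < dim_col (1\<^sub>m 4 :: gint mat)"
    hence km: "k < 4" "m < 4" by auto
    have "(K * KI) $$ (k, m) = coroot golden_int (weight (\<lambda>i. if i = m then 1 else 0)) $ k"
      using km Kx[of k "weight (\<lambda>i. if i = m then 1 else 0)"] by (simp add: K_def KI_def scalar_prod_def del: coroot_index weight_index)
    thus "(K * KI) $$ (k, m) = 1\<^sub>m 4 $$ (k, m)" using km coroot_weight[of k] by auto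
  qed (simp_all add: K_def KI_def)
  hence detK: "det K * det KI = 1" using det_mult[OF C(2,3)] by simp
  have "\<exists>c\<in>carrier_vec 4. simple_root i = R *\<^sub>v c" if i: "i < 4" for i
  proof -
    have "simple_root i \<in> {R *\<^sub>v c | c. c \<in> carrier_vec 4}"
    proof (rule simple_root_in_span[OF gen S _ _ _ _ i])
      show "set rs \<subseteq> {R *\<^sub>v c | c. c \<in> carrier_vec 4}"
      proof
        fix a assume "a \<in> set rs"
        then obtain j where j: "j < 4" "a = rs ! j" using len by (auto simp: in_set_conv_nth)
        have "col R j = rs ! j" using j(1) rs[OF j(1)] by (intro eq_vecI) (auto simp: R_def)
        hence "a = R *\<^sub>v unit_vec 4 j" using j C by (simp add: mat_mult_unit_vec[of _ 4 4])
        thus "a \<in> {R *\<^sub>v c | c. c \<in> carrier_vec 4}"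
          by (intro CollectI exI[of _ "unit_vec 4 j"]) simp
      qed
      show "{R *\<^sub>v c | c. c \<in> carrier_vec 4} \<subseteq> carrier_vec 4" using C by auto
      show "x + y \<in> {R *\<^sub>v c | c. c \<in> carrier_vec 4}"
        if "x \<in> {R *\<^sub>v c | c. c \<in> carrier_vec 4}" "y \<in> {R *\<^sub>v c | c. c \<in> carrier_vec 4}" for x y
      proof -
        from that obtain c d where "c \<in> carrier_vec 4" "d \<in> carrier_vec 4" "x = R *\<^sub>v c" "y = R *\<^sub>v d"
          by blast
        thus ?thesis using C(1)
          by (intro CollectI exI[of _ "c + d"]) (simp add: mult_add_distrib_mat_vec[of _ 4 4])
      qed
      show "c \<cdot>\<^sub>v x \<in> {R *\<^sub>v c | c. c \<in> carrier_vec 4}" if "x \<in> {R *\<^sub>v c | c. c \<in> carrier_vec 4}" for c x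
      proof -
        from that obtain d where "d \<in> carrier_vec 4" "x = R *\<^sub>v d" by blast
        thus ?thesis using C(1)
          by (intro CollectI exI[of _ "c \<cdot>\<^sub>v d"] conjI eq_vecI)
            (auto simp: scalar_prod_def sum_distrib_left intro!: sum.cong)
      qed
    qed
    thus ?thesis by blast
  qed
  then obtain c where c: "\<And>i. i < 4 \<Longrightarrow> c i \<in> carrier_vec 4" "\<And>i. i < 4 \<Longrightarrow> simple_root i = R *\<^sub>v c i"
    by metis
  define D where "D = mat 4 4 (\<lambda>(i, j). c j $ i)"
  have D: "D \<in> carrier_mat 4 4" by (simp add: D_def)
  have "R * D = 1\<^sub>m 4"
  proof (rule eq_matI)
    fix i j assume "i < dim_row (1\<^sub>m 4 :: gint mat)" "j < dim_col (1\<^sub>m 4 :: gint mat)"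
    hence ij: "i < 4" "j < 4" by auto
    have "col D j = c j" using ij(2) c(1)[OF ij(2)] by (intro eq_vecI) (auto simp: D_def)
    hence "(R * D) $$ (i, j) = (R *\<^sub>v c j) $ i" using ij C D by simp
    also have "\<dots> = simple_root j $ i" using c(2)[OF ij(2)] by simp
    finally show "(R * D) $$ (i, j) = 1\<^sub>m 4 $$ (i, j)" using ij by auto
  qed (use C D in auto)
  hence detR: "det R * det D = 1" using det_mult[OF C(1) D] by simp
  have "mat 4 4 (\<lambda>(i, j). form golden_int (rs ! i) (rs ! j)) = transpose_mat R * (K * R)"
  proof (rule eq_matI)
    fix i j assume "i < dim_row (transpose_mat R * (K * R))" "j < dim_col (transpose_mat R * (K * R))"
    hence ij: "i < 4" "j < 4" using C by auto
    have "col (K * R) j = coroot golden_int (rs ! j)"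
    proof (rule eq_vecI)
      fix k assume "k < dim_vec (coroot golden_int (rs ! j))"
      hence k: "k < 4" by simp
      have "col (K * R) j $ k = (\<Sum>l = 0..<4. coroot golden_int (simple_root l) $ k * (rs ! j) $ l)"
        using k ij C by (simp add: scalar_prod_def K_def R_def)
      thus "col (K * R) j $ k = coroot golden_int (rs ! j) $ k" using Kx[OF k] by simp
    qed (use C in simp)
    moreover have "row (transpose_mat R) i = rs ! i" using ij(1) rs[OF ij(1)] by (intro eq_vecI) (auto simp: R_def)
    ultimately have "(transpose_mat R * (K * R)) $$ (i, j) = rs ! i \<bullet> coroot golden_int (rs ! j)"
      using ij C by simp
    also have "\<dots> = coroot golden_int (rs ! j) \<bullet> rs ! i"
      by (rule comm_scalar_prod[of _ 4]) (use rs ij in auto)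
    also have "\<dots> = form golden_int (rs ! i) (rs ! j)"
      using form_coroot[OF rs[OF ij(1)]] form_sym[of golden_int "rs ! i"] by metis
    finally show "mat 4 4 (\<lambda>(i, j). form golden_int (rs ! i) (rs ! j)) $$ (i, j)
        = (transpose_mat R * (K * R)) $$ (i, j)" using ij by simp
  qed (use C in auto)
  hence "det (mat 4 4 (\<lambda>(i, j). form golden_int (rs ! i) (rs ! j))) = det R * (det K * det R)"
    using C by (simp add: det_mult[of _ 4] det_transpose[of _ 4])
  hence "det (mat 4 4 (\<lambda>(i, j). form golden_int (rs ! i) (rs ! j))) * (det D * det KI * det D) = 1"
    using detK detR by (metis (no_types, lifting) mult.assoc mult.commute mult_1)
  thus ?thesis by (metis dvd_triv_left)
qed

section \<open>Kernel relations\<close>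

text \<open>The entries of the Gram matrix come in the order 01, 02, 12 for \<open>p, q, r\<close>
  and 03, 13, 23 for \<open>u, v, w\<close>.\<close>

definition seifert_kernel ::
  "complex \<Rightarrow> complex \<Rightarrow> complex \<Rightarrow> complex \<Rightarrow> complex \<Rightarrow> complex \<Rightarrow> complex \<Rightarrow> (nat \<Rightarrow> complex) \<Rightarrow> bool" where
  "seifert_kernel l p q r u v w z \<longleftrightarrow>
     (1 + l) * z 0 + p * z 1 + q * z 2 + u * z 3 = 0 \<and>
     l * p * z 0 + (1 + l) * z 1 + r * z 2 + v * z 3 = 0 \<and>
     l * q * z 0 + l * r * z 1 + (1 + l) * z 2 + w * z 3 = 0 \<and>
     l * u * z 0 + l * v * z 1 + l * w * z 2 + (1 + l) * z 3 = 0 \<and>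
     (z 0 \<noteq> 0 \<or> z 1 \<noteq> 0 \<or> z 2 \<noteq> 0 \<or> z 3 \<noteq> 0)"

text \<open>For \<open>l = -1\<close> the matrix is alternating. As for the adjugate, suitable
  combinations of the four equations give the Pfaffian times each coordinate of
  \<open>z\<close>.\<close>

lemma seifert_kernel_minus_1:
  assumes "seifert_kernel (-1) p q r u v w z"
  shows "p * w - q * v + u * r = 0"
proof -
  have e: "p * z 1 + q * z 2 + u * z 3 = 0" "- p * z 0 + r * z 2 + v * z 3 = 0"
    "- q * z 0 - r * z 1 + w * z 3 = 0" "- u * z 0 - v * z 1 - w * z 2 = 0"
    and nz: "z 0 \<noteq> 0 \<or> z 1 \<noteq> 0 \<or> z 2 \<noteq> 0 \<or> z 3 \<noteq> 0"
    using assms by (simp_all add: seifert_kernel_def)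
  have "(p * w - q * v + u * r) * z 0
      = - w * (- p * z 0 + r * z 2 + v * z 3) + v * (- q * z 0 - r * z 1 + w * z 3) - r * (- u * z 0 - v * z 1 - w * z 2)"
    "(p * w - q * v + u * r) * z 1
      = w * (p * z 1 + q * z 2 + u * z 3) - u * (- q * z 0 - r * z 1 + w * z 3) + q * (- u * z 0 - v * z 1 - w * z 2)"
    "(p * w - q * v + u * r) * z 2
      = - v * (p * z 1 + q * z 2 + u * z 3) + u * (- p * z 0 + r * z 2 + v * z 3) - p * (- u * z 0 - v * z 1 - w * z 2)"
    "(p * w - q * v + u * r) * z 3
      = r * (p * z 1 + q * z 2 + u * z 3) - q * (- p * z 0 + r * z 2 + v * z 3) + p * (- q * z 0 - r * z 1 + w * z 3)"
    by (simp_all add: algebra_simps)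
  hence "(p * w - q * v + u * r) * z 0 = 0" "(p * w - q * v + u * r) * z 1 = 0"
    "(p * w - q * v + u * r) * z 2 = 0" "(p * w - q * v + u * r) * z 3 = 0"
    unfolding e by simp_all
  thus ?thesis using nz by auto
qed

lemma det3_kernel:
  fixes x y z :: "'a::idom"
  assumes "a * x + b * y + c * z = 0" "d * x + e * y + f * z = 0" "g * x + h * y + i * z = 0"
    and nz: "x \<noteq> 0 \<or> y \<noteq> 0 \<or> z \<noteq> 0"
  shows "a * (e * i - f * h) - b * (d * i - f * g) + c * (d * h - e * g) = 0"
proof -
  let ?D = "a * (e * i - f * h) - b * (d * i - f * g) + c * (d * h - e * g)"
  have "?D * x = (e*i - f*h) * (a*x + b*y + c*z) - (b*i - c*h) * (d*x + e*y + f*z) + (b*f - c*e) * (g*x + h*y + i*z)"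
    "?D * y = (f*g - d*i) * (a*x + b*y + c*z) + (a*i - c*g) * (d*x + e*y + f*z) - (a*f - c*d) * (g*x + h*y + i*z)"
    "?D * z = (d*h - e*g) * (a*x + b*y + c*z) - (a*h - b*g) * (d*x + e*y + f*z) + (a*e - b*d) * (g*x + h*y + i*z)"
    by (simp_all only: algebra_simps)
  hence "?D * x = 0" "?D * y = 0" "?D * z = 0" by (simp_all only: assms(1-3)) simp_all
  thus ?thesis using nz by auto
qed

text \<open>A non-real \<open>l\<close> of modulus 1 has the minimal polynomial X^2 - 2 Re(l) X + 1
  over the reals, and a real quadratic vanishing at \<open>l\<close> is a multiple of it.\<close>

lemma real_quadratic_root:
  fixes a b c :: real
  assumes l: "Im l \<noteq> 0" "cnj l * l = 1"
    and e: "complex_of_real a * l^2 + complex_of_real b * l + complex_of_real c = 0"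
  shows "a = c" "b = - 2 * Re l * a"
proof -
  have n: "Re l * Re l + Im l * Im l = 1" using arg_cong[OF l(2), of Re] by simp
  have "Im (complex_of_real a * l^2 + complex_of_real b * l + complex_of_real c) = 0" by (simp only: e) simp
  hence "Im l * (2 * Re l * a + b) = 0" by (simp add: power2_eq_square algebra_simps)
  thus b: "b = - 2 * Re l * a" using l(1) by simp
  have "Re (complex_of_real a * l^2 + complex_of_real b * l + complex_of_real c) = 0" by (simp only: e) simp
  hence "a * (Re l * Re l - Im l * Im l) + b * Re l + c = 0" by (simp add: power2_eq_square algebra_simps)
  hence "c = a * (Re l * Re l + Im l * Im l)" unfolding b by (simp add: algebra_simps)
  thus "a = c" using n by simp
qed

text \<open>A kernel of dimension 2 contains nonzero vectors vanishing at any given index. So any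
  three columns are dependent and their 3 x 3 minors vanish. A principal minor is
  \<open>1 + l\<close> times a real quadratic in \<open>l\<close>, which gives the formulas for
  \<open>N\<close>.\<close>

lemma seifert_kernel_relations:
  fixes p q r u v w :: real
  assumes l: "Im l \<noteq> 0" "cnj l * l = 1"
    and ker: "\<And>m. m < 4 \<Longrightarrow> \<exists>z. seifert_kernel l p q r u v w z \<and> z m = 0"
  defines "N \<equiv> 2 + 2 * Re l"
  shows "N = p*p + q*q + r*r - p*q*r" "N = p*p + u*u + v*v - p*u*v" "N = q*q + u*u + w*w - q*u*w"
    "(p*r - q) * u = r * v" "(N - p*p) * w = q*u - (p*q - r) * v"
proof -
  have l1: "1 + l \<noteq> 0" using l(1) by (auto simp: complex_eq_iff)
  have l0: "l \<noteq> 0" using l(1) by auto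
  have principal: "N = a*a + b*b + c*c - a*b*c"
    if z: "(1 + l) * x + a * y + b * z = 0" "l * a * x + (1 + l) * y + c * z = 0"
      "l * b * x + l * c * y + (1 + l) * z = 0" "x \<noteq> 0 \<or> y \<noteq> 0 \<or> z \<noteq> 0" for a b c :: real and x y z :: complex
  proof -
    from det3_kernel[OF z(1-3) z(4)]
    have "(1 + l) * (complex_of_real 1 * l^2 + complex_of_real (2 - (a*a + b*b + c*c - a*b*c)) * l + complex_of_real 1) = 0"
      by (simp add: algebra_simps power2_eq_square)
    hence "complex_of_real 1 * l^2 + complex_of_real (2 - (a*a + b*b + c*c - a*b*c)) * l + complex_of_real 1 = 0"
      using l1 by (metis mult_eq_0_iff)
    from real_quadratic_root(2)[OF l this] show ?thesis by (simp add: N_def)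
  qed
  obtain z where z: "seifert_kernel l p q r u v w z" "z 3 = 0" using ker[of 3] by auto
  show 1: "N = p*p + q*q + r*r - p*q*r"
    by (rule principal[of "z 0" p "z 1" q "z 2" r]) (use z in \<open>auto simp: seifert_kernel_def\<close>)
  obtain y where y: "seifert_kernel l p q r u v w y" "y 2 = 0" using ker[of 2] by auto
  show "N = p*p + u*u + v*v - p*u*v"
    by (rule principal[of "y 0" p "y 1" u "y 3" v]) (use y in \<open>auto simp: seifert_kernel_def\<close>)
  obtain x where x: "seifert_kernel l p q r u v w x" "x 1 = 0" using ker[of 1] by auto
  show "N = q*q + u*u + w*w - q*u*w"
    by (rule principal[of "x 0" q "x 2" u "x 3" w]) (use x in \<open>auto simp: seifert_kernel_def\<close>)
  \<comment> \<open>The minor of rows 0, 1, 2 and columns 0, 1, 3 is not principal; both comparisons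
    of coefficients then yield a linear relation.\<close>
  have "(1 + l) * y 0 + p * y 1 + u * y 3 = 0" "l * p * y 0 + (1 + l) * y 1 + v * y 3 = 0"
      "l * q * y 0 + l * r * y 1 + w * y 3 = 0" "y 0 \<noteq> 0 \<or> y 1 \<noteq> 0 \<or> y 3 \<noteq> 0"
    using y by (auto simp: seifert_kernel_def)
  from det3_kernel[OF this]
  have "complex_of_real (w + p*r*u - u*q - v*r) * l^2
     + complex_of_real (2*w + p*q*v - u*q - p*p*w - v*r) * l + complex_of_real w = 0"
    by (simp add: algebra_simps power2_eq_square)
  from real_quadratic_root[OF l this]
  have a: "p*r*u - u*q = v*r" and "2*w + p*q*v - u*q - p*p*w - v*r = - 2 * Re l * w" by simp_all
  thus "(p*r - q) * u = r * v" "(N - p*p) * w = q*u - (p*q - r) * v"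
    by (simp_all add: N_def algebra_simps)
qed

lemma binary_form_zero:
  fixes p q r :: real
  assumes "p * p < 4" "q*q + r*r - p*q*r = 0"
  shows "q = 0 \<and> r = 0"
proof -
  have "(q - p / 2 * r)^2 + (4 - p*p) / 4 * r^2 = 0"
    using assms(2) by (simp add: power2_eq_square field_simps)
  moreover have "0 \<le> (4 - p*p) / 4 * r^2" using assms(1) by simp
  ultimately have "(q - p / 2 * r)^2 = 0 \<and> (4 - p*p) / 4 * r^2 = 0"
    by (subst (asm) add_nonneg_eq_0_iff) auto
  thus ?thesis using assms(1) by auto
qed

text \<open>The binary form X^2 + Y^2 - p X Y takes the value \<open>N - p^2\<close> both at
  \<open>(u, v)\<close> and at \<open>(r, p r - q)\<close>, which the first linear relation makes
  proportional. So the factor is a sign unless this value is 0. In that case \<open>p^2 < 4\<close>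
  makes the binary form definite, and only the entries 01 and 23 survive.\<close>

lemma seifert_normal_form:
  fixes p q r u v w N :: real
  assumes N: "N = p*p + q*q + r*r - p*q*r" "N = p*p + u*u + v*v - p*u*v" "N = q*q + u*u + w*w - q*u*w"
    and lin: "(p*r - q) * u = r * v" "(N - p*p) * w = q*u - (p*q - r) * v" and "N < 4"
  shows "(\<exists>k\<in>{1, -1}. u = k * r \<and> v = k * (p*r - q) \<and> w = k * p) \<or>
    (q = 0 \<and> r = 0 \<and> u = 0 \<and> v = 0 \<and> w*w = p*p)"
proof (cases "N = p*p")
  case True
  with \<open>N < 4\<close> have p: "p*p < 4" by simp
  have "q = 0 \<and> r = 0" using binary_form_zero[OF p, of q r] N(1) True by simp
  moreover have "u = 0 \<and> v = 0" using binary_form_zero[OF p, of u v] N(2) True by simp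
  ultimately show ?thesis using N(3) True by simp
next
  case False
  obtain k where k: "u = k * r" "v = k * (p*r - q)"
  proof (cases "r = 0")
    case True
    hence "q \<noteq> 0" using False N(1) by auto
    thus ?thesis using that[of "- v / q"] True lin(1) by simp
  next
    case False
    thus ?thesis using that[of "u / r"] lin(1) by (simp add: field_simps)
  qed
  have "(N - p*p) * w = (N - p*p) * (k * p)"
  proof -
    have "(N - p*p) * w = k * p * (q*q + r*r - p*q*r)"
      using lin(2) unfolding k by (simp add: algebra_simps)
    moreover have "N - p*p = q*q + r*r - p*q*r" using N(1) by simp
    ultimately show ?thesis by simp
  qed
  hence w: "w = k * p" using False by simp
  have "(N - p*p) * (k*k) = (N - p*p) * 1"
  proof -
    have "(N - p*p) * (k*k) = k*k*(q*q + r*r - p*q*r)" by (subst N(1)) (simp add: algebra_simps)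
    also have "\<dots> = u*u + v*v - p*u*v" unfolding k by (simp add: algebra_simps)
    finally show ?thesis using N(2) by simp
  qed
  hence "k*k = 1" using False by simp
  hence "k = 1 \<or> k = -1" by (simp add: square_eq_1_iff)
  thus ?thesis using k w by blast
qed

text \<open>The Markov-type cubic, which the braid moves preserve; for a nice tuple it is
  \<open>l + 1/l\<close>.\<close>

definition trace_inv :: "gint \<Rightarrow> gint \<Rightarrow> gint \<Rightarrow> gint" where
  "trace_inv p q r = p*p + q*q + r*r - p*q*r - 2"

text \<open>A list written with the constructor, so that the finite checks can be evaluated.\<close>

definition gram_values :: "gint list" where
  "gram_values = [Gint 0 0, Gint 1 0, Gint (-1) 0, Gint 2 0, Gint (-2) 0, Gint 0 1, Gint 0 (-1), Gint (-1) 1, Gint 1 (-1)]"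

text \<open>2 cos of pi/3, pi/5 and 3 pi/5: the corresponding \<open>l\<close> are the primitive
  sixth and tenth roots of unity.\<close>

definition type_traces :: "gint set" where
  "type_traces = {Gint 1 0, Gint 0 1, Gint 1 (-1)}"

lemma gram_values_set: "set gram_values = {0, 1, -1, 2, -2, Gint 0 1, Gint 0 (-1), Gint (-1) 1, Gint 1 (-1)}"
  by (simp add: gram_values_def gint_simps)

lemma unit_trace_check:
  "\<forall>p\<in>set gram_values. \<forall>q\<in>set gram_values. \<forall>r\<in>set gram_values.
     \<bar>gnorm (2 - trace_inv p q r)\<bar> = 1 \<longrightarrow>
     trace_inv p q r \<in> {Gint 1 0, Gint 0 1, Gint 1 (-1), Gint 3 0, Gint 3 1, Gint 4 (-1), Gint 4 3, Gint 7 (-3)}"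
  by code_simp

text \<open>Eight values make \<open>2 - t\<close> a unit, and five of them exceed 2 in the first
  embedding, whereas \<open>t\<close> will be twice the real part of a number on the unit
  circle.\<close>

lemma type_trace_of_unit:
  assumes "p \<in> set gram_values" "q \<in> set gram_values" "r \<in> set gram_values"
    and "2 - trace_inv p q r dvd 1" "ev1 (trace_inv p q r) < 2"
  shows "trace_inv p q r \<in> type_traces"
proof -
  have "trace_inv p q r \<in> {Gint 1 0, Gint 0 1, Gint 1 (-1), Gint 3 0, Gint 3 1, Gint 4 (-1), Gint 4 3, Gint 7 (-3)}"
    using unit_trace_check assms(1-3) gnorm_unit[OF assms(4)] by blast
  thus ?thesis using assms(5) golden_bounds unfolding type_traces_def
    by (elim insertE emptyE) (simp_all add: embed_Gint)
qed

text \<open>This excludes \<open>t = p^2 - 2\<close>, the degenerate case of the normal form; it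
  also keeps the leading 2 x 2 minor of the Seifert matrix away from 0.\<close>

lemma square_trace_check: "\<forall>p\<in>set gram_values. trace_inv p 0 0 \<notin> {Gint 1 0, Gint 0 1, Gint 1 (-1)}"
  by code_simp

lemma eigs_cnj:
  assumes Q: "Q \<in> carrier_mat n n" "map_mat cnj Q = Q"
  shows "image_mset cnj (eigs Q) = eigs Q"
proof -
  obtain as where as: "char_poly Q = (\<Prod>a\<leftarrow>as. [:- a, 1:])" using char_poly_factorized[OF Q(1)] by blast
  have proots: "proots (\<Prod>a\<leftarrow>bs. [:- a, 1:]) = mset bs" for bs :: "complex list"
  proof -
    have "(\<Prod>a\<leftarrow>bs. [:- a, 1:]) \<noteq> 0" for bs :: "complex list"
      by (auto simp: prod_list_zero_iff)
    thus ?thesis by (induction bs) (simp_all add: proots_mult del: mult_pCons_left)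
  qed
  interpret mp: map_poly_comm_ring_hom cnj ..
  have "char_poly Q = map_poly cnj (char_poly Q)"
    using cnj.char_poly_hom[OF Q(1)] unfolding Q(2) .
  also have "\<dots> = (\<Prod>a\<leftarrow>map cnj as. [:- a, 1:])"
    unfolding as by (simp add: mp.hom_prod_list o_def)
  finally have "eigs Q = mset (map cnj as)" unfolding eigs_def by (simp only: proots)
  moreover have "eigs Q = mset as" unfolding eigs_def as by (rule proots)
  ultimately show ?thesis by simp
qed

lemma count_eigs_cnj:
  assumes Q: "Q \<in> carrier_mat n n" "map_mat cnj Q = Q"
  shows "count (eigs Q) (cnj a) = count (eigs Q) a"
proof -
  have "count (image_mset cnj A) (cnj a) = count A a" for A
    by (induction A) auto
  from this[of "eigs Q"] show ?thesis by (simp add: eigs_cnj[OF Q])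
qed

section \<open>The structure of nice tuples\<close>

lemma crefl_eq_refl: "is_root a \<Longrightarrow> crefl a = refl cgolden (map_vec evc a)"
  by (simp add: crefl_def evc.refl_hom is_root_def)

lemma crefl_uminus: "a \<in> carrier_vec 4 \<Longrightarrow> crefl (- a) = crefl a"
proof -
  assume a: "a \<in> carrier_vec 4"
  have "coroot golden_int (- a) $ j = - coroot golden_int a $ j" if "j < 4" for j
    using a that by (auto simp: less_4_cases)
  hence "refl golden_int (- a) = refl golden_int a"
    using a by (intro eq_matI) (auto simp: refl_def)
  thus ?thesis by (simp add: crefl_def)
qed

definition generating_roots :: "gint vec list \<Rightarrow> bool" where
  "generating_roots rs \<longleftrightarrow> (\<forall>a\<in>set rs. is_root a) \<and> generate (GL 4) (crefl ` set rs) = G30"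

lemma generating_pf:
  assumes "generating_roots rs"
  shows "\<exists>a b c d. a < b \<and> b < c \<and> c < d \<and> d < length rs \<and> pf (rs!a) (rs!b) (rs!c) (rs!d) \<noteq> 0"
  by (rule generating_pf_nonzero[of rs]) (use assms in \<open>auto simp: generating_roots_def\<close>)

lemma nice_tuple_roots:
  assumes "As \<in> nice_tuples 4 G30 T"
  obtains rs where "length rs = T" "generating_roots rs" "As = map crefl rs"
proof -
  have "\<exists>a. is_root a \<and> A = crefl a" if "A \<in> set As" for A
    using assms that reflection_root[of A] unfolding nice_tuples_def by blast
  then obtain f where f: "\<And>A. A \<in> set As \<Longrightarrow> is_root (f A) \<and> A = crefl (f A)" by metis
  have "As = map crefl (map f As)" using f by (simp add: map_idI)
  moreover have "crefl ` set (map f As) = set As" using f by force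
  ultimately show thesis
    using assms f by (intro that[of "map f As"]) (auto simp: generating_roots_def nice_tuples_def)
qed

lemma mat_prod_generate:
  assumes "set As \<subseteq> G30"
  shows "mat_prod 4 As \<in> G30"
  using assms
proof (induction As)
  case Nil
  show ?case using generate.one[of "GL 4"] by (simp add: mat_prod_def G30_def)
next
  case (Cons A As)
  hence "A \<in> G30" "mat_prod 4 As \<in> G30" by auto
  thus ?case using generate.eng[of A "GL 4"] by (simp add: mat_prod_def G30_def)
qed

lemma generating_roots_incl: "generating_roots rs \<Longrightarrow> set (map crefl rs) \<subseteq> G30"
  unfolding generating_roots_def using generate.incl[of _ "crefl ` set rs" "GL 4"] by auto

lemma G30_inv: "A \<in> G30 \<Longrightarrow> inv\<^bsub>GL 4\<^esub> A \<in> G30"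
  unfolding G30_def
  by (rule group.generate_m_inv_closed[OF GL_group]) (auto intro: H4_simple_GL)

lemma inverse_product_G30:
  assumes "generating_roots rs"
  shows "mat_prod 4 (map crefl rs) \<in> G30" "inverse_product 4 (map crefl rs) \<in> G30"
  using mat_prod_generate[OF generating_roots_incl[OF assms]] G30_inv by (auto simp: inverse_product_def)

lemma inverse_product_props:
  assumes "generating_roots rs"
  shows "real_isometry (inverse_product 4 (map crefl rs))"
    "inverse_product 4 (map crefl rs) \<in> carrier_mat 4 4" "mat_prod 4 (map crefl rs) \<in> carrier_mat 4 4"
    "mat_prod 4 (map crefl rs) * inverse_product 4 (map crefl rs) = 1\<^sub>m 4"
    "inverse_product 4 (map crefl rs) * mat_prod 4 (map crefl rs) = 1\<^sub>m 4"
proof -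
  note G = inverse_product_G30[OF assms]
  show "real_isometry (inverse_product 4 (map crefl rs))" by (rule G30_real_isometry[OF G(2)])
  have "mat_prod 4 (map crefl rs) \<in> carrier (GL 4)" using G G30_subset by blast
  from GL_inv_props[OF this] this
  show "inverse_product 4 (map crefl rs) \<in> carrier_mat 4 4" "mat_prod 4 (map crefl rs) \<in> carrier_mat 4 4"
    "mat_prod 4 (map crefl rs) * inverse_product 4 (map crefl rs) = 1\<^sub>m 4"
    "inverse_product 4 (map crefl rs) * mat_prod 4 (map crefl rs) = 1\<^sub>m 4"
    by (auto simp: inverse_product_def GL_carrier)
qed

text \<open>The eigenspace has dimension at least two, so some eigenvector has a coefficient vector
  \<open>z\<close> that vanishes at \<open>m\<close>.\<close>

lemma nice_kernel:
  assumes gen: "generating_roots rs" and l: "l \<noteq> 1"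
    and c: "2 \<le> count (tuple_type 4 (map crefl rs)) l" and m: "m < length rs"
  shows "\<exists>z. z m = 0 \<and> (\<exists>k<length rs. z k \<noteq> 0) \<and>
    (\<forall>k<length rs. (\<Sum>j<length rs. (if j < k then l * evc (form golden_int (rs ! k) (rs ! j))
       else if j = k then 1 + l else evc (form golden_int (rs ! k) (rs ! j))) * z j) = 0)"
proof -
  define Q where "Q = inverse_product 4 (map crefl rs)"
  define C where "C = mat_prod 4 (map crefl rs)"
  define as where "as = map (map_vec evc) rs"
  note P = inverse_product_props[OF gen, folded Q_def C_def]
  have rs: "rs ! k \<in> carrier_vec 4" "form golden_int (rs ! k) (rs ! k) = 2" if "k < length rs" for k
    using gen that by (auto simp: generating_roots_def is_root_def)
  have as: "set as \<subseteq> carrier_vec 4" "length as = length rs" "\<And>a. a \<in> set as \<Longrightarrow> form cgolden a a = 2"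
    using gen by (auto simp: as_def generating_roots_def is_root_def evc.form_hom)
  have C: "C = mat_prod 4 (map (refl cgolden) as)"
    unfolding C_def as_def map_map
    by (rule arg_cong[of _ _ "mat_prod 4"]) (use gen in \<open>auto simp: generating_roots_def crefl_eq_refl\<close>)
  have G: "form cgolden (as ! k) (as ! j) = evc (form golden_int (rs ! k) (rs ! j))"
    if "k < length rs" "j < length rs" for k j
    using that rs by (simp add: as_def evc.form_hom)
  obtain v1 v2 where v: "v1 \<in> carrier_vec 4" "v2 \<in> carrier_vec 4" "Q *\<^sub>v v1 = l \<cdot>\<^sub>v v1" "Q *\<^sub>v v2 = l \<cdot>\<^sub>v v2"
    and ind: "\<And>x y. x \<cdot>\<^sub>v v1 + y \<cdot>\<^sub>v v2 = 0\<^sub>v 4 \<Longrightarrow> x = 0 \<and> y = 0"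
    using two_eigenvectors[OF P(1)] c unfolding tuple_type_def Q_def by blast
  have "v1 \<noteq> 0\<^sub>v 4"
  proof
    assume "v1 = 0\<^sub>v 4"
    hence "1 \<cdot>\<^sub>v v1 + 0 \<cdot>\<^sub>v v2 = 0\<^sub>v 4" using v by (intro eq_vecI) auto
    from ind[OF this] show False by simp
  qed
  from eigenvalue_norm[OF P(1) v(1) this v(3)] have l0: "l \<noteq> 0" by auto
  obtain z1 where z1: "defect as C v1 z1" using defect_exists[OF as(1) v(1)] unfolding C by blast
  obtain z2 where z2: "defect as C v2 z2" using defect_exists[OF as(1) v(2)] unfolding C by blast
  obtain x y where xy: "x * z1 m + y * z2 m = 0" "x \<noteq> 0 \<or> y \<noteq> 0"
  proof (cases "z1 m = 0")
    case True thus ?thesis using that[of 1 0] by simp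
  next
    case False thus ?thesis using that[of "z2 m" "- z1 m"] by simp
  qed
  define v where "v = x \<cdot>\<^sub>v v1 + y \<cdot>\<^sub>v v2"
  define z where "z k = x * z1 k + y * z2 k" for k
  have vc: "v \<in> carrier_vec 4" using v by (simp add: v_def)
  have v0: "v \<noteq> 0\<^sub>v 4" using ind xy(2) unfolding v_def by blast
  have Qv: "Q *\<^sub>v v = l \<cdot>\<^sub>v v"
    unfolding v_def using v P(2)
    by (simp add: mult_add_distrib_mat_vec[of _ 4 4] mult_mat_vec[of _ 4 4] smult_add_distrib_vec[of _ 4]
        smult_smult_assoc mult.commute)
  have "v = C *\<^sub>v (Q *\<^sub>v v)" using P vc by (simp add: assoc_mult_mat_vec[of _ 4 4 _ 4, symmetric])
  hence "v = l \<cdot>\<^sub>v (C *\<^sub>v v)" unfolding Qv using P vc by (simp add: mult_mat_vec[of _ 4 4])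
  hence "inverse l \<cdot>\<^sub>v v = inverse l \<cdot>\<^sub>v (l \<cdot>\<^sub>v (C *\<^sub>v v))" by simp
  hence Cv: "C *\<^sub>v v = inverse l \<cdot>\<^sub>v v" using l0 by (simp add: smult_smult_assoc)
  have d: "defect as C v z" unfolding v_def z_def by (rule defect_linear[OF z1 z2 v(1,2) P(3)])
  note E = defect_eigenvector[OF d vc Cv l0 l as(3)]
  show ?thesis
  proof (intro exI[of _ z] conjI allI impI)
    show "z m = 0" using xy by (simp add: z_def)
    show "\<exists>k<length rs. z k \<noteq> 0" using E(2) v0 as(2) by auto
    fix k assume k: "k < length rs"
    have "(\<Sum>j<length rs. (if j < k then l * evc (form golden_int (rs ! k) (rs ! j))
       else if j = k then 1 + l else evc (form golden_int (rs ! k) (rs ! j))) * z j)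
      = (\<Sum>j<length as. (if j < k then l * form cgolden (as ! k) (as ! j)
      else if j = k then 1 + l else form cgolden (as ! k) (as ! j)) * z j)"
      using k as(2) G by (intro sum.cong) auto
    thus "(\<Sum>j<length rs. (if j < k then l * evc (form golden_int (rs ! k) (rs ! j))
       else if j = k then 1 + l else evc (form golden_int (rs ! k) (rs ! j))) * z j) = 0"
      using E(1) k as(2) by simp
  qed
qed

abbreviation gram :: "gint vec list \<Rightarrow> nat \<Rightarrow> nat \<Rightarrow> gint" where
  "gram rs i j \<equiv> form golden_int (rs ! i) (rs ! j)"

lemma nice_kernel_4:
  assumes gen: "generating_roots rs" and len: "length rs = 4" and l: "l \<noteq> 1"
    and c: "2 \<le> count (tuple_type 4 (map crefl rs)) l" and m: "m < 4"
  shows "\<exists>z. seifert_kernel l (evc (gram rs 0 1)) (evc (gram rs 0 2)) (evc (gram rs 1 2)) (evc (gram rs 0 3))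
     (evc (gram rs 1 3)) (evc (gram rs 2 3)) z \<and> z m = 0"
proof -
  obtain z where z: "z m = 0" "\<exists>k<4. z k \<noteq> 0"
    "\<And>k. k < 4 \<Longrightarrow> (\<Sum>j<4. (if j < k then l * evc (gram rs k j)
       else if j = k then 1 + l else evc (gram rs k j)) * z j) = 0"
    using nice_kernel[OF gen l c, of m] m unfolding len by blast
  have s: "gram rs (Suc 0) 0 = gram rs 0 (Suc 0)" "gram rs 2 0 = gram rs 0 2" "gram rs 2 (Suc 0) = gram rs (Suc 0) 2"
    "gram rs 3 0 = gram rs 0 3" "gram rs 3 (Suc 0) = gram rs (Suc 0) 3" "gram rs 3 2 = gram rs 2 3"
    by (rule form_sym)+
  have sum: "(\<Sum>j<4. f j) = f 0 + f 1 + f 2 + f 3" for f :: "nat \<Rightarrow> complex" by (simp add: numeral_eq_Suc)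
  show ?thesis
    using z(1,2) z(3)[of 0] z(3)[of 1] z(3)[of 2] z(3)[of 3]
    by (intro exI[of _ z]) (auto simp: seifert_kernel_def sum s less_4_cases)
qed

section \<open>Eigenvalues on the unit circle and the exclusion of 5-tuples\<close>

lemma two_counts_le: "a \<noteq> b \<Longrightarrow> count M a + count M b \<le> size M"
proof (induction M)
  case (add x M)
  thus ?case by (cases "x = a"; cases "x = b") auto
qed simp

lemma real_eigenvalue:
  assumes gen: "generating_roots rs" and c: "0 < count (tuple_type 4 (map crefl rs)) l" and l: "l \<noteq> 1"
  shows "cnj l * l = 1" "cnj l = l \<Longrightarrow> l = -1"
proof -
  note P = inverse_product_props[OF gen]
  have "eigenvalue (inverse_product 4 (map crefl rs)) l"
    unfolding eigenvalue_root_char_poly[OF P(2)]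
    using c degree_monic_char_poly[OF P(2)]
    by (cases "char_poly (inverse_product 4 (map crefl rs)) = 0") (auto simp: tuple_type_def eigs_def order_root)
  then obtain v where "v \<in> carrier_vec 4" "v \<noteq> 0\<^sub>v 4" "inverse_product 4 (map crefl rs) *\<^sub>v v = l \<cdot>\<^sub>v v"
    using P(2) by (auto simp: eigenvalue_def eigenvector_def)
  from eigenvalue_norm[OF P(1) this] show n: "cnj l * l = 1" .
  assume "cnj l = l"
  hence "(l - 1) * (l + 1) = 0" using n by (simp add: algebra_simps)
  thus "l = -1" using l by (simp add: eq_neg_iff_add_eq_0)
qed

lemma count_type_cnj:
  assumes "generating_roots rs"
  shows "count (tuple_type 4 (map crefl rs)) (cnj l) = count (tuple_type 4 (map crefl rs)) l"
  using count_eigs_cnj[of "inverse_product 4 (map crefl rs)" 4 l] inverse_product_props(1,2)[OF assms]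
  by (simp add: tuple_type_def real_isometry_def)

lemma size_type: "generating_roots rs \<Longrightarrow> size (tuple_type 4 (map crefl rs)) = 4"
  using size_eigs inverse_product_props(2) by (simp add: tuple_type_def)

text \<open>Multiplicity 3 in dimension 4 forces \<open>l\<close> to equal its conjugate, so
  \<open>l = -1\<close>. Four of the roots have a nonzero Pfaffian, but a kernel vector vanishing at
  the fifth index lies in the kernel of their alternating matrix.\<close>

theorem no_nice_5_tuples: "nice_tuples 4 G30 5 = {}"
proof (rule ccontr)
  assume "nice_tuples 4 G30 5 \<noteq> {}"
  then obtain As where As: "As \<in> nice_tuples 4 G30 5" by auto
  obtain rs where rs: "length rs = 5" "generating_roots rs" "As = map crefl rs"
    using nice_tuple_roots[OF As] .
  obtain l where l: "l \<noteq> 1" "count (tuple_type 4 (map crefl rs)) l = 3"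
    using As rs by (auto simp: nice_tuples_def nice_eigenvalue_def)
  have "cnj l = l"
    using two_counts_le[of l "cnj l" "tuple_type 4 (map crefl rs)"] size_type[OF rs(2)]
      count_type_cnj[OF rs(2), of l] l(2) by fastforce
  hence l1: "l = -1" using real_eigenvalue(2)[OF rs(2) _ l(1)] l(2) by simp
  obtain a b c d where abcd: "a < b" "b < c" "c < d" "d < 5" "pf (rs!a) (rs!b) (rs!c) (rs!d) \<noteq> 0"
    using generating_pf[OF rs(2)] unfolding rs(1) by blast
  \<comment> \<open>The index that is left over, 10 being the sum of all five.\<close>
  define m where "m = 10 - (a + b + c + d)"
  have m: "m < 5" "{a, b, c, d, m} = {0, 1, 2, 3, 4}" "m \<notin> {a, b, c, d}"
  proof -
    have "a = 0 \<and> b = 1 \<and> c = 2 \<and> d = 3 \<or> a = 0 \<and> b = 1 \<and> c = 2 \<and> d = 4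
      \<or> a = 0 \<and> b = 1 \<and> c = 3 \<and> d = 4 \<or> a = 0 \<and> b = 2 \<and> c = 3 \<and> d = 4
      \<or> a = 1 \<and> b = 2 \<and> c = 3 \<and> d = 4" using abcd(1-4) by presburger
    thus "m < 5" "{a, b, c, d, m} = {0, 1, 2, 3, 4}" "m \<notin> {a, b, c, d}" by (auto simp: m_def)
  qed
  obtain z where z: "z m = 0" "\<exists>k<5. z k \<noteq> 0"
    "\<And>k. k < 5 \<Longrightarrow> (\<Sum>j<5. (if j < k then l * evc (gram rs k j)
       else if j = k then 1 + l else evc (gram rs k j)) * z j) = 0"
    using nice_kernel[OF rs(2) l(1), of m] m(1) l(2) unfolding rs(1) by auto
  have five: "{..<5} = {a, b, c, d, m}" using m(2) by auto
  have sum: "(\<Sum>j<5. f j) = f a + f b + f c + f d + f m" for f :: "nat \<Rightarrow> complex"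
    unfolding five using abcd m(3) by (simp add: add_ac)
  have s: "gram rs b a = gram rs a b" "gram rs c a = gram rs a c" "gram rs c b = gram rs b c"
    "gram rs d a = gram rs a d" "gram rs d b = gram rs b d" "gram rs d c = gram rs c d"
    by (rule form_sym)+
  have nz: "z a \<noteq> 0 \<or> z b \<noteq> 0 \<or> z c \<noteq> 0 \<or> z d \<noteq> 0"
  proof -
    obtain k where "k \<in> {..<5}" "z k \<noteq> 0" using z(2) by auto
    thus ?thesis unfolding five using z(1) by auto
  qed
  define y where "y k = (if k = 0 then z a else if k = 1 then z b else if k = 2 then z c else z d)" for k :: nat
  have "seifert_kernel (-1) (evc (gram rs a b)) (evc (gram rs a c)) (evc (gram rs b c)) (evc (gram rs a d))
     (evc (gram rs b d)) (evc (gram rs c d)) y"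
    using z(3)[of a] z(3)[of b] z(3)[of c] z(3)[of d] abcd nz z(1)
    unfolding sum l1 by (simp add: seifert_kernel_def y_def s)
  from seifert_kernel_minus_1[OF this] have "evc (pf (rs!a) (rs!b) (rs!c) (rs!d)) = evc 0"
    by (simp add: pf_def evc.emb.hom_add evc.emb.hom_minus evc.emb.hom_mult mult.commute)
  thus False using abcd(5) by (simp only: evc_inj)
qed

section \<open>The normal form of nice 4-tuples\<close>

definition normal_roots :: "gint vec list \<Rightarrow> gint \<Rightarrow> gint \<Rightarrow> gint \<Rightarrow> bool" where
  "normal_roots rs p q r \<longleftrightarrow> length rs = 4 \<and> (\<forall>a\<in>set rs. is_root a) \<and>
     gram rs 0 1 = p \<and> gram rs 0 2 = q \<and> gram rs 1 2 = r \<and> gram rs 0 3 = r \<and>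
     gram rs 1 3 = p * r - q \<and> gram rs 2 3 = p"

definition good_triple :: "gint \<Rightarrow> gint \<Rightarrow> gint \<Rightarrow> bool" where
  "good_triple p q r \<longleftrightarrow> p \<in> set gram_values \<and> q \<in> set gram_values \<and> r \<in> set gram_values \<and>
     trace_inv p q r \<in> type_traces"

definition type_eigenvalue :: "complex \<Rightarrow> gint \<Rightarrow> bool" where
  "type_eigenvalue l t \<longleftrightarrow> Im l \<noteq> 0 \<and> cnj l * l = 1 \<and> l + inverse l = evc t"

lemma nice_structure:
  assumes As: "As \<in> nice_tuples 4 G30 4" and nice: "nice_eigenvalue 4 As l"
  obtains rs p q r where "normal_roots rs p q r" "good_triple p q r" "As = map crefl rs" "generating_roots rs"
    "type_eigenvalue l (trace_inv p q r)" "tuple_type 4 As = {#l, l, inverse l, inverse l#}"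
proof -
  obtain rs where rs: "length rs = 4" "generating_roots rs" "As = map crefl rs"
    using nice_tuple_roots[OF As] .
  define p q r u v w where "p = gram rs 0 1" and "q = gram rs 0 2" and "r = gram rs 1 2"
    and "u = gram rs 0 3" and "v = gram rs 1 3" and "w = gram rs 2 3"
  note G = p_def q_def r_def u_def v_def w_def
  have l: "l \<noteq> 1" "count (tuple_type 4 (map crefl rs)) l = 2"
    using nice rs by (auto simp: nice_eigenvalue_def)
  have ker: "\<exists>z. seifert_kernel l (evc p) (evc q) (evc r) (evc u) (evc v) (evc w) z \<and> z m = 0" if "m < 4" for m
    unfolding G by (rule nice_kernel_4[OF rs(2,1) l(1)]) (use l that in auto)
  have norm: "cnj l * l = 1" using real_eigenvalue(1)[OF rs(2) _ l(1)] l(2) by simp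
  \<comment> \<open>A real \<open>l\<close> would be -1, which makes the Pfaffian of the four roots
    vanish.\<close>
  have nonreal: "cnj l \<noteq> l"
  proof
    assume "cnj l = l"
    hence l1: "l = -1" using real_eigenvalue(2)[OF rs(2) _ l(1)] l(2) by simp
    obtain a b c d where abcd: "a < b" "b < c" "c < d" "d < 4" "pf (rs!a) (rs!b) (rs!c) (rs!d) \<noteq> 0"
      using generating_pf[OF rs(2)] unfolding rs(1) by blast
    hence "a = 0" "b = 1" "c = 2" "d = 3" by auto
    hence "p * w - q * v + u * r \<noteq> 0" using abcd(5) by (simp add: pf_def G)
    moreover have "evc (p * w - q * v + u * r) = evc 0"
      using ker[of 0] seifert_kernel_minus_1 unfolding l1
      by (auto simp: evc.emb.hom_add evc.emb.hom_minus evc.emb.hom_mult)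
    ultimately show False by (simp only: evc_inj)
  qed
  hence im: "Im l \<noteq> 0" by (auto simp: complex_eq_iff)
  have inv: "inverse l = cnj l" using norm by (simp add: inverse_unique mult.commute)
  have type: "tuple_type 4 As = {#l, l, inverse l, inverse l#}"
  proof -
    have "{#l, l, cnj l, cnj l#} \<subseteq># tuple_type 4 As"
      using l(2) count_type_cnj[OF rs(2), of l] nonreal rs(3) by (auto simp: subseteq_mset_def)
    moreover have "size {#l, l, cnj l, cnj l#} = size (tuple_type 4 As)" using size_type[OF rs(2)] rs(3) by simp
    ultimately show ?thesis unfolding inv by (metis mset_subset_size nless_le subset_mset.le_less)
  qed
  have re: "Re l < 1"
  proof -
    have "Re l * Re l + Im l * Im l = 1" using arg_cong[OF norm, of Re] by simp
    moreover have "0 < Im l * Im l" using im by (metis not_real_square_gt_zero)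
    ultimately have "(Re l)^2 < 1" by (simp add: power2_eq_square)
    thus ?thesis unfolding abs_square_less_1 by simp
  qed
  note rel = seifert_kernel_relations[OF im norm, of "ev1 p" "ev1 q" "ev1 r" "ev1 u" "ev1 v" "ev1 w",
      OF ker[unfolded evc_of_real]]
  have hom: "ev1 (x * y) = ev1 x * ev1 y" "ev1 (x - y) = ev1 x - ev1 y" "ev1 (x + y) = ev1 x + ev1 y" for x y
    by (simp_all add: ev1.emb.hom_mult ev1.emb.hom_minus ev1.emb.hom_add)
  have tr: "ev1 (trace_inv p q r) = 2 * Re l" using rel(1) by (simp add: trace_inv_def hom)
  have eig: "type_eigenvalue l (trace_inv p q r)"
    using im norm tr by (simp add: type_eigenvalue_def inv evc_of_real complex_eq_iff)
  have root: "rs ! i \<in> carrier_vec 4" "form golden_int (rs ! i) (rs ! i) = 2" "is_root (rs ! i)" if "i < 4" for i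
    using rs that by (auto simp: generating_roots_def is_root_def)
  have vals: "p \<in> set gram_values" "q \<in> set gram_values" "r \<in> set gram_values"
    unfolding G gram_values_set by (rule root_form_values; use root in simp)+
  have det: "16 - 4 * (p*p + q*q + r*r + u*u + v*v + w*w) + 4 * (p*q*r + p*u*v + q*u*w + r*v*w)
      + p*p*w*w + q*q*v*v + r*r*u*u - 2 * (p*w*q*v + p*w*r*u + q*v*r*u) dvd 1"
  proof -
    have "det (mat 4 4 (\<lambda>(i, j). gram rs i j)) dvd 1"
      using gram_det_unit[OF _ _ rs(1)] rs(2) by (auto simp: generating_roots_def)
    moreover have "gram rs i j = gram rs j i" for i j by (rule form_sym)
    ultimately show ?thesis by (subst (asm) det_gram_4) (use root in \<open>auto simp: G\<close>)
  qed
  have "(\<exists>k\<in>{1, -1}. ev1 u = k * ev1 r \<and> ev1 v = k * (ev1 p * ev1 r - ev1 q) \<and> ev1 w = k * ev1 p) \<or>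
    (ev1 q = 0 \<and> ev1 r = 0 \<and> ev1 u = 0 \<and> ev1 v = 0 \<and> ev1 w * ev1 w = ev1 p * ev1 p)"
  proof -
    have "2 + 2 * Re l < 4" using re by simp
    from seifert_normal_form[OF rel this] show ?thesis .
  qed
  hence cases: "(\<exists>k\<in>{1, -1}. u = k * r \<and> v = k * (p * r - q) \<and> w = k * p) \<or>
    (q = 0 \<and> r = 0 \<and> u = 0 \<and> v = 0 \<and> w * w = p * p)"
    unfolding ev1_eq_0 hom(1,2)[symmetric] ev1_inj
    by (auto simp: ev1.emb.hom_uminus[symmetric] ev1_inj)
  have bound: "ev1 (trace_inv p q r) < 2" using tr re by simp
  from cases show thesis
  proof
    assume z: "q = 0 \<and> r = 0 \<and> u = 0 \<and> v = 0 \<and> w * w = p * p"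
    \<comment> \<open>The Gram matrix splits into two 2 x 2 blocks of determinant
      \<open>4 - p^2\<close>.\<close>
    have "(2 - trace_inv p q r) * (2 - trace_inv p q r) dvd 1"
    proof -
      have "p * p * w * w = p * p * (p * p)" using z by (simp add: mult.assoc)
      thus ?thesis using det z unfolding trace_inv_def by (simp add: algebra_simps)
    qed
    hence "2 - trace_inv p q r dvd 1" by (meson dvd_trans dvd_triv_left)
    hence "trace_inv p 0 0 \<in> type_traces" using type_trace_of_unit[OF vals _ bound] z by simp
    thus thesis using square_trace_check vals(1) by (auto simp: type_traces_def)
  next
    assume "\<exists>k\<in>{1, -1}. u = k * r \<and> v = k * (p * r - q) \<and> w = k * p"
    then obtain k where k: "k = 1 \<or> k = -1" "u = k * r" "v = k * (p * r - q)" "w = k * p" by blast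
    have kk: "k * k = 1" using k(1) by auto
    have "(2 - trace_inv p q r) * (2 - trace_inv p q r) dvd 1"
    proof -
      have "16 - 4 * (p*p + q*q + r*r + u*u + v*v + w*w) + 4 * (p*q*r + p*u*v + q*u*w + r*v*w)
        + p*p*w*w + q*q*v*v + r*r*u*u - 2 * (p*w*q*v + p*w*r*u + q*v*r*u)
        = (2 - trace_inv p q r) * (2 - trace_inv p q r)"
        using k(1) unfolding k(2-4) trace_inv_def by (elim disjE) (simp_all add: algebra_simps)
      thus ?thesis using det by simp
    qed
    hence "2 - trace_inv p q r dvd 1" by (meson dvd_trans dvd_triv_left)
    hence good: "good_triple p q r" using type_trace_of_unit[OF vals _ bound] vals by (simp add: good_triple_def)
    \<comment> \<open>The sign \<open>k\<close> is absorbed into the fourth root, whose reflection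
      does not change.\<close>
    define rs' where "rs' = rs[3 := k \<cdot>\<^sub>v rs ! 3]"
    have k3: "k \<cdot>\<^sub>v rs ! 3 = rs ! 3 \<or> k \<cdot>\<^sub>v rs ! 3 = - rs ! 3" using k(1) root(1)[of 3] by auto
    have r3: "is_root (k \<cdot>\<^sub>v rs ! 3)"
      using root[of 3] kk by (simp add: is_root_def form_linear mult.assoc[symmetric])
    have "map crefl rs' = (map crefl rs)[3 := crefl (k \<cdot>\<^sub>v rs ! 3)]" by (simp add: rs'_def map_update)
    also have "crefl (k \<cdot>\<^sub>v rs ! 3) = map crefl rs ! 3" using k3 crefl_uminus root(1)[of 3] rs(1) by auto
    finally have As': "map crefl rs' = map crefl rs" by simp
    have set': "\<forall>a\<in>set rs'. is_root a"
      using r3 rs(2) set_update_subset_insert[of rs 3 "k \<cdot>\<^sub>v rs ! 3"]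
      by (auto simp: rs'_def generating_roots_def)
    have "generating_roots rs'"
      using set' rs(2) arg_cong[OF As', of set] by (simp add: generating_roots_def)
    moreover have "normal_roots rs' p q r"
      using set' rs(1) root k kk unfolding normal_roots_def rs'_def
      by (simp add: form_linear G[symmetric, unfolded One_nat_def] mult.assoc[symmetric])
    ultimately show thesis using that good eig type As' rs(3) by metis
  qed
qed

section \<open>Rank 2 middle convolutions\<close>

definition refl2 :: "complex vec \<Rightarrow> complex vec \<Rightarrow> complex mat" where
  "refl2 y x = mat 2 2 (\<lambda>(i, j). (if i = j then 1 else 0) - y $ i * x $ j)"

lemma refl2_carrier [simp]: "refl2 y x \<in> carrier_mat 2 2"
  by (simp add: refl2_def)

lemma less_2_cases': "i < 2 \<longleftrightarrow> i = 0 \<or> i = (1::nat)"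
  by auto

lemma sum_2: "(\<Sum>i = 0..<2::nat. f i) = f 0 + (f 1 :: 'a::comm_monoid_add)"
  by (simp add: numeral_eq_Suc)

lemma vec2_eqI:
  assumes "v \<in> carrier_vec 2" "w \<in> carrier_vec 2" "v $ 0 = w $ 0" "v $ 1 = w $ 1"
  shows "v = w"
  using assms by (intro eq_vecI) (auto simp: less_2_cases')

lemma scalar_prod_2: "y \<in> carrier_vec 2 \<Longrightarrow> x \<bullet> y = x $ 0 * y $ 0 + x $ 1 * y $ 1"
  by (simp add: scalar_prod_def sum_2)

lemma refl2_apply:
  assumes "w \<in> carrier_vec 2" "y \<in> carrier_vec 2"
  shows "refl2 y x *\<^sub>v w = w - (x \<bullet> w) \<cdot>\<^sub>v y"
proof (rule eq_vecI)
  fix i assume "i < dim_vec (w - (x \<bullet> w) \<cdot>\<^sub>v y)"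
  hence i: "i < 2" using assms by simp
  have "(refl2 y x *\<^sub>v w) $ i = (\<Sum>j = 0..<2. ((if i = j then 1 else 0) - y $ i * x $ j) * w $ j)"
    using i assms by (simp add: refl2_def scalar_prod_def)
  thus "(refl2 y x *\<^sub>v w) $ i = (w - (x \<bullet> w) \<cdot>\<^sub>v y) $ i"
    using i assms by (auto simp: less_2_cases' sum_2 scalar_prod_2 algebra_simps)
qed (use assms in \<open>simp add: refl2_def\<close>)

lemma vec_diff_zero:
  fixes v w :: "'a::ab_group_add vec"
  assumes "v \<in> carrier_vec n" "w \<in> carrier_vec n" "v - w = 0\<^sub>v n"
  shows "v = w"
proof (rule eq_vecI)
  fix i assume i: "i < dim_vec w"
  have "v $ i - w $ i = (v - w) $ i" using i assms(1,2) by simp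
  also have "\<dots> = 0" using i assms(2) unfolding assms(3) by simp
  finally show "v $ i = w $ i" by simp
qed (use assms in simp)

definition seifert :: "complex \<Rightarrow> (nat \<Rightarrow> nat \<Rightarrow> complex) \<Rightarrow> nat \<Rightarrow> nat \<Rightarrow> complex" where
  "seifert l G j k = (if k < j then l * G j k else if k = j then 1 + l else G j k)"

text \<open>A rank 2 factorization of the Seifert matrix; the middle convolution consists of the complex
  reflections \<open>1 - y\<^sub>k x\<^sub>k\<close>.\<close>

definition seifert_data ::
  "complex \<Rightarrow> (nat \<Rightarrow> nat \<Rightarrow> complex) \<Rightarrow> (nat \<Rightarrow> complex vec) \<Rightarrow> (nat \<Rightarrow> complex vec) \<Rightarrow> bool" where
  "seifert_data l G x y \<longleftrightarrow>
     (\<forall>k<4. x k \<in> carrier_vec 2 \<and> y k \<in> carrier_vec 2) \<and>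
     (\<forall>j<4. \<forall>k<4. x j \<bullet> y k = seifert l G j k) \<and>
     (1 + l) * (1 + l) - l * G 0 1 * G 0 1 \<noteq> 0 \<and> (\<forall>j k. G j k = G k j)"

definition data_mats :: "(nat \<Rightarrow> complex vec) \<Rightarrow> (nat \<Rightarrow> complex vec) \<Rightarrow> complex mat list" where
  "data_mats x y = map (\<lambda>k. refl2 (y k) (x k)) [0..<4]"

text \<open>The leading 2 x 2 block of products is the matrix of \<open>x 0, x 1\<close> times that
  of \<open>y 0, y 1\<close>. Its determinant is the nonzero quantity in
  \<open>seifert_data\<close>, so both pairs are bases.\<close>

lemma seifert_data_independent:
  assumes "seifert_data l G x y"
  shows "w \<in> carrier_vec 2 \<Longrightarrow> x 0 \<bullet> w = 0 \<Longrightarrow> x 1 \<bullet> w = 0 \<Longrightarrow> w = 0\<^sub>v 2"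
    and "w \<in> carrier_vec 2 \<Longrightarrow> \<exists>c d. w = c \<cdot>\<^sub>v y 0 + d \<cdot>\<^sub>v y 1"
proof -
  have C: "x 0 \<in> carrier_vec 2" "x 1 \<in> carrier_vec 2" "y 0 \<in> carrier_vec 2" "y 1 \<in> carrier_vec 2"
    using assms by (auto simp: seifert_data_def)
  have "x 0 \<bullet> y 0 = 1 + l" "x 0 \<bullet> y 1 = G 0 1" "x 1 \<bullet> y 0 = l * G 0 1" "x 1 \<bullet> y 1 = 1 + l"
    using assms by (auto simp: seifert_data_def seifert_def)
  hence e: "x 0 $ 0 * y 0 $ 0 + x 0 $ 1 * y 0 $ 1 = 1 + l" "x 0 $ 0 * y 1 $ 0 + x 0 $ 1 * y 1 $ 1 = G 0 1"
    "x 1 $ 0 * y 0 $ 0 + x 1 $ 1 * y 0 $ 1 = l * G 0 1" "x 1 $ 0 * y 1 $ 0 + x 1 $ 1 * y 1 $ 1 = 1 + l"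
    using C by (simp_all add: scalar_prod_2)
  define dx dy where "dx = x 0 $ 0 * x 1 $ 1 - x 0 $ 1 * x 1 $ 0" and "dy = y 0 $ 0 * y 1 $ 1 - y 0 $ 1 * y 1 $ 0"
  have "dx * dy = (x 0 $ 0 * y 0 $ 0 + x 0 $ 1 * y 0 $ 1) * (x 1 $ 0 * y 1 $ 0 + x 1 $ 1 * y 1 $ 1)
     - (x 1 $ 0 * y 0 $ 0 + x 1 $ 1 * y 0 $ 1) * (x 0 $ 0 * y 1 $ 0 + x 0 $ 1 * y 1 $ 1)"
    by (simp add: dx_def dy_def algebra_simps)
  also have "\<dots> \<noteq> 0" using assms unfolding e by (simp add: seifert_data_def)
  finally have nz: "dx \<noteq> 0" "dy \<noteq> 0" by auto
  show "w = 0\<^sub>v 2" if w: "w \<in> carrier_vec 2" "x 0 \<bullet> w = 0" "x 1 \<bullet> w = 0"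
  proof -
    have "dx * w $ 0 = x 1 $ 1 * (x 0 \<bullet> w) - x 0 $ 1 * (x 1 \<bullet> w)"
      "dx * w $ 1 = x 0 $ 0 * (x 1 \<bullet> w) - x 1 $ 0 * (x 0 \<bullet> w)"
      using w(1) by (simp_all add: scalar_prod_2 dx_def algebra_simps)
    hence "w $ 0 = 0" "w $ 1 = 0" using w nz by simp_all
    thus ?thesis using w(1) by (intro vec2_eqI) auto
  qed
  show "\<exists>c d. w = c \<cdot>\<^sub>v y 0 + d \<cdot>\<^sub>v y 1" if w: "w \<in> carrier_vec 2"
  proof (intro exI)
    show "w = ((w $ 0 * y 1 $ 1 - w $ 1 * y 1 $ 0) / dy) \<cdot>\<^sub>v y 0 + ((w $ 1 * y 0 $ 0 - w $ 0 * y 0 $ 1) / dy) \<cdot>\<^sub>v y 1"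
      using w C nz(2) by (intro vec2_eqI) (simp_all add: field_simps, simp_all add: dy_def algebra_simps)
  qed
qed

text \<open>Since each reflection differs from 1 by rank one, the quotient of V^4 by K is C^4 with
  the coordinates \<open>phi v k\<close>. In these, L becomes the kernel of the Seifert matrix. The
  surjection \<open>P\<close> sends \<open>v\<close> to the sum of the \<open>phi v j\<close> times
  \<open>y j\<close>.\<close>

locale convolution =
  fixes rs :: "gint vec list" and l :: complex and x y :: "nat \<Rightarrow> complex vec"
  assumes len: "length rs = 4" and roots: "\<forall>a\<in>set rs. is_root a" and l1: "l \<noteq> 1"
    and data: "seifert_data l (\<lambda>i j. evc (gram rs i j)) x y"
begin

definition a :: "nat \<Rightarrow> complex vec" where "a k = map_vec evc (rs ! k)"
definition As :: "complex mat list" where "As = map crefl rs"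
definition blk :: "complex vec \<Rightarrow> nat \<Rightarrow> complex vec" where "blk v k = vec 4 (\<lambda>i. v $ (k * 4 + i))"
definition phi :: "complex vec \<Rightarrow> nat \<Rightarrow> complex" where "phi v k = form cgolden (a k) (blk v k)"
definition P :: "complex mat" where
  "P = mat 2 16 (\<lambda>(i, c). y (c div 4) $ i * coroot cgolden (a (c div 4)) $ (c mod 4))"

lemma a_carrier: "k < 4 \<Longrightarrow> a k \<in> carrier_vec 4"
  using roots len by (auto simp: a_def is_root_def)

lemma blk_carrier [simp]: "blk v k \<in> carrier_vec 4"
  by (simp add: blk_def)

lemma dim_blk [simp]: "dim_vec (blk v k) = 4"
  by (simp add: blk_def)

lemma gram_a: "j < 4 \<Longrightarrow> k < 4 \<Longrightarrow> form cgolden (a j) (a k) = evc (gram rs j k)"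
  using roots len by (auto simp: a_def is_root_def evc.form_hom)

lemma norm_a: "k < 4 \<Longrightarrow> form cgolden (a k) (a k) = 2"
  using roots len gram_a[of k k] by (auto simp: is_root_def)

lemma len_As: "length As = 4"
  by (simp add: As_def len)

lemma As_nth: "k < 4 \<Longrightarrow> As ! k = refl cgolden (a k)"
  using roots len by (simp add: As_def a_def crefl_eq_refl)

lemma xy: "k < 4 \<Longrightarrow> x k \<in> carrier_vec 2" "k < 4 \<Longrightarrow> y k \<in> carrier_vec 2"
  using data by (auto simp: seifert_data_def)

lemma sum_blocks: "(\<Sum>c = 0..<16. f c) = (\<Sum>j = 0..<4. \<Sum>b = 0..<4. f (j * 4 + b :: nat) :: complex)"
  by (simp add: numeral_eq_Suc)

lemma div_mod_block: "b < 4 \<Longrightarrow> (j * 4 + b) div 4 = j" "b < 4 \<Longrightarrow> (j * 4 + b) mod 4 = (b::nat)"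
  by simp_all

lemma P_carrier [simp]: "P \<in> carrier_mat 2 16"
  by (simp add: P_def)

lemma P_apply:
  assumes "v \<in> carrier_vec 16" "i < 2"
  shows "(P *\<^sub>v v) $ i = (\<Sum>j = 0..<4. phi v j * y j $ i)"
proof -
  have "(P *\<^sub>v v) $ i = (\<Sum>c = 0..<16. y (c div 4) $ i * coroot cgolden (a (c div 4)) $ (c mod 4) * v $ c)"
    using assms by (simp add: P_def scalar_prod_def)
  also have "\<dots> = (\<Sum>j = 0..<4. \<Sum>b = 0..<4. y j $ i * coroot cgolden (a j) $ b * v $ (j * 4 + b))"
    unfolding sum_blocks by (intro sum.cong) (simp_all add: div_mod_block)
  also have "\<dots> = (\<Sum>j = 0..<4. phi v j * y j $ i)"
    by (intro sum.cong refl)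
      (simp add: phi_def form_coroot scalar_prod_def blk_def sum_distrib_left sum_distrib_right ac_simps)
  finally show ?thesis .
qed

lemma dot_P:
  assumes v: "v \<in> carrier_vec 16" and k: "k < 4"
  shows "x k \<bullet> (P *\<^sub>v v) = (\<Sum>j = 0..<4. seifert l (\<lambda>i j. evc (gram rs i j)) k j * phi v j)"
proof -
  have Pv: "P *\<^sub>v v \<in> carrier_vec 2" using v by (auto intro: carrier_vecI simp: P_def)
  have "x k \<bullet> (P *\<^sub>v v) = (\<Sum>j = 0..<4. (x k $ 0 * y j $ 0 + x k $ 1 * y j $ 1) * phi v j)"
    using P_apply[OF v, of 0] P_apply[OF v, of 1] unfolding scalar_prod_2[OF Pv]
    by (simp add: sum_distrib_left sum.distrib algebra_simps)
  also have "\<dots> = (\<Sum>j = 0..<4. (x k \<bullet> y j) * phi v j)"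
    by (intro sum.cong) (simp_all add: scalar_prod_2 xy)
  also have "\<dots> = (\<Sum>j = 0..<4. seifert l (\<lambda>i j. evc (gram rs i j)) k j * phi v j)"
    using data k by (intro sum.cong) (auto simp: seifert_data_def)
  finally show ?thesis .
qed

lemma block_carrier [simp]: "MC_block 4 l As k \<in> carrier_mat 16 16"
  by (simp add: MC_block_def len_As)

lemma block_apply:
  assumes v: "v \<in> carrier_vec 16" and k: "k < 4" and i: "i < 4" and e: "e < 4"
  shows "(MC_block 4 l As k *\<^sub>v v) $ (i * 4 + e) = (if i \<noteq> k then v $ (i * 4 + e)
    else l * v $ (k * 4 + e) - (\<Sum>j = 0..<4. (if j \<le> k then l else 1) * phi v j * a j $ e))"
proof -
  have r: "i * 4 + e < 16" using i e by simp
  have entry: "MC_block 4 l As k $$ (i * 4 + e, j * 4 + b) =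
      (if i \<noteq> k then (if i = j \<and> e = b then 1 else 0)
       else (if j = k \<and> e = b then l else 0) - (if j \<le> k then l else 1) * (a j $ e * coroot cgolden (a j) $ b))"
    if "j < 4" "b < 4" for j b
  proof -
    have "j * 4 + b < 16" using that by simp
    thus ?thesis using that r e k
      by (auto simp: MC_block_def len_As div_mod_block As_nth refl_def Let_def algebra_simps)
  qed
  have "(MC_block 4 l As k *\<^sub>v v) $ (i * 4 + e) =
      (\<Sum>c = 0..<16. MC_block 4 l As k $$ (i * 4 + e, c) * v $ c)"
    using r v by (simp add: scalar_prod_def MC_block_def len_As)
  also have "\<dots> = (\<Sum>j = 0..<4. \<Sum>b = 0..<4. MC_block 4 l As k $$ (i * 4 + e, j * 4 + b) * v $ (j * 4 + b))"
    by (rule sum_blocks)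
  also have "\<dots> = (if i \<noteq> k then v $ (i * 4 + e)
    else l * v $ (k * 4 + e) - (\<Sum>j = 0..<4. (if j \<le> k then l else 1) * phi v j * a j $ e))"
  proof (cases "i = k")
    case False
    have "(\<Sum>j = 0..<4. \<Sum>b = 0..<4. MC_block 4 l As k $$ (i * 4 + e, j * 4 + b) * v $ (j * 4 + b))
      = (\<Sum>j = 0..<4. if i = j then v $ (i * 4 + e) else 0)"
      by (intro sum.cong refl) (use False e in \<open>auto simp: entry if_distrib[of "\<lambda>c. c * _"] cong: if_cong\<close>)
    thus ?thesis using False i by simp
  next
    case True
    have "(\<Sum>b = 0..<4. MC_block 4 l As k $$ (i * 4 + e, j * 4 + b) * v $ (j * 4 + b))
      = (if j = k then l * v $ (k * 4 + e) else 0) - (if j \<le> k then l else 1) * phi v j * a j $ e"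
      if j: "j < 4" for j
    proof -
      have "(\<Sum>b = 0..<4. MC_block 4 l As k $$ (i * 4 + e, j * 4 + b) * v $ (j * 4 + b))
        = (\<Sum>b = 0..<4. (if e = b then (if j = k then l * v $ (j * 4 + e) else 0) else 0)
           - (if j \<le> k then l else 1) * a j $ e * (coroot cgolden (a j) $ b * v $ (j * 4 + b)))"
        by (intro sum.cong refl, subst entry) (use True j in \<open>auto simp: algebra_simps\<close>)
      also have "\<dots> = (if j = k then l * v $ (j * 4 + e) else 0)
           - (if j \<le> k then l else 1) * a j $ e * (\<Sum>b = 0..<4. coroot cgolden (a j) $ b * v $ (j * 4 + b))"
        using e by (simp add: sum_subtractf sum_distrib_left)
      also have "(\<Sum>b = 0..<4. coroot cgolden (a j) $ b * v $ (j * 4 + b)) = phi v j"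
        by (simp add: phi_def form_coroot scalar_prod_def blk_def)
      finally show ?thesis by (simp add: ac_simps)
    qed
    hence "(\<Sum>j = 0..<4. \<Sum>b = 0..<4. MC_block 4 l As k $$ (i * 4 + e, j * 4 + b) * v $ (j * 4 + b))
      = (\<Sum>j = 0..<4. (if j = k then l * v $ (k * 4 + e) else 0) - (if j \<le> k then l else 1) * phi v j * a j $ e)"
      by (intro sum.cong) auto
    thus ?thesis using True k by (simp add: sum_subtractf)
  qed
  finally show ?thesis .
qed

lemma form_sum_roots:
  assumes "v \<in> carrier_vec 4" "\<And>e. e < 4 \<Longrightarrow> v $ e = (\<Sum>j = 0..<4. c j * a j $ e)" "k < 4"
  shows "form cgolden (a k) v = (\<Sum>j = 0..<4. c j * evc (gram rs k j))"
proof -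
  have "form cgolden (a k) v = (\<Sum>j<4. form cgolden (a k) (map a [0..<4] ! j) * c j)"
    by (rule form_sum) (use assms(2) in \<open>auto simp: atLeast0LessThan intro!: sum.cong\<close>)
  also have "\<dots> = (\<Sum>j = 0..<4. c j * evc (gram rs k j))"
    using assms(3) by (auto simp: atLeast0LessThan gram_a intro!: sum.cong)
  finally show ?thesis .
qed

text \<open>Paired with \<open>a k\<close>, the block row becomes row \<open>k\<close> of the
  Seifert matrix, except for the diagonal: there it has \<open>2 l\<close> instead of
  \<open>1 + l\<close>, and the excess \<open>l - 1\<close> reduces the summand
  \<open>l * phi v k\<close> to \<open>phi v k\<close>.\<close>

lemma phi_block:
  assumes v: "v \<in> carrier_vec 16" and k: "k < 4" and i: "i < 4"
  shows "phi (MC_block 4 l As k *\<^sub>v v) i = (if i = k then phi v k - x k \<bullet> (P *\<^sub>v v) else phi v i)"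
proof (cases "i = k")
  case False
  have "blk (MC_block 4 l As k *\<^sub>v v) i = blk v i"
    by (rule eq_vecI) (use False block_apply[OF v k i] in \<open>auto simp: blk_def\<close>)
  thus ?thesis using False by (simp add: phi_def)
next
  case True
  define w where "w = l \<cdot>\<^sub>v blk v k - blk (MC_block 4 l As k *\<^sub>v v) k"
  have w: "w \<in> carrier_vec 4" by (auto simp: w_def blk_def)
  have "w $ e = (\<Sum>j = 0..<4. ((if j \<le> k then l else 1) * phi v j) * a j $ e)" if "e < 4" for e
    using that block_apply[OF v k k that] by (simp add: w_def blk_def)
  from form_sum_roots[OF w this k]
  have "form cgolden (a k) w = (\<Sum>j = 0..<4. ((if j \<le> k then l else 1) * phi v j) * evc (gram rs k j))" .
  moreover have "form cgolden (a k) w = l * phi v k - phi (MC_block 4 l As k *\<^sub>v v) k"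
    by (simp add: w_def phi_def form_linear)
  ultimately have 1: "phi (MC_block 4 l As k *\<^sub>v v) k
     = l * phi v k - (\<Sum>j = 0..<4. ((if j \<le> k then l else 1) * phi v j) * evc (gram rs k j))" by (simp add: algebra_simps)
  have g: "evc (gram rs k k) = 2" using gram_a[OF k k] norm_a[OF k] by simp
  have "(\<Sum>j = 0..<4. ((if j \<le> k then l else 1) * phi v j) * evc (gram rs k j))
     = (\<Sum>j = 0..<4. seifert l (\<lambda>i j. evc (gram rs i j)) k j * phi v j + (if j = k then (l - 1) * phi v k else 0))"
    by (intro sum.cong) (auto simp: seifert_def g algebra_simps)
  also have "\<dots> = x k \<bullet> (P *\<^sub>v v) + (l - 1) * phi v k"
    using k by (simp add: sum.distrib dot_P[OF v k])
  finally have 2: "(\<Sum>j = 0..<4. ((if j \<le> k then l else 1) * phi v j) * evc (gram rs k j))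
     = x k \<bullet> (P *\<^sub>v v) + (l - 1) * phi v k" .
  show ?thesis unfolding True 1 2 by (simp add: algebra_simps)
qed

lemma P_block:
  assumes k: "k < 4"
  shows "P * MC_block 4 l As k = refl2 (y k) (x k) * P"
proof (rule mat_eq_by_vec[of _ 2 16])
  fix v :: "complex vec" assume v: "v \<in> carrier_vec 16"
  have Bv: "MC_block 4 l As k *\<^sub>v v \<in> carrier_vec 16" using v by (auto intro: carrier_vecI simp: MC_block_def len_As)
  have Pv: "P *\<^sub>v v \<in> carrier_vec 2" using v by (auto intro: carrier_vecI simp: P_def)
  have "P *\<^sub>v (MC_block 4 l As k *\<^sub>v v) = P *\<^sub>v v - (x k \<bullet> (P *\<^sub>v v)) \<cdot>\<^sub>v y k"
  proof (rule eq_vecI)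
    fix i assume "i < dim_vec (P *\<^sub>v v - (x k \<bullet> (P *\<^sub>v v)) \<cdot>\<^sub>v y k)"
    hence i: "i < 2" using xy(2)[OF k] by simp
    have "(P *\<^sub>v (MC_block 4 l As k *\<^sub>v v)) $ i
      = (\<Sum>j = 0..<4. phi v j * y j $ i - (if j = k then (x k \<bullet> (P *\<^sub>v v)) * y k $ i else 0))"
      unfolding P_apply[OF Bv i] using k by (intro sum.cong) (auto simp: phi_block[OF v k] algebra_simps)
    also have "\<dots> = (P *\<^sub>v v) $ i - (x k \<bullet> (P *\<^sub>v v)) * y k $ i"
      using k by (simp add: sum_subtractf P_apply[OF v i])
    finally show "(P *\<^sub>v (MC_block 4 l As k *\<^sub>v v)) $ i = (P *\<^sub>v v - (x k \<bullet> (P *\<^sub>v v)) \<cdot>\<^sub>v y k) $ i"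
      using i xy(2)[OF k] Pv by simp
  qed (use xy(2)[OF k] in \<open>simp add: P_def\<close>)
  also have "\<dots> = refl2 (y k) (x k) *\<^sub>v (P *\<^sub>v v)" using Pv xy(2)[OF k] by (simp add: refl2_apply)
  finally show "P * MC_block 4 l As k *\<^sub>v v = refl2 (y k) (x k) * P *\<^sub>v v"
    using v by (simp add: assoc_mult_mat_vec[of _ 2 16 _ 16] assoc_mult_mat_vec[of _ 2 2 _ 16])
qed (auto intro: mult_carrier_mat[of _ 2 16 _ 16] mult_carrier_mat[of _ 2 2 _ 16])

definition lift :: "(nat \<Rightarrow> complex vec) \<Rightarrow> complex vec" where
  "lift f = vec 16 (\<lambda>c. f (c div 4) $ (c mod 4))"

lemma lift_carrier [simp]: "lift f \<in> carrier_vec 16"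
  by (simp add: lift_def)

lemma blk_lift: "k < 4 \<Longrightarrow> f k \<in> carrier_vec 4 \<Longrightarrow> blk (lift f) k = f k"
  by (rule eq_vecI) (auto simp: blk_def lift_def)

lemma lift_index: "k < 4 \<Longrightarrow> e < 4 \<Longrightarrow> lift f $ (k * 4 + e) = f k $ e"
  by (simp add: lift_def)

lemma P_surj: "(\<lambda>v. P *\<^sub>v v) ` carrier_vec 16 = carrier_vec 2"
proof
  show "(\<lambda>v. P *\<^sub>v v) ` carrier_vec 16 \<subseteq> carrier_vec 2" by (auto intro: carrier_vecI simp: P_def)
  show "carrier_vec 2 \<subseteq> (\<lambda>v. P *\<^sub>v v) ` carrier_vec 16"
  proof
    fix w :: "complex vec" assume w: "w \<in> carrier_vec 2"
    then obtain c d where cd: "w = c \<cdot>\<^sub>v y 0 + d \<cdot>\<^sub>v y 1" using seifert_data_independent(2)[OF data] by blast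
    \<comment> \<open>The halves compensate for the norm 2 of the roots.\<close>
    define f where "f k = (if k = 0 then (c / 2) \<cdot>\<^sub>v a 0 else if k = 1 then (d / 2) \<cdot>\<^sub>v a 1 else 0\<^sub>v 4)" for k :: nat
    have f: "f k \<in> carrier_vec 4" for k using a_carrier by (auto simp: f_def)
    have phi: "phi (lift f) k = (if k = 0 then c else if k = 1 then d else 0)" if k: "k < 4" for k
    proof -
      have "phi (lift f) k = form cgolden (a k) (f k)" unfolding phi_def blk_lift[OF k f] ..
      also have "\<dots> = (if k = 0 then c else if k = 1 then d else 0)"
        using a_carrier[of 0] a_carrier[of 1] norm_a[of 0] norm_a[of 1]
        by (auto simp: f_def form_linear) (simp add: form_def)
      finally show ?thesis .
    qed
    have "P *\<^sub>v lift f = w"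
    proof (rule eq_vecI)
      fix i assume "i < dim_vec w"
      hence i: "i < 2" using w by simp
      have "(P *\<^sub>v lift f) $ i = c * y 0 $ i + d * y 1 $ i"
        unfolding P_apply[OF lift_carrier i] by (simp add: sum_4 phi)
      thus "(P *\<^sub>v lift f) $ i = w $ i" using i xy(2)[of 0] xy(2)[of 1] unfolding cd by simp
    qed (use w in \<open>simp add: P_def\<close>)
    thus "w \<in> (\<lambda>v. P *\<^sub>v v) ` carrier_vec 16" by (metis image_eqI lift_carrier)
  qed
qed

lemma block_index: "c < 16 \<Longrightarrow> \<exists>k<4. \<exists>e<4. c = k * 4 + (e::nat)"
  by (intro exI[of _ "c div 4"] conjI exI[of _ "c mod 4"]) auto

text \<open>For \<open>P w = 0\<close>, the fixed point equations of the blocks with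
  \<open>phi w\<close> as prescribed coordinates are solved for \<open>v\<close> by dividing by
  \<open>l - 1\<close>. The vanishing of \<open>P w\<close> ensures that \<open>v\<close> has these
  coordinates, so \<open>w - v\<close> lies in K.\<close>

lemma P_kernel: "mat_kernel P = {u + v | u v. u \<in> MC_K 4 As \<and> v \<in> MC_L 4 l As}"
proof -
  have root_nz: "\<exists>e<4. a k $ e \<noteq> 0" if k: "k < 4" for k
  proof (rule ccontr)
    assume "\<not> (\<exists>e<4. a k $ e \<noteq> 0)"
    hence "form cgolden (a k) (a k) = 0" by (simp add: form_def)
    thus False using norm_a[OF k] by simp
  qed
  have dims: "length As * 4 = 16" by (simp add: len_As)
  have K: "u \<in> MC_K 4 As \<longleftrightarrow> u \<in> carrier_vec 16 \<and> (\<forall>k<4. phi u k = 0)" for u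
  proof -
    have "vec 4 (\<lambda>i. u $ (k * 4 + i)) \<in> mat_kernel (As ! k - 1\<^sub>m 4) \<longleftrightarrow> phi u k = 0" if k: "k < 4" for k
    proof -
      have "(As ! k - 1\<^sub>m 4) *\<^sub>v blk u k = - (phi u k \<cdot>\<^sub>v a k)"
        unfolding As_nth[OF k]
        by (subst minus_mult_distrib_mat_vec[of _ 4 4])
          (use a_carrier[OF k] in \<open>auto simp: refl_apply phi_def intro!: eq_vecI\<close>)
      also have "\<dots> = 0\<^sub>v 4 \<longleftrightarrow> phi u k = 0"
      proof
        assume h: "- (phi u k \<cdot>\<^sub>v a k) = 0\<^sub>v 4"
        obtain e where e: "e < 4" "a k $ e \<noteq> 0" using root_nz[OF k] by blast
        have "(- (phi u k \<cdot>\<^sub>v a k)) $ e = 0" using h e by simp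
        thus "phi u k = 0" using e a_carrier[OF k] by simp
      qed (use a_carrier[OF k] in \<open>auto intro!: eq_vecI\<close>)
      finally show ?thesis unfolding blk_def[symmetric]
        by (subst mat_kernel[of _ 4 4]) (auto simp: As_nth[OF k] intro: minus_carrier_mat)
    qed
    thus ?thesis by (auto simp: MC_K_def dims len_As)
  qed
  have L: "v \<in> MC_L 4 l As \<longleftrightarrow> v \<in> carrier_vec 16 \<and> (\<forall>k<4. MC_block 4 l As k *\<^sub>v v = v)" for v
  proof -
    have "v \<in> mat_kernel (MC_block 4 l As k - 1\<^sub>m 16) \<longleftrightarrow> MC_block 4 l As k *\<^sub>v v = v"
      if v: "v \<in> carrier_vec 16" for k
    proof -
      have "(MC_block 4 l As k - 1\<^sub>m 16) *\<^sub>v v = MC_block 4 l As k *\<^sub>v v - v"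
        using v by (subst minus_mult_distrib_mat_vec[of _ 16 16]) auto
      moreover have "MC_block 4 l As k *\<^sub>v v - v = 0\<^sub>v 16 \<longleftrightarrow> MC_block 4 l As k *\<^sub>v v = v"
      proof
        assume h: "MC_block 4 l As k *\<^sub>v v - v = 0\<^sub>v 16"
        show "MC_block 4 l As k *\<^sub>v v = v"
          by (rule vec_diff_zero[OF _ v h]) (auto intro: carrier_vecI simp: MC_block_def len_As)
      qed (use v in auto)
      ultimately show ?thesis using v by (subst mat_kernel[of _ 16 16]) (auto intro: minus_carrier_mat)
    qed
    thus ?thesis unfolding MC_L_def dims len_As by auto
  qed
  show ?thesis
  proof (intro equalityI subsetI)
    fix w assume "w \<in> {u + v | u v. u \<in> MC_K 4 As \<and> v \<in> MC_L 4 l As}"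
    then obtain u v where uv: "w = u + v" "u \<in> carrier_vec 16" "v \<in> carrier_vec 16" "\<forall>k<4. phi u k = 0"
      "\<forall>k<4. MC_block 4 l As k *\<^sub>v v = v" using K L by auto
    have Pv: "P *\<^sub>v v \<in> carrier_vec 2" using uv by (auto intro: carrier_vecI simp: P_def)
    have "x k \<bullet> (P *\<^sub>v v) = 0" if k: "k < 4" for k
      using phi_block[OF uv(3) k k] uv(5) k by simp
    hence "P *\<^sub>v v = 0\<^sub>v 2" using seifert_data_independent(1)[OF data Pv] by simp
    moreover have "P *\<^sub>v u = 0\<^sub>v 2"
    proof (rule eq_vecI)
      fix i assume "i < dim_vec (0\<^sub>v 2 :: complex vec)"
      hence "i < 2" by simp
      from P_apply[OF uv(2) this] \<open>i < 2\<close> show "(P *\<^sub>v u) $ i = 0\<^sub>v 2 $ i" using uv(4) by simp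
    qed (simp add: P_def)
    ultimately have "P *\<^sub>v w = 0\<^sub>v 2" using uv by (simp add: mult_add_distrib_mat_vec[of _ 2 16])
    thus "w \<in> mat_kernel P" using uv by (subst mat_kernel[of _ 2 16]) auto
  next
    fix w assume "w \<in> mat_kernel P"
    hence w: "w \<in> carrier_vec 16" "P *\<^sub>v w = 0\<^sub>v 2" by (auto simp: mat_kernel[of _ 2 16])
    define f where "f k = vec 4 (\<lambda>e. (\<Sum>j = 0..<4. (if j \<le> k then l else 1) * phi w j * a j $ e) / (l - 1))" for k
    have f: "f k \<in> carrier_vec 4" for k by (simp add: f_def)
    define v where "v = lift f"
    have v: "v \<in> carrier_vec 16" by (simp add: v_def)
    have phi: "phi v k = phi w k" if k: "k < 4" for k
    proof -
      have "form cgolden (a k) (f k) = (\<Sum>j = 0..<4. ((if j \<le> k then l else 1) * phi w j / (l - 1)) * evc (gram rs k j))"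
        by (rule form_sum_roots[OF f _ k]) (simp add: f_def sum_divide_distrib)
      hence "(l - 1) * phi v k = (\<Sum>j = 0..<4. (if j \<le> k then l else 1) * phi w j * evc (gram rs k j))"
        using l1 by (simp add: phi_def v_def blk_lift[OF k f] sum_distrib_left)
      also have "\<dots> = (\<Sum>j = 0..<4. seifert l (\<lambda>i j. evc (gram rs i j)) k j * phi w j + (if j = k then (l - 1) * phi w k else 0))"
      proof -
        have "evc (gram rs k k) = 2" using gram_a[OF k k] norm_a[OF k] by simp
        thus ?thesis by (intro sum.cong) (auto simp: seifert_def algebra_simps)
      qed
      also have "\<dots> = x k \<bullet> (P *\<^sub>v w) + (l - 1) * phi w k"
        using k by (simp add: sum.distrib dot_P[OF w(1) k])
      also have "x k \<bullet> (P *\<^sub>v w) = 0" unfolding w(2) using xy(1)[OF k] by simp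
      finally show ?thesis using l1 by simp
    qed
    have fix_v: "MC_block 4 l As k *\<^sub>v v = v" if k: "k < 4" for k
    proof (rule eq_vecI)
      fix c assume "c < dim_vec v"
      hence "c < 16" using v by simp
      then obtain i e where ie: "i < 4" "e < 4" "c = i * 4 + e" using block_index by blast
      have "l * v $ (k * 4 + e) - (\<Sum>j = 0..<4. (if j \<le> k then l else 1) * phi v j * a j $ e) = v $ (k * 4 + e)"
      proof -
        have "(l - 1) * v $ (k * 4 + e) = (\<Sum>j = 0..<4. (if j \<le> k then l else 1) * phi w j * a j $ e)"
          using l1 ie k by (simp add: v_def lift_index f_def)
        also have "\<dots> = (\<Sum>j = 0..<4. (if j \<le> k then l else 1) * phi v j * a j $ e)"
          by (intro sum.cong) (auto simp: phi)
        finally show ?thesis by (simp add: algebra_simps)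
      qed
      thus "(MC_block 4 l As k *\<^sub>v v) $ c = v $ c"
        unfolding ie(3) block_apply[OF v k ie(1,2)] by auto
    qed (use v in \<open>simp add: MC_block_def len_As\<close>)
    have "w - v \<in> MC_K 4 As"
    proof -
      have "blk (w - v) k = blk w k - blk v k" if "k < 4" for k
        using that w v by (intro eq_vecI) (auto simp: blk_def)
      thus ?thesis unfolding K using w v phi by (auto simp: phi_def form_linear)
    qed
    moreover have "v \<in> MC_L 4 l As" unfolding L using v fix_v by simp
    moreover have "w = (w - v) + v" using w v by (intro eq_vecI) auto
    ultimately show "w \<in> {u + v | u v. u \<in> MC_K 4 As \<and> v \<in> MC_L 4 l As}" by blast
  qed
qed

lemma convolution_exists: "middle_convolution 4 l As 2 (data_mats x y)"
  unfolding middle_convolution_def len_As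
proof (intro conjI bexI[of _ P] allI impI)
  show "length (data_mats x y) = 4" by (simp add: data_mats_def)
  show "set (data_mats x y) \<subseteq> carrier_mat 2 2" by (auto simp: data_mats_def)
  show "mat_kernel P = {u + v | u v. u \<in> MC_K 4 As \<and> v \<in> MC_L 4 l As}" by (rule P_kernel)
  show "(\<lambda>v. P *\<^sub>v v) ` carrier_vec (4 * 4) = carrier_vec 2" using P_surj by simp
  show "P * MC_block 4 l As k = data_mats x y ! k * P" if "k < 4" for k
    using P_block[OF that] that by (simp add: data_mats_def)
qed simp

text \<open>Two surjections onto C^2 with the same kernel differ by an invertible matrix, and this
  matrix conjugates the induced maps.\<close>

lemma convolution_unique:
  assumes "middle_convolution 4 l As 2 Ms"
  shows "sim_conj (data_mats x y) Ms"
proof -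
  obtain P' where P': "P' \<in> carrier_mat 2 16" "mat_kernel P' = mat_kernel P"
    "(\<lambda>v. P' *\<^sub>v v) ` carrier_vec 16 = carrier_vec 2" "\<And>k. k < 4 \<Longrightarrow> P' * MC_block 4 l As k = Ms ! k * P'"
    and Ms: "length Ms = 4" "set Ms \<subseteq> carrier_mat 2 2"
    using assms unfolding middle_convolution_def len_As P_kernel by auto
  have inv: "\<exists>S\<in>carrier_mat 16 2. R * S = 1\<^sub>m 2"
    if R: "R \<in> carrier_mat 2 16" "(\<lambda>v. R *\<^sub>v v) ` carrier_vec 16 = carrier_vec 2" for R :: "complex mat"
  proof -
    have "\<exists>v\<in>carrier_vec 16. R *\<^sub>v v = unit_vec 2 i" for i
      using R(2) unit_vec_carrier[of 2 i] by (metis (no_types, lifting) imageE)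
    then obtain s where s: "\<And>i. s i \<in> carrier_vec 16" "\<And>i. R *\<^sub>v s i = unit_vec 2 i" by metis
    have "R * mat 16 2 (\<lambda>(c, i). s i $ c) = 1\<^sub>m 2"
    proof (rule eq_matI)
      fix i j assume "i < dim_row (1\<^sub>m 2 :: complex mat)" "j < dim_col (1\<^sub>m 2 :: complex mat)"
      hence ij: "i < 2" "j < 2" by auto
      have "col (mat 16 2 (\<lambda>(c, i). s i $ c)) j = s j" using ij s(1)[of j] by (intro eq_vecI) auto
      hence "(R * mat 16 2 (\<lambda>(c, i). s i $ c)) $$ (i, j) = (R *\<^sub>v s j) $ i" using ij R(1) by simp
      thus "(R * mat 16 2 (\<lambda>(c, i). s i $ c)) $$ (i, j) = 1\<^sub>m 2 $$ (i, j)" using ij unfolding s(2) by auto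
    qed (use R in auto)
    thus ?thesis by (intro bexI[of _ "mat 16 2 (\<lambda>(c, i). s i $ c)"]) auto
  qed
  \<comment> \<open>A map that kills the kernel of \<open>R\<close> factors through
    \<open>R\<close>, by way of a right inverse of \<open>R\<close>.\<close>
  have factor: "R' = R' * S * R"
    if R: "R \<in> carrier_mat 2 16" "R' \<in> carrier_mat 2 16" "mat_kernel R \<subseteq> mat_kernel R'"
      and S: "S \<in> carrier_mat 16 2" "R * S = 1\<^sub>m 2" for R R' S :: "complex mat"
  proof (rule mat_eq_by_vec[of _ 2 16])
    fix v :: "complex vec" assume v: "v \<in> carrier_vec 16"
    have Rv: "R *\<^sub>v v \<in> carrier_vec 2" using v R by (auto intro: carrier_vecI)
    define w where "w = v - S *\<^sub>v (R *\<^sub>v v)"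
    have SRv: "S *\<^sub>v (R *\<^sub>v v) \<in> carrier_vec 16" using S Rv by (auto intro: carrier_vecI)
    have w: "w \<in> carrier_vec 16" using v SRv by (simp add: w_def)
    have "R *\<^sub>v (S *\<^sub>v (R *\<^sub>v v)) = R *\<^sub>v v"
      using assoc_mult_mat_vec[OF R(1) S(1) Rv] S(2) Rv by simp
    hence "R *\<^sub>v w = 0\<^sub>v 2" unfolding w_def using R v SRv Rv by (simp add: mult_minus_distrib_mat_vec[of _ 2 16])
    hence "w \<in> mat_kernel R" using w R by (simp add: mat_kernel[of _ 2 16])
    hence "R' *\<^sub>v w = 0\<^sub>v 2" using R by (auto simp: mat_kernel[of _ 2 16])
    hence d: "R' *\<^sub>v v - R' *\<^sub>v (S *\<^sub>v (R *\<^sub>v v)) = 0\<^sub>v 2"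
      unfolding w_def using R v SRv by (simp add: mult_minus_distrib_mat_vec[of _ 2 16])
    have c: "R' *\<^sub>v v \<in> carrier_vec 2" "R' *\<^sub>v (S *\<^sub>v (R *\<^sub>v v)) \<in> carrier_vec 2"
      using R v SRv by (auto intro: carrier_vecI)
    have "R' *\<^sub>v v = R' *\<^sub>v (S *\<^sub>v (R *\<^sub>v v))" by (rule vec_diff_zero[OF c d])
    also have "\<dots> = R' * S * R *\<^sub>v v"
      unfolding assoc_mult_mat_vec[OF mult_carrier_mat[OF R(2) S(1)] R(1) v]
        assoc_mult_mat_vec[OF R(2) S(1) Rv] ..
    finally show "R' *\<^sub>v v = R' * S * R *\<^sub>v v" .
  qed (use R S in \<open>auto intro: mult_carrier_mat\<close>)
  obtain S where S: "S \<in> carrier_mat 16 2" "P * S = 1\<^sub>m 2" using inv[OF P_carrier P_surj] by blast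
  obtain S' where S': "S' \<in> carrier_mat 16 2" "P' * S' = 1\<^sub>m 2" using inv[OF P'(1,3)] by blast
  define g where "g = P' * S"
  define h where "h = P * S'"
  have g: "g \<in> carrier_mat 2 2" "h \<in> carrier_mat 2 2" 
    using mult_carrier_mat[OF P'(1) S(1)] mult_carrier_mat[OF P_carrier S'(1)] by (simp_all add: g_def h_def)
  have Pg: "P' = g * P" using factor[OF P_carrier P'(1) _ S] P'(2) by (simp add: g_def)
  have Ph: "P = h * P'" using factor[OF P'(1) P_carrier _ S'] P'(2) by (simp add: h_def)
  have "g * h = g * (P * S')" by (simp add: h_def)
  also have "\<dots> = P' * S'" using g S' Pg by (metis P_carrier assoc_mult_mat)
  finally have gh: "g * h = 1\<^sub>m 2" using S' by simp
  have "h * g = h * (P' * S)" by (simp add: g_def)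
  also have "\<dots> = P * S" using g S Ph P'(1) by (metis assoc_mult_mat)
  finally have hg: "h * g = 1\<^sub>m 2" using S by simp
  have gGL: "g \<in> carrier (GL 2)" using g gh hg by (auto simp: GL_carrier)
  have "Ms ! k = g * refl2 (y k) (x k) * h" if k: "k < 4" for k
  proof -
    have M: "Ms ! k \<in> carrier_mat 2 2" using Ms k by auto
    have "Ms ! k * P' = g * P * MC_block 4 l As k" using P'(4)[OF k] Pg by simp
    also have "\<dots> = g * (refl2 (y k) (x k) * P)"
      using P_block[OF k] g by (metis assoc_mult_mat P_carrier block_carrier)
    also have "\<dots> = g * refl2 (y k) (x k) * P"
      using g by (metis assoc_mult_mat P_carrier refl2_carrier)
    finally have e: "Ms ! k * P' = g * refl2 (y k) (x k) * P" .
    have "Ms ! k = Ms ! k * (P' * S')" using M S' by simp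
    also have "\<dots> = g * refl2 (y k) (x k) * P * S'"
      unfolding e[symmetric] by (rule assoc_mult_mat[OF M P'(1) S'(1), symmetric])
    also have "\<dots> = g * refl2 (y k) (x k) * h"
      unfolding h_def by (rule assoc_mult_mat[OF mult_carrier_mat[OF g(1) refl2_carrier] P_carrier S'(1)])
    finally show ?thesis .
  qed
  moreover have "inv\<^bsub>GL 2\<^esub> g = h" using GL_inv[OF g gh hg] .
  ultimately have "Ms = map (\<lambda>A. g * A * inv\<^bsub>GL 2\<^esub> g) (data_mats x y)"
    using Ms by (intro nth_equalityI) (auto simp: data_mats_def)
  thus ?thesis unfolding sim_conj_def using gGL by blast
qed

end

section \<open>Seifert data in normal form\<close>

text \<open>The Gram matrix of a nice tuple; the six entries are determined by the index sums.\<close>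

definition nform :: "complex \<Rightarrow> complex \<Rightarrow> complex \<Rightarrow> nat \<Rightarrow> nat \<Rightarrow> complex" where
  "nform p q r i j = (if i = j then 2 else if i + j = 1 \<or> i + j = 5 then p else if i + j = 2 then q
     else if i + j = 4 then p * r - q else r)"

lemma nform_sym: "nform p q r i j = nform p q r j i"
  by (auto simp: nform_def add.commute)

definition vec2 :: "'a \<Rightarrow> 'a \<Rightarrow> 'a vec" where
  "vec2 a b = vec 2 (\<lambda>i. if i = 0 then a else b)"

lemma vec2_simps [simp]: "vec2 a b $ 0 = a" "vec2 a b $ Suc 0 = b" "vec2 a b \<in> carrier_vec 2" "dim_vec (vec2 a b) = 2"
  by (simp_all add: vec2_def)

lemma sdata_carrier:
  assumes "seifert_data l G x y" "k < 4"
  shows "x k \<in> carrier_vec 2" "y k \<in> carrier_vec 2" "dim_vec (x k) = 2" "dim_vec (y k) = 2"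
  using assms by (auto simp: seifert_data_def)

lemma sdata_dot: "seifert_data l G x y \<Longrightarrow> j < 4 \<Longrightarrow> k < 4 \<Longrightarrow> x j \<bullet> y k = seifert l G j k"
  by (auto simp: seifert_data_def)

lemma seifert_data_cong:
  assumes "seifert_data l G x y" "\<And>i j. i < 4 \<Longrightarrow> j < 4 \<Longrightarrow> G i j = G' i j" "\<And>i j. G' i j = G' j i"
  shows "seifert_data l G' x y"
  using assms unfolding seifert_data_def seifert_def by (auto simp: less_4_cases)

text \<open>\<open>x k\<close> consists of the entries of row \<open>k\<close> in the first two
  columns, and \<open>y k\<close> expresses column \<open>k\<close> through these two columns by
  Cramer's rule with the leading minor \<open>d\<close>. That this works for all rows is the
  relation on \<open>l\<close>.\<close>

lemma seifert_data_exists: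
  assumes nz: "(1 + l) * (1 + l) - l * p * p \<noteq> 0"
    and rel: "(1 + l) * (1 + l) = l * (p*p + q*q + r*r - p*q*r)"
  shows "\<exists>x y. seifert_data l (nform p q r) x y"
proof -
  define d where "d = (1 + l) * (1 + l) - l * p * p"
  have d: "d \<noteq> 0" "l * (q*q + r*r - p*q*r) = d" using nz rel by (simp_all add: d_def algebra_simps)
  define s where "s = p * r - q"
  define x where "x k = (if k = 0 then vec2 (1 + l) p else if k = 1 then vec2 (l * p) (1 + l)
    else if k = 2 then vec2 (l * q) (l * r) else vec2 (l * r) (l * s))" for k :: nat
  define y where "y k = (if k = 0 then vec2 1 0 else if k = 1 then vec2 0 1
    else if k = 2 then vec2 (((1 + l) * q - p * r) / d) (((1 + l) * r - l * p * q) / d)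
    else vec2 (((1 + l) * r - p * s) / d) (((1 + l) * s - l * p * r) / d))" for k :: nat
  have e: "(1 + l) * ((1 + l) * q - p * r) + p * ((1 + l) * r - l * p * q) = q * d"
    "(1 + l) * ((1 + l) * r - p * s) + p * ((1 + l) * s - l * p * r) = r * d"
    "l * p * ((1 + l) * q - p * r) + (1 + l) * ((1 + l) * r - l * p * q) = r * d"
    "l * p * ((1 + l) * r - p * s) + (1 + l) * ((1 + l) * s - l * p * r) = s * d"
    by (simp_all add: d_def algebra_simps)
  have e': "l * q * ((1 + l) * q - p * r) + l * r * ((1 + l) * r - l * p * q) = (1 + l) * (l * (q*q + r*r - p*q*r))"
    "l * q * ((1 + l) * r - p * s) + l * r * ((1 + l) * s - l * p * r) = p * (l * (q*q + r*r - p*q*r))"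
    "l * r * ((1 + l) * q - p * r) + l * s * ((1 + l) * r - l * p * q) = l * p * (l * (q*q + r*r - p*q*r))"
    "l * r * ((1 + l) * r - p * s) + l * s * ((1 + l) * s - l * p * r) = (1 + l) * (l * (q*q + r*r - p*q*r))"
    by (simp_all add: s_def algebra_simps)
  have div: "a * (b / d) + a' * (b' / d) = c" if "a * b + a' * b' = c * d" for a b a' b' c
    using that d(1) by (simp add: field_simps)
  note v = e[THEN div] e'[unfolded d(2), THEN div]
  have "x j \<bullet> y k = seifert l (nform p q r) j k" if "j < 4" "k < 4" for j k
    using that v unfolding less_4_cases
    by (elim disjE) (simp_all add: scalar_prod_2 x_def y_def seifert_def nform_def s_def[symmetric])
  moreover have "x k \<in> carrier_vec 2" "y k \<in> carrier_vec 2" for k by (simp_all add: x_def y_def)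
  moreover have "nform p q r 0 1 = p" by (simp add: nform_def)
  ultimately show ?thesis using nz nform_sym unfolding seifert_data_def
    by (intro exI[of _ x] exI[of _ y]) auto
qed

text \<open>A rank 2 factorization is unique up to a change of basis. \<open>g\<close> sends
  \<open>y 0, y 1\<close> to \<open>y' 0, y' 1\<close>; the inverse of the leading block turns
  products with \<open>x 0, x 1\<close> into coordinates.\<close>

lemma seifert_data_transfer:
  assumes D: "seifert_data l G x y" and D': "seifert_data l G x' y'"
  shows "\<exists>g\<in>carrier_mat 2 2. (\<forall>k<4. g *\<^sub>v y k = y' k) \<and>
    (\<forall>k<4. \<forall>w\<in>carrier_vec 2. x' k \<bullet> (g *\<^sub>v w) = x k \<bullet> w)"
proof -
  define d where "d = (1 + l) * (1 + l) - l * G 0 1 * G 0 1"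
  have d: "d \<noteq> 0" using D by (simp add: seifert_data_def d_def)
  define g where "g = mat 2 2 (\<lambda>(i, j). (y' 0 $ i * ((1 + l) * x 0 $ j - G 0 1 * x 1 $ j)
     + y' 1 $ i * ((1 + l) * x 1 $ j - l * G 0 1 * x 0 $ j)) / d)"
  have g: "g \<in> carrier_mat 2 2" by (simp add: g_def)
  note C = sdata_carrier[OF D] sdata_carrier[OF D']
  have gw: "g *\<^sub>v w = (((1 + l) * (x 0 \<bullet> w) - G 0 1 * (x 1 \<bullet> w)) / d) \<cdot>\<^sub>v y' 0
      + (((1 + l) * (x 1 \<bullet> w) - l * G 0 1 * (x 0 \<bullet> w)) / d) \<cdot>\<^sub>v y' 1" if w: "w \<in> carrier_vec 2" for w
  proof (rule eq_vecI)
    fix i assume "i < dim_vec ((((1 + l) * (x 0 \<bullet> w) - G 0 1 * (x 1 \<bullet> w)) / d) \<cdot>\<^sub>v y' 0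
      + (((1 + l) * (x 1 \<bullet> w) - l * G 0 1 * (x 0 \<bullet> w)) / d) \<cdot>\<^sub>v y' 1)"
    hence i: "i < 2" using C by simp
    have "(g *\<^sub>v w) $ i = g $$ (i, 0) * w $ 0 + g $$ (i, 1) * w $ 1"
      using i w g by (simp add: scalar_prod_def sum_2)
    thus "(g *\<^sub>v w) $ i = ((((1 + l) * (x 0 \<bullet> w) - G 0 1 * (x 1 \<bullet> w)) / d) \<cdot>\<^sub>v y' 0
      + (((1 + l) * (x 1 \<bullet> w) - l * G 0 1 * (x 0 \<bullet> w)) / d) \<cdot>\<^sub>v y' 1) $ i"
      using i w C[of 0] C[of 1]
      by (simp add: g_def scalar_prod_2 add_divide_distrib diff_divide_distrib algebra_simps)
  qed (use C[of 0] C[of 1] g in simp)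
  have gC: "g *\<^sub>v w \<in> carrier_vec 2" if "w \<in> carrier_vec 2" for w using g by (auto intro: carrier_vecI)
  have dots: "x' 0 \<bullet> y' 0 = 1 + l" "x' 0 \<bullet> y' 1 = G 0 1" "x' 1 \<bullet> y' 0 = l * G 0 1" "x' 1 \<bullet> y' 1 = 1 + l"
    using D' by (auto simp: seifert_data_def seifert_def)
  have lin: "x' k \<bullet> (a \<cdot>\<^sub>v y' 0 + b \<cdot>\<^sub>v y' 1) = a * (x' k \<bullet> y' 0) + b * (x' k \<bullet> y' 1)" if "k < 4" for k a b
    using C[OF that] C[of 0] C[of 1] by (simp add: scalar_prod_2 algebra_simps)
  have lin0: "x' 0 \<bullet> (a \<cdot>\<^sub>v y' 0 + b \<cdot>\<^sub>v y' 1) = a * (x' 0 \<bullet> y' 0) + b * (x' 0 \<bullet> y' 1)" for a b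
    by (rule lin) simp
  have lin1: "x' 1 \<bullet> (a \<cdot>\<^sub>v y' 0 + b \<cdot>\<^sub>v y' 1) = a * (x' 1 \<bullet> y' 0) + b * (x' 1 \<bullet> y' 1)" for a b
    by (rule lin) simp
  have 01: "x' 0 \<bullet> (g *\<^sub>v w) = x 0 \<bullet> w" "x' 1 \<bullet> (g *\<^sub>v w) = x 1 \<bullet> w" if w: "w \<in> carrier_vec 2" for w
  proof -
    have "((1 + l) * s - G 0 1 * t) / d * (1 + l) + ((1 + l) * t - l * G 0 1 * s) / d * G 0 1 = s"
      "((1 + l) * s - G 0 1 * t) / d * (l * G 0 1) + ((1 + l) * t - l * G 0 1 * s) / d * (1 + l) = t" for s t
    proof -
      have "((1 + l) * s - G 0 1 * t) * (1 + l) + ((1 + l) * t - l * G 0 1 * s) * G 0 1 = s * d"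
        "((1 + l) * s - G 0 1 * t) * (l * G 0 1) + ((1 + l) * t - l * G 0 1 * s) * (1 + l) = t * d"
        by (simp_all add: d_def algebra_simps)
      thus "((1 + l) * s - G 0 1 * t) / d * (1 + l) + ((1 + l) * t - l * G 0 1 * s) / d * G 0 1 = s"
      "((1 + l) * s - G 0 1 * t) / d * (l * G 0 1) + ((1 + l) * t - l * G 0 1 * s) / d * (1 + l) = t"
        using d by (simp_all add: add_divide_distrib[symmetric])
    qed
    thus "x' 0 \<bullet> (g *\<^sub>v w) = x 0 \<bullet> w" "x' 1 \<bullet> (g *\<^sub>v w) = x 1 \<bullet> w"
      unfolding gw[OF w] lin0 lin1 dots by blast+
  qed
  have gy: "g *\<^sub>v y k = y' k" if k: "k < 4" for k
  proof -
    have yc: "y k \<in> carrier_vec 2" "y' k \<in> carrier_vec 2" using C k by auto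
    have "x' j \<bullet> (g *\<^sub>v y k - y' k) = x' j \<bullet> (g *\<^sub>v y k) - x' j \<bullet> y' k" if "j < 4" for j
      by (rule scalar_prod_minus_distrib[of _ 2]) (use that yc C gC in auto)
    moreover have "x 0 \<bullet> y k = x' 0 \<bullet> y' k" "x 1 \<bullet> y k = x' 1 \<bullet> y' k"
      using k by (simp_all add: sdata_dot[OF D] sdata_dot[OF D'])
    ultimately have "x' 0 \<bullet> (g *\<^sub>v y k - y' k) = 0" "x' 1 \<bullet> (g *\<^sub>v y k - y' k) = 0"
      using 01[OF yc(1)] by simp_all
    hence "g *\<^sub>v y k - y' k = 0\<^sub>v 2"
      using seifert_data_independent(1)[OF D'] gC[OF yc(1)] yc(2) by simp
    thus ?thesis by (rule vec_diff_zero[OF gC[OF yc(1)] yc(2)])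
  qed
  have "x' k \<bullet> (g *\<^sub>v w) = x k \<bullet> w" if k: "k < 4" and w: "w \<in> carrier_vec 2" for k w
  proof -
    obtain a b where ab: "w = a \<cdot>\<^sub>v y 0 + b \<cdot>\<^sub>v y 1" using seifert_data_independent(2)[OF D w] by blast
    have "g *\<^sub>v w = a \<cdot>\<^sub>v y' 0 + b \<cdot>\<^sub>v y' 1"
      unfolding ab using C g gy[of 0] gy[of 1]
      by (simp add: mult_add_distrib_mat_vec[of _ 2 2] mult_mat_vec[of _ 2 2])
    hence "x' k \<bullet> (g *\<^sub>v w) = a * seifert l G k 0 + b * seifert l G k 1"
      using lin[OF k, of a b] sdata_dot[OF D' k, of 0] sdata_dot[OF D' k, of 1] by simp
    also have "\<dots> = x k \<bullet> w"
      unfolding ab sdata_dot[OF D k, of 0, symmetric, simplified] sdata_dot[OF D k, of 1, symmetric, simplified]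
      using C[of 0] C[of 1] C[OF k] by (simp add: scalar_prod_2 sdata_dot[OF D k, symmetric] algebra_simps)
    finally show ?thesis .
  qed
  with g gy show ?thesis by blast
qed

definition scaled :: "(nat \<Rightarrow> complex) \<Rightarrow> (nat \<Rightarrow> complex vec) \<Rightarrow> (nat \<Rightarrow> complex vec) \<Rightarrow> complex mat list" where
  "scaled c x y = map (\<lambda>k. c k \<cdot>\<^sub>m refl2 (y k) (x k)) [0..<4]"

lemma scaled_list: "scaled c x y = [c 0 \<cdot>\<^sub>m refl2 (y 0) (x 0), c 1 \<cdot>\<^sub>m refl2 (y 1) (x 1),
    c 2 \<cdot>\<^sub>m refl2 (y 2) (x 2), c 3 \<cdot>\<^sub>m refl2 (y 3) (x 3)]"
  by (simp add: scaled_def upt_rec numeral_eq_Suc)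

lemma scaled_carrier: "A \<in> set (scaled c x y) \<Longrightarrow> A \<in> carrier_mat 2 2"
  by (auto simp: scaled_def)

lemma conj_smult:
  fixes c :: complex
  assumes "g \<in> carrier_mat 2 2" "h \<in> carrier_mat 2 2" "A \<in> carrier_mat 2 2"
  shows "g * (c \<cdot>\<^sub>m A) * h = c \<cdot>\<^sub>m (g * A * h)"
  using assms by (simp add: mult_smult_distrib[of _ 2 2 _ 2] mult_smult_assoc_mat[of _ 2 2 _ 2])

lemma seifert_data_conj:
  assumes D: "seifert_data l G x y" and D': "seifert_data l G x' y'"
  shows "\<exists>g\<in>carrier (GL 2). \<forall>k<4. g * refl2 (y k) (x k) * inv\<^bsub>GL 2\<^esub> g = refl2 (y' k) (x' k)"
proof -
  obtain g where g: "g \<in> carrier_mat 2 2" "\<And>k. k < 4 \<Longrightarrow> g *\<^sub>v y k = y' k"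
    "\<And>k w. k < 4 \<Longrightarrow> w \<in> carrier_vec 2 \<Longrightarrow> x' k \<bullet> (g *\<^sub>v w) = x k \<bullet> w"
    using seifert_data_transfer[OF D D'] by blast
  obtain h where h: "h \<in> carrier_mat 2 2" "\<And>k. k < 4 \<Longrightarrow> h *\<^sub>v y' k = y k"
    "\<And>k w. k < 4 \<Longrightarrow> w \<in> carrier_vec 2 \<Longrightarrow> x k \<bullet> (h *\<^sub>v w) = x' k \<bullet> w"
    using seifert_data_transfer[OF D' D] by blast
  have one: "A * B = 1\<^sub>m 2"
    if E: "seifert_data l G u v" "A \<in> carrier_mat 2 2" "B \<in> carrier_mat 2 2" "\<And>k. k < 4 \<Longrightarrow> A *\<^sub>v (B *\<^sub>v v k) = v k" for u v A B
  proof (rule mat_eq_by_vec[of _ 2 2])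
    fix w :: "complex vec" assume w: "w \<in> carrier_vec 2"
    obtain a b where ab: "w = a \<cdot>\<^sub>v v 0 + b \<cdot>\<^sub>v v 1" using seifert_data_independent(2)[OF E(1) w] by blast
    have c: "v 0 \<in> carrier_vec 2" "v 1 \<in> carrier_vec 2" "B *\<^sub>v v 0 \<in> carrier_vec 2" "B *\<^sub>v v 1 \<in> carrier_vec 2"
      using sdata_carrier[OF E(1)] E(3) by (auto intro: carrier_vecI)
    have "A *\<^sub>v (B *\<^sub>v w) = w"
      unfolding ab using E(2,3) c E(4)[of 0] E(4)[of 1]
      by (simp add: mult_add_distrib_mat_vec[of _ 2 2] mult_mat_vec[of _ 2 2])
    thus "A * B *\<^sub>v w = 1\<^sub>m 2 *\<^sub>v w" using w E by (simp add: assoc_mult_mat_vec[of _ 2 2 _ 2])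
  qed (use E in \<open>auto intro: mult_carrier_mat[of _ 2 2 _ 2]\<close>)
  have gh: "g * h = 1\<^sub>m 2" by (rule one[OF D' g(1) h(1)]) (simp add: g h)
  have hg: "h * g = 1\<^sub>m 2" by (rule one[OF D h(1) g(1)]) (simp add: g h)
  have inv: "inv\<^bsub>GL 2\<^esub> g = h" using GL_inv[OF g(1) h(1) gh hg] .
  have int: "g * refl2 (y k) (x k) = refl2 (y' k) (x' k) * g" if k: "k < 4" for k
  proof (rule mat_eq_by_vec[of _ 2 2])
    fix w :: "complex vec" assume w: "w \<in> carrier_vec 2"
    have c: "y k \<in> carrier_vec 2" "y' k \<in> carrier_vec 2" "g *\<^sub>v w \<in> carrier_vec 2"
      using sdata_carrier[OF D k] sdata_carrier[OF D' k] g(1) by (auto intro: carrier_vecI)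
    have "g *\<^sub>v (refl2 (y k) (x k) *\<^sub>v w) = g *\<^sub>v w - (x k \<bullet> w) \<cdot>\<^sub>v y' k"
      using w c g(1) g(2)[OF k]
      by (simp add: refl2_apply mult_minus_distrib_mat_vec[of _ 2 2] mult_mat_vec[of _ 2 2])
    also have "\<dots> = refl2 (y' k) (x' k) *\<^sub>v (g *\<^sub>v w)" using c g(3)[OF k w] by (simp add: refl2_apply)
    finally show "g * refl2 (y k) (x k) *\<^sub>v w = refl2 (y' k) (x' k) * g *\<^sub>v w"
      using w g(1) by (simp add: assoc_mult_mat_vec[of _ 2 2 _ 2])
  qed (use g(1) in \<open>auto intro: mult_carrier_mat[of _ 2 2 _ 2]\<close>)
  have "g * refl2 (y k) (x k) * inv\<^bsub>GL 2\<^esub> g = refl2 (y' k) (x' k)" if k: "k < 4" for k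
    unfolding inv int[OF k] using g(1) h(1) gh
    by (simp add: assoc_mult_mat[of _ 2 2 _ 2 _ 2] right_mult_one_mat[OF refl2_carrier])
  moreover have "g \<in> carrier (GL 2)" using g(1) h(1) gh hg by (auto simp: GL_carrier)
  ultimately show ?thesis by blast
qed

lemma seifert_data_conjugate:
  assumes D: "seifert_data l G x y" and "sim_conj (data_mats x y) Ms"
  obtains x' y' where "seifert_data l G x' y'" "Ms = data_mats x' y'"
proof -
  obtain g where g: "g \<in> carrier (GL 2)" "Ms = map (\<lambda>A. g * A * inv\<^bsub>GL 2\<^esub> g) (data_mats x y)"
    using assms(2) by (auto simp: sim_conj_def)
  define h where "h = inv\<^bsub>GL 2\<^esub> g"
  have gh: "g \<in> carrier_mat 2 2" "h \<in> carrier_mat 2 2" "g * h = 1\<^sub>m 2" "h * g = 1\<^sub>m 2"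
    using GL_inv_props[OF g(1)] g(1) by (auto simp: h_def GL_carrier)
  note C = sdata_carrier[OF D]
  \<comment> \<open>Functionals transform by the inverse transpose.\<close>
  define x' y' where "x' k = transpose_mat h *\<^sub>v x k" and "y' k = g *\<^sub>v y k" for k
  have C': "x' k \<in> carrier_vec 2" "y' k \<in> carrier_vec 2" for k
    using gh by (auto simp: x'_def y'_def intro: carrier_vecI)
  have hx: "x' k \<bullet> w = x k \<bullet> (h *\<^sub>v w)" if k: "k < 4" and w: "w \<in> carrier_vec 2" for k w
  proof -
    have "x' k \<bullet> w = (h $$ (0,0) * x k $ 0 + h $$ (1,0) * x k $ 1) * w $ 0
       + (h $$ (0,1) * x k $ 0 + h $$ (1,1) * x k $ 1) * w $ 1"
      using w gh C[OF k] by (simp add: scalar_prod_2 x'_def)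
    moreover have "x k \<bullet> (h *\<^sub>v w) = x k $ 0 * (h $$ (0,0) * w $ 0 + h $$ (0,1) * w $ 1)
       + x k $ 1 * (h $$ (1,0) * w $ 0 + h $$ (1,1) * w $ 1)"
      using w gh by (subst scalar_prod_2) (auto intro: carrier_vecI simp: scalar_prod_def sum_2)
    ultimately show ?thesis by (simp add: algebra_simps)
  qed
  have hg: "h *\<^sub>v (g *\<^sub>v w) = w" if "w \<in> carrier_vec 2" for w
    using that gh by (simp add: assoc_mult_mat_vec[of _ 2 2 _ 2, symmetric])
  have "x' j \<bullet> y' k = seifert l G j k" if "j < 4" "k < 4" for j k
    using that C hg[of "y k"] hx[OF that(1) C'(2)] by (simp add: y'_def sdata_dot[OF D])
  hence D': "seifert_data l G x' y'" using D C' unfolding seifert_data_def by blast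
  have "g * refl2 (y k) (x k) * h = refl2 (y' k) (x' k)" if k: "k < 4" for k
  proof (rule mat_eq_by_vec[of _ 2 2])
    fix w :: "complex vec" assume w: "w \<in> carrier_vec 2"
    have hw: "h *\<^sub>v w \<in> carrier_vec 2" using gh by (auto intro: carrier_vecI)
    have "g *\<^sub>v (h *\<^sub>v w) = w" using w gh by (simp add: assoc_mult_mat_vec[of _ 2 2 _ 2, symmetric])
    hence "g *\<^sub>v (refl2 (y k) (x k) *\<^sub>v (h *\<^sub>v w)) = w - (x' k \<bullet> w) \<cdot>\<^sub>v y' k"
      using hw C[OF k] gh(1) hx[OF k w]
      by (simp add: refl2_apply y'_def mult_minus_distrib_mat_vec[of _ 2 2] mult_mat_vec[of _ 2 2])
    also have "\<dots> = refl2 (y' k) (x' k) *\<^sub>v w" using w C' by (simp add: refl2_apply)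
    finally show "g * refl2 (y k) (x k) * h *\<^sub>v w = refl2 (y' k) (x' k) *\<^sub>v w"
      using w hw gh by (simp add: assoc_mult_mat_vec[of _ 2 2 _ 2] mult_carrier_mat[of _ 2 2 _ 2])
  qed (use gh in \<open>auto intro!: mult_carrier_mat[of _ 2 2 _ 2]\<close>)
  hence "Ms = data_mats x' y'" unfolding g(2) data_mats_def h_def[symmetric] by auto
  with D' that show thesis by blast
qed

text \<open>As the Gram matrix is symmetric, the transpose of \<open>l L + U\<close> is
  \<open>l\<close> times \<open>l^(-1) L + U\<close>; so \<open>x\<close> and \<open>y\<close>
  exchange roles.\<close>

lemma seifert_data_inverse:
  assumes D: "seifert_data l G x y" and l: "l \<noteq> 0"
  shows "seifert_data (inverse l) G y (\<lambda>k. inverse l \<cdot>\<^sub>v x k)"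
proof -
  note C = sdata_carrier[OF D]
  have "y j \<bullet> (inverse l \<cdot>\<^sub>v x k) = seifert (inverse l) G j k" if jk: "j < 4" "k < 4" for j k
  proof -
    have "y j \<bullet> (inverse l \<cdot>\<^sub>v x k) = inverse l * (x k \<bullet> y j)"
      using C[OF jk(1)] C[OF jk(2)] by (simp add: scalar_prod_2 algebra_simps)
    also have "\<dots> = inverse l * seifert l G k j" using jk by (simp add: sdata_dot[OF D])
    also have "\<dots> = seifert (inverse l) G j k"
      using l D by (auto simp: seifert_def seifert_data_def field_simps)
    finally show ?thesis .
  qed
  moreover have nz: "(1 + inverse l) * (1 + inverse l) - inverse l * G 0 1 * G 0 1
     = inverse l * inverse l * ((1 + l) * (1 + l) - l * G 0 1 * G 0 1)"
    using l by (simp add: field_simps)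
  moreover have "(1 + inverse l) * (1 + inverse l) - inverse l * G 0 1 * G 0 1 \<noteq> 0"
    unfolding nz using D l by (simp add: seifert_data_def)
  ultimately show ?thesis using D C unfolding seifert_data_def by (metis smult_carrier_vec)
qed

section \<open>Determinants and the product of the rank 2 reflections\<close>

lemma det_mat2:
  assumes "A \<in> carrier_mat 2 2"
  shows "det A = A $$ (0,0) * A $$ (1,1) - A $$ (0,1) * A $$ (1,0)"
proof -
  have "A = mat (Suc (Suc 0)) (Suc (Suc 0)) (\<lambda>(i, j). A $$ (i, j))" using assms by (intro eq_matI) auto
  hence "det A = det (mat (Suc (Suc 0)) (Suc (Suc 0)) (\<lambda>(i, j). A $$ (i, j)))" by simp
  also have "\<dots> = A $$ (0,0) * A $$ (1,1) - A $$ (0,1) * A $$ (1,0)"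
    unfolding det_mat_Suc by simp
  finally show ?thesis .
qed

lemma det_refl2:
  assumes "seifert_data l G x y" "k < 4"
  shows "det (refl2 (y k) (x k)) = - l"
proof -
  have "x k \<bullet> y k = 1 + l" using sdata_dot[OF assms(1,2,2)] by (simp add: seifert_def)
  hence "1 + l = x k $ 0 * y k $ 0 + x k $ 1 * y k $ 1" using sdata_carrier[OF assms] by (simp add: scalar_prod_2)
  hence "- l = 1 - (x k $ 0 * y k $ 0 + x k $ 1 * y k $ 1)" by (simp add: algebra_simps)
  thus ?thesis by (simp add: det_mat2 refl2_def algebra_simps)
qed

text \<open>It suffices to test on \<open>y 0, y 1\<close> against \<open>x 0, x 1\<close>. Applying
  the four reflections to \<open>v\<close> is back substitution in the triangular system
  \<open>U z = (x k \<bullet> v)\<close>, whose solutions are explicit thanks to the relation on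
  \<open>l\<close>.\<close>

lemma product_refl2:
  assumes D: "seifert_data l (nform p q r) x y" and rel: "(1 + l) * (1 + l) = l * (p*p + q*q + r*r - p*q*r)"
  shows "refl2 (y 0) (x 0) * (refl2 (y 1) (x 1) * (refl2 (y 2) (x 2) * refl2 (y 3) (x 3))) = (l * l) \<cdot>\<^sub>m 1\<^sub>m 2"
    (is "?A * (?B * (?C * ?D)) = _")
proof (rule mat_eq_by_vec[of _ 2 2])
  note C = sdata_carrier[OF D]
  have V: "v - c \<cdot>\<^sub>v w \<in> carrier_vec 2" if "v \<in> carrier_vec 2" "w \<in> carrier_vec 2" for c and v w :: "complex vec"
    using that by simp
  have L: "x j \<bullet> (v - c \<cdot>\<^sub>v y k) = x j \<bullet> v - c * seifert l (nform p q r) j k"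
    if "j < 4" "k < 4" "v \<in> carrier_vec 2" for j k c v
  proof -
    have "x j \<bullet> (v - c \<cdot>\<^sub>v y k) = x j \<bullet> v - c * (x j \<bullet> y k)"
      using C[OF that(1)] C[OF that(2)] that(3) by (simp add: scalar_prod_2 algebra_simps)
    thus ?thesis by (simp add: sdata_dot[OF D that(1,2)])
  qed
  define t where "t = p * r - q"
  have H: "seifert l (nform p q r) 0 3 = r" "seifert l (nform p q r) 0 2 = q" "seifert l (nform p q r) 0 1 = p"
    "seifert l (nform p q r) 0 0 = 1 + l" "seifert l (nform p q r) 1 3 = t" "seifert l (nform p q r) 1 2 = r"
    "seifert l (nform p q r) 1 1 = 1 + l" "seifert l (nform p q r) 1 0 = l * p" "seifert l (nform p q r) 2 3 = p"
    "seifert l (nform p q r) 2 0 = l * q" "seifert l (nform p q r) 2 1 = l * r"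
    "seifert l (nform p q r) 3 0 = l * r" "seifert l (nform p q r) 3 1 = l * t"
    by (simp_all add: seifert_def nform_def t_def)
  have product: "x 0 \<bullet> (?A *\<^sub>v (?B *\<^sub>v (?C *\<^sub>v (?D *\<^sub>v v)))) = - l * z0"
    "x 1 \<bullet> (?A *\<^sub>v (?B *\<^sub>v (?C *\<^sub>v (?D *\<^sub>v v)))) = - l * z1 - l * p * z0"
    if v: "v \<in> carrier_vec 2" and z: "z3 = x 3 \<bullet> v" "z2 = x 2 \<bullet> v - z3 * p" "z1 = x 1 \<bullet> v - z3 * t - z2 * r"
      "z0 = x 0 \<bullet> v - z3 * r - z2 * q - z1 * p" for v z0 z1 z2 z3
  proof -
    define v3 v2 v1 where "v3 = v - z3 \<cdot>\<^sub>v y 3" and "v2 = v3 - z2 \<cdot>\<^sub>v y 2" and "v1 = v2 - z1 \<cdot>\<^sub>v y 1"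
    have vc: "v3 \<in> carrier_vec 2" "v2 \<in> carrier_vec 2" "v1 \<in> carrier_vec 2"
      using v C by (simp_all add: v3_def v2_def v1_def)
    have d3: "x j \<bullet> v3 = x j \<bullet> v - z3 * seifert l (nform p q r) j 3" if "j < 4" for j
      unfolding v3_def by (rule L) (use that v in auto)
    have d2: "x j \<bullet> v2 = x j \<bullet> v3 - z2 * seifert l (nform p q r) j 2" if "j < 4" for j
      unfolding v2_def by (rule L) (use that vc in auto)
    have d1: "x j \<bullet> v1 = x j \<bullet> v2 - z1 * seifert l (nform p q r) j 1" if "j < 4" for j
      unfolding v1_def by (rule L) (use that vc in auto)
    have "?D *\<^sub>v v = v3" using v C[of 3] by (simp add: refl2_apply v3_def z(1))
    moreover have "?C *\<^sub>v v3 = v2" using vc C[of 2] d3[of 2] by (simp add: refl2_apply v2_def H z(2))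
    moreover have "?B *\<^sub>v v2 = v1"
      using vc C[of 1] d2[of 1] d3[of 1] by (simp add: refl2_apply v1_def H[simplified] z(3))
    moreover have "?A *\<^sub>v v1 = v1 - z0 \<cdot>\<^sub>v y 0"
      using vc C[of 0] d1[of 0] d2[of 0] d3[of 0] by (simp add: refl2_apply H[simplified] z(4))
    ultimately have e: "?A *\<^sub>v (?B *\<^sub>v (?C *\<^sub>v (?D *\<^sub>v v))) = v1 - z0 \<cdot>\<^sub>v y 0" by simp
    have "x 0 \<bullet> (v1 - z0 \<cdot>\<^sub>v y 0) = z0 - z0 * (1 + l)"
      using L[of 0 0 v1 z0] vc d1[of 0] d2[of 0] d3[of 0] by (simp add: H[simplified] z(4))
    thus "x 0 \<bullet> (?A *\<^sub>v (?B *\<^sub>v (?C *\<^sub>v (?D *\<^sub>v v)))) = - l * z0" unfolding e by (simp add: algebra_simps)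
    have "x 1 \<bullet> (v1 - z0 \<cdot>\<^sub>v y 0) = z1 - z1 * (1 + l) - z0 * (l * p)"
      using L[of 1 0 v1 z0] vc d1[of 1] d2[of 1] d3[of 1] by (simp add: H[simplified] z(3))
    thus "x 1 \<bullet> (?A *\<^sub>v (?B *\<^sub>v (?C *\<^sub>v (?D *\<^sub>v v)))) = - l * z1 - l * p * z0" unfolding e by (simp add: algebra_simps)
  qed
  have step: "x j \<bullet> (?A *\<^sub>v (?B *\<^sub>v (?C *\<^sub>v (?D *\<^sub>v y k)))) = l * l * (x j \<bullet> y k)"
    if jk: "j = 0 \<or> j = 1" "k = 0 \<or> k = 1" for j k :: nat
  proof -
    have rel': "l * (q*q) + l * (r*r) = (1 + l) * (1 + l) - l * (p*p) + l * (p*q*r)"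
      using rel by (simp add: algebra_simps)
    have z0: "l * p = l * p - l * r * t + l * r * t" "- l * (1 + l) = (1 + l) - l * r * r - (l * q - l * r * p) * q - l * p * p"
      "l * p = l * p - (l * r) * t - (l * q - l * r * p) * r"
      using rel' by (simp_all add: t_def algebra_simps)
    have z1: "- l * (1 + l) + l * p * p = (1 + l) - (l * t) * t - (l * r - l * t * p) * r"
    proof -
      have "(l * t) * t + (l * r - l * t * p) * r = l * (q*q) + l * (r*r) - l * (p*q*r)"
        by (simp add: t_def algebra_simps)
      thus ?thesis using rel' by (simp add: algebra_simps)
    qed
    have z2: "- l * p = p - (l * t) * r - (l * r - l * t * p) * q - (- l * (1 + l) + l * p * p) * p"
    proof -
      have "(l * t) * r + (l * r - l * t * p) * q = p * (l * (q*q) + l * (r*r) - l * (p*q*r))"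
        by (simp add: t_def algebra_simps)
      thus ?thesis unfolding rel' by (simp add: algebra_simps)
    qed
    \<comment> \<open>The numbers are the solutions \<open>z3, z2, z1, z0\<close> of the triangular
      system for \<open>y 0\<close> and \<open>y 1\<close>.\<close>
    note P0 = product[of "y 0" "l * r" "l * q - l * r * p" "l * p" "- l * (1 + l)"]
    note P1 = product[of "y 1" "l * t" "l * r - l * t * p" "- l * (1 + l) + l * p * p" "- l * p"]
    have "x 3 \<bullet> y 0 = l * r" "x 2 \<bullet> y 0 = l * q" "x 1 \<bullet> y 0 = l * p" "x 0 \<bullet> y 0 = 1 + l"
      "x 3 \<bullet> y 1 = l * t" "x 2 \<bullet> y 1 = l * r" "x 1 \<bullet> y 1 = 1 + l" "x 0 \<bullet> y 1 = p"
      using sdata_dot[OF D] H by simp_all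
    note d = this
    have e0: "l * q - l * r * p = x 2 \<bullet> y 0 - l * r * p" "l * p = x 1 \<bullet> y 0 - l * r * t - (l * q - l * r * p) * r"
      "- l * (1 + l) = x 0 \<bullet> y 0 - l * r * r - (l * q - l * r * p) * q - l * p * p"
      unfolding d by (rule refl z0(3) z0(2))+
    have e1: "l * r - l * t * p = x 2 \<bullet> y 1 - l * t * p"
      "- l * (1 + l) + l * p * p = x 1 \<bullet> y 1 - l * t * t - (l * r - l * t * p) * r"
      "- l * p = x 0 \<bullet> y 1 - l * t * r - (l * r - l * t * p) * q - (- l * (1 + l) + l * p * p) * p"
      unfolding d by (rule refl z1 z2)+
    have yc: "y 0 \<in> carrier_vec 2" "y 1 \<in> carrier_vec 2" using C by simp_all
    note R0 = P0[OF yc(1) d(1)[symmetric] e0]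
    note R1 = P1[OF yc(2) d(5)[symmetric] e1]
    show ?thesis using jk
      by (elim disjE) (simp_all only: R0 R1 d, simp_all add: algebra_simps)
  qed
  fix w :: "complex vec" assume w: "w \<in> carrier_vec 2"
  obtain a b where ab: "w = a \<cdot>\<^sub>v y 0 + b \<cdot>\<^sub>v y 1" using seifert_data_independent(2)[OF D w] by blast
  define F where "F v = ?A *\<^sub>v (?B *\<^sub>v (?C *\<^sub>v (?D *\<^sub>v v)))" for v
  have M: "refl2 a b *\<^sub>v v \<in> carrier_vec 2" for a b v by (auto intro: carrier_vecI simp: refl2_def)
  have Fw: "F w = a \<cdot>\<^sub>v F (y 0) + b \<cdot>\<^sub>v F (y 1)"
    unfolding F_def ab using C[of 0] C[of 1] M
    by (simp add: mult_add_distrib_mat_vec[of _ 2 2] mult_mat_vec[of _ 2 2])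
  have Fc: "F v \<in> carrier_vec 2" for v unfolding F_def by (rule M)
  have "x j \<bullet> (F w - (l * l) \<cdot>\<^sub>v w) = 0" if j: "j = 0 \<or> j = 1" for j
  proof -
    have "x j \<bullet> (F w - (l * l) \<cdot>\<^sub>v w) = a * (x j \<bullet> F (y 0)) + b * (x j \<bullet> F (y 1)) - l * l * (x j \<bullet> w)"
      unfolding Fw using Fc[of "y 0"] Fc[of "y 1"] w by (simp add: scalar_prod_2 algebra_simps)
    also have "x j \<bullet> w = a * (x j \<bullet> y 0) + b * (x j \<bullet> y 1)"
      unfolding ab using C[of 0] C[of 1] by (simp add: scalar_prod_2 algebra_simps)
    finally show ?thesis using step[OF j, of 0] step[OF j, of 1] unfolding F_def by (simp add: algebra_simps)
  qed
  hence "F w - (l * l) \<cdot>\<^sub>v w = 0\<^sub>v 2"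
    using seifert_data_independent(1)[OF D, of "F w - (l * l) \<cdot>\<^sub>v w"] Fc w by simp
  from vec_diff_zero[OF Fc _ this] w have "F w = (l * l) \<cdot>\<^sub>v w" by simp
  moreover have "((l * l) \<cdot>\<^sub>m 1\<^sub>m 2) *\<^sub>v w = (l * l) \<cdot>\<^sub>v w"
    using w by (intro eq_vecI) (auto simp: scalar_prod_def sum_2 less_2_cases')
  ultimately show "?A * (?B * (?C * ?D)) *\<^sub>v w = ((l * l) \<cdot>\<^sub>m 1\<^sub>m 2) *\<^sub>v w"
    using w unfolding F_def
    by (simp add: assoc_mult_mat_vec[of _ 2 2 _ 2] mult_carrier_mat[of _ 2 2 _ 2])
qed (auto intro!: mult_carrier_mat[of _ 2 2 _ 2])

section \<open>The braid action on Seifert data\<close>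

text \<open>The first relation is \<open>l + 1/l = t\<close> cleared of denominators. The leading
  minor could vanish only for \<open>t = p^2 - 2\<close>.\<close>

lemma good_triple_relations:
  assumes l: "type_eigenvalue l t" and g: "good_triple p q r" "trace_inv p q r = t"
  defines "P \<equiv> evc p" and "Q \<equiv> evc q" and "R \<equiv> evc r"
  shows "(1 + l) * (1 + l) = l * (P*P + Q*Q + R*R - P*Q*R)" "(1 + l) * (1 + l) - l * P * P \<noteq> 0"
proof -
  have l0: "l \<noteq> 0" using l by (auto simp: type_eigenvalue_def)
  have "P*P + Q*Q + R*R - P*Q*R - 2 = l + inverse l"
    using l g unfolding type_eigenvalue_def P_def Q_def R_def trace_inv_def
    by (auto simp: evc.emb.hom_add evc.emb.hom_minus evc.emb.hom_mult)
  hence "P*P + Q*Q + R*R - P*Q*R = 2 + l + inverse l" by (simp add: algebra_simps)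
  hence rel: "l * (P*P + Q*Q + R*R - P*Q*R) = (1 + l) * (1 + l)" using l0 by (simp add: algebra_simps)
  thus "(1 + l) * (1 + l) = l * (P*P + Q*Q + R*R - P*Q*R)" by simp
  show "(1 + l) * (1 + l) - l * P * P \<noteq> 0"
  proof
    assume "(1 + l) * (1 + l) - l * P * P = 0"
    hence "l * (P*P + Q*Q + R*R - P*Q*R) = l * (P * P)" using rel by (simp add: mult.assoc)
    hence "P*P + Q*Q + R*R - P*Q*R = P * P" using l0 by simp
    hence "evc (trace_inv p q r) = evc (trace_inv p 0 0)"
      by (simp add: trace_inv_def P_def Q_def R_def evc.emb.hom_add evc.emb.hom_minus evc.emb.hom_mult)
    hence "trace_inv p 0 0 \<in> type_traces" using g by (simp add: evc_inj good_triple_def)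
    thus False using square_trace_check g by (auto simp: good_triple_def type_traces_def)
  qed
qed

definition cform :: "gint \<Rightarrow> gint \<Rightarrow> gint \<Rightarrow> nat \<Rightarrow> nat \<Rightarrow> complex" where
  "cform p q r = nform (evc p) (evc q) (evc r)"

text \<open>The indices 0 and 2 act alike: the normal form has \<open>p\<close> in both of the
  corresponding places.\<close>

definition braid_triple :: "nat \<Rightarrow> gint \<times> gint \<times> gint \<Rightarrow> gint \<times> gint \<times> gint" where
  "braid_triple i = (\<lambda>(p, q, r). if i = 1 then (p * r - q, p, r) else (p, p * q - r, q))"

definition unbraid_triple :: "nat \<Rightarrow> gint \<times> gint \<times> gint \<Rightarrow> gint \<times> gint \<times> gint" where
  "unbraid_triple i = (\<lambda>(p, q, r). if i = 1 then (q, q * r - p, r) else (p, r, p * r - q))"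

definition good_check :: "gint \<times> gint \<times> gint \<Rightarrow> bool" where
  "good_check = (\<lambda>(p, q, r). p \<in> set gram_values \<and> q \<in> set gram_values \<and> r \<in> set gram_values)"

text \<open>Expressions such as \<open>p r - q\<close> might leave the nine values; for the three
  types they do not, so the moves act on a finite set.\<close>

lemma braid_triple_check:
  "\<forall>p\<in>set gram_values. \<forall>q\<in>set gram_values. \<forall>r\<in>set gram_values.
     trace_inv p q r \<in> {Gint 1 0, Gint 0 1, Gint 1 (-1)} \<longrightarrow>
       good_check (braid_triple 0 (p, q, r)) \<and> good_check (braid_triple 1 (p, q, r)) \<and>
       good_check (unbraid_triple 0 (p, q, r)) \<and> good_check (unbraid_triple 1 (p, q, r))"
  by code_simp

lemma good_triple_braid:
  assumes "good_triple p q r" "trace_inv p q r = t" "braid_triple i (p, q, r) = (p', q', r') \<or> unbraid_triple i (p, q, r) = (p', q', r')"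
  shows "good_triple p' q' r'" "trace_inv p' q' r' = t"
proof -
  show t: "trace_inv p' q' r' = t"
  proof -
    have "p' = p * r - q \<and> q' = p \<and> r' = r \<or> p' = p \<and> q' = p * q - r \<and> r' = q \<or>
      p' = q \<and> q' = q * r - p \<and> r' = r \<or> p' = p \<and> q' = r \<and> r' = p * r - q"
      using assms(3) by (auto simp: braid_triple_def unbraid_triple_def split: if_splits)
    thus ?thesis unfolding assms(2)[symmetric]
      by (elim disjE conjE; hypsubst) (simp_all add: trace_inv_def algebra_simps)
  qed
  have "good_check (braid_triple 0 (p, q, r)) \<and> good_check (braid_triple 1 (p, q, r)) \<and>
       good_check (unbraid_triple 0 (p, q, r)) \<and> good_check (unbraid_triple 1 (p, q, r))"
    using braid_triple_check assms(1) unfolding good_triple_def type_traces_def by blast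
  moreover have "braid_triple i (p, q, r) = braid_triple (if i = 1 then 1 else 0) (p, q, r)"
    "unbraid_triple i (p, q, r) = unbraid_triple (if i = 1 then 1 else 0) (p, q, r)"
    by (simp_all add: braid_triple_def unbraid_triple_def)
  ultimately have "good_check (p', q', r')" using assms(3) by (metis (full_types))
  thus "good_triple p' q' r'" using t assms(1,2) by (simp add: good_check_def good_triple_def)
qed

text \<open>The image of one vector under the reflection of its neighbour, up to a sign. The sign
  keeps the Gram matrix in normal form, and it does not affect the reflection because
  \<open>x\<close> and \<open>y\<close> share it.\<close>

definition swap_lin :: "nat \<Rightarrow> complex \<Rightarrow> (nat \<Rightarrow> complex vec) \<Rightarrow> nat \<Rightarrow> complex vec" where
  "swap_lin i g x = x(i := g \<cdot>\<^sub>v x i - x (Suc i), Suc i := x i)"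

definition swap_lin' :: "nat \<Rightarrow> complex \<Rightarrow> (nat \<Rightarrow> complex vec) \<Rightarrow> nat \<Rightarrow> complex vec" where
  "swap_lin' i g x = x(i := x (Suc i), Suc i := g \<cdot>\<^sub>v x (Suc i) - x i)"

lemma dot_lin:
  fixes a b c :: "complex vec"
  assumes "a \<in> carrier_vec 2" "b \<in> carrier_vec 2" "c \<in> carrier_vec 2"
  shows "(g \<cdot>\<^sub>v a - b) \<bullet> c = g * (a \<bullet> c) - b \<bullet> c" "c \<bullet> (g \<cdot>\<^sub>v a - b) = g * (c \<bullet> a) - c \<bullet> b"
  using assms by (simp_all add: scalar_prod_2 algebra_simps)

lemma less_3_cases: "i < 3 \<longleftrightarrow> i = 0 \<or> i = 1 \<or> i = (2::nat)"
  by auto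

lemma swap_lin_data:
  assumes D: "seifert_data l (nform p q r) x y" and i: "i < 3" and g: "g = nform p q r i (Suc i)"
    and new: "(p', q', r') = (if i = 1 then (p * r - q, p, r) else (p, p * q - r, q))"
    and nz: "(1 + l) * (1 + l) - l * p' * p' \<noteq> 0"
  shows "seifert_data l (nform p' q' r') (swap_lin i g x) (swap_lin i g y)"
proof -
  have C: "x 0 \<in> carrier_vec 2" "x 1 \<in> carrier_vec 2" "x 2 \<in> carrier_vec 2" "x 3 \<in> carrier_vec 2"
    "y 0 \<in> carrier_vec 2" "y 1 \<in> carrier_vec 2" "y 2 \<in> carrier_vec 2" "y 3 \<in> carrier_vec 2"
    using sdata_carrier[OF D] by auto
  have tab: "x 0 \<bullet> y 0 = 1 + l" "x 0 \<bullet> y 1 = p" "x 0 \<bullet> y 2 = q" "x 0 \<bullet> y 3 = r"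
    "x 1 \<bullet> y 0 = l * p" "x 1 \<bullet> y 1 = 1 + l" "x 1 \<bullet> y 2 = r" "x 1 \<bullet> y 3 = p * r - q"
    "x 2 \<bullet> y 0 = l * q" "x 2 \<bullet> y 1 = l * r" "x 2 \<bullet> y 2 = 1 + l" "x 2 \<bullet> y 3 = p"
    "x 3 \<bullet> y 0 = l * r" "x 3 \<bullet> y 1 = l * (p * r - q)" "x 3 \<bullet> y 2 = l * p" "x 3 \<bullet> y 3 = 1 + l"
    using sdata_dot[OF D] by (simp_all add: seifert_def nform_def)
  have S: "h \<cdot>\<^sub>v a - b \<in> carrier_vec 2" if "a \<in> carrier_vec 2" "b \<in> carrier_vec 2" for h and a b :: "complex vec"
    using that by simp
  have eq: "\<forall>j<4. \<forall>k<4. swap_lin i g x j \<bullet> swap_lin i g y k = seifert l (nform p' q' r') j k"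
  proof -
    consider "i = 0" | "i = 1" | "i = 2" using i by linarith
    thus ?thesis
    proof cases
      case 1
      hence v: "g = p" "p' = p" "q' = p * q - r" "r' = q" using g new by (simp_all add: nform_def)
      show ?thesis unfolding all_less_4 v 1 swap_lin_def seifert_def nform_def
        by (simp add: numeral_2_eq_2[symmetric] dot_lin C[unfolded One_nat_def] S tab[unfolded One_nat_def]) (simp add: algebra_simps)
    next
      case 2
      hence v: "g = r" "p' = p * r - q" "q' = p" "r' = r" using g new by (simp_all add: nform_def)
      show ?thesis unfolding all_less_4 v 2 swap_lin_def seifert_def nform_def
        by (simp add: numeral_2_eq_2[symmetric] dot_lin C[unfolded One_nat_def] S tab[unfolded One_nat_def]) (simp add: algebra_simps)
    next
      case 3
      hence v: "g = p" "p' = p" "q' = p * q - r" "r' = q" using g new by (simp_all add: nform_def)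
      show ?thesis unfolding all_less_4 v 3 swap_lin_def seifert_def nform_def
        by (simp add: numeral_2_eq_2[symmetric] dot_lin C[unfolded One_nat_def] S tab[unfolded One_nat_def]) (simp add: algebra_simps)
    qed
  qed
  have "swap_lin i g x k \<in> carrier_vec 2" "swap_lin i g y k \<in> carrier_vec 2" if "k < 4" for k
    using i that C unfolding less_3_cases less_4_cases by (auto simp: swap_lin_def numeral_2_eq_2[symmetric])
  moreover have "nform p' q' r' 0 1 = p'" by (simp add: nform_def)
  ultimately show ?thesis using eq nz nform_sym[of p' q' r'] unfolding seifert_data_def by auto
qed

lemma swap_lin'_data:
  assumes D: "seifert_data l (nform p q r) x y" and i: "i < 3" and g: "g = nform p q r i (Suc i)"
    and new: "(p', q', r') = (if i = 1 then (q, q * r - p, r) else (p, r, p * r - q))"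
    and nz: "(1 + l) * (1 + l) - l * p' * p' \<noteq> 0"
  shows "seifert_data l (nform p' q' r') (swap_lin' i g x) (swap_lin' i g y)"
proof -
  have C: "x 0 \<in> carrier_vec 2" "x 1 \<in> carrier_vec 2" "x 2 \<in> carrier_vec 2" "x 3 \<in> carrier_vec 2"
    "y 0 \<in> carrier_vec 2" "y 1 \<in> carrier_vec 2" "y 2 \<in> carrier_vec 2" "y 3 \<in> carrier_vec 2"
    using sdata_carrier[OF D] by auto
  have tab: "x 0 \<bullet> y 0 = 1 + l" "x 0 \<bullet> y 1 = p" "x 0 \<bullet> y 2 = q" "x 0 \<bullet> y 3 = r"
    "x 1 \<bullet> y 0 = l * p" "x 1 \<bullet> y 1 = 1 + l" "x 1 \<bullet> y 2 = r" "x 1 \<bullet> y 3 = p * r - q"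
    "x 2 \<bullet> y 0 = l * q" "x 2 \<bullet> y 1 = l * r" "x 2 \<bullet> y 2 = 1 + l" "x 2 \<bullet> y 3 = p"
    "x 3 \<bullet> y 0 = l * r" "x 3 \<bullet> y 1 = l * (p * r - q)" "x 3 \<bullet> y 2 = l * p" "x 3 \<bullet> y 3 = 1 + l"
    using sdata_dot[OF D] by (simp_all add: seifert_def nform_def)
  have S: "h \<cdot>\<^sub>v a - b \<in> carrier_vec 2" if "a \<in> carrier_vec 2" "b \<in> carrier_vec 2" for h and a b :: "complex vec"
    using that by simp
  have eq: "\<forall>j<4. \<forall>k<4. swap_lin' i g x j \<bullet> swap_lin' i g y k = seifert l (nform p' q' r') j k"
  proof -
    consider "i = 0" | "i = 1" | "i = 2" using i by linarith
    thus ?thesis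
    proof cases
      case 1
      hence v: "g = p" "p' = p" "q' = r" "r' = p * r - q" using g new by (simp_all add: nform_def)
      show ?thesis unfolding all_less_4 v 1 swap_lin'_def seifert_def nform_def
        by (simp add: numeral_2_eq_2[symmetric] dot_lin C[unfolded One_nat_def] S tab[unfolded One_nat_def]) (simp add: algebra_simps)
    next
      case 2
      hence v: "g = r" "p' = q" "q' = q * r - p" "r' = r" using g new by (simp_all add: nform_def)
      show ?thesis unfolding all_less_4 v 2 swap_lin'_def seifert_def nform_def
        by (simp add: numeral_2_eq_2[symmetric] dot_lin C[unfolded One_nat_def] S tab[unfolded One_nat_def]) (simp add: algebra_simps)
    next
      case 3
      hence v: "g = p" "p' = p" "q' = r" "r' = p * r - q" using g new by (simp_all add: nform_def)
      show ?thesis unfolding all_less_4 v 3 swap_lin'_def seifert_def nform_def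
        by (simp add: numeral_2_eq_2[symmetric] dot_lin C[unfolded One_nat_def] S tab[unfolded One_nat_def]) (simp add: algebra_simps)
    qed
  qed
  have "swap_lin' i g x k \<in> carrier_vec 2" "swap_lin' i g y k \<in> carrier_vec 2" if "k < 4" for k
    using i that C unfolding less_3_cases less_4_cases
    by (elim disjE; simp add: swap_lin_def swap_lin'_def numeral_2_eq_2[symmetric] C[unfolded One_nat_def])+
  moreover have "nform p' q' r' 0 1 = p'" by (simp add: nform_def)
  ultimately show ?thesis using eq nz nform_sym[of p' q' r'] unfolding seifert_data_def by auto
qed

text \<open>Both sides subtract the same combination of \<open>y i\<close> and \<open>y j\<close>
  from a vector. The first equation serves the braid move, the second its inverse.\<close>

lemma refl2_swap:
  assumes D: "seifert_data l G x y" and i: "i < 3"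
  defines "g \<equiv> G i (Suc i)" and "j \<equiv> Suc i"
  shows "refl2 (y i) (x i) * refl2 (y j) (x j) = refl2 (g \<cdot>\<^sub>v y i - y j) (g \<cdot>\<^sub>v x i - x j) * refl2 (y i) (x i)"
    and "refl2 (y i) (x i) * refl2 (y j) (x j) = refl2 (y j) (x j) * refl2 (g \<cdot>\<^sub>v y j - y i) (g \<cdot>\<^sub>v x j - x i)"
proof -
  have ij: "i < 4" "j < 4" using i by (auto simp: j_def)
  have C: "x i \<in> carrier_vec 2" "x j \<in> carrier_vec 2" "y i \<in> carrier_vec 2" "y j \<in> carrier_vec 2"
    using sdata_carrier[OF D] ij by auto
  have sym: "G j i = g" using D by (simp add: seifert_data_def g_def j_def)
  have dot: "x i \<bullet> y i = 1 + l" "x i \<bullet> y j = g" "x j \<bullet> y i = l * g" "x j \<bullet> y j = 1 + l"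
    using ij sym by (simp_all add: sdata_dot[OF D] seifert_def) (simp_all add: g_def j_def)
  note dot2 = dot[unfolded scalar_prod_2[OF C(3)] scalar_prod_2[OF C(4)]]
  have lin: "a \<bullet> (u - c \<cdot>\<^sub>v v) = a \<bullet> u - c * (a \<bullet> v)" if "u \<in> carrier_vec 2" "v \<in> carrier_vec 2" for a u v and c :: complex
    using that by (simp add: scalar_prod_2 algebra_simps)
  have S: "u - c \<cdot>\<^sub>v v \<in> carrier_vec 2" "c \<cdot>\<^sub>v u - v \<in> carrier_vec 2"
    if "u \<in> carrier_vec 2" "v \<in> carrier_vec 2" for u v :: "complex vec" and c
    using that by simp_all
  have lhs: "refl2 (y i) (x i) * refl2 (y j) (x j) *\<^sub>v w = w - (x j \<bullet> w) \<cdot>\<^sub>v y j - (x i \<bullet> w - (x j \<bullet> w) * g) \<cdot>\<^sub>v y i"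
    if w: "w \<in> carrier_vec 2" for w
    using w C by (simp add: assoc_mult_mat_vec[of _ 2 2 _ 2] refl2_apply S lin dot)
  show "refl2 (y i) (x i) * refl2 (y j) (x j) = refl2 (g \<cdot>\<^sub>v y i - y j) (g \<cdot>\<^sub>v x i - x j) * refl2 (y i) (x i)"
  proof (rule mat_eq_by_vec[of _ 2 2])
    fix w :: "complex vec" assume w: "w \<in> carrier_vec 2"
    define u where "u = w - (x i \<bullet> w) \<cdot>\<^sub>v y i"
    have u: "u \<in> carrier_vec 2" using w C by (simp add: u_def)
    have "(g \<cdot>\<^sub>v x i - x j) \<bullet> u = - (x j \<bullet> w)"
      unfolding dot_lin(1)[OF C(1,2) u] unfolding u_def lin[OF w C(3)] dot by (simp add: algebra_simps)
    hence "refl2 (g \<cdot>\<^sub>v y i - y j) (g \<cdot>\<^sub>v x i - x j) * refl2 (y i) (x i) *\<^sub>v w = u + (x j \<bullet> w) \<cdot>\<^sub>v (g \<cdot>\<^sub>v y i - y j)"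
      using w C u by (simp add: assoc_mult_mat_vec[of _ 2 2 _ 2] refl2_apply S u_def[symmetric]) (auto intro!: eq_vecI)
    also have "\<dots> = w - (x j \<bullet> w) \<cdot>\<^sub>v y j - (x i \<bullet> w - (x j \<bullet> w) * g) \<cdot>\<^sub>v y i"
      using w C by (intro eq_vecI) (auto simp: u_def algebra_simps)
    finally show "refl2 (y i) (x i) * refl2 (y j) (x j) *\<^sub>v w
        = refl2 (g \<cdot>\<^sub>v y i - y j) (g \<cdot>\<^sub>v x i - x j) * refl2 (y i) (x i) *\<^sub>v w" using lhs[OF w] by simp
  qed (auto intro!: mult_carrier_mat[of _ 2 2 _ 2])
  show "refl2 (y i) (x i) * refl2 (y j) (x j) = refl2 (y j) (x j) * refl2 (g \<cdot>\<^sub>v y j - y i) (g \<cdot>\<^sub>v x j - x i)"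
  proof (rule mat_eq_by_vec[of _ 2 2])
    fix w :: "complex vec" assume w: "w \<in> carrier_vec 2"
    define s where "s = g * (x j \<bullet> w) - x i \<bullet> w"
    define u where "u = w - s \<cdot>\<^sub>v (g \<cdot>\<^sub>v y j - y i)"
    have u: "u \<in> carrier_vec 2" using w C by (simp add: u_def)
    have "refl2 (g \<cdot>\<^sub>v y j - y i) (g \<cdot>\<^sub>v x j - x i) *\<^sub>v w = u"
      using w C by (simp add: refl2_apply S dot_lin(1) u_def s_def)
    moreover have "x j \<bullet> u = x j \<bullet> w - s * g"
      unfolding u_def lin[OF w S(2)[OF C(4,3)]] dot_lin(2)[OF C(4,3,2)] dot by (simp add: algebra_simps)
    ultimately have "refl2 (y j) (x j) * refl2 (g \<cdot>\<^sub>v y j - y i) (g \<cdot>\<^sub>v x j - x i) *\<^sub>v w = u - (x j \<bullet> w - s * g) \<cdot>\<^sub>v y j"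
      using w u C by (simp add: assoc_mult_mat_vec[of _ 2 2 _ 2] refl2_apply)
    also have "\<dots> = w - (x j \<bullet> w) \<cdot>\<^sub>v y j - (x i \<bullet> w - (x j \<bullet> w) * g) \<cdot>\<^sub>v y i"
      using w C by (intro eq_vecI) (auto simp: u_def s_def algebra_simps)
    finally show "refl2 (y i) (x i) * refl2 (y j) (x j) *\<^sub>v w
        = refl2 (y j) (x j) * refl2 (g \<cdot>\<^sub>v y j - y i) (g \<cdot>\<^sub>v x j - x i) *\<^sub>v w" using lhs[OF w] by simp
  qed (auto intro!: mult_carrier_mat[of _ 2 2 _ 2])
qed

section \<open>Braiding scaled tuples\<close>

lemma SL2_GL:
  assumes "A \<in> carrier_mat 2 2" "det A = 1"
  shows "A \<in> carrier (GL 2)"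
  using det_non_zero_imp_unit[OF assms(1), of "()"] assms(2) unfolding GL_def units_of_def by simp

lemma det_scaled:
  assumes "seifert_data l G x y" "k < 4" "c * c * l = -1"
  shows "det (c \<cdot>\<^sub>m refl2 (y k) (x k)) = 1"
proof -
  have "det (c \<cdot>\<^sub>m refl2 (y k) (x k)) = c * c * det (refl2 (y k) (x k))"
    by (simp add: det_mat2 refl2_def power2_eq_square algebra_simps)
  thus ?thesis using det_refl2[OF assms(1,2)] assms(3) by simp
qed

lemma scaled_nth: "k < 4 \<Longrightarrow> scaled c x y ! k = c k \<cdot>\<^sub>m refl2 (y k) (x k)"
  by (simp add: scaled_def)

lemma length_scaled [simp]: "length (scaled c x y) = 4"
  by (simp add: scaled_def)

lemma length_braid [simp]: "Suc i < length M \<Longrightarrow> length (braid i M) = length M"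
  by (simp add: braid_def)

lemma braid_nth:
  assumes "Suc i < length M" "k < length M"
  shows "braid i M ! k = (if k = i then M ! i * M ! Suc i * inv\<^bsub>GL 2\<^esub> (M ! i) else if k = Suc i then M ! i else M ! k)"
proof -
  consider "k \<le> Suc i" | d where "k = i + 2 + d" by (metis add_2_eq_Suc' le_iff_add not_less_eq_eq)
  thus ?thesis using assms
    by cases (auto simp: braid_def nth_append min_def nth_Cons' le_Suc_eq)
qed

lemma two_scalars:
  fixes a b :: complex
  assumes that: "A \<in> carrier_mat 2 2" "B \<in> carrier_mat 2 2"
  shows "(a \<cdot>\<^sub>m A) * (b \<cdot>\<^sub>m B) = (a * b) \<cdot>\<^sub>m (A * B)"
proof -
  have "(a \<cdot>\<^sub>m A) * (b \<cdot>\<^sub>m B) = a \<cdot>\<^sub>m (A * (b \<cdot>\<^sub>m B))"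
    by (rule mult_smult_assoc_mat[of _ 2 2 _ 2]) (use that in auto)
  also have "A * (b \<cdot>\<^sub>m B) = b \<cdot>\<^sub>m (A * B)"
    by (rule mult_smult_distrib[of _ 2 2 _ 2]) (use that in auto)
  finally show ?thesis by (auto intro!: eq_matI)
qed

lemma braid_scaled:
  assumes D: "seifert_data l G x y" and i: "i < 3" and c: "c i * c i * l = -1"
  defines "g \<equiv> G i (Suc i)"
  shows "braid i (scaled c x y) = scaled (c(i := c (Suc i), Suc i := c i)) (swap_lin i g x) (swap_lin i g y)"
proof (rule nth_equalityI)
  fix k assume "k < length (braid i (scaled c x y))"
  hence k: "k < 4" using i by simp
  let ?R = "\<lambda>k. refl2 (y k) (x k)"
  let ?S = "refl2 (g \<cdot>\<^sub>v y i - y (Suc i)) (g \<cdot>\<^sub>v x i - x (Suc i))"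
  have GL: "c i \<cdot>\<^sub>m ?R i \<in> carrier (GL 2)" by (rule SL2_GL) (use det_scaled[OF D _ c] i in auto)
  note I = GL_inv_props[OF GL]
  have "(c i \<cdot>\<^sub>m ?R i) * (c (Suc i) \<cdot>\<^sub>m ?R (Suc i)) = (c (Suc i) \<cdot>\<^sub>m ?S) * (c i \<cdot>\<^sub>m ?R i)"
    by (simp add: two_scalars refl2_swap(1)[OF D i] g_def mult.commute)
  hence "(c i \<cdot>\<^sub>m ?R i) * (c (Suc i) \<cdot>\<^sub>m ?R (Suc i)) * inv\<^bsub>GL 2\<^esub> (c i \<cdot>\<^sub>m ?R i)
     = (c (Suc i) \<cdot>\<^sub>m ?S) * (c i \<cdot>\<^sub>m ?R i) * inv\<^bsub>GL 2\<^esub> (c i \<cdot>\<^sub>m ?R i)" by simp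
  also have "\<dots> = c (Suc i) \<cdot>\<^sub>m ?S"
    using I by (subst assoc_mult_mat[of _ 2 2 _ 2 _ 2]) (auto simp: right_mult_one_mat[of _ 2 2])
  finally show "braid i (scaled c x y) ! k = scaled (c(i := c (Suc i), Suc i := c i)) (swap_lin i g x) (swap_lin i g y) ! k"
    using i k by (simp add: braid_nth scaled_nth swap_lin_def)
qed (use i in simp)

text \<open>A preimage is determined by its image: entry \<open>i\<close> of \<open>N\<close>
  reappears at \<open>Suc i\<close>, and cancelling it in the conjugate yields the other
  entry.\<close>

lemma unbraid_scaled:
  assumes D: "seifert_data l G x y" and i: "i < 3" and c: "c (Suc i) * c (Suc i) * l = -1"
    and N: "length N = 4" "set N \<subseteq> carrier (GL 2)" "braid i N = scaled c x y"
  defines "g \<equiv> G i (Suc i)"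
  shows "N = scaled (c(i := c (Suc i), Suc i := c i)) (swap_lin' i g x) (swap_lin' i g y)"
proof -
  let ?R = "\<lambda>k. refl2 (y k) (x k)"
  let ?S = "refl2 (g \<cdot>\<^sub>v y (Suc i) - y i) (g \<cdot>\<^sub>v x (Suc i) - x i)"
  have nth: "scaled c x y ! k = (if k = i then N ! i * N ! Suc i * inv\<^bsub>GL 2\<^esub> (N ! i) else if k = Suc i then N ! i else N ! k)"
    if "k < 4" for k
    using N(3) braid_nth[of i N k] that i N(1) by simp
  have n: "N ! i \<in> carrier (GL 2)" "N ! Suc i \<in> carrier (GL 2)" using N i by auto
  hence nc: "N ! i \<in> carrier_mat 2 2" "N ! Suc i \<in> carrier_mat 2 2" by (auto simp: GL_carrier)
  note I = GL_inv_props[OF n(1)]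
  have e1: "N ! i = c (Suc i) \<cdot>\<^sub>m ?R (Suc i)" using nth[of "Suc i"] i by (simp add: scaled_nth)
  have "N ! i * N ! Suc i * inv\<^bsub>GL 2\<^esub> (N ! i) = c i \<cdot>\<^sub>m ?R i" using nth[of i] i by (simp add: scaled_nth)
  hence "(c i \<cdot>\<^sub>m ?R i) * N ! i = N ! i * N ! Suc i * inv\<^bsub>GL 2\<^esub> (N ! i) * N ! i" by simp
  also have "\<dots> = N ! i * N ! Suc i"
    using I nc by (subst assoc_mult_mat[of _ 2 2 _ 2 _ 2]) (auto simp: right_mult_one_mat[of _ 2 2] intro!: mult_carrier_mat[of _ 2 2 _ 2])
  finally have "N ! i * N ! Suc i = (c i \<cdot>\<^sub>m ?R i) * (c (Suc i) \<cdot>\<^sub>m ?R (Suc i))" using e1 by simp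
  also have "\<dots> = (c (Suc i) \<cdot>\<^sub>m ?R (Suc i)) * (c i \<cdot>\<^sub>m ?S)"
    by (simp add: two_scalars refl2_swap(2)[OF D i] g_def mult.commute)
  finally have "N ! i * N ! Suc i = N ! i * (c i \<cdot>\<^sub>m ?S)" using e1 by simp
  hence "inv\<^bsub>GL 2\<^esub> (N ! i) * (N ! i * N ! Suc i) = inv\<^bsub>GL 2\<^esub> (N ! i) * (N ! i * (c i \<cdot>\<^sub>m ?S))" by simp
  hence e2: "N ! Suc i = c i \<cdot>\<^sub>m ?S"
    using I nc by (simp add: assoc_mult_mat[of _ 2 2 _ 2 _ 2, symmetric] left_mult_one_mat[of _ 2 2])
  show ?thesis
  proof (rule nth_equalityI)
    fix k assume "k < length N"
    thus "N ! k = scaled (c(i := c (Suc i), Suc i := c i)) (swap_lin' i g x) (swap_lin' i g y) ! k"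
      using N(1) nth[of k] e1 e2 by (simp add: scaled_nth swap_lin'_def split: if_splits)
  qed (use N in simp)
qed

section \<open>Finiteness of the orbits\<close>

definition fam4 :: "complex \<Rightarrow> complex \<Rightarrow> gint \<Rightarrow> complex mat list set" where
  "fam4 l m t = {N. \<exists>c x y p q r. N = scaled c x y \<and> good_triple p q r \<and> trace_inv p q r = t \<and>
     seifert_data l (cform p q r) x y \<and> (\<forall>k<4. c k = m \<or> c k = - m)}"

lemma swap_good_data:
  assumes l: "type_eigenvalue l t" and good: "good_triple p q r" "trace_inv p q r = t"
    and D: "seifert_data l (cform p q r) x y" and i: "i < 3"
  defines "g \<equiv> cform p q r i (Suc i)"
  shows "braid_triple i (p, q, r) = (p', q', r') \<Longrightarrow> seifert_data l (cform p' q' r') (swap_lin i g x) (swap_lin i g y)"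
    and "unbraid_triple i (p, q, r) = (p', q', r') \<Longrightarrow> seifert_data l (cform p' q' r') (swap_lin' i g x) (swap_lin' i g y)"
proof -
  assume b: "braid_triple i (p, q, r) = (p', q', r')"
  have good': "good_triple p' q' r'" "trace_inv p' q' r' = t" using good_triple_braid[OF good] b by blast+
  have "(evc p', evc q', evc r') = (if i = 1 then (evc p * evc r - evc q, evc p, evc r) else (evc p, evc p * evc q - evc r, evc q))"
    using b by (auto simp: braid_triple_def evc.emb.hom_minus evc.emb.hom_mult split: if_splits)
  from swap_lin_data[OF D[unfolded cform_def] i refl this good_triple_relations(2)[OF l good']]
  show "seifert_data l (cform p' q' r') (swap_lin i g x) (swap_lin i g y)" by (simp add: g_def cform_def)
next
  assume b: "unbraid_triple i (p, q, r) = (p', q', r')"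
  have good': "good_triple p' q' r'" "trace_inv p' q' r' = t" using good_triple_braid[OF good] b by blast+
  have "(evc p', evc q', evc r') = (if i = 1 then (evc q, evc q * evc r - evc p, evc r) else (evc p, evc r, evc p * evc r - evc q))"
    using b by (auto simp: unbraid_triple_def evc.emb.hom_minus evc.emb.hom_mult split: if_splits)
  from swap_lin'_data[OF D[unfolded cform_def] i refl this good_triple_relations(2)[OF l good']]
  show "seifert_data l (cform p' q' r') (swap_lin' i g x) (swap_lin' i g y)" by (simp add: g_def cform_def)
qed

lemma fam4_braid:
  assumes l: "type_eigenvalue l t" and m: "m * m * l = -1" and N: "N \<in> fam4 l m t" and i: "i < 3"
  shows "braid i N \<in> fam4 l m t"
proof -
  obtain c x y p q r where N': "N = scaled c x y" "good_triple p q r" "trace_inv p q r = t"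
    "seifert_data l (cform p q r) x y" "\<forall>k<4. c k = m \<or> c k = - m"
    using N by (auto simp: fam4_def)
  have "c i = m \<or> c i = - m" using N'(5) i by simp
  hence "c i * c i * l = -1" using m by auto
  note B = braid_scaled[of l "cform p q r" x y i c, OF N'(4) i this]
  obtain p' q' r' where b: "braid_triple i (p, q, r) = (p', q', r')" by (cases "braid_triple i (p, q, r)")
  have "good_triple p' q' r'" "trace_inv p' q' r' = t" using good_triple_braid[OF N'(2,3)] b by blast+
  moreover note swap_good_data(1)[OF l N'(2,3,4) i b]
  ultimately show ?thesis unfolding N'(1) B fam4_def using N'(5) i
    by (intro CollectI exI conjI) (rule refl, assumption+, auto)
qed

lemma fam4_unbraid:
  assumes l: "type_eigenvalue l t" and m: "m * m * l = -1" and N: "braid i N \<in> fam4 l m t" and i: "i < 3"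
    and "length N = 4" "set N \<subseteq> carrier (GL 2)"
  shows "N \<in> fam4 l m t"
proof -
  obtain c x y p q r where N': "braid i N = scaled c x y" "good_triple p q r" "trace_inv p q r = t"
    "seifert_data l (cform p q r) x y" "\<forall>k<4. c k = m \<or> c k = - m"
    using N by (auto simp: fam4_def)
  have "Suc i < 4" using i by simp
  hence "c (Suc i) = m \<or> c (Suc i) = - m" using N'(5) by blast
  hence "c (Suc i) * c (Suc i) * l = -1" using m by auto
  note B = unbraid_scaled[of l "cform p q r" x y i c, OF N'(4) i this assms(5,6) N'(1)]
  obtain p' q' r' where b: "unbraid_triple i (p, q, r) = (p', q', r')" by (cases "unbraid_triple i (p, q, r)")
  have "good_triple p' q' r'" "trace_inv p' q' r' = t" using good_triple_braid[OF N'(2,3)] b by blast+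
  moreover note swap_good_data(2)[OF l N'(2,3,4) i b]
  ultimately show ?thesis unfolding fam4_def using N'(5) i
    by (intro CollectI exI conjI) (rule B, assumption+, auto)
qed

section \<open>Conjugacy classes and finite families\<close>

lemma sim_conj_sym:
  assumes "sim_conj M N" "set M \<subseteq> carrier_mat 2 2"
  shows "sim_conj N M"
proof -
  obtain g where g: "g \<in> carrier (GL 2)" "N = map (\<lambda>A. g * A * inv\<^bsub>GL 2\<^esub> g) M" using assms(1) by (auto simp: sim_conj_def)
  define h where "h = inv\<^bsub>GL 2\<^esub> g"
  have gh: "g \<in> carrier_mat 2 2" "h \<in> carrier_mat 2 2" "g * h = 1\<^sub>m 2" "h * g = 1\<^sub>m 2"
    using GL_inv_props[OF g(1)] g(1) by (auto simp: h_def GL_carrier)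
  have h: "h \<in> carrier (GL 2)" "inv\<^bsub>GL 2\<^esub> h = g" using gh GL_inv[OF gh(2,1,4,3)] by (auto simp: GL_carrier)
  have "h * (g * A * h) * g = A" if A: "A \<in> carrier_mat 2 2" for A
  proof -
    have "h * (g * A * h) * g = (h * g) * A * (h * g)"
      using gh(1,2) A by (simp add: assoc_mult_mat[of _ 2 2 _ 2 _ 2] mult_carrier_mat[of _ 2 2 _ 2])
    thus ?thesis using gh A by (simp add: left_mult_one_mat[of _ 2 2] right_mult_one_mat[of _ 2 2])
  qed
  hence "M = map (\<lambda>A. h * A * inv\<^bsub>GL 2\<^esub> h) N"
    using assms(2) unfolding g(2) h_def[symmetric] h(2) by (auto simp: map_idI subset_iff)
  thus ?thesis using h(1) unfolding sim_conj_def by blast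
qed

lemma sim_conj_trans:
  assumes "sim_conj L M" "sim_conj M N" "set L \<subseteq> carrier_mat 2 2"
  shows "sim_conj L N"
proof -
  interpret group "GL 2" by (rule GL_group)
  obtain g where g: "g \<in> carrier (GL 2)" "M = map (\<lambda>A. g * A * inv\<^bsub>GL 2\<^esub> g) L" using assms(1) by (auto simp: sim_conj_def)
  obtain h where h: "h \<in> carrier (GL 2)" "N = map (\<lambda>A. h * A * inv\<^bsub>GL 2\<^esub> h) M" using assms(2) by (auto simp: sim_conj_def)
  have hg: "h * g \<in> carrier (GL 2)" "inv\<^bsub>GL 2\<^esub> (h * g) = inv\<^bsub>GL 2\<^esub> g * inv\<^bsub>GL 2\<^esub> h"
    using m_closed[OF h(1) g(1)] inv_mult_group[OF h(1) g(1)] by simp_all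
  have C: "g \<in> carrier_mat 2 2" "h \<in> carrier_mat 2 2" "inv\<^bsub>GL 2\<^esub> g \<in> carrier_mat 2 2" "inv\<^bsub>GL 2\<^esub> h \<in> carrier_mat 2 2"
    using g h GL_inv_props by (auto simp: GL_carrier)
  have "h * (g * A * inv\<^bsub>GL 2\<^esub> g) * inv\<^bsub>GL 2\<^esub> h = h * g * A * inv\<^bsub>GL 2\<^esub> (h * g)" if A: "A \<in> carrier_mat 2 2" for A
    unfolding hg(2) using C A by (simp add: assoc_mult_mat[of _ 2 2 _ 2 _ 2] mult_carrier_mat[of _ 2 2 _ 2])
  hence "N = map (\<lambda>A. h * g * A * inv\<^bsub>GL 2\<^esub> (h * g)) L" using assms(3) unfolding g(2) h(2) by auto
  thus ?thesis using hg(1) unfolding sim_conj_def by blast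
qed

lemma sim_conj_class_eq:
  assumes "sim_conj M N" "set M \<subseteq> carrier_mat 2 2" "set N \<subseteq> carrier_mat 2 2"
  shows "{N'. sim_conj M N'} = {N'. sim_conj N N'}"
  using sim_conj_trans[OF assms(1)] sim_conj_trans[OF sim_conj_sym[OF assms(1,2)]] assms by blast

text \<open>Closure is demanded in both directions, because the orbit is generated by steps and
  their converses.\<close>

lemma mcg_finite_by_family:
  assumes "SL2_tuple M" "M \<in> S"
    and "\<And>A B. A \<in> S \<Longrightarrow> braid_step A B \<Longrightarrow> B \<in> S" "\<And>A B. B \<in> S \<Longrightarrow> braid_step A B \<Longrightarrow> A \<in> S"
    and fin: "finite ((\<lambda>N. {N'. sim_conj N N'}) ` S)"
  shows "mcg_finite M"
proof -
  have "N \<in> S" if "equivclp braid_step M N" for N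
    using that by (induction rule: equivclp_induct) (use assms(2-4) in blast)+
  hence "{N. equivclp braid_step M N} \<subseteq> S" by auto
  thus ?thesis unfolding mcg_finite_def using assms(1) finite_subset[OF image_mono fin] by blast
qed

text \<open>The shape with \<open>take\<close>, \<open>xs\<close> and \<open>drop\<close> covers the
  tuple itself as well as an identity inserted at any place.\<close>

lemma scaled_sim_conj:
  assumes "seifert_data l G x y" "seifert_data l G x' y'" "set xs \<subseteq> {1\<^sub>m 2}" "\<And>k. k < 4 \<Longrightarrow> c k = c' k"
  shows "sim_conj (take n (scaled c x y) @ xs @ drop n' (scaled c x y)) (take n (scaled c' x' y') @ xs @ drop n' (scaled c' x' y'))"
proof -
  obtain g where g: "g \<in> carrier (GL 2)" "\<forall>k<4. g * refl2 (y k) (x k) * inv\<^bsub>GL 2\<^esub> g = refl2 (y' k) (x' k)"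
    using seifert_data_conj[OF assms(1,2)] by blast
  have gc: "g \<in> carrier_mat 2 2" "inv\<^bsub>GL 2\<^esub> g \<in> carrier_mat 2 2" "g * inv\<^bsub>GL 2\<^esub> g = 1\<^sub>m 2"
    using GL_inv_props[OF g(1)] g(1) by (auto simp: GL_carrier)
  have "map (\<lambda>A. g * A * inv\<^bsub>GL 2\<^esub> g) (scaled c x y) = scaled c' x' y'"
    unfolding scaled_def using g(2) gc assms(4) by (auto simp: conj_smult)
  moreover have "map (\<lambda>A. g * A * inv\<^bsub>GL 2\<^esub> g) xs = xs"
    using assms(3) gc by (intro map_idI) (auto simp: right_mult_one_mat[of _ 2 2])
  ultimately have "take n (scaled c' x' y') @ xs @ drop n' (scaled c' x' y')
    = map (\<lambda>A. g * A * inv\<^bsub>GL 2\<^esub> g) (take n (scaled c x y) @ xs @ drop n' (scaled c x y))"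
    by (simp add: take_map[symmetric] drop_map[symmetric])
  thus ?thesis using g(1) unfolding sim_conj_def by blast
qed

definition insert_one :: "nat \<Rightarrow> complex mat list \<Rightarrow> complex mat list" where
  "insert_one j N = take j N @ 1\<^sub>m 2 # drop j N"

text \<open>Data with a given Gram matrix are unique up to conjugation, so a class depends only on
  the triple and on four signs. The chosen \<open>d p q r\<close> represents all data of its
  triple.\<close>

lemma fam4_classes_finite:
  assumes n: "n \<le> 4" "n' \<le> 4" "set xs \<subseteq> {1\<^sub>m 2}"
  shows "finite ((\<lambda>N. {N'. sim_conj (take n N @ xs @ drop n' N) N'}) ` fam4 l m t)"
proof -
  define F where "F N = take n N @ xs @ drop n' N" for N :: "complex mat list"
  define d where "d p q r = (SOME d. seifert_data l (cform p q r) (fst d) (snd d))" for p q r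
  define K where "K = {ks. set ks \<subseteq> {m, - m} \<and> length ks = 4}"
  define H where "H = (\<lambda>((p, q, r), ks). {N'. sim_conj (F (scaled ((!) ks) (fst (d p q r)) (snd (d p q r)))) N'})"
  have FC: "set (F (scaled c x y)) \<subseteq> carrier_mat 2 2" for c x y
    using n(3) by (auto simp: F_def dest!: in_set_takeD in_set_dropD intro: scaled_carrier)
  have "(\<lambda>N. {N'. sim_conj (F N) N'}) ` fam4 l m t
     \<subseteq> H ` ((set gram_values \<times> set gram_values \<times> set gram_values) \<times> K)"
  proof (rule image_subsetI)
    fix N assume "N \<in> fam4 l m t"
    then obtain c x y p q r where N: "N = scaled c x y" "good_triple p q r" "trace_inv p q r = t"
      "seifert_data l (cform p q r) x y" "\<forall>k<4. c k = m \<or> c k = - m" by (auto simp: fam4_def)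
    define ks where "ks = map c [0..<4]"
    have ks: "ks \<in> K" using N(5) by (auto simp: K_def ks_def)
    have "seifert_data l (cform p q r) (fst (d p q r)) (snd (d p q r))"
      unfolding d_def by (rule someI[of _ "(x, y)"]) (use N in simp)
    hence "sim_conj (F N) (F (scaled ((!) ks) (fst (d p q r)) (snd (d p q r))))"
      unfolding F_def N(1) by (intro scaled_sim_conj[OF N(4)] n) (simp_all add: ks_def)
    from sim_conj_class_eq[OF this] FC
    have "{N'. sim_conj (F N) N'} = H ((p, q, r), ks)" unfolding H_def N(1) by simp
    thus "{N'. sim_conj (F N) N'} \<in> H ` ((set gram_values \<times> set gram_values \<times> set gram_values) \<times> K)"
      using ks N(2) by (auto simp: good_triple_def)
  qed
  moreover have "finite K" unfolding K_def by (rule finite_lists_length_eq) simp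
  hence "finite (H ` ((set gram_values \<times> set gram_values \<times> set gram_values) \<times> K))" by simp
  ultimately show ?thesis unfolding F_def by (rule finite_subset)
qed

lemma SL2_tuple_GL: "SL2_tuple N \<Longrightarrow> set N \<subseteq> carrier (GL 2)"
  by (auto simp: SL2_tuple_def intro: SL2_GL)

lemma mcg_finite_fam4:
  assumes l: "type_eigenvalue l t" and m: "m * m * l = -1" and N: "N \<in> fam4 l m t" "SL2_tuple N"
  shows "mcg_finite N"
proof (rule mcg_finite_by_family[OF N(2,1)])
  have len: "length A = 4" if "A \<in> fam4 l m t" for A using that by (auto simp: fam4_def)
  show "B \<in> fam4 l m t" if "A \<in> fam4 l m t" "braid_step A B" for A B
    using that fam4_braid[OF l m that(1)] len[OF that(1)] by (auto simp: braid_step_def)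
  show "A \<in> fam4 l m t" if h: "B \<in> fam4 l m t" "braid_step A B" for A B
  proof -
    obtain i where i: "SL2_tuple A" "Suc i < length A" "B = braid i A" using h by (auto simp: braid_step_def)
    hence "length A = 4" using len[OF h(1)] by simp
    thus ?thesis using fam4_unbraid[OF l m _ _ _ SL2_tuple_GL[OF i(1)]] h(1) i by simp
  qed
  show "finite ((\<lambda>N. {N'. sim_conj N N'}) ` fam4 l m t)"
    using fam4_classes_finite[of 4 4 "[]" l m t] len by (simp cong: image_cong)
qed

lemma list_4: "length N = 4 \<Longrightarrow> \<exists>a b c d. N = [a, b, c, d]"
  by (auto simp: numeral_eq_Suc length_Suc_conv)

text \<open>Braiding with the identity only moves it to the neighbouring place, and any other braid
  move acts on the remaining 4-tuple. So the family with an identity inserted anywhere is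
  closed.\<close>

lemma mcg_finite_insert_one:
  assumes l: "type_eigenvalue l t" and m: "m * m * l = -1" and N: "N \<in> fam4 l m t" and "j \<le> 4"
    and SL: "SL2_tuple (insert_one j N)"
  shows "mcg_finite (insert_one j N)"
proof (rule mcg_finite_by_family[OF SL])
  define S where "S = {insert_one j N | j N. j \<le> 4 \<and> N \<in> fam4 l m t}"
  show "insert_one j N \<in> S" using N \<open>j \<le> 4\<close> by (auto simp: S_def)
  have one: "inv\<^bsub>GL 2\<^esub> (1\<^sub>m 2) = 1\<^sub>m 2" by (rule GL_inv) auto
  have unit: "1\<^sub>m 2 * A * 1\<^sub>m 2 = A" "A * 1\<^sub>m 2 * inv\<^bsub>GL 2\<^esub> A = 1\<^sub>m 2" if "A \<in> carrier (GL 2)" for A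
    using that GL_inv_props(2)[OF that] by (auto simp: GL_carrier left_mult_one_mat[of _ 2 2] right_mult_one_mat[of _ 2 2])
  have conj1: "B = 1\<^sub>m 2" if "A \<in> carrier (GL 2)" "B \<in> carrier (GL 2)" "A * B * inv\<^bsub>GL 2\<^esub> A = 1\<^sub>m 2" for A B
  proof -
    have C: "A \<in> carrier_mat 2 2" "B \<in> carrier_mat 2 2" using that(1,2) by (auto simp: GL_carrier)
    note I = GL_inv_props[OF that(1)]
    have "A * B * inv\<^bsub>GL 2\<^esub> A * A = A * B" using C I
      by (subst assoc_mult_mat[of _ 2 2 _ 2 _ 2]) (auto simp: right_mult_one_mat[of _ 2 2] intro!: mult_carrier_mat[of _ 2 2 _ 2])
    hence "A * B = A" using C by (simp add: that(3) left_mult_one_mat[of _ 2 2])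
    hence "inv\<^bsub>GL 2\<^esub> A * (A * B) = inv\<^bsub>GL 2\<^esub> A * A" by simp
    thus ?thesis using C I by (simp add: assoc_mult_mat[of _ 2 2 _ 2 _ 2, symmetric] left_mult_one_mat[of _ 2 2])
  qed
  have fam: "length M = 4" "set M \<subseteq> carrier (GL 2)" if Mf: "M \<in> fam4 l m t" for M
  proof -
    show "length M = 4" using Mf by (auto simp: fam4_def)
    obtain c x y p q r where M: "M = scaled c x y" "seifert_data l (cform p q r) x y" "\<forall>k<4. c k = m \<or> c k = - m"
      using Mf unfolding fam4_def by blast
    have "c k * c k * l = -1" if "k < 4" for k
    proof -
      have "c k = m \<or> c k = - m" using M(3) that by blast
      thus ?thesis using m by auto
    qed
    thus "set M \<subseteq> carrier (GL 2)" unfolding M(1) scaled_def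
      by (auto intro!: SL2_GL det_scaled[OF M(2)])
  qed
  have forw: "[a * b * inv\<^bsub>GL 2\<^esub> a, a, c, d] \<in> fam4 l m t" "[a, b * c * inv\<^bsub>GL 2\<^esub> b, b, d] \<in> fam4 l m t"
    "[a, b, c * d * inv\<^bsub>GL 2\<^esub> c, c] \<in> fam4 l m t" if "[a, b, c, d] \<in> fam4 l m t" for a b c d
    using fam4_braid[OF l m that, of 0] fam4_braid[OF l m that, of 1] fam4_braid[OF l m that, of 2]
    by (simp_all add: braid_def numeral_eq_Suc)
  have backw: "[a, b, c, d] \<in> fam4 l m t" if "{a, b, c, d} \<subseteq> carrier (GL 2)"
     "[a * b * inv\<^bsub>GL 2\<^esub> a, a, c, d] \<in> fam4 l m t \<or> [a, b * c * inv\<^bsub>GL 2\<^esub> b, b, d] \<in> fam4 l m t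
      \<or> [a, b, c * d * inv\<^bsub>GL 2\<^esub> c, c] \<in> fam4 l m t" for a b c d
    using that fam4_unbraid[OF l m, of 0 "[a, b, c, d]"] fam4_unbraid[OF l m, of 1 "[a, b, c, d]"]
      fam4_unbraid[OF l m, of 2 "[a, b, c, d]"]
    by (auto simp: braid_def numeral_eq_Suc)
  \<comment> \<open>With membership as a disjunction over the five places, several of which may
    apply, each braid move becomes an equivalence of disjunctions.\<close>
  have S: "[a, b, c, d, e] \<in> S \<longleftrightarrow> a = 1\<^sub>m 2 \<and> [b, c, d, e] \<in> fam4 l m t \<or> b = 1\<^sub>m 2 \<and> [a, c, d, e] \<in> fam4 l m t
     \<or> c = 1\<^sub>m 2 \<and> [a, b, d, e] \<in> fam4 l m t \<or> d = 1\<^sub>m 2 \<and> [a, b, c, e] \<in> fam4 l m t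
     \<or> e = 1\<^sub>m 2 \<and> [a, b, c, d] \<in> fam4 l m t" (is "_ \<longleftrightarrow> ?R") for a b c d e
  proof
    assume "[a, b, c, d, e] \<in> S"
    then obtain j M where jM: "j \<le> 4" "M \<in> fam4 l m t" "[a, b, c, d, e] = insert_one j M" by (auto simp: S_def)
    obtain p q r s where M: "M = [p, q, r, s]" using list_4 fam(1)[OF jM(2)] by blast
    have "j = 0 \<or> j = 1 \<or> j = 2 \<or> j = 3 \<or> j = 4" using jM(1) by auto
    thus ?R using jM(2,3) unfolding M by (elim disjE) (simp_all add: insert_one_def numeral_eq_Suc)
  next
    assume R: ?R
    have I: "insert_one 0 [p, q, r, s] = [1\<^sub>m 2, p, q, r, s]" "insert_one 1 [p, q, r, s] = [p, 1\<^sub>m 2, q, r, s]"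
      "insert_one 2 [p, q, r, s] = [p, q, 1\<^sub>m 2, r, s]" "insert_one 3 [p, q, r, s] = [p, q, r, 1\<^sub>m 2, s]"
      "insert_one 4 [p, q, r, s] = [p, q, r, s, 1\<^sub>m 2]" for p q r s
      by (simp_all add: insert_one_def numeral_eq_Suc)
    have mem: "insert_one j M \<in> S" if "j \<le> 4" "M \<in> fam4 l m t" for j M using that by (auto simp: S_def)
    from R show "[a, b, c, d, e] \<in> S"
      using mem[of 0 "[b, c, d, e]"] mem[of 1 "[a, c, d, e]"] mem[of 2 "[a, b, d, e]"] mem[of 3 "[a, b, c, e]"]
        mem[of 4 "[a, b, c, d]"] unfolding I by auto
  qed
  have list5: "\<exists>a b c d e. A = [a, b, c, d, e]" if "length A = 5" for A :: "complex mat list"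
    using that by (auto simp: numeral_eq_Suc length_Suc_conv)
  have lenS: "length A = 5" if "A \<in> S" for A using that fam(1) by (auto simp: S_def insert_one_def)
  have br: "braid 0 [a, b, c, d, e] = [a * b * inv\<^bsub>GL 2\<^esub> a, a, c, d, e]"
    "braid 1 [a, b, c, d, e] = [a, b * c * inv\<^bsub>GL 2\<^esub> b, b, d, e]"
    "braid 2 [a, b, c, d, e] = [a, b, c * d * inv\<^bsub>GL 2\<^esub> c, c, e]"
    "braid 3 [a, b, c, d, e] = [a, b, c, d * e * inv\<^bsub>GL 2\<^esub> d, d]" for a b c d e
    by (simp_all add: braid_def numeral_eq_Suc)
  have both: "[a, b, c, d, e] \<in> S \<longleftrightarrow> braid i [a, b, c, d, e] \<in> S"
    if GL: "{a, b, c, d, e} \<subseteq> carrier (GL 2)" and i: "i < 4" for a b c d e i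
  proof -
    have G: "a \<in> carrier (GL 2)" "b \<in> carrier (GL 2)" "c \<in> carrier (GL 2)" "d \<in> carrier (GL 2)" "e \<in> carrier (GL 2)"
      using GL by auto
    have c: "u * v * inv\<^bsub>GL 2\<^esub> u = 1\<^sub>m 2 \<longleftrightarrow> v = 1\<^sub>m 2" if "u \<in> carrier (GL 2)" "v \<in> carrier (GL 2)" for u v
      using conj1[OF that] unit(2)[OF that(1)] by blast
    have u: "u = 1\<^sub>m 2 \<and> P (u * v * inv\<^bsub>GL 2\<^esub> u) \<longleftrightarrow> u = 1\<^sub>m 2 \<and> P v" if "v \<in> carrier (GL 2)" for u v and P :: "complex mat \<Rightarrow> bool"
      using unit(1)[OF that] one by metis
    have f: "[u * v * inv\<^bsub>GL 2\<^esub> u, u, v', v''] \<in> fam4 l m t \<longleftrightarrow> [u, v, v', v''] \<in> fam4 l m t"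
       "[v', u * v * inv\<^bsub>GL 2\<^esub> u, u, v''] \<in> fam4 l m t \<longleftrightarrow> [v', u, v, v''] \<in> fam4 l m t"
       "[v', v'', u * v * inv\<^bsub>GL 2\<^esub> u, u] \<in> fam4 l m t \<longleftrightarrow> [v', v'', u, v] \<in> fam4 l m t"
      if "u \<in> carrier (GL 2)" "v \<in> carrier (GL 2)" "v' \<in> carrier (GL 2)" "v'' \<in> carrier (GL 2)" for u v v' v''
      using forw[of u v v' v''] forw[of v' u v v''] forw[of v' v'' u v]
        backw[of u v v' v''] backw[of v' u v v''] backw[of v' v'' u v] that by blast+
    have "[a, b, c, d, e] \<in> S \<longleftrightarrow> braid 0 [a, b, c, d, e] \<in> S"
      unfolding br S c[OF G(1,2)] u[OF G(2), of _ "\<lambda>z. [z, c, d, e] \<in> fam4 l m t"]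
      by (simp only: f G) blast
    moreover have "[a, b, c, d, e] \<in> S \<longleftrightarrow> braid 1 [a, b, c, d, e] \<in> S"
      unfolding br S c[OF G(2,3)] u[OF G(3), of _ "\<lambda>z. [a, z, d, e] \<in> fam4 l m t"]
      by (simp only: f G) blast
    moreover have "[a, b, c, d, e] \<in> S \<longleftrightarrow> braid 2 [a, b, c, d, e] \<in> S"
      unfolding br S c[OF G(3,4)] u[OF G(4), of _ "\<lambda>z. [a, b, z, e] \<in> fam4 l m t"]
      by (simp only: f G) blast
    moreover have "[a, b, c, d, e] \<in> S \<longleftrightarrow> braid 3 [a, b, c, d, e] \<in> S"
      unfolding br S c[OF G(4,5)] u[OF G(5), of _ "\<lambda>z. [a, b, c, z] \<in> fam4 l m t"]
      by (simp only: f G) blast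
    ultimately show ?thesis using i unfolding less_4_cases by blast
  qed
  have step: "A \<in> S \<longleftrightarrow> B \<in> S" if h: "braid_step A B" "length A = 5" for A B
  proof -
    obtain i where i: "SL2_tuple A" "Suc i < length A" "B = braid i A" using h by (auto simp: braid_step_def)
    obtain a b c d e where A: "A = [a, b, c, d, e]" using list5[OF h(2)] by blast
    show ?thesis using both[of a b c d e i] SL2_tuple_GL[OF i(1)] i(2,3) unfolding A by simp
  qed
  show "B \<in> S" if "A \<in> S" "braid_step A B" for A B using step[OF that(2)] that(1) lenS by simp
  show "A \<in> S" if "B \<in> S" "braid_step A B" for A B
  proof -
    have "length A = length B" using that(2) by (auto simp: braid_step_def)
    thus ?thesis using step[OF that(2)] that(1) lenS by simp
  qed
  have "(\<lambda>N. {N'. sim_conj N N'}) ` S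
      = (\<Union>j\<in>{..4}. (\<lambda>N. {N'. sim_conj (take j N @ [1\<^sub>m 2] @ drop j N) N'}) ` fam4 l m t)"
    by (auto simp: S_def insert_one_def)
  also have "finite \<dots>" by (intro finite_UN_I fam4_classes_finite) auto
  finally show "finite ((\<lambda>N. {N'. sim_conj N N'}) ` S)" .
qed

section \<open>Equivalence of the rank 2 tuples\<close>

abbreviation good_trace :: "gint \<Rightarrow> gint \<times> gint \<times> gint \<Rightarrow> bool" where
  "good_trace t \<equiv> \<lambda>(p, q, r). good_triple p q r \<and> trace_inv p q r = t"

definition triple_data :: "complex \<Rightarrow> gint \<times> gint \<times> gint \<Rightarrow> (nat \<Rightarrow> complex vec) \<Rightarrow> (nat \<Rightarrow> complex vec) \<Rightarrow> bool" where
  "triple_data l = (\<lambda>(p, q, r). seifert_data l (cform p q r))"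

text \<open>For \<open>m^2 l = -1\<close> the scaled reflections have determinant 1 and, since
  \<open>m^4 l^2 = 1\<close>, product 1; hence the identity in the fifth place.\<close>

definition extended :: "complex \<Rightarrow> (nat \<Rightarrow> complex vec) \<Rightarrow> (nat \<Rightarrow> complex vec) \<Rightarrow> complex mat list" where
  "extended m x y = scaled (\<lambda>_. m) x y @ [1\<^sub>m 2]"

lemma triple_data_exists:
  assumes "type_eigenvalue l t" "good_trace t \<tau>"
  shows "\<exists>x y. triple_data l \<tau> x y"
proof -
  obtain p q r where \<tau>: "\<tau> = (p, q, r)" by (cases \<tau>)
  show ?thesis
    using seifert_data_exists[OF good_triple_relations(2) good_triple_relations(1), of l t p q r t] assms
    by (simp add: \<tau> triple_data_def cform_def)
qed

lemma SL2_tuple_scaled: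
  assumes l: "type_eigenvalue l t" and m: "m * m * l = -1" and \<tau>: "good_trace t \<tau>" and D: "triple_data l \<tau> x y"
  shows "SL2_tuple (scaled (\<lambda>_. m) x y)" "SL2_tuple (extended m x y)"
proof -
  obtain p q r where pqr: "\<tau> = (p, q, r)" by (cases \<tau>)
  have D': "seifert_data l (cform p q r) x y" using D by (simp add: pqr triple_data_def)
  have good: "good_triple p q r" "trace_inv p q r = t" using \<tau> by (simp_all add: pqr)
  have P: "refl2 (y 0) (x 0) * (refl2 (y 1) (x 1) * (refl2 (y 2) (x 2) * refl2 (y 3) (x 3))) = (l * l) \<cdot>\<^sub>m 1\<^sub>m 2"
    by (rule product_refl2[OF D'[unfolded cform_def] good_triple_relations(1)[OF l good]])
  have "m * (m * (m * m)) * (l * l) = (m * m * l) * (m * m * l)" by (simp add: algebra_simps)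
  hence m4: "m * (m * (m * m)) * (l * l) = 1" using m by simp
  have "(m \<cdot>\<^sub>m refl2 (y 0) (x 0)) * ((m \<cdot>\<^sub>m refl2 (y 1) (x 1)) * ((m \<cdot>\<^sub>m refl2 (y 2) (x 2)) * (m \<cdot>\<^sub>m refl2 (y 3) (x 3))))
      = (m * (m * (m * m))) \<cdot>\<^sub>m (refl2 (y 0) (x 0) * (refl2 (y 1) (x 1) * (refl2 (y 2) (x 2) * refl2 (y 3) (x 3))))"
    by (simp add: two_scalars mult_carrier_mat[of _ 2 2 _ 2])
  also have "\<dots> = 1\<^sub>m 2" unfolding P using m4 by (auto intro!: eq_matI simp: mult.assoc)
  finally have Q: "(m \<cdot>\<^sub>m refl2 (y 0) (x 0)) * ((m \<cdot>\<^sub>m refl2 (y 1) (x 1)) * ((m \<cdot>\<^sub>m refl2 (y 2) (x 2)) * (m \<cdot>\<^sub>m refl2 (y 3) (x 3))))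
      = 1\<^sub>m 2" .
  have "mat_prod 2 (scaled (\<lambda>_. m) x y) = 1\<^sub>m 2" "mat_prod 2 (extended m x y) = 1\<^sub>m 2"
    using Q unfolding extended_def scaled_list mat_prod_def by (simp_all add: right_mult_one_mat[of _ 2 2])
  moreover have "\<forall>A\<in>set (scaled (\<lambda>_. m) x y). A \<in> carrier_mat 2 2 \<and> det A = 1"
    using det_scaled[OF D' _ m] by (auto simp: scaled_def)
  ultimately show "SL2_tuple (scaled (\<lambda>_. m) x y)" "SL2_tuple (extended m x y)"
    by (auto simp: SL2_tuple_def extended_def)
qed

lemma mcg_finite_tuples:
  assumes l: "type_eigenvalue l t" and m: "m * m * l = -1" and \<tau>: "good_trace t \<tau>" and D: "triple_data l \<tau> x y"
  shows "mcg_finite (scaled (\<lambda>_. m) x y)" "mcg_finite (extended m x y)"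
proof -
  note S = SL2_tuple_scaled[OF assms]
  obtain p q r where pqr: "\<tau> = (p, q, r)" by (cases \<tau>)
  have F: "scaled (\<lambda>_. m) x y \<in> fam4 l m t"
    unfolding fam4_def using \<tau> D
    by (intro CollectI exI[of _ "\<lambda>_. m"] exI[of _ x] exI[of _ y] exI[of _ p] exI[of _ q] exI[of _ r])
      (simp add: pqr triple_data_def)
  show "mcg_finite (scaled (\<lambda>_. m) x y)" by (rule mcg_finite_fam4[OF l m F S(1)])
  have "insert_one 4 (scaled (\<lambda>_. m) x y) = extended m x y" by (simp add: insert_one_def extended_def)
  thus "mcg_finite (extended m x y)" using mcg_finite_insert_one[OF l m F, of 4] S(2) by simp
qed

lemma tuple_equiv_refl: "tuple_equiv M M"
  by (simp add: tuple_equiv_def)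

lemma tuple_equiv_sym: "tuple_equiv M N \<Longrightarrow> tuple_equiv N M"
  unfolding tuple_equiv_def by (rule equivclp_sym)

lemma tuple_equiv_trans: "tuple_equiv M N \<Longrightarrow> tuple_equiv N N' \<Longrightarrow> tuple_equiv M N'"
  unfolding tuple_equiv_def by (rule equivclp_trans)

lemma tuple_equivI: "SL2_tuple M \<Longrightarrow> sim_conj M N \<or> braid_step M N \<or> sign_change M N \<Longrightarrow> tuple_equiv M N"
  unfolding tuple_equiv_def by (rule r_into_equivclp) simp

lemma extended_conj:
  assumes "type_eigenvalue l t" "m * m * l = -1" "good_trace t \<tau>" "triple_data l \<tau> x y" "triple_data l \<tau> x' y'"
  shows "tuple_equiv (extended m x y) (extended m x' y')"
proof -
  obtain p q r where pqr: "\<tau> = (p, q, r)" by (cases \<tau>)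
  have "sim_conj (extended m x y) (extended m x' y')"
    using scaled_sim_conj[of l "cform p q r" x y x' y' "[1\<^sub>m 2]" "\<lambda>_. m" "\<lambda>_. m" 4 4] assms(4,5)
    by (simp add: extended_def pqr triple_data_def)
  thus ?thesis using tuple_equivI SL2_tuple_scaled(2)[OF assms(1-4)] by blast
qed

lemma extended_braid:
  assumes l: "type_eigenvalue l t" and m: "m * m * l = -1" and \<tau>: "good_trace t \<tau>" and D: "triple_data l \<tau> x y" and i: "i < 3"
  shows "good_trace t (braid_triple i \<tau>)" "\<exists>x' y'. triple_data l (braid_triple i \<tau>) x' y' \<and> tuple_equiv (extended m x y) (extended m x' y')"
proof -
  obtain p q r where pqr: "\<tau> = (p, q, r)" by (cases \<tau>)
  obtain p' q' r' where b: "braid_triple i (p, q, r) = (p', q', r')" by (cases "braid_triple i (p, q, r)")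
  have D': "seifert_data l (cform p q r) x y" using D by (simp add: pqr triple_data_def)
  have good: "good_triple p q r" "trace_inv p q r = t" using \<tau> by (simp_all add: pqr)
  have "good_triple p' q' r'" "trace_inv p' q' r' = t" using good_triple_braid[OF good] b by blast+
  thus "good_trace t (braid_triple i \<tau>)" by (simp add: pqr b)
  define g where "g = cform p q r i (Suc i)"
  have "seifert_data l (cform p' q' r') (swap_lin i g x) (swap_lin i g y)"
    unfolding g_def by (rule swap_good_data(1)[OF l good D' i b])
  moreover have "braid i (extended m x y) = extended m (swap_lin i g x) (swap_lin i g y)"
  proof -
    have "braid i (scaled (\<lambda>_. m) x y @ [1\<^sub>m 2]) = braid i (scaled (\<lambda>_. m) x y) @ [1\<^sub>m 2]"
      using i by (simp add: braid_def nth_append)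
    also have "braid i (scaled (\<lambda>_. m) x y) = scaled (\<lambda>_. m) (swap_lin i g x) (swap_lin i g y)"
      using braid_scaled[OF D' i, of "\<lambda>_. m"] m by (simp add: g_def fun_upd_def)
    finally show ?thesis by (simp add: extended_def)
  qed
  hence "braid_step (extended m x y) (extended m (swap_lin i g x) (swap_lin i g y))"
    unfolding braid_step_def using SL2_tuple_scaled(2)[OF l m \<tau> D] i
    by (intro conjI exI[of _ i]) (simp_all add: extended_def)
  hence "tuple_equiv (extended m x y) (extended m (swap_lin i g x) (swap_lin i g y))"
    using tuple_equivI SL2_tuple_scaled(2)[OF l m \<tau> D] by blast
  ultimately show "\<exists>x' y'. triple_data l (braid_triple i \<tau>) x' y' \<and> tuple_equiv (extended m x y) (extended m x' y')"
    unfolding pqr b triple_data_def by auto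
qed

text \<open>Replacing the roots \<open>a\<close> by \<open>- a\<close> does not change the reflections.\<close>

lemma seifert_data_flip:
  assumes D: "seifert_data l (nform p q r) x y" and \<epsilon>: "\<And>k. \<epsilon> k = 1 \<or> \<epsilon> k = (-1 :: complex)"
    and G: "\<And>j k. j < 4 \<Longrightarrow> k < 4 \<Longrightarrow> nform p' q' r' j k = \<epsilon> j * \<epsilon> k * nform p q r j k"
  shows "seifert_data l (nform p' q' r') (\<lambda>k. \<epsilon> k \<cdot>\<^sub>v x k) (\<lambda>k. \<epsilon> k \<cdot>\<^sub>v y k)"
proof -
  note C = sdata_carrier[OF D]
  have sq: "\<epsilon> k * \<epsilon> k = 1" "\<epsilon> k * (\<epsilon> k * z) = z" for k z using \<epsilon>[of k] by auto
  have "(\<epsilon> j \<cdot>\<^sub>v x j) \<bullet> (\<epsilon> k \<cdot>\<^sub>v y k) = seifert l (nform p' q' r') j k" if jk: "j < 4" "k < 4" for j k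
  proof -
    have "(\<epsilon> j \<cdot>\<^sub>v x j) \<bullet> (\<epsilon> k \<cdot>\<^sub>v y k) = \<epsilon> j * \<epsilon> k * (x j \<bullet> y k)"
      using C[OF jk(1)] C[OF jk(2)] by (simp add: scalar_prod_2 algebra_simps)
    also have "\<dots> = seifert l (nform p' q' r') j k"
      using sq unfolding sdata_dot[OF D jk] seifert_def G[OF jk] by (auto simp: algebra_simps)
    finally show ?thesis .
  qed
  note dot = this
  have "nform p' q' r' 0 1 * nform p' q' r' 0 1 = nform p q r 0 1 * nform p q r 0 1"
    using G[of 0 1] sq[of 0] sq[of 1] by (simp add: mult.assoc mult.left_commute)
  hence "l * nform p' q' r' 0 1 * nform p' q' r' 0 1 = l * nform p q r 0 1 * nform p q r 0 1" by (simp only: mult.assoc)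
  hence nz: "(1 + l) * (1 + l) - l * nform p' q' r' 0 1 * nform p' q' r' 0 1 \<noteq> 0"
    using D unfolding seifert_data_def by metis
  have C': "\<epsilon> k \<cdot>\<^sub>v x k \<in> carrier_vec 2" "\<epsilon> k \<cdot>\<^sub>v y k \<in> carrier_vec 2" if "k < 4" for k
    using C[OF that] by simp_all
  show ?thesis
    unfolding seifert_data_def using dot nz C' nform_sym[of p' q' r'] by blast
qed

text \<open>The effect of negating the roots 0 and 3, or the roots 1 and 3; both sign changes
  preserve the normal form.\<close>

definition flip_triple :: "nat \<Rightarrow> gint \<times> gint \<times> gint \<Rightarrow> gint \<times> gint \<times> gint" where
  "flip_triple i = (\<lambda>(p, q, r). if i = 0 then (- p, - q, r) else (- p, q, - r))"

lemma gram_values_uminus_check: "\<forall>p\<in>set gram_values. - p \<in> set gram_values"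
  by code_simp

lemma gram_values_uminus: "p \<in> set gram_values \<Longrightarrow> - p \<in> set gram_values"
  using gram_values_uminus_check by blast

lemma extended_flip:
  assumes l: "type_eigenvalue l t" and m: "m * m * l = -1" and \<tau>: "good_trace t \<tau>" and D: "triple_data l \<tau> x y"
  shows "good_trace t (flip_triple i \<tau>)" "\<exists>x' y'. triple_data l (flip_triple i \<tau>) x' y' \<and> tuple_equiv (extended m x y) (extended m x' y')"
proof -
  obtain p q r where pqr: "\<tau> = (p, q, r)" by (cases \<tau>)
  have D': "seifert_data l (nform (evc p) (evc q) (evc r)) x y" using D by (simp add: pqr triple_data_def cform_def)
  show "good_trace t (flip_triple i \<tau>)"
    using \<tau> by (auto simp: pqr flip_triple_def good_triple_def trace_inv_def gram_values_uminus)
  define \<epsilon> where "\<epsilon> k = (if k = 3 \<or> k = (if i = 0 then 0 else 1) then -1 else 1 :: complex)" for k :: nat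
  obtain p' q' r' where b: "flip_triple i (p, q, r) = (p', q', r')" by (cases "flip_triple i (p, q, r)")
  have "seifert_data l (cform p' q' r') (\<lambda>k. \<epsilon> k \<cdot>\<^sub>v x k) (\<lambda>k. \<epsilon> k \<cdot>\<^sub>v y k)"
    unfolding cform_def
  proof (rule seifert_data_flip[OF D'])
    show "\<epsilon> k = 1 \<or> \<epsilon> k = -1" for k by (simp add: \<epsilon>_def)
    show "nform (evc p') (evc q') (evc r') j k = \<epsilon> j * \<epsilon> k * nform (evc p) (evc q) (evc r) j k" if "j < 4" "k < 4" for j k
    proof (cases "i = 0")
      case True
      hence "p' = - p" "q' = - q" "r' = r" using b by (auto simp: flip_triple_def)
      thus ?thesis using that True unfolding less_4_cases
        by (elim disjE) (simp_all add: \<epsilon>_def nform_def evc.emb.hom_uminus)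
    next
      case False
      hence "p' = - p" "q' = q" "r' = - r" using b by (auto simp: flip_triple_def)
      thus ?thesis using that False unfolding less_4_cases
        by (elim disjE) (simp_all add: \<epsilon>_def nform_def evc.emb.hom_uminus)
    qed
  qed
  moreover have "refl2 (\<epsilon> k \<cdot>\<^sub>v y k) (\<epsilon> k \<cdot>\<^sub>v x k) = refl2 (y k) (x k)" if "k < 4" for k
    using sdata_carrier[OF D' that] by (auto intro!: eq_matI simp: refl2_def \<epsilon>_def)
  hence "extended m (\<lambda>k. \<epsilon> k \<cdot>\<^sub>v x k) (\<lambda>k. \<epsilon> k \<cdot>\<^sub>v y k) = extended m x y"
    by (simp add: extended_def scaled_def)
  ultimately show "\<exists>x' y'. triple_data l (flip_triple i \<tau>) x' y' \<and> tuple_equiv (extended m x y) (extended m x' y')"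
    unfolding pqr b triple_data_def using tuple_equiv_refl by (metis case_prod_conv)
qed

section \<open>Transitivity on the triples of a given invariant\<close>

definition triple_moves :: "gint \<times> gint \<times> gint \<Rightarrow> (gint \<times> gint \<times> gint) list" where
  "triple_moves \<tau> = [braid_triple 0 \<tau>, braid_triple 1 \<tau>, flip_triple 0 \<tau>, flip_triple 1 \<tau>]"

text \<open>Breadth-first search with a bound on the number of steps. Only soundness is proved; that
  80 steps reach every triple is seen by evaluation.\<close>

fun search :: "nat \<Rightarrow> (gint \<times> gint \<times> gint) list \<Rightarrow> (gint \<times> gint \<times> gint) list \<Rightarrow> (gint \<times> gint \<times> gint) list" where
  "search 0 seen fr = seen"
| "search (Suc n) seen [] = seen"
| "search (Suc n) seen (\<tau> # fr) = (let new = filter (\<lambda>\<sigma>. \<not> List.member seen \<sigma>) (remdups (triple_moves \<tau>)) in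
     search n (new @ seen) (fr @ new))"

lemma search_closed:
  assumes "\<And>\<tau> \<sigma>. \<tau> \<in> S \<Longrightarrow> \<sigma> \<in> set (triple_moves \<tau>) \<Longrightarrow> \<sigma> \<in> S" "set seen \<subseteq> S" "set fr \<subseteq> S"
  shows "set (search n seen fr) \<subseteq> S"
  using assms(2,3)
proof (induction n seen fr rule: search.induct)
  case (3 n seen \<tau> fr)
  have "set (filter (\<lambda>\<sigma>. \<not> List.member seen \<sigma>) (remdups (triple_moves \<tau>))) \<subseteq> S"
    using assms(1)[of \<tau>] "3.prems"(2) by auto
  thus ?case using "3.IH"[OF refl] "3.prems" by (simp add: Let_def)
qed auto

definition good_triples :: "gint \<Rightarrow> (gint \<times> gint \<times> gint) list" where
  "good_triples t = filter (\<lambda>(p, q, r). trace_inv p q r = t)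
     (List.product gram_values (List.product gram_values gram_values))"

definition all_in :: "'a list \<Rightarrow> 'a list \<Rightarrow> bool" where
  "all_in xs ys \<longleftrightarrow> (\<forall>x\<in>set xs. x \<in> set ys)"

text \<open>Any triple with the given invariant could be the base point; these are the Gram entries
  of the three explicit tuples.\<close>

definition base_triple :: "gint \<Rightarrow> gint \<times> gint \<times> gint" where
  "base_triple t = (if t = Gint 1 0 then (Gint 0 (-1), Gint (-1) 1, Gint (-1) 0)
     else if t = Gint 0 1 then (Gint (-1) 0, Gint 0 1, Gint 0 (-1))
     else (Gint 1 (-1), Gint (-1) 1, Gint (-1) 0))"

lemma search_check_1:
  "all_in (good_triples (Gint 1 0)) (search 80 [base_triple (Gint 1 0)] [base_triple (Gint 1 0)])"
  by code_simp

lemma search_check_2: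
  "all_in (good_triples (Gint 0 1)) (search 80 [base_triple (Gint 0 1)] [base_triple (Gint 0 1)])"
  by code_simp

lemma search_check_3:
  "all_in (good_triples (Gint 1 (-1))) (search 80 [base_triple (Gint 1 (-1))] [base_triple (Gint 1 (-1))])"
  by code_simp

lemma base_triple_check:
  "\<forall>t\<in>set [Gint 1 0, Gint 0 1, Gint 1 (-1)].
     good_check (base_triple t) \<and> (\<lambda>(p, q, r). trace_inv p q r) (base_triple t) = t"
  by code_simp

lemma base_triple_good: "t \<in> type_traces \<Longrightarrow> good_trace t (base_triple t)"
proof -
  assume t: "t \<in> type_traces"
  obtain p q r where b: "base_triple t = (p, q, r)" by (cases "base_triple t")
  have "good_check (p, q, r) \<and> trace_inv p q r = t"
    using bspec[OF base_triple_check, of t] t by (simp add: type_traces_def b)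
  thus ?thesis using t by (simp add: b good_check_def good_triple_def)
qed

text \<open>\<open>S\<close> quantifies over all data of a triple, so that a move may produce any
  data it likes; uniqueness up to conjugation covers the others.\<close>

lemma extended_to_base:
  assumes l: "type_eigenvalue l t" and m: "m * m * l = -1" and \<tau>: "good_trace t \<tau>" and D: "triple_data l \<tau> x y"
    and D0: "triple_data l (base_triple t) x0 y0"
  shows "tuple_equiv (extended m x0 y0) (extended m x y)"
proof -
  define S where "S = {\<tau>. good_trace t \<tau> \<and> (\<forall>x y. triple_data l \<tau> x y \<longrightarrow> tuple_equiv (extended m x0 y0) (extended m x y))}"
  have t: "t \<in> type_traces" using \<tau> by (auto simp: good_triple_def split: prod.splits)
  note b = base_triple_good[OF t]
  have base: "base_triple t \<in> S"
    unfolding S_def using b extended_conj[OF l m b D0] by simp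
  have closed: "\<sigma> \<in> S" if \<tau>: "\<tau> \<in> S" and \<sigma>: "\<sigma> \<in> set (triple_moves \<tau>)" for \<tau> \<sigma>
  proof -
    have g: "good_trace t \<tau>" using \<tau> by (simp add: S_def)
    obtain x y where D: "triple_data l \<tau> x y" using triple_data_exists[OF l g] by blast
    have e: "tuple_equiv (extended m x0 y0) (extended m x y)" using \<tau> D by (simp add: S_def)
    have "good_trace t \<sigma> \<and> (\<exists>x' y'. triple_data l \<sigma> x' y' \<and> tuple_equiv (extended m x y) (extended m x' y'))"
      using \<sigma> extended_braid[OF l m g D, of 0] extended_braid[OF l m g D, of 1]
        extended_flip[OF l m g D, of 0] extended_flip[OF l m g D, of 1]
      unfolding triple_moves_def by auto
    then obtain x' y' where g': "good_trace t \<sigma>" and D': "triple_data l \<sigma> x' y'"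
      and e': "tuple_equiv (extended m x y) (extended m x' y')" by blast
    have "tuple_equiv (extended m x0 y0) (extended m x'' y'')" if "triple_data l \<sigma> x'' y''" for x'' y''
      using tuple_equiv_trans[OF tuple_equiv_trans[OF e e'] extended_conj[OF l m g' D' that]] .
    thus ?thesis using g' by (simp add: S_def)
  qed
  have "set (search 80 [base_triple t] [base_triple t]) \<subseteq> S"
    by (rule search_closed) (use closed base in auto)
  moreover have "all_in (good_triples t) (search 80 [base_triple t] [base_triple t])"
    using t search_check_1 search_check_2 search_check_3 unfolding type_traces_def by blast
  moreover have "\<tau> \<in> set (good_triples t)"
    using \<tau> by (auto simp: good_triples_def good_triple_def)
  ultimately have "\<tau> \<in> S" unfolding all_in_def by blast
  thus ?thesis using D by (simp add: S_def)
qed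

lemma type_eigenvalue_inverse: "type_eigenvalue l t \<Longrightarrow> type_eigenvalue (inverse l) t"
proof -
  assume l: "type_eigenvalue l t"
  hence "l \<noteq> 0" by (auto simp: type_eigenvalue_def)
  hence "inverse l = cnj l" using l by (simp add: type_eigenvalue_def field_simps)
  moreover from this have "inverse (cnj l) = l" by (metis inverse_inverse_eq)
  ultimately show ?thesis using l by (simp add: type_eigenvalue_def mult.commute add.commute)
qed

lemma type_eigenvalue_unique:
  assumes "type_eigenvalue l t" "type_eigenvalue l' t"
  shows "l' = l \<or> l' = inverse l"
proof -
  have nz: "l \<noteq> 0" "l' \<noteq> 0" using assms by (auto simp: type_eigenvalue_def)
  have "l + inverse l = l' + inverse l'" using assms by (simp add: type_eigenvalue_def)
  hence "l * l * l' + l' = l' * l' * l + l" using nz by (simp add: field_simps)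
  hence "(l' - l) * (l' * l - 1) = 0" by (simp add: algebra_simps)
  hence "l' = l \<or> l * l' = 1" by (simp add: mult.commute)
  thus ?thesis using inverse_unique[of l l'] by auto
qed

text \<open>Conjugation by \<open>J = ((0, 1), (- 1, 0))\<close> is the inverse transpose on \<open>SL\<^sub>2\<close>.\<close>

lemma extended_inverse:
  assumes l: "type_eigenvalue l t" and m: "m * m * l = -1" and \<tau>: "good_trace t \<tau>" and D: "triple_data l \<tau> x y"
  shows "triple_data (inverse l) \<tau> y (\<lambda>k. inverse l \<cdot>\<^sub>v x k)"
    "tuple_equiv (extended m x y) (extended (inverse m) y (\<lambda>k. inverse l \<cdot>\<^sub>v x k))"
proof -
  obtain p q r where pqr: "\<tau> = (p, q, r)" by (cases \<tau>)
  have D': "seifert_data l (cform p q r) x y" using D by (simp add: pqr triple_data_def)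
  have l0: "l \<noteq> 0" "m \<noteq> 0" using m by auto
  show "triple_data (inverse l) \<tau> y (\<lambda>k. inverse l \<cdot>\<^sub>v x k)"
    using seifert_data_inverse[OF D' l0(1)] by (simp add: pqr triple_data_def)
  define J where "J = mat 2 2 (\<lambda>(i, j). if i = j then 0 else if i = 0 then 1 else -1 :: complex)"
  define K where "K = mat 2 2 (\<lambda>(i, j). if i = j then 0 else if i = 0 then -1 else 1 :: complex)"
  have c: "J \<in> carrier_mat 2 2" "K \<in> carrier_mat 2 2" by (simp_all add: J_def K_def)
  have JK: "J * K = 1\<^sub>m 2" "K * J = 1\<^sub>m 2"
    by (rule eq_matI; auto simp: J_def K_def scalar_prod_def less_2_cases' sum_2)+
  have inv: "inv\<^bsub>GL 2\<^esub> J = K" by (rule GL_inv[OF c JK])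
  have J: "J \<in> carrier (GL 2)" using c JK by (auto simp: GL_carrier)
  have im: "inverse m = - (m * l)" using m l0 by (simp add: field_simps)
  have conj: "J * (m \<cdot>\<^sub>m refl2 (y k) (x k)) * K = inverse m \<cdot>\<^sub>m refl2 (inverse l \<cdot>\<^sub>v x k) (y k)" if k: "k < 4" for k
  proof -
    note C = sdata_carrier[OF D' k]
    have "x k \<bullet> y k = 1 + l" using sdata_dot[OF D' k k] by (simp add: seifert_def)
    hence d: "x k $ 0 * y k $ 0 + x k $ 1 * y k $ 1 = 1 + l" using C by (simp add: scalar_prod_2)
    \<comment> \<open>\<open>J A K\<close> is the matrix of cofactors of \<open>A\<close>.\<close>
    have e: "J * A * K = mat 2 2 (\<lambda>(i, j). (if i = j then 1 else -1) * A $$ (1 - i, 1 - j))"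
      if "A \<in> carrier_mat 2 2" for A
      using that by (intro eq_matI) (auto simp: J_def K_def scalar_prod_def less_2_cases' sum_2)
    have d': "m * (1 - y k $ 1 * x k $ 1) = - (m * l) * (1 - inverse l * x k $ 0 * y k $ 0)"
      "m * (1 - y k $ 0 * x k $ 0) = - (m * l) * (1 - inverse l * x k $ 1 * y k $ 1)"
    proof -
      have "1 - y k $ 1 * x k $ 1 = - l * (1 - inverse l * x k $ 0 * y k $ 0)"
        "1 - y k $ 0 * x k $ 0 = - l * (1 - inverse l * x k $ 1 * y k $ 1)"
      proof -
        have "y k $ 1 * x k $ 1 = 1 + l - x k $ 0 * y k $ 0" "y k $ 0 * x k $ 0 = 1 + l - x k $ 1 * y k $ 1"
          using d by (simp_all add: algebra_simps)
        thus "1 - y k $ 1 * x k $ 1 = - l * (1 - inverse l * x k $ 0 * y k $ 0)"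
          "1 - y k $ 0 * x k $ 0 = - l * (1 - inverse l * x k $ 1 * y k $ 1)"
          using l0 by (simp_all only:) (simp_all add: field_simps)
      qed
      thus "m * (1 - y k $ 1 * x k $ 1) = - (m * l) * (1 - inverse l * x k $ 0 * y k $ 0)"
      "m * (1 - y k $ 0 * x k $ 0) = - (m * l) * (1 - inverse l * x k $ 1 * y k $ 1)"
        by (metis mult.assoc mult_minus_left mult_minus_right)+
    qed
    show ?thesis unfolding im
      by (subst e) (use C d' l0 in \<open>auto intro!: eq_matI simp: refl2_def less_2_cases'\<close>)
  qed
  have "map (\<lambda>A. J * A * inv\<^bsub>GL 2\<^esub> J) (extended m x y) = extended (inverse m) y (\<lambda>k. inverse l \<cdot>\<^sub>v x k)"
    using conj JK(1) right_mult_one_mat[OF c(1)] by (simp add: inv extended_def scaled_def)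
  hence "sim_conj (extended m x y) (extended (inverse m) y (\<lambda>k. inverse l \<cdot>\<^sub>v x k))"
    using J unfolding sim_conj_def by (intro bexI[of _ J]) simp_all
  thus "tuple_equiv (extended m x y) (extended (inverse m) y (\<lambda>k. inverse l \<cdot>\<^sub>v x k))"
    using tuple_equivI SL2_tuple_scaled(2)[OF assms] by blast
qed

lemma extended_sign: "sign_change (extended m x y) (extended (- m) x y)"
  unfolding sign_change_def
proof (intro exI conjI)
  show "extended (- m) x y = map2 (\<cdot>\<^sub>m) [-1, -1, -1, -1, 1] (extended m x y)"
    unfolding extended_def scaled_list by (auto intro!: eq_matI simp: refl2_def)
qed (simp_all add: extended_def)

text \<open>All choices are connected: the triple by moves, \<open>m\<close> with \<open>- m\<close>
  by four minus signs, and \<open>l\<close> with \<open>1/l\<close> by the inverse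
  transpose.\<close>

lemma extended_equiv:
  assumes l: "type_eigenvalue l t" and m: "m * m * l = -1" and \<tau>: "good_trace t \<tau>" and D: "triple_data l \<tau> x y"
    and l': "type_eigenvalue l' t" and m': "m' * m' * l' = -1" and \<tau>': "good_trace t \<tau>'" and D': "triple_data l' \<tau>' x' y'"
  shows "tuple_equiv (extended m x y) (extended m' x' y')"
proof -
  have *: "tuple_equiv (extended m x y) (extended m' x' y')"
    if l: "type_eigenvalue l t" and m: "m * m * l = -1" and \<tau>: "good_trace t \<tau>" and D: "triple_data l \<tau> x y"
      and m': "m' * m' * l = -1" and \<tau>': "good_trace t \<tau>'" and D': "triple_data l \<tau>' x' y'" for l m \<tau> x y m' \<tau>' x' y'
  proof -
    have t: "t \<in> type_traces" using \<tau> by (auto simp: good_triple_def split: prod.splits)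
    obtain x0 y0 where D0: "triple_data l (base_triple t) x0 y0"
      using triple_data_exists[OF l base_triple_good[OF t]] by blast
    have e: "tuple_equiv (extended m x y) (extended m x' y')"
      using tuple_equiv_trans[OF tuple_equiv_sym[OF extended_to_base[OF l m \<tau> D D0]] extended_to_base[OF l m \<tau>' D' D0]] .
    have "l \<noteq> 0" using m by auto
    hence "m * m = m' * m'" using m m' by (metis mult_cancel_right)
    hence "m' = m \<or> m' = - m" by (metis square_eq_iff)
    moreover have "tuple_equiv (extended m x' y') (extended (- m) x' y')"
      using tuple_equivI[OF SL2_tuple_scaled(2)[OF l m \<tau>' D']] extended_sign by blast
    ultimately show ?thesis using e tuple_equiv_trans by blast
  qed
  have "l' = l \<or> l' = inverse l" by (rule type_eigenvalue_unique[OF l l'])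
  thus ?thesis
  proof
    assume "l' = l"
    thus ?thesis using *[OF l m \<tau> D, of m' \<tau>' x' y'] m' \<tau>' D' by simp
  next
    assume li: "l' = inverse l"
    note I = extended_inverse[OF l m \<tau> D]
    have "inverse m * inverse m * l' = inverse (m * m * l)" by (simp add: li)
    hence "inverse m * inverse m * l' = -1" unfolding m by simp
    from *[OF l' this \<tau> I(1)[folded li] m' \<tau>' D'] I(2) tuple_equiv_trans show ?thesis by (simp add: li)
  qed
qed

section \<open>An invariant that separates the types\<close>

definition trace2 :: "complex mat \<Rightarrow> complex" where
  "trace2 A = A $$ (0, 0) + A $$ (1, 1)"

lemma trace2_comm:
  assumes "A \<in> carrier_mat 2 2" "B \<in> carrier_mat 2 2"
  shows "trace2 (A * B) = trace2 (B * A)"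
  using assms by (simp add: trace2_def scalar_prod_def sum_2 algebra_simps)

text \<open>Squaring removes the ambiguity of the signs, and passing to a set that of the order of
  the entries.\<close>

definition square_traces :: "complex mat list \<Rightarrow> complex set" where
  "square_traces M = (\<lambda>A. trace2 A * trace2 A) ` set M"

lemma trace_conj:
  assumes "g \<in> carrier (GL 2)" "A \<in> carrier_mat 2 2"
  shows "trace2 (g * A * inv\<^bsub>GL 2\<^esub> g) = trace2 A"
proof -
  note I = GL_inv_props[OF assms(1)]
  have g: "g \<in> carrier_mat 2 2" using assms(1) by (simp add: GL_carrier)
  have "trace2 (g * A * inv\<^bsub>GL 2\<^esub> g) = trace2 (inv\<^bsub>GL 2\<^esub> g * (g * A))"
    using trace2_comm[of "g * A" "inv\<^bsub>GL 2\<^esub> g"] g I assms(2) by (simp add: mult_carrier_mat[of _ 2 2 _ 2])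
  also have "inv\<^bsub>GL 2\<^esub> g * (g * A) = A"
    using I g assms(2) by (simp add: assoc_mult_mat[of _ 2 2 _ 2 _ 2, symmetric] left_mult_one_mat[of _ 2 2])
  finally show ?thesis .
qed

lemma tuple_equiv_square_traces:
  assumes "tuple_equiv M N"
  shows "square_traces M = square_traces N"
proof -
  have step: "square_traces M = square_traces N"
    if S: "SL2_tuple M" and h: "sim_conj M N \<or> braid_step M N \<or> sign_change M N" for M N
  proof -
    have GL: "A \<in> carrier (GL 2)" "A \<in> carrier_mat 2 2" if "A \<in> set M" for A
      using S SL2_tuple_GL[OF S] that by (auto simp: SL2_tuple_def)
    from h show ?thesis
    proof (elim disjE)
      assume "sim_conj M N"
      then obtain g where g: "g \<in> carrier (GL 2)" "N = map (\<lambda>A. g * A * inv\<^bsub>GL 2\<^esub> g) M" by (auto simp: sim_conj_def)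
      show ?thesis unfolding square_traces_def g(2) using trace_conj[OF g(1)] GL(2) by (simp add: image_image)
    next
      assume "braid_step M N"
      then obtain i where i: "Suc i < length M" "N = braid i M" by (auto simp: braid_step_def)
      have M: "M = take i M @ [M ! i, M ! Suc i] @ drop (i + 2) M"
        using i(1) by (simp add: Cons_nth_drop_Suc)
      have "trace2 (M ! i * M ! Suc i * inv\<^bsub>GL 2\<^esub> (M ! i)) = trace2 (M ! Suc i)"
        using i(1) by (intro trace_conj GL) auto
      hence "square_traces N = square_traces (take i M @ [M ! i, M ! Suc i] @ drop (i + 2) M)"
        unfolding i(2) braid_def square_traces_def by auto
      thus ?thesis using M by simp
    next
      assume "sign_change M N"
      then obtain es where es: "length es = length M" "set es \<subseteq> {1, -1}" "N = map2 (\<cdot>\<^sub>m) es M"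
        by (auto simp: sign_change_def)
      have "trace2 (N ! k) * trace2 (N ! k) = trace2 (M ! k) * trace2 (M ! k)" if k: "k < length M" for k
      proof -
        have "es ! k \<in> set es" using es(1) k by simp
        hence "es ! k = 1 \<or> es ! k = -1" using es(2) by blast
        moreover have "trace2 (e \<cdot>\<^sub>m A) = e * trace2 A" if "A \<in> carrier_mat 2 2" for e and A :: "complex mat"
          using that by (simp add: trace2_def distrib_left)
        ultimately show ?thesis using es(1,3) k GL(2)[of "M ! k"] by auto
      qed
      moreover have "length N = length M" using es by simp
      ultimately have "map (\<lambda>A. trace2 A * trace2 A) N = map (\<lambda>A. trace2 A * trace2 A) M"
        by (intro nth_equalityI) simp_all
      hence "set (map (\<lambda>A. trace2 A * trace2 A) N) = set (map (\<lambda>A. trace2 A * trace2 A) M)" by (rule arg_cong)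
      thus ?thesis by (simp add: square_traces_def)
    qed
  qed
  show ?thesis using assms unfolding tuple_equiv_def
    by (induction rule: equivclp_induct) (use step in auto)
qed

text \<open>The reflections have trace \<open>1 - l\<close>, so the square is
  \<open>m^2 (1 - l)^2 = 2 - l - 1/l\<close>; the identity contributes 4.\<close>

lemma square_traces_extended:
  assumes l: "type_eigenvalue l t" and m: "m * m * l = -1" and D: "triple_data l \<tau> x y"
  shows "square_traces (extended m x y) = {evc (2 - t), 4}"
proof -
  obtain p q r where pqr: "\<tau> = (p, q, r)" by (cases \<tau>)
  have D': "seifert_data l (cform p q r) x y" using D by (simp add: pqr triple_data_def)
  have l0: "l \<noteq> 0" using m by auto
  have tr: "trace2 (m \<cdot>\<^sub>m refl2 (y k) (x k)) * trace2 (m \<cdot>\<^sub>m refl2 (y k) (x k)) = evc (2 - t)" if k: "k < 4" for k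
  proof -
    have "x k \<bullet> y k = 1 + l" using sdata_dot[OF D' k k] by (simp add: seifert_def)
    hence d: "x k $ 0 * y k $ 0 + x k $ 1 * y k $ 1 = 1 + l" using sdata_carrier[OF D' k] by (simp add: scalar_prod_2)
    have "trace2 (m \<cdot>\<^sub>m refl2 (y k) (x k)) = m * (2 - (x k $ 0 * y k $ 0 + x k $ 1 * y k $ 1))"
      by (simp add: trace2_def refl2_def sum_2 algebra_simps)
    hence "trace2 (m \<cdot>\<^sub>m refl2 (y k) (x k)) = m * (1 - l)" unfolding d by simp
    moreover have "m * m = - inverse l" using m l0 by (simp add: field_simps)
    hence "(m * (1 - l)) * (m * (1 - l)) = - inverse l * ((1 - l) * (1 - l))"
      by (metis mult.assoc mult.left_commute)
    moreover have "- inverse l * ((1 - l) * (1 - l)) = 2 - (l + inverse l)" using l0 by (simp add: field_simps)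
    ultimately have "trace2 (m \<cdot>\<^sub>m refl2 (y k) (x k)) * trace2 (m \<cdot>\<^sub>m refl2 (y k) (x k)) = 2 - (l + inverse l)" by simp
    also have "\<dots> = evc (2 - t)" using l by (simp add: type_eigenvalue_def evc.emb.hom_minus evc.emb.hom_numeral)
    finally show ?thesis .
  qed
  have "(\<lambda>k. trace2 (m \<cdot>\<^sub>m refl2 (y k) (x k)) * trace2 (m \<cdot>\<^sub>m refl2 (y k) (x k))) ` {..<4} = {evc (2 - t)}"
    using tr by (auto intro!: image_eqI[of _ _ 0])
  moreover have "set (extended m x y) = (\<lambda>k. m \<cdot>\<^sub>m refl2 (y k) (x k)) ` {..<4} \<union> {1\<^sub>m 2}"
    by (auto simp: extended_def scaled_def)
  moreover have "trace2 (1\<^sub>m 2) = 2" by (simp add: trace2_def)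
  ultimately show ?thesis unfolding square_traces_def by (simp add: image_Un image_image insert_commute)
qed

section \<open>Three explicit nice tuples\<close>

text \<open>Tuples in place of vectors, so that inner products and reflections can be
  evaluated.\<close>

type_synonym quad = "gint \<times> gint \<times> gint \<times> gint"

definition quad_vec :: "quad \<Rightarrow> gint vec" where
  "quad_vec = (\<lambda>(a, b, c, d). vec_of_list [a, b, c, d])"

definition quad_form :: "quad \<Rightarrow> quad \<Rightarrow> gint" where
  "quad_form = (\<lambda>(a, b, c, d) (a', b', c', d').
     (a * a' + a * a' + b * b' + b * b' + c * c' + c * c' + d * d' + d * d') - golden_int * (a * b' + b * a')
     - (b * c' + c * b') - (c * d' + d * c'))"

definition quad_refl :: "quad \<Rightarrow> quad \<Rightarrow> quad" where
  "quad_refl x y = (let f = quad_form x y in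
     (\<lambda>(a, b, c, d) (a', b', c', d'). (a' - f * a, b' - f * b, c' - f * c, d' - f * d)) x y)"

lemma quad_vec_index [simp]:
  "quad_vec (a, b, c, d) $ 0 = a" "quad_vec (a, b, c, d) $ Suc 0 = b" "quad_vec (a, b, c, d) $ 2 = c"
  "quad_vec (a, b, c, d) $ 3 = d"
  by (simp_all add: quad_vec_def numeral_eq_Suc)

lemma quad_vec_carrier [simp]: "quad_vec x \<in> carrier_vec 4" "dim_vec (quad_vec x) = 4"
proof -
  obtain a b c d where x: "x = (a, b, c, d)" by (metis prod_cases4)
  show "dim_vec (quad_vec x) = 4" by (simp add: x quad_vec_def)
  thus "quad_vec x \<in> carrier_vec 4" by (rule carrier_vecI)
qed

lemma form_quad_vec: "form golden_int (quad_vec x) (quad_vec y) = quad_form x y"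
proof -
  obtain a b c d where x: "x = (a, b, c, d)" by (metis prod_cases4)
  obtain a' b' c' d' where y: "y = (a', b', c', d')" by (metis prod_cases4)
  show ?thesis unfolding x y form_def quad_form_def by (simp add: algebra_simps)
qed

lemma quad_vec_refl: "quad_vec (quad_refl x y) = refl golden_int (quad_vec x) *\<^sub>v quad_vec y"
proof -
  obtain a b c d where x: "x = (a, b, c, d)" by (metis prod_cases4)
  obtain a' b' c' d' where y: "y = (a', b', c', d')" by (metis prod_cases4)
  have "quad_vec (quad_refl x y) = quad_vec y - quad_form x y \<cdot>\<^sub>v quad_vec x"
    by (rule vec4_eqI) (simp_all add: quad_refl_def x y Let_def)
  thus ?thesis by (simp add: refl_apply form_quad_vec)
qed

lemma refl_refl:
  assumes a: "is_root a" and b: "is_root b"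
  shows "is_root (refl golden_int a *\<^sub>v b)"
    "refl golden_int (refl golden_int a *\<^sub>v b) = refl golden_int a * refl golden_int b * refl golden_int a"
proof -
  let ?R = "refl golden_int a" and ?S = "refl golden_int b"
  have ac: "a \<in> carrier_vec 4" "form golden_int a a = 2" and bc: "b \<in> carrier_vec 4" "form golden_int b b = 2"
    using a b by (auto simp: is_root_def)
  have iso: "form golden_int (?R *\<^sub>v x) (?R *\<^sub>v y) = form golden_int x y"
    if "x \<in> carrier_vec 4" "y \<in> carrier_vec 4" for x y
    using isometry_refl[OF ac] that unfolding isometry_def by blast
  have Rc: "?R *\<^sub>v x \<in> carrier_vec 4" if "x \<in> carrier_vec 4" for x
    using that refl_carrier mult_mat_vec_carrier by blast
  show "is_root (?R *\<^sub>v b)" using Rc[OF bc(1)] iso[OF bc(1) bc(1)] bc by (simp add: is_root_def)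
  have RR: "?R *\<^sub>v (?R *\<^sub>v x) = x" if "x \<in> carrier_vec 4" for x
    using refl_involution[OF ac] that by (simp add: assoc_mult_mat_vec[of _ 4 4 _ 4, symmetric])
  have R_smult: "?R *\<^sub>v (c \<cdot>\<^sub>v b) = c \<cdot>\<^sub>v (?R *\<^sub>v b)" for c
    using ac(1) bc(1) by (intro vec4_eqI) (simp_all add: refl_apply form_smult_right Rc algebra_simps)
  show "refl golden_int (?R *\<^sub>v b) = ?R * ?S * ?R"
  proof (rule mat_eq_by_vec[of _ 4 4])
    fix v :: "gint vec" assume v: "v \<in> carrier_vec 4"
    have "form golden_int (?R *\<^sub>v b) v = form golden_int (?R *\<^sub>v b) (?R *\<^sub>v (?R *\<^sub>v v))" by (simp add: RR[OF v])
    also have "\<dots> = form golden_int b (?R *\<^sub>v v)" by (rule iso[OF bc(1) Rc[OF v]])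
    finally have "refl golden_int (?R *\<^sub>v b) *\<^sub>v v = v - form golden_int b (?R *\<^sub>v v) \<cdot>\<^sub>v (?R *\<^sub>v b)"
      using refl_apply[OF v Rc[OF bc(1)]] by simp
    also have "\<dots> = ?R *\<^sub>v (?R *\<^sub>v v - form golden_int b (?R *\<^sub>v v) \<cdot>\<^sub>v b)"
      using RR[OF v] Rc[OF v] bc(1)
      by (simp add: mult_minus_distrib_mat_vec[of _ 4 4] R_smult)
    also have "\<dots> = ?R *\<^sub>v (?S *\<^sub>v (?R *\<^sub>v v))" by (simp add: refl_apply[OF Rc[OF v] bc(1)])
    finally show "refl golden_int (?R *\<^sub>v b) *\<^sub>v v = ?R * ?S * ?R *\<^sub>v v"
      using v Rc[OF v] by (simp add: assoc_mult_mat_vec[of _ 4 4 _ 4] mult_carrier_mat[of _ 4 4 _ 4])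
  qed (auto intro!: mult_carrier_mat[of _ 4 4 _ 4])
qed

lemma crefl_refl:
  assumes "is_root a" "is_root b"
  shows "crefl (refl golden_int a *\<^sub>v b) = crefl a * crefl b * crefl a"
  unfolding crefl_def refl_refl(2)[OF assms]
  by (simp add: map_mat_evc_mult mult_carrier_mat[of _ 4 4 _ 4])

text \<open>A list of pairs is a certificate that roots can be derived from others, each new root
  being an earlier one reflected in an earlier one. A pair with equal indices yields the negative of
  a root.\<close>

fun reflected :: "quad list \<Rightarrow> (nat \<times> nat) list \<Rightarrow> quad list" where
  "reflected L [] = L"
| "reflected L ((i, j) # s) = (if i < length L \<and> j < length L then reflected (L @ [quad_refl (L ! i) (L ! j)]) s else L)"

lemma derive_generate:
  assumes S: "S \<subseteq> carrier (GL 4)"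
    and L: "\<And>x. x \<in> set L \<Longrightarrow> is_root (quad_vec x) \<and> crefl (quad_vec x) \<in> generate (GL 4) S"
    and x: "x \<in> set (reflected L s)"
  shows "is_root (quad_vec x) \<and> crefl (quad_vec x) \<in> generate (GL 4) S"
  using L x
proof (induction L s rule: reflected.induct)
  case (2 L i j s)
  show ?case
  proof (cases "i < length L \<and> j < length L")
    case True
    hence a: "is_root (quad_vec (L ! i))" "crefl (quad_vec (L ! i)) \<in> generate (GL 4) S"
      and b: "is_root (quad_vec (L ! j))" "crefl (quad_vec (L ! j)) \<in> generate (GL 4) S"
      using "2.prems"(1)[of "L ! i"] "2.prems"(1)[of "L ! j"] by auto
    have "crefl (quad_vec (L ! i)) * crefl (quad_vec (L ! j)) * crefl (quad_vec (L ! i)) \<in> generate (GL 4) S"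
      using generate.eng[OF generate.eng[OF a(2) b(2)] a(2)] by simp
    hence new: "is_root (quad_vec (quad_refl (L ! i) (L ! j))) \<and>
       crefl (quad_vec (quad_refl (L ! i) (L ! j))) \<in> generate (GL 4) S"
      using refl_refl(1)[OF a(1) b(1)] crefl_refl[OF a(1) b(1)] by (simp add: quad_vec_refl)
    show ?thesis
    proof (rule "2.IH"[OF True])
      show "is_root (quad_vec z) \<and> crefl (quad_vec z) \<in> generate (GL 4) S"
        if "z \<in> set (L @ [quad_refl (L ! i) (L ! j)])" for z
        using that new "2.prems"(1)[of z] by auto
      show "x \<in> set (reflected (L @ [quad_refl (L ! i) (L ! j)]) s)" using "2.prems"(2) True by simp
    qed
  next
    case False
    thus ?thesis using "2.prems"(1)[of x] "2.prems"(2) by auto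
  qed
qed auto

definition simple_quads :: "quad list" where
  "simple_quads = [(Gint 1 0, Gint 0 0, Gint 0 0, Gint 0 0), (Gint 0 0, Gint 1 0, Gint 0 0, Gint 0 0),
     (Gint 0 0, Gint 0 0, Gint 1 0, Gint 0 0), (Gint 0 0, Gint 0 0, Gint 0 0, Gint 1 0)]"

lemma simple_quads: "map quad_vec simple_quads = map simple_root [0..<4]"
proof (rule nth_equalityI)
  fix i assume "i < length (map quad_vec simple_quads)"
  hence i: "i = 0 \<or> i = 1 \<or> i = 2 \<or> i = 3" by (auto simp: simple_quads_def)
  thus "map quad_vec simple_quads ! i = map simple_root [0..<4] ! i"
    by (elim disjE) (auto intro!: vec4_eqI simp: simple_quads_def zero_gint_def one_gint_def)
qed (simp add: simple_quads_def)

text \<open>One certificate for each inclusion between the group generated by the reflections in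
  \<open>qs\<close> and the group generated by the simple reflections.\<close>

definition connected_to_simple :: "quad list \<Rightarrow> (nat \<times> nat) list \<Rightarrow> (nat \<times> nat) list \<Rightarrow> bool" where
  "connected_to_simple qs s s' \<longleftrightarrow> all_in qs (reflected simple_quads s) \<and> all_in simple_quads (reflected qs s')"

lemma generating_quads:
  assumes "connected_to_simple qs s s'"
  shows "generating_roots (map quad_vec qs)"
proof -
  have G30: "G30 = generate (GL 4) ((\<lambda>x. crefl (quad_vec x)) ` set simple_quads)"
  proof -
    have "(\<lambda>x. crefl (quad_vec x)) ` set simple_quads = crefl ` set (map quad_vec simple_quads)"
      by (simp add: image_image)
    also have "\<dots> = H4_simple ` {0..<4}" unfolding simple_quads by (auto simp: H4_simple_refl crefl_def)
    finally show ?thesis by (simp add: G30_def)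
  qed
  have simple: "is_root (quad_vec x)" if "x \<in> set simple_quads" for x
  proof -
    have "quad_vec x \<in> set (map quad_vec simple_quads)" using that by simp
    thus ?thesis unfolding simple_quads by (auto simp: simple_is_root)
  qed
  have 1: "is_root (quad_vec x) \<and> crefl (quad_vec x) \<in> G30" if "x \<in> set qs" for x
    unfolding G30
  proof (rule derive_generate)
    show "x \<in> set (reflected simple_quads s)" using assms that by (auto simp: connected_to_simple_def all_in_def)
    show "is_root (quad_vec z) \<and> crefl (quad_vec z) \<in> generate (GL 4) ((\<lambda>x. crefl (quad_vec x)) ` set simple_quads)"
      if "z \<in> set simple_quads" for z using simple[OF that] that by (auto intro!: generate.incl)
  qed (use simple crefl_GL in auto)
  have 2: "crefl (quad_vec x) \<in> generate (GL 4) (crefl ` set (map quad_vec qs))" if "x \<in> set simple_quads" for x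
  proof -
    have "is_root (quad_vec x) \<and> crefl (quad_vec x) \<in> generate (GL 4) (crefl ` set (map quad_vec qs))"
    proof (rule derive_generate)
      show "x \<in> set (reflected qs s')" using assms that by (auto simp: connected_to_simple_def all_in_def)
      show "is_root (quad_vec z) \<and> crefl (quad_vec z) \<in> generate (GL 4) (crefl ` set (map quad_vec qs))"
        if "z \<in> set qs" for z using 1[OF that] that by (auto intro: generate.incl)
    qed (use 1 crefl_GL in auto)
    thus ?thesis by blast
  qed
  have "generate (GL 4) (crefl ` set (map quad_vec qs)) = G30"
  proof
    show "generate (GL 4) (crefl ` set (map quad_vec qs)) \<subseteq> G30"
      unfolding G30
      by (rule group.generate_subgroup_incl[OF GL_group _ group.generate_is_subgroup[OF GL_group]])
        (use 1[unfolded G30] simple crefl_GL in auto)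
    show "G30 \<subseteq> generate (GL 4) (crefl ` set (map quad_vec qs))"
      unfolding G30
      by (rule group.generate_subgroup_incl[OF GL_group _ group.generate_is_subgroup[OF GL_group]])
        (use 1 2 crefl_GL in auto)
  qed
  thus ?thesis using 1 by (auto simp: generating_roots_def)
qed

text \<open>The matrix determinant lemma, over a commutative ring so that it applies to polynomial
  entries.\<close>

lemma det_rank_one_4:
  fixes z :: "'a::comm_ring_1"
  shows "det (mat 4 4 (\<lambda>(i, j). (if i = j then z else 0) + u i * v j))
    = z * z * z * (z + (u 0 * v 0 + u 1 * v 1 + u 2 * v 2 + u 3 * v 3))"
proof -
  have "det (mat (Suc (Suc (Suc (Suc 0)))) (Suc (Suc (Suc (Suc 0)))) (\<lambda>(i, j). (if i = j then z else 0) + u i * v j))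
    = z * z * z * (z + (u 0 * v 0 + u (Suc 0) * v (Suc 0) + u (Suc (Suc 0)) * v (Suc (Suc 0))
       + u (Suc (Suc (Suc 0))) * v (Suc (Suc (Suc 0)))))"
    unfolding det_mat_Suc by simp (simp add: algebra_simps)
  thus ?thesis by (simp add: numeral_eq_Suc)
qed

text \<open>The characteristic matrix is \<open>X - 1\<close> times the identity plus a matrix of
  rank one and trace 2, so its determinant is (X - 1)^3 (X + 1).\<close>

lemma reflection_crefl:
  assumes a: "is_root a"
  shows "reflection 4 (crefl a)"
proof -
  have ac: "a \<in> carrier_vec 4" "form golden_int a a = 2" using a by (auto simp: is_root_def)
  let ?u = "\<lambda>i. [:evc (a $ i):]" and ?v = "\<lambda>j. [:evc (coroot golden_int a $ j):]"
  have "char_poly (crefl a) = det (mat 4 4 (\<lambda>(i, j). (if i = j then [:-1, 1:] else 0) + ?u i * ?v j))"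
    unfolding char_poly_def
    by (intro arg_cong[of _ _ det] eq_matI)
      (auto simp: char_poly_matrix_def crefl_def refl_def evc.emb.hom_minus evc.emb.hom_mult one_pCons)
  also have "\<dots> = [:-1, 1:] * [:-1, 1:] * [:-1, 1:] * ([:-1, 1:] + (?u 0 * ?v 0 + ?u 1 * ?v 1 + ?u 2 * ?v 2 + ?u 3 * ?v 3))"
    by (rule det_rank_one_4)
  also have "?u 0 * ?v 0 + ?u 1 * ?v 1 + ?u 2 * ?v 2 + ?u 3 * ?v 3 = [:evc (coroot golden_int a \<bullet> a):]"
    by (simp add: scalar_prod_def sum_4 ac carrier_vecD[OF ac(1)] evc.emb.hom_add evc.emb.hom_mult algebra_simps del: coroot_index(1-4))
  also have "coroot golden_int a \<bullet> a = 2" using form_coroot[OF ac(1), of golden_int a] ac(2) by simp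
  finally have "char_poly (crefl a) = [:-1, 1:] ^ 3 * [:-(-1), 1:]"
    by (simp add: numeral_3_eq_3)
  hence "eigs (crefl a) = proots ([:-1, 1 :: complex:] ^ 3) + proots [:-(-1), 1:]"
    unfolding eigs_def by (simp only:) (rule proots_mult; simp)
  also have "\<dots> = repeat_mset 3 {#1#} + {#-1#}"
    unfolding proots_power proots_linear_factor by simp
  finally have "size {#\<mu> \<in># eigs (crefl a). \<mu> \<noteq> 1#} = 1" by (simp add: numeral_3_eq_3)
  moreover have "crefl a ^\<^sub>m 2 = 1\<^sub>m 4" using crefl_involution[OF a] by (simp add: numeral_2_eq_2)
  ultimately show ?thesis unfolding reflection_def using crefl_GL[OF a] by (intro conjI exI[of _ 2]) auto
qed

section \<open>Eigenvalues of the explicit products\<close>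

definition quad_scale :: "gint \<Rightarrow> quad \<Rightarrow> quad" where
  "quad_scale t = (\<lambda>(a, b, c, d). (t * a, t * b, t * c, t * d))"

definition quad_add :: "quad \<Rightarrow> quad \<Rightarrow> quad" where
  "quad_add = (\<lambda>(a, b, c, d) (a', b', c', d'). (a + a', b + b', c + c', d + d'))"

lemma quad_vec_linear: "quad_vec (quad_scale t x) = t \<cdot>\<^sub>v quad_vec x" "quad_vec (quad_add x y) = quad_vec x + quad_vec y"
proof -
  obtain a b c d where x: "x = (a, b, c, d)" by (metis prod_cases4)
  obtain a' b' c' d' where y: "y = (a', b', c', d')" by (metis prod_cases4)
  show "quad_vec (quad_scale t x) = t \<cdot>\<^sub>v quad_vec x" "quad_vec (quad_add x y) = quad_vec x + quad_vec y"
    unfolding x y quad_scale_def quad_add_def by (rule vec4_eqI; simp)+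
qed

text \<open>The product \<open>P\<close> of the reflections satisfies \<open>P + P\<^sup>-\<^sup>1 = t\<close>.\<close>

definition trace_condition :: "gint \<Rightarrow> quad list \<Rightarrow> bool" where
  "trace_condition t qs \<longleftrightarrow> (\<forall>e\<in>set simple_quads.
     quad_add (foldr quad_refl qs e) (foldr quad_refl (rev qs) e) = quad_scale t e)"

lemma quad_vec_foldr:
  "quad_vec (foldr quad_refl qs e) = foldr (*) (map (\<lambda>x. refl golden_int (quad_vec x)) qs) (1\<^sub>m 4) *\<^sub>v quad_vec e \<and>
   foldr (*) (map (\<lambda>x. refl golden_int (quad_vec x)) qs) (1\<^sub>m 4) \<in> carrier_mat 4 4"
  by (induction qs)
    (simp_all add: quad_vec_refl assoc_mult_mat_vec[of _ 4 4 _ 4] mult_carrier_mat[of _ 4 4 _ 4])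

lemma mat_prod_crefl:
  "mat_prod 4 (map crefl (map quad_vec qs)) = map_mat evc (foldr (*) (map (\<lambda>x. refl golden_int (quad_vec x)) qs) (1\<^sub>m 4))"
proof (induction qs)
  case (Cons x qs)
  thus ?case using quad_vec_foldr[of qs] by (simp add: mat_prod_def crefl_def map_mat_evc_mult)
qed (simp add: mat_prod_def map_mat_evc_one)

lemma trace_condition_mat:
  assumes "trace_condition t qs"
  shows "mat_prod 4 (map crefl (map quad_vec qs)) + mat_prod 4 (map crefl (map quad_vec (rev qs))) = evc t \<cdot>\<^sub>m 1\<^sub>m 4"
proof -
  let ?A = "foldr (*) (map (\<lambda>x. refl golden_int (quad_vec x)) qs) (1\<^sub>m 4)"
  let ?B = "foldr (*) (map (\<lambda>x. refl golden_int (quad_vec x)) (rev qs)) (1\<^sub>m 4)"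
  have A: "?A \<in> carrier_mat 4 4" and B: "?B \<in> carrier_mat 4 4" using quad_vec_foldr by blast+
  have len: "length simple_quads = 4" by (simp add: simple_quads_def)
  have "col (?A + ?B) j = col (t \<cdot>\<^sub>m 1\<^sub>m 4) j" if j: "j < 4" for j
  proof -
    have u: "unit_vec 4 j = quad_vec (simple_quads ! j)"
      using arg_cong[OF simple_quads, of "\<lambda>xs. xs ! j"] j len by (simp add: simple_root_def)
    have "simple_quads ! j \<in> set simple_quads" using j len by simp
    hence "quad_add (foldr quad_refl qs (simple_quads ! j)) (foldr quad_refl (rev qs) (simple_quads ! j))
        = quad_scale t (simple_quads ! j)" using assms by (simp add: trace_condition_def)
    hence "?A *\<^sub>v unit_vec 4 j + ?B *\<^sub>v unit_vec 4 j = t \<cdot>\<^sub>v unit_vec 4 j"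
      unfolding u using quad_vec_foldr by (metis quad_vec_linear)
    hence "col ?A j + col ?B j = t \<cdot>\<^sub>v unit_vec 4 j"
      unfolding mat_mult_unit_vec[OF A j] mat_mult_unit_vec[OF B j] .
    moreover have "col (?A + ?B) j = col ?A j + col ?B j" using A B j by (intro eq_vecI) auto
    moreover have "col (t \<cdot>\<^sub>m 1\<^sub>m 4) j = t \<cdot>\<^sub>v unit_vec 4 j" using j by (intro eq_vecI) auto
    ultimately show ?thesis by simp
  qed
  hence "?A + ?B = t \<cdot>\<^sub>m 1\<^sub>m 4" using A B by (intro mat_col_eqI) auto
  hence "map_mat evc (?A + ?B) = map_mat evc (t \<cdot>\<^sub>m 1\<^sub>m 4)" by simp
  moreover have "map_mat evc (?A + ?B) = map_mat evc ?A + map_mat evc ?B"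
    using A B by (intro eq_matI) (auto simp: evc.emb.hom_add)
  moreover have "map_mat evc (t \<cdot>\<^sub>m 1\<^sub>m 4) = evc t \<cdot>\<^sub>m 1\<^sub>m 4"
    by (intro eq_matI) (auto simp: evc.emb.hom_mult)
  ultimately show ?thesis unfolding mat_prod_crefl by simp
qed

lemma mat_prod_append: "A \<in> carrier_mat n n \<Longrightarrow> set As \<subseteq> carrier_mat n n \<Longrightarrow> mat_prod n (As @ [A]) = mat_prod n As * A"
proof (induction As)
  case (Cons B As)
  moreover have "mat_prod n As \<in> carrier_mat n n" if "set As \<subseteq> carrier_mat n n" for As
    using that by (induction As) (auto simp: mat_prod_def intro!: mult_carrier_mat[of _ n n _ n])
  ultimately show ?case by (simp add: mat_prod_def assoc_mult_mat[of _ n n _ n _ n])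
qed (simp add: mat_prod_def)

lemma mat_prod_GL: "set As \<subseteq> carrier (GL n) \<Longrightarrow> mat_prod n As \<in> carrier (GL n)"
proof (induction As)
  case Nil
  thus ?case using group.is_monoid[OF GL_group, THEN monoid.one_closed, of n] by (simp add: mat_prod_def)
next
  case (Cons A As)
  thus ?case using group.is_monoid[OF GL_group, THEN monoid.m_closed, of A n "mat_prod n As"] by (simp add: mat_prod_def)
qed

lemma mat_prod_inverse_tuple: "set As \<subseteq> carrier (GL n) \<Longrightarrow> mat_prod n (inverse_tuple n As) = inv\<^bsub>GL n\<^esub> (mat_prod n As)"
proof (induction As)
  case Nil
  thus ?case using monoid.inv_one[OF group.is_monoid[OF GL_group], of n] by (simp add: mat_prod_def inverse_tuple_def)
next
  case (Cons A As)
  have A: "A \<in> carrier (GL n)" "set As \<subseteq> carrier (GL n)" using Cons.prems by auto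
  have "mat_prod n (inverse_tuple n (A # As)) = mat_prod n (inverse_tuple n As @ [inv\<^bsub>GL n\<^esub> A])" by (simp add: inverse_tuple_def)
  also have "\<dots> = mat_prod n (inverse_tuple n As) * inv\<^bsub>GL n\<^esub> A"
    by (rule mat_prod_append) (use A GL_inv_props(1) in \<open>auto simp: inverse_tuple_def\<close>)
  also have "\<dots> = inv\<^bsub>GL n\<^esub> (mat_prod n As) * inv\<^bsub>GL n\<^esub> A" using Cons.IH[OF A(2)] by simp
  also have "\<dots> = inv\<^bsub>GL n\<^esub> (mat_prod n (A # As))"
    using group.inv_mult_group[OF GL_group A(1) mat_prod_GL[OF A(2)]] by (simp add: mat_prod_def)
  finally show ?case .
qed

lemma eigs_eigenvalue:
  assumes "A \<in> carrier_mat n n"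
  shows "l \<in># eigs A \<longleftrightarrow> eigenvalue A l"
proof -
  have "char_poly A \<noteq> 0" using degree_monic_char_poly[OF assms] by auto
  thus ?thesis by (simp add: eigs_def eigenvalue_root_char_poly[OF assms] count_greater_zero_iff[symmetric] order_root)
qed

text \<open>By the trace condition every eigenvalue satisfies \<open>l + 1/l = t\<close>, so only
  \<open>l\<close> and its conjugate occur. As the matrix is real, both have multiplicity 2.\<close>

lemma quads_nice:
  assumes con: "connected_to_simple qs s s'" and len: "length qs = 4" and tr: "trace_condition t qs"
    and t: "t \<in> type_traces"
  shows "\<exists>As\<in>nice_tuples 4 G30 4. \<exists>l. nice_eigenvalue 4 As l \<and> type_eigenvalue l t"
proof -
  define rs where "rs = map quad_vec qs"
  define As where "As = map crefl rs"
  have gen: "generating_roots rs" unfolding rs_def by (rule generating_quads[OF con])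
  have roots: "is_root a" if "a \<in> set rs" for a using gen that by (simp add: generating_roots_def)
  note P = inverse_product_props[OF gen, folded As_def]
  have GL: "set As \<subseteq> carrier (GL 4)" using roots crefl_GL by (auto simp: As_def)
  have "inverse_tuple 4 As = map crefl (map quad_vec (rev qs))"
    using roots by (auto simp: inverse_tuple_def As_def rs_def rev_map crefl_inv)
  hence "inverse_product 4 As = mat_prod 4 (map crefl (map quad_vec (rev qs)))"
    using mat_prod_inverse_tuple[OF GL] by (simp add: inverse_product_def)
  hence sum: "mat_prod 4 As + inverse_product 4 As = evc t \<cdot>\<^sub>m 1\<^sub>m 4"
    using trace_condition_mat[OF tr] by (simp add: As_def rs_def)
  have ev: "type_eigenvalue l t" if l: "l \<in># tuple_type 4 As" for l
  proof -
    obtain v where v: "v \<in> carrier_vec 4" "v \<noteq> 0\<^sub>v 4" "inverse_product 4 As *\<^sub>v v = l \<cdot>\<^sub>v v"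
      using l eigs_eigenvalue[OF P(2)] P(2) by (auto simp: tuple_type_def eigenvalue_def eigenvector_def)
    have n: "cnj l * l = 1" by (rule eigenvalue_norm[OF P(1) v])
    hence l0: "l \<noteq> 0" by auto
    have "l \<cdot>\<^sub>v (mat_prod 4 As *\<^sub>v v) = mat_prod 4 As *\<^sub>v (inverse_product 4 As *\<^sub>v v)"
      unfolding v(3) using P(3) v(1) by (simp add: mult_mat_vec)
    also have "\<dots> = v" using P v(1) by (simp add: assoc_mult_mat_vec[of _ 4 4 _ 4, symmetric])
    finally have Pv: "mat_prod 4 As *\<^sub>v v = inverse l \<cdot>\<^sub>v v"
      using l0 by (metis smult_smult_assoc left_inverse one_smult_vec)
    have "inverse l \<cdot>\<^sub>v v + l \<cdot>\<^sub>v v = (mat_prod 4 As + inverse_product 4 As) *\<^sub>v v"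
      using P(2,3) v(1) by (simp add: add_mult_distrib_mat_vec[of _ 4 4] Pv v(3))
    also have "\<dots> = evc t \<cdot>\<^sub>v v" unfolding sum using v(1) by (intro eq_vecI) auto
    finally have e: "inverse l \<cdot>\<^sub>v v + l \<cdot>\<^sub>v v = evc t \<cdot>\<^sub>v v" .
    obtain i where i: "i < 4" "v $ i \<noteq> 0" using v(1,2) by (metis eq_vecI carrier_vecD index_zero_vec)
    have "inverse l * v $ i + l * v $ i = evc t * v $ i" using arg_cong[OF e, of "\<lambda>w. w $ i"] i v(1) by simp
    hence s: "l + inverse l = evc t" using i(2) by (metis add.commute distrib_right mult_cancel_right)
    have "inverse l = cnj l" using n by (metis inverse_unique mult.commute)
    hence "complex_of_real (2 * Re l) = complex_of_real (ev1 t)"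
      using s by (simp add: complex_add_cnj evc_of_real)
    hence re: "2 * Re l = ev1 t" by (simp only: of_real_eq_iff)
    have "Im l \<noteq> 0"
    proof
      assume "Im l = 0"
      hence "Re l * Re l = 1" using n by (auto simp: complex_eq_iff)
      hence "Re l = 1 \<or> Re l = -1" by (simp add: square_eq_1_iff)
      thus False using re t golden_bounds by (auto simp: type_traces_def embed_Gint)
    qed
    thus ?thesis using n s by (simp add: type_eigenvalue_def)
  qed
  have size: "size (tuple_type 4 As) = 4" unfolding As_def by (rule size_type[OF gen])
  then obtain l where l: "l \<in># tuple_type 4 As" by (metis multiset_nonemptyE size_empty zero_neq_numeral)
  note le = ev[OF l]
  have "l * cnj l = 1" "Im l \<noteq> 0" using le by (auto simp: type_eigenvalue_def mult.commute)
  hence cl: "inverse l = cnj l" by (intro inverse_unique)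
  have cl2: "l \<noteq> cnj l" using \<open>Im l \<noteq> 0\<close> by (auto simp: complex_eq_iff)
  have "\<forall>z\<in>#tuple_type 4 As. z = l \<or> z = cnj l" using type_eigenvalue_unique[OF le ev] cl by auto
  hence "tuple_type 4 As = filter_mset (\<lambda>z. z = l) (tuple_type 4 As) + filter_mset (\<lambda>z. z \<noteq> l) (tuple_type 4 As)"
    "filter_mset (\<lambda>z. z \<noteq> l) (tuple_type 4 As) = filter_mset (\<lambda>z. z = cnj l) (tuple_type 4 As)"
    using cl2 by (auto intro!: filter_mset_cong simp: multiset_partition[symmetric])
  hence "size (tuple_type 4 As) = count (tuple_type 4 As) l + count (tuple_type 4 As) (cnj l)"
    by (metis filter_eq_replicate_mset size_replicate_mset size_union)
  hence "count (tuple_type 4 As) l = 2"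
    using size count_type_cnj[OF gen, of l] by (simp add: As_def)
  moreover have "l \<noteq> 1" using le by (auto simp: type_eigenvalue_def)
  moreover have "length As = 4" using len by (simp add: As_def rs_def)
  ultimately have nice: "nice_eigenvalue 4 As l" using l by (simp add: nice_eigenvalue_def)
  have "As \<in> nice_tuples 4 G30 4"
    unfolding nice_tuples_def
  proof (intro CollectI conjI ballI)
    show "length As = 4" by fact
    show "reflection 4 A" if "A \<in> set As" for A using that roots reflection_crefl by (auto simp: As_def)
    show "A \<in> G30" if "A \<in> set As" for A using that generating_roots_incl[OF gen] by (auto simp: As_def)
    show "generate (GL 4) (set As) = G30" using gen by (simp add: As_def generating_roots_def)
    show "\<exists>l. nice_eigenvalue 4 As l" using nice by blast
  qed
  thus ?thesis using nice le by blast
qed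

text \<open>In this and the next two lemmas the Gram matrix of the four roots is the normal form
  given by \<open>base_triple\<close>, and the lists of pairs derive the four roots from the simple
  roots and conversely.\<close>

lemma explicit_quads_1:
  "(\<lambda>qs. connected_to_simple qs [(1, 0), (0, 4), (2, 5), (4, 2), (2, 7), (3, 8)] [(0, 0), (2, 4), (1, 5), (2, 1), (3, 7), (8, 3)]
      \<and> trace_condition (Gint 1 0) qs)
    [(Gint 1 0, Gint 0 0, Gint 0 0, Gint 0 0), (Gint 0 0, Gint 1 0, Gint 0 0, Gint 0 0),
     (Gint 0 1, Gint 0 1, Gint 0 1, Gint 0 0), (Gint 0 1, Gint 1 1, Gint 0 1, Gint 0 1)]"
  by code_simp

lemma explicit_quads_2:
  "(\<lambda>qs. connected_to_simple qs [(1, 0), (2, 4), (0, 4)] [(0, 2), (4, 3), (3, 5), (5, 5)]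
      \<and> trace_condition (Gint 0 1) qs)
    [(Gint 0 0, Gint 0 0, Gint 1 0, Gint 0 0), (Gint 0 0, Gint 0 0, Gint 0 0, Gint 1 0),
     (Gint 1 0, Gint 0 1, Gint 0 1, Gint 0 0), (Gint 0 1, Gint 0 1, Gint 0 0, Gint 0 0)]"
  by code_simp

lemma explicit_quads_3:
  "(\<lambda>qs. connected_to_simple qs [(1, 0), (0, 4), (2, 5), (2, 4), (7, 2), (8, 3), (9, 1), (10, 3)]
        [(1, 0), (0, 4), (0, 1), (2, 6), (7, 2), (3, 5), (9, 2), (10, 10)]
      \<and> trace_condition (Gint 1 (-1)) qs)
    [(Gint 1 0, Gint 0 0, Gint 0 0, Gint 0 0), (Gint 1 0, Gint 0 1, Gint 0 0, Gint 0 0),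
     (Gint 0 1, Gint 0 1, Gint 0 1, Gint 0 0), (Gint 1 2, Gint 1 3, Gint 1 2, Gint 1 1)]"
  by code_simp

lemma nice_tuples_exist:
  assumes t: "t \<in> type_traces"
  shows "\<exists>As\<in>nice_tuples 4 G30 4. \<exists>l. nice_eigenvalue 4 As l \<and> type_eigenvalue l t"
proof -
  have "t = Gint 1 0 \<or> t = Gint 0 1 \<or> t = Gint 1 (-1)" using t by (auto simp: type_traces_def)
  thus ?thesis
    using quads_nice[OF conjunct1[OF explicit_quads_1] _ conjunct2[OF explicit_quads_1]]
      quads_nice[OF conjunct1[OF explicit_quads_2] _ conjunct2[OF explicit_quads_2]]
      quads_nice[OF conjunct1[OF explicit_quads_3] _ conjunct2[OF explicit_quads_3]] t by auto
qed

section \<open>The produced tuples\<close>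

lemma normal_roots_gram:
  assumes "normal_roots rs p q r" "i < 4" "j < 4"
  shows "cform p q r i j = evc (gram rs i j)"
proof -
  have n: "length rs = 4" "\<forall>a\<in>set rs. is_root a" "gram rs 0 1 = p" "gram rs 0 2 = q" "gram rs 1 2 = r"
    "gram rs 0 3 = r" "gram rs 1 3 = p * r - q" "gram rs 2 3 = p"
    using assms(1) by (auto simp: normal_roots_def)
  have d: "gram rs k k = 2" if "k < 4" for k using n(1,2) that by (auto simp: is_root_def)
  have s: "gram rs 1 0 = p" "gram rs 2 0 = q" "gram rs 2 1 = r" "gram rs 3 0 = r" "gram rs 3 1 = p * r - q" "gram rs 3 2 = p"
    using n(3-8) by (metis form_sym)+
  note e = n(3-8) s d[of 0] d[of 1] d[of 2] d[of 3]
  show ?thesis using assms(2,3) unfolding less_4_cases cform_def nform_def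
    by (elim disjE) (simp_all add: e e[unfolded One_nat_def] evc.emb.hom_minus evc.emb.hom_mult)
qed

text \<open>The last conclusion covers every basis of the quotient: conjugate convolutions come from
  other data of the same triple.\<close>

lemma nice_convolution:
  assumes As: "As \<in> nice_tuples 4 G30 4" and nice: "nice_eigenvalue 4 As l"
  obtains t \<tau> x y where "t \<in> type_traces" "type_eigenvalue l t" "good_trace t \<tau>" "triple_data l \<tau> x y"
    "tuple_type 4 As = {#l, l, inverse l, inverse l#}" "middle_convolution 4 l As 2 (data_mats x y)"
    "\<forall>Ms. middle_convolution 4 l As 2 Ms \<longrightarrow> (\<exists>x' y'. triple_data l \<tau> x' y' \<and> Ms = data_mats x' y')"
proof -
  obtain rs p q r where rs: "normal_roots rs p q r" "good_triple p q r" "As = map crefl rs"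
    "type_eigenvalue l (trace_inv p q r)" "tuple_type 4 As = {#l, l, inverse l, inverse l#}"
  proof (rule nice_structure[OF As nice])
    fix rs p q r assume "normal_roots rs p q r" "good_triple p q r" "As = map crefl rs"
      "type_eigenvalue l (trace_inv p q r)" "tuple_type 4 As = {#l, l, inverse l, inverse l#}"
    thus thesis by (rule that)
  qed
  let ?t = "trace_inv p q r"
  have good: "good_trace ?t (p, q, r)" using rs(2) by simp
  obtain x y where D: "triple_data l (p, q, r) x y" using triple_data_exists[OF rs(4) good] by blast
  hence D': "seifert_data l (cform p q r) x y" by (simp add: triple_data_def)
  interpret conv: convolution rs l x y
  proof
    show "length rs = 4" "\<forall>a\<in>set rs. is_root a" using rs(1) by (auto simp: normal_roots_def)
    show "l \<noteq> 1" using nice by (simp add: nice_eigenvalue_def)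
    show "seifert_data l (\<lambda>i j. evc (gram rs i j)) x y"
      by (rule seifert_data_cong[OF D']) (auto simp: normal_roots_gram[OF rs(1)] form_sym)
  qed
  show ?thesis
  proof (rule that[OF _ rs(4) good D rs(5)])
    show "?t \<in> type_traces" using rs(2) by (simp add: good_triple_def)
    show "middle_convolution 4 l As 2 (data_mats x y)" using conv.convolution_exists rs(3) by (simp add: conv.As_def)
    show "\<forall>Ms. middle_convolution 4 l As 2 Ms \<longrightarrow> (\<exists>x' y'. triple_data l (p, q, r) x' y' \<and> Ms = data_mats x' y')"
    proof (intro allI impI)
      fix Ms assume "middle_convolution 4 l As 2 Ms"
      hence "sim_conj (data_mats x y) Ms" using conv.convolution_unique rs(3) by (simp add: conv.As_def)
      then obtain x' y' where "seifert_data l (cform p q r) x' y'" "Ms = data_mats x' y'"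
        by (rule seifert_data_conjugate[OF D'])
      thus "\<exists>x' y'. triple_data l (p, q, r) x' y' \<and> Ms = data_mats x' y'" by (auto simp: triple_data_def)
    qed
  qed
qed

section \<open>Model tuples and induced tuples\<close>

lemma sign_change_sym:
  assumes "sign_change M N" shows "sign_change N M"
proof -
  obtain es where es: "length es = length M" "set es \<subseteq> {1, -1}" "prod_list es = 1" "N = map2 (\<cdot>\<^sub>m) es M"
    using assms by (auto simp: sign_change_def)
  have "M = map2 (\<cdot>\<^sub>m) es N"
  proof (rule nth_equalityI)
    fix k assume k: "k < length M"
    have "es ! k \<in> set es" using es(1) k by simp
    hence "es ! k = 1 \<or> es ! k = -1" using es(2) by blast
    moreover have "(1 :: complex) \<cdot>\<^sub>m (1 \<cdot>\<^sub>m A) = A" "(-1 :: complex) \<cdot>\<^sub>m ((-1) \<cdot>\<^sub>m A) = A" for A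
      by (auto intro!: eq_matI)
    ultimately show "M ! k = map2 (\<cdot>\<^sub>m) es N ! k" using es(1,4) k by auto
  qed (use es in simp)
  thus ?thesis using es unfolding sign_change_def by (intro exI[of _ es]) simp
qed

text \<open>The choices of \<open>l\<close>, \<open>m\<close>, the triple and the data are
  immaterial up to equivalence, by \<open>extended_equiv\<close>.\<close>

definition model_tuple :: "gint \<Rightarrow> complex mat list \<Rightarrow> bool" where
  "model_tuple t E \<longleftrightarrow> (\<exists>l m \<tau> x y. type_eigenvalue l t \<and> m * m * l = -1 \<and> good_trace t \<tau> \<and>
     triple_data l \<tau> x y \<and> E = extended m x y)"

lemma model_tuple_props:
  assumes "model_tuple t E"
  shows "SL2_tuple E" "mcg_finite E" "E ! 4 = 1\<^sub>m 2" "mcg_finite (take 4 E)" "square_traces E = {evc (2 - t), 4}"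
proof -
  obtain l m \<tau> x y where E: "type_eigenvalue l t" "m * m * l = -1" "good_trace t \<tau>" "triple_data l \<tau> x y"
    "E = extended m x y" using assms unfolding model_tuple_def by blast
  show "SL2_tuple E" "mcg_finite E" "mcg_finite (take 4 E)" "square_traces E = {evc (2 - t), 4}"
    using SL2_tuple_scaled[OF E(1-4)] mcg_finite_tuples[OF E(1-4)] square_traces_extended[OF E(1,2,4)] E(5)
    by (simp_all add: extended_def)
  show "E ! 4 = 1\<^sub>m 2" unfolding E(5) extended_def by (simp add: nth_append)
qed

lemma model_tuple_equiv: "model_tuple t E \<Longrightarrow> model_tuple t E' \<Longrightarrow> tuple_equiv E E'"
  unfolding model_tuple_def using extended_equiv by blast

lemma data_mats_list: "data_mats x y = [refl2 (y 0) (x 0), refl2 (y 1) (x 1), refl2 (y 2) (x 2), refl2 (y 3) (x 3)]"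
  by (simp add: data_mats_def upt_rec numeral_eq_Suc)

lemma data_mats_inverse:
  assumes l: "type_eigenvalue l t" and \<tau>: "good_trace t \<tau>" and D: "triple_data l \<tau> x y"
  shows "inv\<^bsub>GL 2\<^esub> (mat_prod 2 (data_mats x y)) = inverse (l * l) \<cdot>\<^sub>m 1\<^sub>m 2"
proof -
  obtain p q r where pqr: "\<tau> = (p, q, r)" by (cases \<tau>)
  have D': "seifert_data l (cform p q r) x y" using D by (simp add: pqr triple_data_def)
  have good: "good_triple p q r" "trace_inv p q r = t" using \<tau> by (simp_all add: pqr)
  have l0: "l * l \<noteq> 0" using l by (auto simp: type_eigenvalue_def)
  have "refl2 (y 0) (x 0) * (refl2 (y 1) (x 1) * (refl2 (y 2) (x 2) * refl2 (y 3) (x 3))) = (l * l) \<cdot>\<^sub>m 1\<^sub>m 2"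
    by (rule product_refl2[OF D'[unfolded cform_def] good_triple_relations(1)[OF l good]])
  hence P: "mat_prod 2 (data_mats x y) = (l * l) \<cdot>\<^sub>m 1\<^sub>m 2"
    by (simp add: mat_prod_def data_mats_list right_mult_one_mat[of _ 2 2])
  have "((l * l) \<cdot>\<^sub>m 1\<^sub>m 2) * (inverse (l * l) \<cdot>\<^sub>m 1\<^sub>m 2) = (1\<^sub>m 2 :: complex mat)"
    "(inverse (l * l) \<cdot>\<^sub>m 1\<^sub>m 2) * ((l * l) \<cdot>\<^sub>m 1\<^sub>m 2) = (1\<^sub>m 2 :: complex mat)"
    using l0 by (simp_all only: two_scalars[OF one_carrier_mat one_carrier_mat] right_inverse left_inverse)
      (auto intro!: eq_matI simp: field_simps)
  thus ?thesis unfolding P by (intro GL_inv) auto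
qed

lemma det_smult_2:
  fixes c :: complex
  shows "A \<in> carrier_mat 2 2 \<Longrightarrow> det (c \<cdot>\<^sub>m A) = c * c * det A"
  by (simp add: power2_eq_square)

text \<open>Determinant 1 forces each of the first four scalars to be \<open>m\<close> or
  \<open>- m\<close>, and the fifth to be \<open>l^2\<close> up to sign. As the scalars have product
  1, the signs have product 1.\<close>

lemma induced_model:
  assumes l: "type_eigenvalue l t" and \<tau>: "good_trace t \<tau>"
    and conv: "\<forall>Ms. middle_convolution 4 l As 2 Ms \<longrightarrow> (\<exists>x' y'. triple_data l \<tau> x' y' \<and> Ms = data_mats x' y')"
    and len: "length As = 4" and M: "induced_tuple 4 l As M"
  shows "\<exists>E. model_tuple t E \<and> sign_change M E"
proof -
  obtain Ms cs where Ms: "middle_convolution 4 l As 2 Ms" "length cs = 5" "prod_list cs = 1"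
    "M = map2 (\<cdot>\<^sub>m) cs (Ms @ [inv\<^bsub>GL 2\<^esub> (mat_prod 2 Ms)])" "\<forall>A\<in>set M. det A = 1"
    using M len by (auto simp: induced_tuple_def)
  obtain x y where D: "triple_data l \<tau> x y" and xy: "Ms = data_mats x y" using conv Ms(1) by blast
  define m where "m = csqrt (- inverse l)"
  have l0: "l \<noteq> 0" using l by (auto simp: type_eigenvalue_def)
  have "m * m = - inverse l" using power2_csqrt[of "- inverse l"] by (simp only: m_def power2_eq_square)
  hence m: "m * m * l = -1" using l0 by simp
  have m0: "m \<noteq> 0" using m by auto
  obtain p q r where pqr: "\<tau> = (p, q, r)" by (cases \<tau>)
  have D': "seifert_data l (cform p q r) x y" using D by (simp add: pqr triple_data_def)
  obtain c0 c1 c2 c3 c4 where cs: "cs = [c0, c1, c2, c3, c4]"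
    using Ms(2) by (auto simp: numeral_eq_Suc length_Suc_conv)
  have M': "M = [c0 \<cdot>\<^sub>m refl2 (y 0) (x 0), c1 \<cdot>\<^sub>m refl2 (y 1) (x 1), c2 \<cdot>\<^sub>m refl2 (y 2) (x 2), c3 \<cdot>\<^sub>m refl2 (y 3) (x 3),
     c4 \<cdot>\<^sub>m (inverse (l * l) \<cdot>\<^sub>m 1\<^sub>m 2)]"
    unfolding Ms(4) cs xy data_mats_inverse[OF l \<tau> D] by (simp add: data_mats_list)
  have scal: "\<exists>e\<in>{1, -1}. c = e * m" if "det (c \<cdot>\<^sub>m refl2 (y k) (x k)) = 1" "k < 4" for c k
  proof -
    have "c * c * - l = 1"
      using that(1) unfolding det_smult_2[OF refl2_carrier] det_refl2[OF D' that(2)] .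
    hence "c * c * l = -1" by (metis minus_minus mult_minus_right)
    hence "c * c = m * m" using m l0 by (metis mult_cancel_right)
    thus ?thesis by (auto simp: square_eq_iff)
  qed
  have dets: "det (c0 \<cdot>\<^sub>m refl2 (y 0) (x 0)) = 1" "det (c1 \<cdot>\<^sub>m refl2 (y 1) (x 1)) = 1"
    "det (c2 \<cdot>\<^sub>m refl2 (y 2) (x 2)) = 1" "det (c3 \<cdot>\<^sub>m refl2 (y 3) (x 3)) = 1"
    by (rule bspec[OF Ms(5)]; simp add: M')+
  have "\<exists>e\<in>{1, -1}. c0 = e * m" by (rule scal[OF dets(1)]) simp
  then obtain e0 where e0: "e0 \<in> {1, -1}" "c0 = e0 * m" by blast
  have "\<exists>e\<in>{1, -1}. c1 = e * m" by (rule scal[OF dets(2)]) simp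
  then obtain e1 where e1: "e1 \<in> {1, -1}" "c1 = e1 * m" by blast
  have "\<exists>e\<in>{1, -1}. c2 = e * m" by (rule scal[OF dets(3)]) simp
  then obtain e2 where e2: "e2 \<in> {1, -1}" "c2 = e2 * m" by blast
  have "\<exists>e\<in>{1, -1}. c3 = e * m" by (rule scal[OF dets(4)]) simp
  then obtain e3 where e3: "e3 \<in> {1, -1}" "c3 = e3 * m" by blast
  note e = e0 e1 e2 e3
  define e4 where "e4 = c4 * inverse (l * l)"
  have "det (c4 \<cdot>\<^sub>m (inverse (l * l) \<cdot>\<^sub>m 1\<^sub>m 2)) = 1" using Ms(5) unfolding M' by simp
  hence "e4 * e4 = 1" by (simp add: e4_def power4_eq_xxxx power2_eq_square algebra_simps)
  hence e4: "e4 \<in> {1, -1}" by (simp add: square_eq_1_iff)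
  have c4: "c4 = e4 * (l * l)" using l0 by (simp add: e4_def field_simps)
  have "c0 * (c1 * (c2 * (c3 * c4))) = 1" using Ms(3) by (simp add: cs)
  hence "e0 * (e1 * (e2 * (e3 * e4))) * ((m * m * l) * (m * m * l)) = 1"
    unfolding e(2,4,6,8) c4 by (simp add: algebra_simps)
  hence prod: "e0 * (e1 * (e2 * (e3 * e4))) = 1" unfolding m by simp
  have "M = map2 (\<cdot>\<^sub>m) [e0, e1, e2, e3, e4] (extended m x y)"
    unfolding M' extended_def scaled_list by (auto intro!: eq_matI simp: e(2,4,6,8) e4_def mult.assoc)
  hence "sign_change (extended m x y) M"
    unfolding sign_change_def using e(1,3,5,7) e4 prod
    by (intro exI[of _ "[e0, e1, e2, e3, e4]"]) (simp add: extended_def)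
  moreover have "model_tuple t (extended m x y)" unfolding model_tuple_def using l m \<tau> D by blast
  ultimately show ?thesis using sign_change_sym by blast
qed

text \<open>The fifth scalar \<open>l^2\<close> turns the inverse product, the scalar matrix
  \<open>l^(-2)\<close>, into the identity.\<close>

lemma model_induced:
  assumes l: "type_eigenvalue l t" and \<tau>: "good_trace t \<tau>" and D: "triple_data l \<tau> x y"
    and conv: "middle_convolution 4 l As 2 (data_mats x y)" and len: "length As = 4"
  shows "\<exists>E. model_tuple t E \<and> induced_tuple 4 l As E"
proof -
  define m where "m = csqrt (- inverse l)"
  have l0: "l \<noteq> 0" using l by (auto simp: type_eigenvalue_def)
  have "m * m = - inverse l" using power2_csqrt[of "- inverse l"] by (simp only: m_def power2_eq_square)
  hence m: "m * m * l = -1" using l0 by simp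
  have m0: "m \<noteq> 0" using m by auto
  have E: "model_tuple t (extended m x y)" unfolding model_tuple_def using l m \<tau> D by blast
  have "induced_tuple 4 l As (extended m x y)"
    unfolding induced_tuple_def
  proof (intro exI conjI)
    show "middle_convolution 4 l As 2 (data_mats x y)" by fact
    show "length [m, m, m, m, l * l] = length As + 1" using len by simp
    show "0 \<notin> set [m, m, m, m, l * l]" using l0 m0 by simp
    have "prod_list [m, m, m, m, l * l] = (m * m * l) * (m * m * l)" by (simp add: algebra_simps)
    thus "prod_list [m, m, m, m, l * l] = 1" unfolding m by simp
    show "extended m x y = map2 (\<cdot>\<^sub>m) [m, m, m, m, l * l] (data_mats x y @ [inv\<^bsub>GL 2\<^esub> (mat_prod 2 (data_mats x y))])"
      unfolding data_mats_inverse[OF l \<tau> D] extended_def scaled_list using l0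
      by (simp add: data_mats_list) (auto intro!: eq_matI simp: field_simps)
    show "\<forall>A\<in>set (extended m x y). det A = 1" using model_tuple_props(1)[OF E] by (simp add: SL2_tuple_def)
  qed
  thus ?thesis using E by blast
qed

section \<open>Type equivalence in terms of the trace invariant\<close>

definition nice_trace :: "complex mat list \<Rightarrow> gint \<Rightarrow> bool" where
  "nice_trace As t \<longleftrightarrow> (\<exists>l. nice_eigenvalue 4 As l \<and> type_eigenvalue l t)"

lemma type_eigenvalue_trace: "type_eigenvalue l t \<Longrightarrow> type_eigenvalue l t' \<Longrightarrow> t = t'"
  by (metis evc_inj type_eigenvalue_def)

lemma nice_trace_eigenvalue:
  assumes As: "As \<in> nice_tuples 4 G30 4" and t: "nice_trace As t" and l: "l \<in># tuple_type 4 As"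
  shows "type_eigenvalue l t"
proof -
  obtain l0 where l0: "nice_eigenvalue 4 As l0" "type_eigenvalue l0 t" using t by (auto simp: nice_trace_def)
  have "tuple_type 4 As = {#l0, l0, inverse l0, inverse l0#}"
    by (rule nice_convolution[OF As l0(1)])
  hence "l = l0 \<or> l = inverse l0" using l by auto
  thus ?thesis using l0(2) type_eigenvalue_inverse by blast
qed

lemma nice_trace_type:
  assumes As: "As \<in> nice_tuples 4 G30 4" and t: "nice_trace As t" and l: "type_eigenvalue l t"
  shows "tuple_type 4 As = {#l, l, inverse l, inverse l#}"
proof -
  obtain l0 where l0: "nice_eigenvalue 4 As l0" "type_eigenvalue l0 t" using t by (auto simp: nice_trace_def)
  have e: "tuple_type 4 As = {#l0, l0, inverse l0, inverse l0#}"
    by (rule nice_convolution[OF As l0(1)])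
  have "l = l0 \<or> l = inverse l0" by (rule type_eigenvalue_unique[OF l0(2) l])
  thus ?thesis using e by (auto simp: add_mset_commute)
qed

lemma nice_trace_exists:
  assumes "As \<in> nice_tuples 4 G30 4"
  shows "\<exists>t\<in>type_traces. nice_trace As t"
proof -
  obtain l where l: "nice_eigenvalue 4 As l" using assms by (auto simp: nice_tuples_def)
  show ?thesis by (rule nice_convolution[OF assms l]) (use l in \<open>auto simp: nice_trace_def\<close>)
qed

lemma nice_trace_unique:
  assumes "As \<in> nice_tuples 4 G30 4" "nice_trace As t" "nice_trace As t'"
  shows "t = t'"
proof -
  obtain l where "l \<in># tuple_type 4 As" using assms(2) by (auto simp: nice_trace_def nice_eigenvalue_def)
  thus ?thesis using nice_trace_eigenvalue[OF assms(1)] assms(2,3) type_eigenvalue_trace by blast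
qed

text \<open>The inverse product of the inverse tuple is the product of the original tuple, whose
  eigenvalues are the inverses of those in the type.\<close>

lemma inverse_tuple_eigenvalue:
  assumes As: "As \<in> nice_tuples 4 G30 4" and l: "l \<in># tuple_type 4 (inverse_tuple 4 As)"
  shows "inverse l \<in># tuple_type 4 As"
proof -
  obtain rs where rs: "generating_roots rs" "As = map crefl rs" using nice_tuple_roots[OF As] by blast
  note P = inverse_product_props[OF rs(1), folded rs(2)]
  have GL: "set As \<subseteq> carrier (GL 4)" using rs crefl_GL by (auto simp: generating_roots_def)
  have "inverse_product 4 (inverse_tuple 4 As) = mat_prod 4 As"
    unfolding inverse_product_def mat_prod_inverse_tuple[OF GL]
    by (rule GL_inv) (use P in \<open>simp_all add: inverse_product_def\<close>)
  then obtain v where v: "v \<in> carrier_vec 4" "v \<noteq> 0\<^sub>v 4" "mat_prod 4 As *\<^sub>v v = l \<cdot>\<^sub>v v"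
    using l eigs_eigenvalue[OF P(3)] P(3) by (auto simp: tuple_type_def eigenvalue_def eigenvector_def)
  have "l \<cdot>\<^sub>v (inverse_product 4 As *\<^sub>v v) = inverse_product 4 As *\<^sub>v (mat_prod 4 As *\<^sub>v v)"
    unfolding v(3) using P(2) v(1) by (simp add: mult_mat_vec)
  also have "\<dots> = v" using P v(1) by (simp add: assoc_mult_mat_vec[of _ 4 4 _ 4, symmetric])
  finally have e: "l \<cdot>\<^sub>v (inverse_product 4 As *\<^sub>v v) = v" .
  have "0 \<cdot>\<^sub>v (inverse_product 4 As *\<^sub>v v) = 0\<^sub>v 4" using P(2) by (intro eq_vecI) auto
  hence "l \<noteq> 0" using e v(2) by auto
  hence "inverse_product 4 As *\<^sub>v v = inverse l \<cdot>\<^sub>v v" using e by (metis smult_smult_assoc left_inverse one_smult_vec)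
  hence "eigenvalue (inverse_product 4 As) (inverse l)"
    using v P(2) unfolding eigenvalue_def eigenvector_def by auto
  thus ?thesis using eigs_eigenvalue[OF P(2)] by (simp add: tuple_type_def)
qed

text \<open>\<open>t\<close> determines the type and is symmetric in \<open>l\<close> and
  \<open>1/l\<close>, so it does not change when a tuple is replaced by its inverse tuple.\<close>

lemma type_equiv_trace:
  assumes As: "As \<in> nice_tuples 4 G30 4" "nice_trace As t" and Bs: "Bs \<in> nice_tuples 4 G30 4" "nice_trace Bs t'"
  shows "type_equiv 4 As Bs \<longleftrightarrow> t = t'"
proof
  assume eq: "type_equiv 4 As Bs"
  have flip: "t = t'" if h: "As \<in> nice_tuples 4 G30 4" "nice_trace As t" "Bs \<in> nice_tuples 4 G30 4" "nice_trace Bs t'"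
     "tuple_type 4 As = tuple_type 4 (inverse_tuple 4 Bs)" for As Bs t t'
  proof -
    obtain l where l: "l \<in># tuple_type 4 As" using h(2) by (auto simp: nice_trace_def nice_eigenvalue_def)
    hence "inverse l \<in># tuple_type 4 Bs" using inverse_tuple_eigenvalue[OF h(3)] h(5) by simp
    hence "type_eigenvalue l t'"
      using type_eigenvalue_inverse[OF nice_trace_eigenvalue[OF h(3,4)]] by fastforce
    thus ?thesis using nice_trace_eigenvalue[OF h(1,2) l] type_eigenvalue_trace by blast
  qed
  have "t = t'" if h: "tuple_type 4 As = tuple_type 4 Bs"
  proof -
    obtain l where l: "l \<in># tuple_type 4 As" using As(2) by (auto simp: nice_trace_def nice_eigenvalue_def)
    thus ?thesis using nice_trace_eigenvalue[OF As l] nice_trace_eigenvalue[OF Bs, of l] h type_eigenvalue_trace by auto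
  qed
  thus "t = t'" using eq flip[OF As Bs] flip[OF Bs As] unfolding type_equiv_def by auto
next
  assume "t = t'"
  moreover obtain l where "type_eigenvalue l t" using As(2) by (auto simp: nice_trace_def)
  ultimately show "type_equiv 4 As Bs"
    using nice_trace_type[OF As] nice_trace_type[OF Bs] by (auto simp: type_equiv_def)
qed

definition trace_class :: "gint \<Rightarrow> complex mat list set" where
  "trace_class t = {As \<in> nice_tuples 4 G30 4. nice_trace As t}"

lemma nice_classes_eq: "nice_classes 4 G30 4 = trace_class ` type_traces"
proof -
  let ?R = "{(As, Bs). As \<in> nice_tuples 4 G30 4 \<and> Bs \<in> nice_tuples 4 G30 4 \<and> type_equiv 4 As Bs}"
  have cls: "?R `` {As} = trace_class t" if "As \<in> nice_tuples 4 G30 4" "nice_trace As t" for As t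
  proof (intro equalityI subsetI)
    fix Bs assume "Bs \<in> ?R `` {As}"
    hence B: "Bs \<in> nice_tuples 4 G30 4" "type_equiv 4 As Bs" by auto
    obtain t' where t': "nice_trace Bs t'" using nice_trace_exists[OF B(1)] by blast
    have "t = t'" using type_equiv_trace[OF that B(1) t'] B(2) by blast
    thus "Bs \<in> trace_class t" using B(1) t' by (simp add: trace_class_def)
  next
    fix Bs assume "Bs \<in> trace_class t"
    hence B: "Bs \<in> nice_tuples 4 G30 4" "nice_trace Bs t" by (auto simp: trace_class_def)
    show "Bs \<in> ?R `` {As}" using type_equiv_trace[OF that B] that(1) B(1) by blast
  qed
  show ?thesis
  proof (intro equalityI subsetI)
    fix C assume "C \<in> nice_classes 4 G30 4"
    then obtain As where A: "As \<in> nice_tuples 4 G30 4" "C = ?R `` {As}" unfolding nice_classes_def by (rule quotientE)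
    thus "C \<in> trace_class ` type_traces" using nice_trace_exists[OF A(1)] cls[OF A(1)] by blast
  next
    fix C assume "C \<in> trace_class ` type_traces"
    then obtain t where t: "t \<in> type_traces" "C = trace_class t" by blast
    obtain As where A: "As \<in> nice_tuples 4 G30 4" "nice_trace As t"
      using nice_tuples_exist[OF t(1)] unfolding nice_trace_def by blast
    show "C \<in> nice_classes 4 G30 4"
      unfolding nice_classes_def t(2) cls[OF A, symmetric] using A(1) by (rule quotientI)
  qed
qed

lemma trace_class_nonempty: "t \<in> type_traces \<Longrightarrow> trace_class t \<noteq> {}"
  using nice_tuples_exist[of t] unfolding trace_class_def nice_trace_def by blast

lemma card_nice_classes: "card (nice_classes 4 G30 4) = 3"
proof -
  have "inj_on trace_class type_traces"
  proof (rule inj_onI)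
    fix t t' assume "t \<in> type_traces" "trace_class t = trace_class t'"
    thus "t = t'" using trace_class_nonempty[of t] nice_trace_unique unfolding trace_class_def by blast
  qed
  hence "card (nice_classes 4 G30 4) = card type_traces" unfolding nice_classes_eq by (rule card_image)
  thus ?thesis by (simp add: type_traces_def)
qed

section \<open>The classes of produced tuples\<close>

lemma produced_model:
  assumes "M \<in> produced 4 (trace_class t)"
  shows "\<exists>E. model_tuple t E \<and> sign_change M E \<and> tuple_equiv E M"
proof -
  obtain As l where A: "As \<in> nice_tuples 4 G30 4" "nice_trace As t" "nice_eigenvalue 4 As l" "induced_tuple 4 l As M"
    using assms by (auto simp: produced_def trace_class_def)
  have lt: "type_eigenvalue l t" using nice_trace_eigenvalue[OF A(1,2)] A(3) by (simp add: nice_eigenvalue_def)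
  have len: "length As = 4" using A(1) by (simp add: nice_tuples_def)
  obtain E where E: "model_tuple t E" "sign_change M E"
  proof (rule nice_convolution[OF A(1,3)])
    fix t' \<tau> x y assume h: "type_eigenvalue l t'" "good_trace t' \<tau>"
      "\<forall>Ms. middle_convolution 4 l As 2 Ms \<longrightarrow> (\<exists>x' y'. triple_data l \<tau> x' y' \<and> Ms = data_mats x' y')"
    have "t' = t" by (rule type_eigenvalue_trace[OF h(1) lt])
    thus thesis using induced_model[OF h len A(4)] that by blast
  qed
  have "tuple_equiv E M"
    using tuple_equivI[OF model_tuple_props(1)[OF E(1)]] sign_change_sym[OF E(2)] by blast
  thus ?thesis using E by blast
qed

lemma nice_model_induced:
  assumes As: "As \<in> nice_tuples 4 G30 4" "nice_eigenvalue 4 As l" and lt: "type_eigenvalue l t"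
  shows "\<exists>E. model_tuple t E \<and> induced_tuple 4 l As E"
proof (rule nice_convolution[OF As])
  fix t' \<tau> x y assume h: "type_eigenvalue l t'" "good_trace t' \<tau>" "triple_data l \<tau> x y"
    "middle_convolution 4 l As 2 (data_mats x y)"
  have "t' = t" by (rule type_eigenvalue_trace[OF h(1) lt])
  thus ?thesis using model_induced[OF h] As(1) by (simp add: nice_tuples_def)
qed

text \<open>Every produced tuple is a sign change of a model tuple, and all model tuples of one
  invariant are equivalent. The class is taken among all lists, so that classes of different types
  can be compared.\<close>

lemma produced_mcg_class:
  assumes t: "t \<in> type_traces" and E: "model_tuple t E"
  shows "produced_mcg_classes 4 (trace_class t) = {{N. tuple_equiv E N}}"
proof -
  let ?R = "{(M, N). tuple_equiv M N}"
  have cls: "?R `` {M} = {N. tuple_equiv E N}" if "M \<in> produced 4 (trace_class t)" for M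
  proof -
    obtain E' where "model_tuple t E'" "tuple_equiv E' M" using produced_model[OF \<open>M \<in> _\<close>] by blast
    hence "tuple_equiv E M" using model_tuple_equiv[OF E] tuple_equiv_trans by blast
    thus ?thesis using tuple_equiv_trans tuple_equiv_sym by blast
  qed
  obtain As l where A: "As \<in> nice_tuples 4 G30 4" "nice_eigenvalue 4 As l" "type_eigenvalue l t"
    using nice_tuples_exist[OF t] by blast
  obtain E' where E': "model_tuple t E'" "induced_tuple 4 l As E'" using nice_model_induced[OF A] by blast
  have p: "E' \<in> produced 4 (trace_class t)"
    unfolding produced_def trace_class_def nice_trace_def using A E'(2) by blast
  show ?thesis
  proof (intro equalityI subsetI)
    fix C assume "C \<in> produced_mcg_classes 4 (trace_class t)"
    then obtain M where "M \<in> produced 4 (trace_class t)" "C = ?R `` {M}"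
      unfolding produced_mcg_classes_def by (auto elim!: quotientE)
    thus "C \<in> {{N. tuple_equiv E N}}" using cls by simp
  next
    fix C assume "C \<in> {{N. tuple_equiv E N}}"
    hence C: "C = ?R `` {E'}" using cls[OF p] by simp
    have "E' \<in> {M \<in> produced 4 (trace_class t). mcg_finite M}"
      using p model_tuple_props(2)[OF E'(1)] by simp
    thus "C \<in> produced_mcg_classes 4 (trace_class t)"
      unfolding produced_mcg_classes_def C by (rule quotientI)
  qed
qed

lemma model_tuple_exists: "t \<in> type_traces \<Longrightarrow> \<exists>E. model_tuple t E"
  using nice_tuples_exist[of t] nice_model_induced by blast

lemma produced_mcg_classes_card:
  assumes "t \<in> type_traces" shows "card (produced_mcg_classes 4 (trace_class t)) = 1"
  using model_tuple_exists[OF assms] produced_mcg_class[OF assms] by fastforce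

text \<open>Equivalent tuples share the set \<open>{2 - t, 4}\<close> of squared traces; since 4
  always belongs to it, the set determines \<open>t\<close>.\<close>

lemma produced_mcg_classes_disjoint:
  assumes t: "t \<in> type_traces" "t' \<in> type_traces" "t \<noteq> t'"
  shows "produced_mcg_classes 4 (trace_class t) \<inter> produced_mcg_classes 4 (trace_class t') = {}"
proof -
  obtain E E' where E: "model_tuple t E" "model_tuple t' E'" using model_tuple_exists t by blast
  have "\<not> tuple_equiv E E'"
  proof
    assume eq: "tuple_equiv E E'"
    have "{evc (2 - t), 4} = {evc (2 - t'), 4}"
      using tuple_equiv_square_traces[OF eq] unfolding model_tuple_props(5)[OF E(1)] model_tuple_props(5)[OF E(2)] .
    hence "evc (2 - t) = evc (2 - t')" by (metis doubleton_eq_iff)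
    hence "2 - t = 2 - t'" by (metis evc_inj)
    thus False using t(3) by (simp add: algebra_simps)
  qed
  hence "{N. tuple_equiv E N} \<noteq> {N. tuple_equiv E' N}" using tuple_equiv_refl by blast
  thus ?thesis unfolding produced_mcg_class[OF t(1) E(1)] produced_mcg_class[OF t(2) E(2)] by simp
qed

lemma produced_normalised:
  assumes "M \<in> produced 4 (nice_tuples 4 G30 4)"
  shows "\<exists>N. sign_change M N \<and> N ! 4 = 1\<^sub>m 2 \<and> mcg_finite (take 4 N) \<and> length N = 5"
proof -
  obtain As where As: "As \<in> nice_tuples 4 G30 4" "M \<in> produced 4 {As}" using assms by (auto simp: produced_def)
  obtain t where "nice_trace As t" using nice_trace_exists[OF As(1)] by blast
  hence "M \<in> produced 4 (trace_class t)" using As by (auto simp: produced_def trace_class_def)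
  then obtain E where E: "model_tuple t E" "sign_change M E" using produced_model by blast
  have "length E = 5" using E(1) by (auto simp: model_tuple_def extended_def)
  thus ?thesis using E model_tuple_props[OF E(1)] by blast
qed

theorem theorem1p11:
  shows "card (nice_classes 4 G30 4) = 3 \<and>
    (\<forall>C \<in> nice_classes 4 G30 4. card (produced_mcg_classes 4 C) = 1) \<and>
    (\<forall>C \<in> nice_classes 4 G30 4. \<forall>D \<in> nice_classes 4 G30 4.
       C \<noteq> D \<longrightarrow> produced_mcg_classes 4 C \<inter> produced_mcg_classes 4 D = {}) \<and>
    (\<forall>C \<in> nice_classes 4 G30 4. \<forall>M \<in> produced 4 C. mcg_finite M \<longrightarrow>
       (\<exists>N. sign_change M N \<and> N ! 4 = 1\<^sub>m 2 \<and> mcg_finite (take 4 N))) \<and>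
    (\<forall>As \<in> nice_tuples 4 G30 4. \<forall>lam. nice_eigenvalue 4 As lam \<longrightarrow>
       (\<exists>M. induced_tuple 4 lam As M \<and> M ! 4 = 1\<^sub>m 2 \<and> mcg_finite (take 4 M))) \<and>
    (\<forall>M \<in> produced 4 (nice_tuples 4 G30 4). mcg_finite M \<longrightarrow> \<not> identity_free M) \<and>
    nice_tuples 4 G30 5 = {}"
proof (intro conjI ballI allI impI)
  show "card (nice_classes 4 G30 4) = 3" by (rule card_nice_classes)
next
  fix C assume "C \<in> nice_classes 4 G30 4"
  thus "card (produced_mcg_classes 4 C) = 1" using produced_mcg_classes_card by (auto simp: nice_classes_eq)
next
  fix C D assume "C \<in> nice_classes 4 G30 4" "D \<in> nice_classes 4 G30 4" "C \<noteq> D"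
  thus "produced_mcg_classes 4 C \<inter> produced_mcg_classes 4 D = {}"
    using produced_mcg_classes_disjoint by (force simp: nice_classes_eq)
next
  fix C M assume "C \<in> nice_classes 4 G30 4" "M \<in> produced 4 C"
  hence "M \<in> produced 4 (nice_tuples 4 G30 4)" by (auto simp: nice_classes_eq trace_class_def produced_def)
  thus "\<exists>N. sign_change M N \<and> N ! 4 = 1\<^sub>m 2 \<and> mcg_finite (take 4 N)" using produced_normalised by blast
next
  fix As lam assume A: "As \<in> nice_tuples 4 G30 4" "nice_eigenvalue 4 As lam"
  obtain t where t: "nice_trace As t" using nice_trace_exists[OF A(1)] by blast
  have "type_eigenvalue lam t" using nice_trace_eigenvalue[OF A(1) t] A(2) by (simp add: nice_eigenvalue_def)
  from nice_model_induced[OF A this]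
  show "\<exists>M. induced_tuple 4 lam As M \<and> M ! 4 = 1\<^sub>m 2 \<and> mcg_finite (take 4 M)" using model_tuple_props by blast
next
  fix M assume "M \<in> produced 4 (nice_tuples 4 G30 4)"
  then obtain N where N: "sign_change M N" "N ! 4 = 1\<^sub>m 2" "length N = 5" using produced_normalised by blast
  have "N ! 4 \<in> set N" using N(3) by simp
  thus "\<not> identity_free M" unfolding identity_free_def using N(1,2) by metis
next
  show "nice_tuples 4 G30 5 = {}" by (rule no_nice_5_tuples)
qed


end
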